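(* Let $1/2<\gamma\le 1$, $0<\alpha<1$, and let $X_1,X_2,\ldots$ be i.i.d. from a law $P_0$ on $[0,1]$ with density $f_0$ that is bounded away from zero and satisfies the Hölder condition $$\sup_{x,y\in[0,1],\,x\ne y}\frac{|f_0(x)-f_0(y)|}{|x-y|^\gamma}<\infty .$$ Let $L=L_n$ be integers such that $2^{L_n}\sim (n/\log n)^{1/(2\gamma+1)}$, let $\Pi=\Pi_{L_n}$ be the dyadic random histogram prior on probability densities described in the context, and let $\Pi(\cdot\mid X_1,\ldots,X_n)$ be the resulting posterior distribution. Let $w=(w_l)_{l\ge -1}$ be any monotone increasing sequence with $w_l\ge 1$ such that $w_l/\sqrt l\uparrow\infty$ as $l\to\infty$. Define $$C_n=\Big\{f:\ \max_{k,\,l\le L_n}\frac{|\langle f-P_n,\psi_{lk}\rangle|}{w_l}\le \frac{R_n}{\sqrt n}\Big\},$$ where $R_n=R(\alpha,X_1,\ldots,X_n)$ are random constants chosen such that $\Pi(C_n\mid X_1,\ldots,X_n)=1-\alpha$. Then, as $n\to\infty$, $$P_0^{\mathbb N}(f_0\in C_n)\to 1-\alpha .$$ Moreover, if $u_n=w_{L_n}/\sqrt{L_n}$, then the last limit remains true with $C_n$ replaced by $$\bar C_n=C_n\cap\big\{f:\ |\langle f,\psi_{lk}\rangle|\le u_n2^{-l(\gamma+1/2)}\ \ \forall k,l\big\},$$ and the diameter $|\bar C_n|_\infty=\sup\{\|f-g\|_\infty: f,g\in\bar C_n\}$ satisfies $$|\bar C_n|_\infty=O_{P_0^{\mathbb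 N}}\Big(\Big(\frac{\log n}{n}\Big)^{\gamma/(2\gamma+1)}u_n\Big).$$
   Context: Haar wavelets: $\psi_{-10}=\mathbf 1_{[0,1]}$ and, for $l\in\mathbb N\cup\{0\}$, $k=0,\ldots,2^l-1$, $\psi_{lk}=2^{l/2}\big(\mathbf 1_{(k/2^l,(k+1/2)/2^l]}-\mathbf 1_{((k+1/2)/2^l,(k+1)/2^l]}\big)$; the indices $l$ run over $\{-1,0,1,2,\ldots\}$, with only $k=0$ for $l=-1$. For $f\in L^2([0,1])$, $\langle f,\psi_{lk}\rangle=\int_0^1 f\psi_{lk}$. The empirical measure is $P_n=\frac1n\sum_{i=1}^n\delta_{X_i}$, with $\langle P_n,\psi_{lk}\rangle=\frac1n\sum_{i=1}^n\psi_{lk}(X_i)$. The functions $f$ in the definition of $C_n$ range over $L^2([0,1])$. Random histogram prior: for $L\in\mathbb N$ let $I_0^L=[0,2^{-L}]$ and $I_k^L=(k2^{-L},(k+1)2^{-L}]$ for $k=1,\ldots,2^L-1$. $\Pi_L$ is the law of the random probability density $f=2^L\sum_{k=0}^{2^L-1}h_k\mathbf 1_{I_k^L}$, where $(h_0,\ldots,h_{2^L-1})$ is drawn from the Dirichlet distribution $\mathcal D(1,\ldots,1)$ on the unit simplex of $\mathbb R^{2^L}$. The posterior $\Pi(\cdot\mid X_1,\ldots,X_n)$ is the conditional law of $f$ given the data when $f\sim\Pi_{L_n}$ and, given $f$, $X_1,\ldots,X_n$ are i.i.d. with density $f$. $P_0^{\mathbb N}$ denotes the law of $(X_1,X_2,\ldots)$.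 The notation $a_n\sim b_n$ means that $a_n/b_n$ is bounded away from $0$ and $\infty$. $O_{P}(\cdot)$ denotes stochastic boundedness in $P$-probability. *)

theory Defs
  imports "HOL-Probability.Probability" "HOL-Library.Landau_Symbols"
begin

section \<open>Square-integrable functions on the unit interval and Haar wavelets\<close>

abbreviation unit_leb :: "real measure" where
  "unit_leb \<equiv> restrict_space lborel {0..1}"

text \<open>Members are functions rather than equivalence classes; values outside the unit interval
  are irrelevant.\<close>

definition L2 :: "(real \<Rightarrow> real) set" where
  "L2 = {f. f \<in> borel_measurable unit_leb \<and> integrable unit_leb (\<lambda>x. (f x)\<^sup>2)}"

definition inner_L2 :: "(real \<Rightarrow> real) \<Rightarrow> (real \<Rightarrow> real) \<Rightarrow> real" where
  "inner_L2 f g = (LINT x|unit_leb. f x * g x)"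

text \<open>By separability of \<open>L\<^sup>2\<close>, the \<open>\<sigma>\<close>-algebra generated by the continuous linear functionals
  is the Borel \<open>\<sigma>\<close>-algebra of the norm.\<close>

definition L2_borel :: "(real \<Rightarrow> real) measure" where
  "L2_borel = sigma L2 {{f \<in> L2. inner_L2 f g \<in> B} | g B. g \<in> L2 \<and> B \<in> sets borel}"

definition haar :: "int \<Rightarrow> nat \<Rightarrow> real \<Rightarrow> real" where
  "haar l k x =
     (if l = -1 then indicator {0..1} x
      else 2 powr (real_of_int l / 2) *
        (indicator {real k / 2 ^ nat l <.. (real k + 1/2) / 2 ^ nat l} x
         - indicator {(real k + 1/2) / 2 ^ nat l <.. (real k + 1) / 2 ^ nat l} x))"

definition haar_index :: "(int \<times> nat) set" where
  "haar_index = {(l, k). l = -1 \<and> k = 0 \<or> 0 \<le> l \<and> k < 2 ^ nat l}"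

text \<open>The observations \<open>X\<^sub>1, \<dots>, X\<^sub>n\<close> are \<open>x 0, \<dots>, x (n - 1)\<close>.\<close>

definition empirical_coeff :: "nat \<Rightarrow> (nat \<Rightarrow> real) \<Rightarrow> int \<Rightarrow> nat \<Rightarrow> real" where
  "empirical_coeff n x l k = (\<Sum>i<n. haar l k (x i)) / real n"


section \<open>The random histogram prior and its posterior\<close>

text \<open>The Dirichlet law with parameters \<open>a 0, \<dots>, a (N - 1)\<close>, for \<open>N \<ge> 1\<close>, given by its density in
  the first \<open>N - 1\<close> coordinates; the last coordinate is determined by the sum being \<open>1\<close>.\<close>

definition simplex_lift :: "nat \<Rightarrow> (nat \<Rightarrow> real) \<Rightarrow> nat \<Rightarrow> real" where
  "simplex_lift N y = (\<lambda>i\<in>{..<N}. if i = N - 1 then 1 - (\<Sum>j<N - 1. y j) else y i)"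

definition dirichlet :: "nat \<Rightarrow> (nat \<Rightarrow> real) \<Rightarrow> (nat \<Rightarrow> real) measure" where
  "dirichlet N a =
     distr
       (density (\<Pi>\<^sub>M i\<in>{..<N - 1}. lborel)
         (\<lambda>y. ennreal
           (if \<forall>i<N. 0 < simplex_lift N y i
            then Gamma (\<Sum>i<N. a i) / (\<Prod>i<N. Gamma (a i))
                   * (\<Prod>i<N. simplex_lift N y i powr (a i - 1))
            else 0)))
       (\<Pi>\<^sub>M i\<in>{..<N}. borel)
       (simplex_lift N)"

definition dyadic_bin :: "nat \<Rightarrow> nat \<Rightarrow> real set" where
  "dyadic_bin L k =
     (if k = 0 then {0..1 / 2 ^ L} else {real k / 2 ^ L <.. (real k + 1) / 2 ^ L})"

definition histogram :: "nat \<Rightarrow> (nat \<Rightarrow> real) \<Rightarrow> real \<Rightarrow> real" where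
  "histogram L h x = 2 ^ L * (\<Sum>k<2 ^ L. h k * indicator (dyadic_bin L k) x)"

abbreviation data_space :: "nat \<Rightarrow> (nat \<Rightarrow> real) measure" where
  "data_space n \<equiv> (\<Pi>\<^sub>M i\<in>{..<n}. borel)"

text \<open>The joint law of \<open>(f, (X\<^sub>1, \<dots>, X\<^sub>n))\<close> in the Bayesian model, where \<open>f = histogram L h\<close> with \<open>h\<close>
  drawn from the Dirichlet law with all parameters \<open>1\<close> (so that \<open>f\<close> is drawn from the
  prior), and the \<open>X\<^sub>i\<close> are, given \<open>f\<close>, i.i.d. with density \<open>f\<close>, that is, have the product
  density \<open>f(x\<^sub>1) \<cdots> f(x\<^sub>n)\<close>. Histograms vanish outside the unit interval, so Lebesgue measure on
  the whole line serves as the reference measure for the data.\<close>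

definition histogram_model :: "nat \<Rightarrow> nat \<Rightarrow> ((real \<Rightarrow> real) \<times> (nat \<Rightarrow> real)) measure" where
  "histogram_model L n =
     distr
       (density (dirichlet (2 ^ L) (\<lambda>_. 1) \<Otimes>\<^sub>M (\<Pi>\<^sub>M i\<in>{..<n}. lborel))
         (\<lambda>(h, x). \<Prod>i<n. ennreal (histogram L h (x i))))
       (L2_borel \<Otimes>\<^sub>M data_space n)
       (\<lambda>(h, x). (histogram L h, x))"

text \<open>\<open>K\<close> is a version of the (regular) conditional law of the first component given the second
  one under the law \<open>J\<close> on \<open>A \<Otimes>\<^sub>M B\<close>.\<close>

definition conditional_law ::
    "('a \<times> 'b) measure \<Rightarrow> 'a measure \<Rightarrow> 'b measure \<Rightarrow> ('b \<Rightarrow> 'a measure) \<Rightarrow> bool" where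
  "conditional_law J A B K \<longleftrightarrow>
     K \<in> B \<rightarrow>\<^sub>M prob_algebra A \<and>
     (\<forall>S\<in>sets A. \<forall>T\<in>sets B.
        emeasure J (S \<times> T) = (\<integral>\<^sup>+y\<in>T. emeasure (K y) S \<partial>distr J B snd))"

definition is_posterior :: "nat \<Rightarrow> nat \<Rightarrow> ((nat \<Rightarrow> real) \<Rightarrow> (real \<Rightarrow> real) measure) \<Rightarrow> bool" where
  "is_posterior L n K \<longleftrightarrow> conditional_law (histogram_model L n) L2_borel (data_space n) K"


section \<open>Credible sets, their diameters, and the sampling law\<close>

text \<open>The radius \<open>r\<close> is to be calibrated so that the posterior mass is exactly \<open>1 - \<alpha>\<close>. Such an
  \<open>r\<close> does not exist for every sample: a histogram with \<open>2 ^ L\<close> bins has zero Haar coefficients at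
  level \<open>l = L\<close>, so this level contributes a constant to the maximum and the posterior law of
  the maximum can have an atom there of mass above \<open>1 - \<alpha>\<close>. Exact calibration can thus only be
  demanded on events whose sampling probability tends to \<open>1\<close>.\<close>

definition credible_set ::
    "(int \<Rightarrow> real) \<Rightarrow> nat \<Rightarrow> nat \<Rightarrow> real \<Rightarrow> (nat \<Rightarrow> real) \<Rightarrow> (real \<Rightarrow> real) set" where
  "credible_set w L n r x =
     {f \<in> L2. (MAX (l, k)\<in>{(l, k) \<in> haar_index. l \<le> int L}.
        \<bar>inner_L2 f (haar l k) - empirical_coeff n x l k\<bar> / w l) \<le> r / sqrt (real n)}"

definition smooth_set :: "real \<Rightarrow> real \<Rightarrow> (real \<Rightarrow> real) set" where
  "smooth_set \<gamma> u =
     {f \<in> L2. \<forall>(l, k)\<in>haar_index.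
        \<bar>inner_L2 f (haar l k)\<bar> \<le> u * 2 powr (- real_of_int l * (\<gamma> + 1/2))}"

text \<open>The essential supremum is needed because elements of \<open>L\<^sup>2\<close> are determined only almost
  everywhere.\<close>

definition sup_diameter :: "(real \<Rightarrow> real) set \<Rightarrow> ennreal" where
  "sup_diameter F = (SUP f\<in>F. SUP g\<in>F. esssup unit_leb (\<lambda>t. ennreal \<bar>f t - g t\<bar>))"

definition sample_law :: "(real \<Rightarrow> real) \<Rightarrow> (nat \<Rightarrow> real) measure" where
  "sample_law f0 =
     (\<Pi>\<^sub>M i\<in>UNIV. density lborel (\<lambda>x. ennreal (f0 x) * indicator {0..1} x))"

text \<open>\<open>Y\<^sub>n = O\<^sub>P(a\<^sub>n)\<close>. The variables \<open>Y\<^sub>n\<close> need not be known to be measurable: the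
  exceptional sets have small outer probability.\<close>

definition bounded_in_prob :: "'a measure \<Rightarrow> (nat \<Rightarrow> 'a \<Rightarrow> ennreal) \<Rightarrow> (nat \<Rightarrow> real) \<Rightarrow> bool" where
  "bounded_in_prob P Y a \<longleftrightarrow>
     (\<forall>\<epsilon>>0. \<exists>M. \<forall>\<^sub>F n in sequentially.
        \<exists>A\<in>sets P. measure P A \<ge> 1 - \<epsilon> \<and> (\<forall>x\<in>A. Y n x \<le> ennreal (M * a n)))"

end

theory Submission
  imports Defs "HOL-Real_Asymp.Real_Asymp"
begin

text \<open>Given the sample, the posterior is the law of the histogram with weights proportional to
  independent Erlang variables of shapes \<open>1 + N\<^sub>j\<close>, where \<open>N\<^sub>j\<close> counts the observations in the bin \<open>j\<close>.
  Its Haar coefficients are thus ratios of sums of independent variables; centred at the empirical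
  coefficients and scaled by \<open>sqrt n\<close>, finitely many of them have, for typical samples, the same
  Gaussian limit as the empirical coefficients centred at those of \<open>f\<^sub>0\<close>, and both limits are obtained
  from characteristic functions. Since \<open>w\<^sub>l / sqrt l\<close> tends to infinity, Chernoff bounds and a union
  bound over the \<open>2 ^ l\<close> coefficients of each level show that on both sides the levels above \<open>J\<close>
  contribute, uniformly in \<open>n\<close>, a probability that is small for large \<open>J\<close>. The posterior quantile \<open>R\<^sub>n\<close>
  therefore lies between quantiles of the Gaussian maximum of levels close to \<open>1 - \<alpha>\<close>, which also
  bracket the sampling probability of covering \<open>f\<^sub>0\<close>. The diameter bound sums the coefficient bounds over
  all levels: the level \<open>l\<close> contributes \<open>2 powr (l / 2)\<close> times the largest coefficient to the supremum
  norm.\<close>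

section \<open>Convergence of box probabilities from characteristic functions\<close>

text \<open>Since \<open>\<gamma> > 1/2\<close>, the number \<open>2 ^ L n\<close> of bins is of
  smaller order than \<open>sqrt n\<close>. The prior adds one unit to every bin count, so on
  typical samples it moves a coefficient scaled by \<open>sqrt n\<close> by at most a constant times
  \<open>2 ^ L n / sqrt n\<close>, which vanishes. The same smallness admits the Chernoff parameter
  \<open>sqrt l\<close> on every level \<open>l\<close> up to \<open>L n\<close>. At the level
  \<open>L n\<close> itself histograms have zero coefficients, so the constraint there concerns the
  sample alone; it holds eventually for any fixed positive radius, because sampling noise and bias
  at that level are both of order \<open>sqrt (L n / n)\<close>. Statements about the posterior are
  proved along arbitrary deterministic sequences of typical samples and become uniform by choosing
  counterexamples. A posterior kernel is determined only up to null sets while credible sets move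
  with the data; for a fixed radius they depend on the data through finitely many coefficients with
  countably many values, and monotonicity in the radius then encloses the random radius between
  fixed ones.\<close>

lemma tendsto_approximation:
  fixes A :: "nat \<Rightarrow> 'b::metric_space"
  assumes "\<And>e. e > 0 \<Longrightarrow> \<exists>B b. B \<longlonglongrightarrow> b \<and> (\<forall>\<^sub>F n in sequentially. dist (A n) (B n) \<le> e) \<and> dist a b \<le> e"
  shows "A \<longlonglongrightarrow> a"
proof (rule tendstoI)
  fix e :: real assume e: "0 < e"
  then obtain B b where B: "B \<longlonglongrightarrow> b" "\<forall>\<^sub>F n in sequentially. dist (A n) (B n) \<le> e/4" "dist a b \<le> e/4"
    using assms[of "e/4"] by auto
  have "\<forall>\<^sub>F n in sequentially. dist (B n) b < e/4"
    using B(1) e by (intro tendstoD) auto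
  with B(2) show "\<forall>\<^sub>F n in sequentially. dist (A n) a < e"
  proof eventually_elim
    case (elim n)
    have "dist (A n) a \<le> dist (A n) (B n) + dist (B n) b + dist a b"
      by (smt (verit) dist_commute dist_triangle)
    then show ?case using elim B(3) e by linarith
  qed
qed

section \<open>Trigonometric polynomials with arbitrary real frequencies\<close>

inductive trig_poly :: "(real \<Rightarrow> complex) \<Rightarrow> bool" where
  exp: "trig_poly (\<lambda>x. c * iexp (a * x))"
| add: "trig_poly f \<Longrightarrow> trig_poly g \<Longrightarrow> trig_poly (\<lambda>x. f x + g x)"

lemma trig_poly_const: "trig_poly (\<lambda>x. c)"
  using trig_poly.exp[of c 0] by simp

lemma trig_poly_mult:
  assumes "trig_poly f" "trig_poly g"
  shows "trig_poly (\<lambda>x. f x * g x)"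
  using assms
proof (induction arbitrary: g)
  case (exp c a)
  from exp.prems show ?case
  proof induction
    case (exp c' a')
    have "(\<lambda>x. c * iexp (a * x) * (c' * iexp (a' * x))) = (\<lambda>x. (c * c') * iexp ((a + a') * x))"
      by (auto simp: algebra_simps exp_add)
    then show ?case using trig_poly.exp by metis
  next
    case (add f g)
    then show ?case unfolding distrib_left by (intro trig_poly.add) simp_all
  qed
next
  case (add f1 f2)
  then show ?case unfolding distrib_right by (intro trig_poly.add) simp_all
qed

lemma trig_poly_power: "trig_poly f \<Longrightarrow> trig_poly (\<lambda>x. f x ^ k)"
proof (induction k)
  case (Suc k)
  then show ?case using trig_poly_mult[of f "\<lambda>x. f x ^ k"] by simp
qed (simp add: trig_poly_const)

lemma trig_poly_sum: "finite I \<Longrightarrow> (\<And>i. i \<in> I \<Longrightarrow> trig_poly (f i)) \<Longrightarrow> trig_poly (\<lambda>x. \<Sum>i\<in>I. f i x)"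
proof (induction I rule: finite_induct)
  case (insert i I)
  then have "trig_poly (\<lambda>x. f i x + (\<Sum>i\<in>I. f i x))" by (intro trig_poly.add) auto
  with insert show ?case by simp
qed (simp add: trig_poly_const)

lemma trig_poly_cos: "trig_poly (\<lambda>x. complex_of_real (cos (a * x)))"
proof -
  have "(\<lambda>x. complex_of_real (cos (a * x))) = (\<lambda>x. (1/2) * iexp (a * x) + (1/2) * iexp ((- a) * x))"
    by (auto simp: cos_exp_eq complex_eq_iff Re_exp Im_exp simp flip: cos_of_real)
  then show ?thesis by (simp only: ) (intro trig_poly.intros)
qed

lemma trig_poly_bounded_measurable:
  assumes "trig_poly f"
  shows "f \<in> borel_measurable borel \<and> (\<exists>B. \<forall>x. norm (f x) \<le> B)"
  using assms
proof induction
  case (exp c a)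
  then show ?case by (auto simp: norm_mult intro!: exI[of _ "norm c"])
next
  case (add f g)
  then obtain B1 B2 where "\<forall>x. norm (f x) \<le> B1" "\<forall>x. norm (g x) \<le> B2" by auto
  then have "\<forall>x. norm (f x + g x) \<le> B1 + B2"
    by (meson add_mono norm_triangle_le)
  with add show ?case by (auto intro!: borel_measurable_add)
qed

text \<open>Only the integral of the majorant \<open>D\<close> enters, so the estimate serves
  uniform approximation, with \<open>D\<close> constant, as well as approximation that fails on a
  set of small probability.\<close>

lemma norm_integral_diff_le:
  fixes V :: "'c \<Rightarrow> complex" and f g :: "'c \<Rightarrow> real"
  assumes "prob_space Q" and [measurable]: "V \<in> borel_measurable Q" "f \<in> borel_measurable Q" "g \<in> borel_measurable Q"
    and V: "\<And>x. norm (V x) \<le> 1" and D: "integrable Q D" "\<And>x. \<bar>f x - g x\<bar> \<le> D x"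
    and B: "\<And>x. \<bar>f x\<bar> \<le> B" "\<And>x. \<bar>g x\<bar> \<le> B"
  shows "norm ((LINT x|Q. V x * of_real (f x)) - (LINT x|Q. V x * of_real (g x))) \<le> (LINT x|Q. D x)"
proof -
  interpret Q: prob_space Q by fact
  have bd: "norm (V x * of_real r) \<le> C" if "\<bar>r\<bar> \<le> C" for x C and r :: real
    using mult_mono[OF V[of x] that] by (simp add: norm_mult)
  have i1: "integrable Q (\<lambda>x. V x * of_real (f x))" "integrable Q (\<lambda>x. V x * of_real (g x))"
    by (rule Q.integrable_const_bound[where B=B]; use bd B in auto)+
  have "(LINT x|Q. V x * of_real (f x)) - (LINT x|Q. V x * of_real (g x)) = (LINT x|Q. V x * of_real (f x - g x))"
    by (subst Bochner_Integration.integral_diff[OF i1, symmetric]) (simp add: right_diff_distrib)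
  also have "norm \<dots> \<le> (LINT x|Q. norm (V x * of_real (f x - g x)))"
    by (rule integral_norm_bound)
  also have "\<dots> \<le> (LINT x|Q. D x)"
    using Bochner_Integration.integrable_diff[OF i1]
    by (intro integral_mono D integrable_norm bd) (simp add: right_diff_distrib)
  finally show ?thesis .
qed

section \<open>Replacing exponentials by indicators under varying probability laws\<close>

locale box_limit =
  fixes M :: "nat \<Rightarrow> 'a measure" and N :: "'b measure"
  assumes prob_M: "\<And>n. prob_space (M n)" and prob_N: "prob_space N"
begin

text \<open>The bounded factor \<open>U n\<close> carries the coordinates that are not being treated
  at the moment; everything is linear in \<open>f\<close>, so exponentials suffice.\<close>

lemma integral_trig_poly_tendsto:
  fixes U :: "nat \<Rightarrow> 'a \<Rightarrow> complex" and U' :: "'b \<Rightarrow> complex"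
  assumes U[measurable]: "\<And>n. U n \<in> borel_measurable (M n)" "\<And>n x. norm (U n x) \<le> 1"
    and U'[measurable]: "U' \<in> borel_measurable N" "\<And>x. norm (U' x) \<le> 1"
    and Z[measurable]: "\<And>n. Z n \<in> borel_measurable (M n)" and Y[measurable]: "Y \<in> borel_measurable N"
    and conv: "\<And>a. (\<lambda>n. LINT x|M n. U n x * iexp (a * Z n x)) \<longlonglongrightarrow> (LINT x|N. U' x * iexp (a * Y x))"
    and f: "trig_poly f"
  shows "(\<lambda>n. LINT x|M n. U n x * f (Z n x)) \<longlonglongrightarrow> (LINT x|N. U' x * f (Y x))"
  using f
proof induction
  case (exp c a)
  have "(\<lambda>n. LINT x|M n. U n x * (c * iexp (a * Z n x))) = (\<lambda>n. c * (LINT x|M n. U n x * iexp (a * Z n x)))"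
    by (subst integral_mult_right_zero[symmetric]) (simp add: algebra_simps)
  moreover have "(LINT x|N. U' x * (c * iexp (a * Y x))) = c * (LINT x|N. U' x * iexp (a * Y x))"
    by (subst integral_mult_right_zero[symmetric]) (simp add: algebra_simps)
  ultimately show ?case using tendsto_mult_left[OF conv[of a], of c] by presburger
next
  case (add f g)
  have int: "integrable (M n) (\<lambda>x. U n x * f (Z n x))" "integrable N (\<lambda>x. U' x * f (Y x))"
    if "trig_poly f" for f n
  proof -
    interpret M: prob_space "M n" by (rule prob_M)
    interpret N: prob_space N by (rule prob_N)
    from trig_poly_bounded_measurable[OF that] obtain B where
      [measurable]: "f \<in> borel_measurable borel" and B: "\<And>x. norm (f x) \<le> B" by auto
    have B': "norm (u * f x) \<le> B" if "norm u \<le> 1" for x u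
      using mult_mono[OF that B, of x] by (simp add: norm_mult)
    show "integrable (M n) (\<lambda>x. U n x * f (Z n x))"
      by (rule M.integrable_const_bound[where B=B]) (use B' U in auto)
    show "integrable N (\<lambda>x. U' x * f (Y x))"
      by (rule N.integrable_const_bound[where B=B]) (use B' U' in auto)
  qed
  show ?case
    unfolding distrib_left
    using add.IH by (subst (1 2) Bochner_Integration.integral_add) (auto intro!: tendsto_add int add.hyps)
qed

text \<open>A polynomial in a cosine is a trigonometric polynomial, and Weierstrass approximation on
  the compact range \<open>{-1..1}\<close> of the cosine is uniform over the whole real line. Thus
  no tightness argument is involved; the price is that only periodic test functions are
  reached.\<close>

lemma integral_cos_tendsto:
  fixes U :: "nat \<Rightarrow> 'a \<Rightarrow> complex" and U' :: "'b \<Rightarrow> complex" and F :: "real \<Rightarrow> real"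
  assumes U[measurable]: "\<And>n. U n \<in> borel_measurable (M n)" "\<And>n x. norm (U n x) \<le> 1"
    and U'[measurable]: "U' \<in> borel_measurable N" "\<And>x. norm (U' x) \<le> 1"
    and Z[measurable]: "\<And>n. Z n \<in> borel_measurable (M n)" and Y[measurable]: "Y \<in> borel_measurable N"
    and conv: "\<And>a. (\<lambda>n. LINT x|M n. U n x * iexp (a * Z n x)) \<longlonglongrightarrow> (LINT x|N. U' x * iexp (a * Y x))"
    and F: "continuous_on UNIV F"
  shows "(\<lambda>n. LINT x|M n. U n x * of_real (F (cos (b * Z n x)))) \<longlonglongrightarrow> (LINT x|N. U' x * of_real (F (cos (b * Y x))))"
proof (rule tendsto_approximation)
  fix e :: real assume "e > 0"
  then obtain g where g: "real_polynomial_function g" "\<And>x. x \<in> {-1..1} \<Longrightarrow> \<bar>F x - g x\<bar> < e"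
    using Stone_Weierstrass_real_polynomial_function[of "{-1..1}" F e] F
    by (metis UNIV_I compact_Icc continuous_on_subset subsetI)
  then obtain a n where gs: "g = (\<lambda>x. \<Sum>i\<le>(n::nat). a i * x ^ i)"
    by (auto simp: real_polynomial_function_iff_sum)
  define f where "f x = complex_of_real (g (cos (b * x)))" for x
  have tf: "trig_poly f"
    unfolding f_def gs
    by (simp add: trig_poly_sum trig_poly_mult trig_poly_const trig_poly_power trig_poly_cos)
  from trig_poly_bounded_measurable[OF tf] obtain B where
      [measurable]: "f \<in> borel_measurable borel" and B: "\<And>x. norm (f x) \<le> B" by auto
  have [measurable]: "F \<in> borel_measurable borel"
    using F by (rule borel_measurable_continuous_onI)
  have diff: "norm (complex_of_real (F (cos (b * x))) - f x) \<le> e" for x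
    using g(2)[of "cos (b * x)"] unfolding f_def
    by (metis abs_cos_le_one abs_le_iff atLeastAtMost_iff less_imp_le minus_le_iff norm_of_real of_real_diff)
  have gB: "\<bar>g (cos (b * y))\<bar> \<le> B" for y
    using B[of y] by (simp add: f_def)
  have FB: "\<bar>F (cos (b * y)) - g (cos (b * y))\<bar> \<le> e" for y
    using g(2)[of "cos (b * y)"] by auto
  have FB': "\<bar>F (cos (b * y))\<bar> \<le> B + e" "\<bar>g (cos (b * y))\<bar> \<le> B + e" for y
    using FB[of y] gB[of y] \<open>e > 0\<close> by linarith+
  have [measurable]: "g \<in> borel_measurable borel"
    unfolding gs by measurable
  show "\<exists>B b'. B \<longlonglongrightarrow> b' \<and> (\<forall>\<^sub>F n in sequentially. dist (LINT x|M n. U n x * of_real (F (cos (b * Z n x)))) (B n) \<le> e)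
      \<and> dist (LINT x|N. U' x * of_real (F (cos (b * Y x)))) b' \<le> e"
  proof (intro exI conjI)
    show "(\<lambda>n. LINT x|M n. U n x * f (Z n x)) \<longlonglongrightarrow> (LINT x|N. U' x * f (Y x))"
      by (rule integral_trig_poly_tendsto[OF U U' Z Y conv tf])
    have "norm ((LINT x|M n. U n x * of_real (F (cos (b * Z n x)))) - (LINT x|M n. U n x * f (Z n x))) \<le> (LINT x|M n. e)" for n
      unfolding f_def
      by (rule norm_integral_diff_le[OF prob_M U(1) _ _ U(2) _ FB FB'])
        (use prob_M[of n] in \<open>auto simp: prob_space_def intro: finite_measure.integrable_const\<close>)
    then show "\<forall>\<^sub>F n in sequentially. dist (LINT x|M n. U n x * of_real (F (cos (b * Z n x)))) (LINT x|M n. U n x * f (Z n x)) \<le> e"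
      using prob_space.prob_space[OF prob_M] by (auto simp: dist_norm)
    have "norm ((LINT x|N. U' x * of_real (F (cos (b * Y x)))) - (LINT x|N. U' x * f (Y x))) \<le> (LINT x|N. e)"
      unfolding f_def
      by (rule norm_integral_diff_le[OF prob_N U'(1) _ _ U'(2) _ FB FB'])
        (use prob_N in \<open>auto simp: prob_space_def intro: finite_measure.integrable_const\<close>)
    then show "dist (LINT x|N. U' x * of_real (F (cos (b * Y x)))) (LINT x|N. U' x * f (Y x)) \<le> e"
      using prob_space.prob_space[OF prob_N] by (auto simp: dist_norm)
  qed
qed

text \<open>Periodic continuous approximation of the indicator of \<open>{-h..h}\<close>: for fixed \<open>x\<close> the quantity
  \<open>m\<^sup>2 (cos (x/m) - cos (h/m))\<close> tends to \<open>(h\<^sup>2 - x\<^sup>2) / 2\<close>, so the extra factor \<open>m\<close>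
  pushes it to plus or minus infinity unless \<open>\<bar>x\<bar> = h\<close>.\<close>

definition cos_clamp :: "real \<Rightarrow> nat \<Rightarrow> real \<Rightarrow> real" where
  "cos_clamp h m y = max 0 (min 1 (1 + real (Suc m) ^ 3 * (y - cos (h / real (Suc m)))))"

lemma cos_clamp_tendsto:
  assumes "0 \<le> h"
  shows "(\<lambda>m. cos_clamp h m (cos (x / real (Suc m)))) \<longlonglongrightarrow> indicator {-h..h} x"
proof -
  consider "\<bar>x\<bar> < h" | "\<bar>x\<bar> = h" | "\<bar>x\<bar> > h" by linarith
  then show ?thesis
  proof cases
    case 1
    then have "h > 0" by linarith
    have le: "cos (h / real (Suc m)) \<le> cos (x / real (Suc m))" if "h / real (Suc m) \<le> pi" for m
    proof -
      have "cos (h / real (Suc m)) \<le> cos (\<bar>x\<bar> / real (Suc m))"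
        by (rule cos_monotone_0_pi_le) (use 1 that in \<open>auto intro: divide_right_mono\<close>)
      also have "cos (\<bar>x\<bar> / real (Suc m)) = cos (x / real (Suc m))"
        by (cases "x \<ge> 0") auto
      finally show ?thesis .
    qed
    have "(\<lambda>m. h / real (Suc m)) \<longlonglongrightarrow> 0" by real_asymp
    then have "\<forall>\<^sub>F m in sequentially. h / real (Suc m) < pi"
      by (rule order_tendstoD) simp
    then have "\<forall>\<^sub>F m in sequentially. cos_clamp h m (cos (x / real (Suc m))) = 1"
    proof eventually_elim
      case (elim m)
      then have "0 \<le> real (Suc m) ^ 3 * (cos (x / real (Suc m)) - cos (h / real (Suc m)))"
        using le[of m] by (intro mult_nonneg_nonneg) auto
      then show ?case unfolding cos_clamp_def by linarith
    qed
    then show ?thesis using 1 by (auto intro!: tendsto_eventually simp: indicator_def elim: eventually_mono)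
  next
    case 2
    \<comment> \<open>At the boundary the clamp equals one for every \<open>m\<close>, which is the
      value of the indicator of the closed interval.\<close>
    have "cos (x / real (Suc m)) = cos (h / real (Suc m))" for m
      using 2 by (cases "x \<ge> 0") auto
    then show ?thesis using 2 unfolding cos_clamp_def by (auto simp: indicator_def)
  next
    case 3
    have pos: "\<bar>x\<bar> > h" "0 \<le> h" "0 < \<bar>x\<bar> + h" "0 < \<bar>x\<bar> - h" using 3 assms by auto
    define p q where "p = \<bar>x\<bar> + h" and "q = \<bar>x\<bar> - h"
    \<comment> \<open>The difference of the two cosines, with its sign changed, written as a
      product: each sine is of order \<open>1 / m\<close>, so the cubic factor wins.\<close>
    have "filterlim (\<lambda>m. real (Suc m) ^ 3 * (2 * sin (p / (2 * real (Suc m))) * sin (q / (2 * real (Suc m))))) at_top sequentially"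
      using pos by (fold p_def q_def) real_asymp
    then have "\<forall>\<^sub>F m in sequentially. real (Suc m) ^ 3 * (2 * sin (p / (2 * real (Suc m))) * sin (q / (2 * real (Suc m)))) \<ge> 1"
      by (simp add: filterlim_at_top)
    then have "\<forall>\<^sub>F m in sequentially. cos_clamp h m (cos (x / real (Suc m))) = 0"
    proof eventually_elim
      case (elim m)
      have "cos (\<bar>x\<bar> / real (Suc m)) = cos (x / real (Suc m))"
        by (cases "x \<ge> 0") auto
      then have "cos (x / real (Suc m)) - cos (h / real (Suc m)) =
          - (2 * sin (p / (2 * real (Suc m))) * sin (q / (2 * real (Suc m))))"
        using cos_diff_cos[of "\<bar>x\<bar> / real (Suc m)" "h / real (Suc m)"]
        by (simp add: p_def q_def add_divide_distrib diff_divide_distrib sin_diff algebra_simps)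
      then show ?case using elim unfolding cos_clamp_def by (simp add: mult_minus_right)
    qed
    then show ?thesis using 3 by (auto intro!: tendsto_eventually simp: indicator_def elim: eventually_mono)
  qed
qed

text \<open>The error \<open>D m\<close> of the periodic approximation has small expectation in the
  limit law by dominated convergence. It is discontinuous only at \<open>h\<close> and
  \<open>-h\<close>, where \<open>Y\<close> has no atom, so Levy's continuity theorem for the single
  coordinate carries the bound over to \<open>M n\<close>; this is the purpose of the unweighted
  hypothesis \<open>conv1\<close>. What remains is a continuous function of a cosine.\<close>

lemma integral_indicator_tendsto:
  fixes U :: "nat \<Rightarrow> 'a \<Rightarrow> complex" and U' :: "'b \<Rightarrow> complex"
  assumes U[measurable]: "\<And>n. U n \<in> borel_measurable (M n)" "\<And>n x. norm (U n x) \<le> 1"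
    and U'[measurable]: "U' \<in> borel_measurable N" "\<And>x. norm (U' x) \<le> 1"
    and Z[measurable]: "\<And>n. Z n \<in> borel_measurable (M n)" and Y[measurable]: "Y \<in> borel_measurable N"
    and conv: "\<And>a. (\<lambda>n. LINT x|M n. U n x * iexp (a * Z n x)) \<longlonglongrightarrow> (LINT x|N. U' x * iexp (a * Y x))"
    and conv1: "\<And>a. (\<lambda>n. LINT x|M n. iexp (a * Z n x)) \<longlonglongrightarrow> (LINT x|N. iexp (a * Y x))"
    and h: "0 \<le> h"
    and atom: "\<And>y. measure N {x\<in>space N. Y x = y} = 0"
  shows "(\<lambda>n. LINT x|M n. U n x * indicator {-h..h} (Z n x)) \<longlonglongrightarrow> (LINT x|N. U' x * indicator {-h..h} (Y x))"
proof (rule tendsto_approximation)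
  fix e :: real assume "e > 0"
  interpret N: prob_space N by (rule prob_N)
  define D where "D m x = \<bar>indicator {-h..h} x - cos_clamp h m (cos (x / real (Suc m)))\<bar>" for m x
  have clamp01: "0 \<le> cos_clamp h m y" "cos_clamp h m y \<le> 1" for m y
    unfolding cos_clamp_def by auto
  have cont: "continuous_on UNIV (cos_clamp h m)" for m
    unfolding cos_clamp_def by (intro continuous_intros)
  have [measurable]: "cos_clamp h m \<in> borel_measurable borel" for m
    using cont by (rule borel_measurable_continuous_onI)
  have D01: "0 \<le> D m x" "D m x \<le> 1" for m x
    unfolding D_def using clamp01[of m "cos (x / real (Suc m))"] by (auto simp: indicator_def)
  have [measurable]: "D m \<in> borel_measurable borel" for m
    unfolding D_def by measurable
  have "(\<lambda>m. LINT x|N. D m (Y x)) \<longlonglongrightarrow> (LINT x|N. 0)"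
  proof (rule integral_dominated_convergence[where w="\<lambda>_. 1"])
    show "AE x in N. (\<lambda>i. D i (Y x)) \<longlonglongrightarrow> 0"
    proof (rule AE_I2)
      fix x
      have "(\<lambda>m. \<bar>indicator {-h..h} (Y x) - cos_clamp h m (cos (Y x / real (Suc m)))\<bar>) \<longlonglongrightarrow> \<bar>indicator {-h..h} (Y x) - indicator {-h..h} (Y x)\<bar>"
        by (intro tendsto_intros cos_clamp_tendsto h)
      then show "(\<lambda>i. D i (Y x)) \<longlonglongrightarrow> 0" by (simp add: D_def)
    qed
  qed (use D01 in \<open>auto\<close>)
  then have "\<forall>\<^sub>F m in sequentially. (LINT x|N. D m (Y x)) < e"
    using \<open>e > 0\<close> by (intro order_tendstoD) auto
  then obtain m where m: "(LINT x|N. D m (Y x)) < e"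
    by (auto simp: eventually_sequentially)
  let ?MZ = "\<lambda>n. distr (M n) borel (Z n)" and ?NY = "distr N borel Y"
  have rd: "real_distribution (?MZ n)" "real_distribution ?NY" for n
    using prob_M prob_N by (auto intro!: prob_space.real_distribution_distr)
  have "weak_conv_m ?MZ ?NY"
  proof (rule levy_continuity)
    show "(\<lambda>n. char (?MZ n) t) \<longlonglongrightarrow> char ?NY t" for t
      using conv1[of t] by (simp add: char_def integral_distr)
  qed (use rd in auto)
  moreover have "measure ?NY {x. \<not> isCont (D m) x} = 0"
    proof -
      have "isCont (D m) x" if "x \<noteq> h" "x \<noteq> -h" for x
      proof -
        have i: "isCont (indicator {-h..h} :: real \<Rightarrow> real) x"
          using that frontier_cbox[of "-h" h] by (auto simp: isCont_indicator)
        have "isCont (\<lambda>x. cos_clamp h m (cos (x / real (Suc m)))) x"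
          by (intro continuous_intros isCont_o2[OF _ cont[unfolded continuous_on_eq_continuous_at[OF open_UNIV], rule_format]]) auto
        then show ?thesis unfolding D_def using i by (intro continuous_intros)
      qed
      then have sub: "{x. \<not> isCont (D m) x} \<subseteq> {h, -h}" by auto
      have "measure ?NY {x. \<not> isCont (D m) x} \<le> measure ?NY {h, -h}"
        using real_distribution.axioms(1)[OF rd(2)] sub
        by (intro finite_measure.finite_measure_mono) (auto simp: prob_space_def)
      also have "\<dots> \<le> measure ?NY {h} + measure ?NY {-h}"
        using measure_Un_le[of "{h}" ?NY "{-h}"] by (simp add: insert_is_Un[of h "{-h}"])
      also have "\<dots> = 0"
        using atom[of h] atom[of "-h"] by (simp add: measure_distr vimage_def Int_def conj_commute)
      finally show ?thesis by (simp add: measure_le_0_iff)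
    qed
  ultimately have "(\<lambda>n. LINT x|?MZ n. D m x) \<longlonglongrightarrow> (LINT x|?NY. D m x)"
    using D01 real_distribution.axioms(1)[OF rd(2)]
    by (intro weak_conv_imp_bdd_ae_continuous_conv[OF rd, where B=1])
      (auto simp: prob_space_def finite_measure.emeasure_eq_measure)
  then have "(\<lambda>n. LINT x|M n. D m (Z n x)) \<longlonglongrightarrow> (LINT x|N. D m (Y x))"
    by (simp add: integral_distr)
  then have ev: "\<forall>\<^sub>F n in sequentially. (LINT x|M n. D m (Z n x)) < e"
    using m by (rule order_tendstoD)
  define f where "f x = cos_clamp h m (cos ((1 / real (Suc m)) * x))" for x
  have [measurable]: "f \<in> borel_measurable borel" unfolding f_def by measurable
  show "\<exists>B b. B \<longlonglongrightarrow> b \<and> (\<forall>\<^sub>F n in sequentially. dist (LINT x|M n. U n x * indicator {-h..h} (Z n x)) (B n) \<le> e)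
      \<and> dist (LINT x|N. U' x * indicator {-h..h} (Y x)) b \<le> e"
  proof (intro exI conjI)
    show "(\<lambda>n. LINT x|M n. U n x * of_real (f (Z n x))) \<longlonglongrightarrow> (LINT x|N. U' x * of_real (f (Y x)))"
      unfolding f_def by (rule integral_cos_tendsto[OF U U' Z Y conv cont])
    have ind: "complex_of_real (indicator A x) = indicator A x" for A :: "real set" and x
      by (auto simp: indicator_def)
    have iD: "integrable (M n) (\<lambda>x. D m (Z n x))" "integrable N (\<lambda>x. D m (Y x))" for n
      by (rule finite_measure.integrable_const_bound[OF prob_space.finite_measure[OF prob_M], where B=1]
          finite_measure.integrable_const_bound[OF prob_space.finite_measure[OF prob_N], where B=1]; use D01 in auto)+
    have *: "norm ((LINT x|M n. U n x * of_real (indicator {-h..h} (Z n x))) - (LINT x|M n. U n x * of_real (f (Z n x)))) \<le> (LINT x|M n. D m (Z n x))" for n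
      by (rule norm_integral_diff_le[OF prob_M U(1) _ _ U(2), where B=1])
        (use iD clamp01 in \<open>auto simp: D_def f_def indicator_def\<close>)
    show "\<forall>\<^sub>F n in sequentially. dist (LINT x|M n. U n x * indicator {-h..h} (Z n x)) (LINT x|M n. U n x * of_real (f (Z n x))) \<le> e"
      using ev by eventually_elim (use * in \<open>auto simp: dist_norm ind intro: order_trans less_imp_le\<close>)
    have "norm ((LINT x|N. U' x * of_real (indicator {-h..h} (Y x))) - (LINT x|N. U' x * of_real (f (Y x)))) \<le> (LINT x|N. D m (Y x))"
      by (rule norm_integral_diff_le[OF prob_N U'(1) _ _ U'(2), where B=1])
        (use iD clamp01 in \<open>auto simp: D_def f_def indicator_def\<close>)
    then show "dist (LINT x|N. U' x * indicator {-h..h} (Y x)) (LINT x|N. U' x * of_real (f (Y x))) \<le> e"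
      using m by (auto simp: dist_norm ind)
  qed
qed

text \<open>The coordinates are converted one at a time: in the induction the coordinates in
  \<open>S\<close> already carry indicators while the others keep free frequencies \<open>t\<close>.
  Only one-dimensional weak convergence is ever invoked, and the absence of atoms is required of
  each marginal alone.\<close>

proposition box_probability_tendsto:
  fixes Z :: "nat \<Rightarrow> 'i \<Rightarrow> 'a \<Rightarrow> real" and Y :: "'i \<Rightarrow> 'b \<Rightarrow> real"
  assumes fin: "finite I"
    and Z[measurable]: "\<And>n i. i \<in> I \<Longrightarrow> Z n i \<in> borel_measurable (M n)"
    and Y[measurable]: "\<And>i. i \<in> I \<Longrightarrow> Y i \<in> borel_measurable N"
    and conv: "\<And>t. (\<lambda>n. LINT x|M n. iexp (\<Sum>i\<in>I. t i * Z n i x)) \<longlonglongrightarrow> (LINT x|N. iexp (\<Sum>i\<in>I. t i * Y i x))"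
    and h: "\<And>i. i \<in> I \<Longrightarrow> 0 \<le> h i"
    and atom: "\<And>i y. i \<in> I \<Longrightarrow> measure N {x\<in>space N. Y i x = y} = 0"
  shows "(\<lambda>n. measure (M n) {x\<in>space (M n). \<forall>i\<in>I. \<bar>Z n i x\<bar> \<le> h i})
      \<longlonglongrightarrow> measure N {x\<in>space N. \<forall>i\<in>I. \<bar>Y i x\<bar> \<le> h i}"
proof -
  \<comment> \<open>Frequency vectors supported at a single index give the characteristic functions
    of the marginals.\<close>
  have conv1: "(\<lambda>n. LINT x|M n. iexp (a * Z n i x)) \<longlonglongrightarrow> (LINT x|N. iexp (a * Y i x))" if "i \<in> I" for i a
  proof -
    have "(\<Sum>j\<in>I. (if j = i then a else 0) * X j) = a * X i" for X :: "'i \<Rightarrow> real"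
      using that fin by (simp add: if_distrib[of "\<lambda>c. c * _"] sum.delta cong: if_cong)
    then show ?thesis using conv[of "\<lambda>j. if j = i then a else 0"] by simp
  qed
  have main: "S \<subseteq> I \<Longrightarrow> \<forall>t. (\<lambda>n. LINT x|M n. (\<Prod>i\<in>S. indicator {-h i..h i} (Z n i x)) * iexp (\<Sum>i\<in>I - S. t i * Z n i x))
      \<longlonglongrightarrow> (LINT x|N. (\<Prod>i\<in>S. indicator {-h i..h i} (Y i x)) * iexp (\<Sum>i\<in>I - S. t i * Y i x))" for S
  proof (induction S rule: infinite_finite_induct)
    case (infinite A)
    then show ?case using fin finite_subset by blast
  next
    case empty
    then show ?case using conv by simp
  next
    case (insert j S)
    show ?case
    proof
      fix t :: "'i \<Rightarrow> real"
      define E where "E X = iexp (\<Sum>i\<in>I - insert j S. t i * X i)" for X :: "'i \<Rightarrow> real"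
      have j: "j \<in> I" and S: "S \<subseteq> I" using insert.prems by auto
      \<comment> \<open>Varying the frequency of \<open>j\<close> alone turns the induction
        hypothesis into convergence of all exponentials in coordinate \<open>j\<close>, weighted by
        the remaining factors, which is what the one-coordinate step requires.\<close>
      have split: "iexp (\<Sum>i\<in>I - S. (t(j := a)) i * X i) = E X * iexp (a * X j)" for a and X :: "'i \<Rightarrow> real"
      proof -
        have "I - S - {j} = I - insert j S" "j \<in> I - S" using j insert.hyps by auto
        then have "(\<Sum>i\<in>I - S. (t(j := a)) i * X i) = a * X j + (\<Sum>i\<in>I - insert j S. (t(j := a)) i * X i)"
          using fin sum.remove[of "I - S" j "\<lambda>i. (t(j := a)) i * X i"] by simp
        also have "(\<Sum>i\<in>I - insert j S. (t(j := a)) i * X i) = (\<Sum>i\<in>I - insert j S. t i * X i)"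
          by (intro sum.cong) auto
        finally have "(\<Sum>i\<in>I - S. (t(j := a)) i * X i) = (\<Sum>i\<in>I - insert j S. t i * X i) + a * X j" by simp
        then show ?thesis unfolding E_def by (simp only: of_real_add distrib_left exp_add)
      qed
      have ZS[measurable]: "\<And>i n. i \<in> S \<Longrightarrow> Z n i \<in> borel_measurable (M n)"
         "\<And>i n. i \<in> I - insert j S \<Longrightarrow> Z n i \<in> borel_measurable (M n)"
         "\<And>n. Z n j \<in> borel_measurable (M n)"
        and YS[measurable]: "\<And>i. i \<in> S \<Longrightarrow> Y i \<in> borel_measurable N"
         "\<And>i. i \<in> I - insert j S \<Longrightarrow> Y i \<in> borel_measurable N" "Y j \<in> borel_measurable N"
        using S j by auto
      have prod_le: "norm (\<Prod>i\<in>S. indicator {-h i..h i} (X i) :: complex) \<le> 1" for X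
        unfolding prod_norm[symmetric] by (intro prod_le_1) (auto simp: indicator_def)
      have "(\<lambda>n. LINT x|M n. ((\<Prod>i\<in>S. indicator {-h i..h i} (Z n i x)) * E (\<lambda>i. Z n i x)) * indicator {-h j..h j} (Z n j x))
        \<longlonglongrightarrow> (LINT x|N. ((\<Prod>i\<in>S. indicator {-h i..h i} (Y i x)) * E (\<lambda>i. Y i x)) * indicator {-h j..h j} (Y j x))"
      proof (rule integral_indicator_tendsto)
        fix a
        show "(\<lambda>n. LINT x|M n. ((\<Prod>i\<in>S. indicator {-h i..h i} (Z n i x)) * E (\<lambda>i. Z n i x)) * iexp (a * Z n j x))
        \<longlonglongrightarrow> (LINT x|N. ((\<Prod>i\<in>S. indicator {-h i..h i} (Y i x)) * E (\<lambda>i. Y i x)) * iexp (a * Y j x))"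
          using insert.IH[OF S, rule_format, of "t(j := a)"] unfolding split by (simp add: mult.assoc)
      next
        fix a
        show "(\<lambda>n. LINT x|M n. iexp (a * Z n j x)) \<longlonglongrightarrow> (LINT x|N. iexp (a * Y j x))"
          by (rule conv1[OF j])
      qed (use prod_le in \<open>auto simp: E_def norm_mult h[OF j] atom[OF j]\<close>)
      then show "(\<lambda>n. LINT x|M n. (\<Prod>i\<in>insert j S. indicator {-h i..h i} (Z n i x)) * iexp (\<Sum>i\<in>I - insert j S. t i * Z n i x))
      \<longlonglongrightarrow> (LINT x|N. (\<Prod>i\<in>insert j S. indicator {-h i..h i} (Y i x)) * iexp (\<Sum>i\<in>I - insert j S. t i * Y i x))"
        using insert.hyps by (simp add: E_def mult_ac)
    qed
  qed
  have eq: "(\<Prod>i\<in>I. indicator {-h i..h i} (X i) :: complex) = of_real (indicator {x. \<forall>i\<in>I. \<bar>x i\<bar> \<le> h i} X)" for X :: "'i \<Rightarrow> real"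
  proof (cases "\<forall>i\<in>I. \<bar>X i\<bar> \<le> h i")
    case True
    then show ?thesis by (auto simp: indicator_def abs_le_iff minus_le_iff intro!: prod.neutral)
  next
    case False
    then obtain i where "i \<in> I" "\<not> \<bar>X i\<bar> \<le> h i" by auto
    then have "(\<Prod>i\<in>I. indicator {-h i..h i} (X i) :: complex) = 0"
      using fin by (intro prod_zero) (auto simp: indicator_def intro!: bexI[of _ i])
    with False show ?thesis by (auto simp: indicator_def)
  qed
  have meas: "(LINT x|Q. indicator {x. \<forall>i\<in>I. \<bar>x i\<bar> \<le> h i} (\<lambda>i. X i x)) = measure Q {x\<in>space Q. \<forall>i\<in>I. \<bar>X i x\<bar> \<le> h i}"
    if "prob_space Q" "\<And>i. i \<in> I \<Longrightarrow> X i \<in> borel_measurable Q" for Q :: "'c measure" and X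
  proof -
    interpret prob_space Q by fact
    have "{x\<in>space Q. \<forall>i\<in>I. \<bar>X i x\<bar> \<le> h i} \<in> sets Q"
      using that fin by (intro sets.sets_Collect_finite_All) (auto intro!: borel_measurable_le borel_measurable_abs)
    then have "(LINT x|Q. indicator {x\<in>space Q. \<forall>i\<in>I. \<bar>X i x\<bar> \<le> h i} x) = measure Q {x\<in>space Q. \<forall>i\<in>I. \<bar>X i x\<bar> \<le> h i}"
      by simp
    moreover have "(LINT x|Q. indicator {x. \<forall>i\<in>I. \<bar>x i\<bar> \<le> h i} (\<lambda>i. X i x)) = (LINT x|Q. indicator {x\<in>space Q. \<forall>i\<in>I. \<bar>X i x\<bar> \<le> h i} x :: real)"
      by (intro Bochner_Integration.integral_cong) (auto simp: indicator_def)
    ultimately show ?thesis by simp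
  qed
  have "(\<lambda>n. complex_of_real (measure (M n) {x\<in>space (M n). \<forall>i\<in>I. \<bar>Z n i x\<bar> \<le> h i}))
      \<longlonglongrightarrow> complex_of_real (measure N {x\<in>space N. \<forall>i\<in>I. \<bar>Y i x\<bar> \<le> h i})"
    using main[OF order_refl, rule_format, of "\<lambda>_. 0"]
    by (simp add: eq meas[OF prob_M Z] meas[OF prob_N Y])
  then show ?thesis by (rule tendsto_of_real_iff[THEN iffD1])
qed

end

section \<open>Exponential and characteristic-function bounds on product spaces\<close>

lemma PiM_density_lborel:
  fixes f :: "'i \<Rightarrow> real \<Rightarrow> ennreal"
  assumes I: "finite I" and [measurable]: "\<And>i. f i \<in> borel_measurable borel"
    and sf: "\<And>i. sigma_finite_measure (density lborel (f i))"
  shows "(\<Pi>\<^sub>M i\<in>I. density lborel (f i)) = density (\<Pi>\<^sub>M i\<in>I. lborel) (\<lambda>x. \<Prod>i\<in>I. f i (x i))"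
proof -
  interpret P: product_sigma_finite "\<lambda>i. density lborel (f i)"
    by (simp add: product_sigma_finite_def sf)
  interpret L: product_sigma_finite "\<lambda>i::'i. lborel :: real measure"
    by standard
  have "density (\<Pi>\<^sub>M i\<in>I. lborel) (\<lambda>x. \<Prod>i\<in>I. f i (x i)) = (\<Pi>\<^sub>M i\<in>I. density lborel (f i))"
  proof (rule P.PiM_eqI[OF I])
    fix A assume A: "\<And>i. i \<in> I \<Longrightarrow> A i \<in> sets (density lborel (f i))"
    then have [measurable]: "\<And>i. i \<in> I \<Longrightarrow> A i \<in> sets borel" by simp
    have "Pi\<^sub>E I A \<in> sets (\<Pi>\<^sub>M i\<in>I. lborel :: real measure)"
      using A by (intro sets_PiM_I_finite I) auto
    then have "emeasure (density (\<Pi>\<^sub>M i\<in>I. lborel) (\<lambda>x. \<Prod>i\<in>I. f i (x i))) (Pi\<^sub>E I A)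
        = (\<integral>\<^sup>+x. (\<Prod>i\<in>I. f i (x i)) * indicator (Pi\<^sub>E I A) x \<partial>(\<Pi>\<^sub>M i\<in>I. lborel))"
      by (intro emeasure_density) auto
    also have "\<dots> = (\<integral>\<^sup>+x. (\<Prod>i\<in>I. f i (x i) * indicator (A i) (x i)) \<partial>(\<Pi>\<^sub>M i\<in>I. lborel))"
    proof (intro nn_integral_cong)
      fix x assume x: "x \<in> space (\<Pi>\<^sub>M i\<in>I. lborel :: real measure)"
      show "(\<Prod>i\<in>I. f i (x i)) * indicator (Pi\<^sub>E I A) x = (\<Prod>i\<in>I. f i (x i) * indicator (A i) (x i))"
      proof (cases "x \<in> Pi\<^sub>E I A")
        case True
        then show ?thesis by (auto intro!: prod.cong simp: PiE_mem)
      next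
        case False
        then obtain i where "i \<in> I" "x i \<notin> A i" using x by (auto simp: space_PiM PiE_def Pi_def)
        then have "(\<Prod>i\<in>I. f i (x i) * indicator (A i) (x i)) = 0"
          using I by (intro prod_zero) (auto intro!: bexI[of _ i])
        then show ?thesis using False by simp
      qed
    qed
    also have "\<dots> = (\<Prod>i\<in>I. \<integral>\<^sup>+x. f i x * indicator (A i) x \<partial>lborel)"
      by (rule L.product_nn_integral_prod[OF I]) measurable
    also have "\<dots> = (\<Prod>i\<in>I. emeasure (density lborel (f i)) (A i))"
      using A by (intro prod.cong) (auto simp: emeasure_density)
    finally show "emeasure (density (\<Pi>\<^sub>M i\<in>I. lborel) (\<lambda>x. \<Prod>i\<in>I. f i (x i))) (Pi\<^sub>E I A) = \<dots>" .
  next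
    show "sets (density (\<Pi>\<^sub>M i\<in>I. lborel) (\<lambda>x. \<Prod>i\<in>I. f i (x i))) = sets (\<Pi>\<^sub>M i\<in>I. density lborel (f i))"
      by (simp cong: sets_PiM_cong)
  qed
  then show ?thesis by simp
qed

lemma product_prob_space_I: "(\<And>i. prob_space (M i)) \<Longrightarrow> product_prob_space M"
  unfolding product_prob_space_def product_prob_space_axioms_def product_sigma_finite_def
  using prob_space_imp_sigma_finite by blast

text \<open>Markov's inequality for the exponentials with parameters \<open>l\<close> and
  \<open>- l\<close>, factorised by independence. The \<open>v i\<close> act as variance proxies,
  and the moment generating functions are controlled only at these two parameters, so that
  \<open>l\<close> may later depend on the Haar level.\<close>

lemma PiM_chernoff:
  fixes Y :: "'i \<Rightarrow> 'a \<Rightarrow> real"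
  assumes I: "finite I" and M: "\<And>i. prob_space (M i)"
    and Y[measurable]: "\<And>i. i \<in> I \<Longrightarrow> Y i \<in> borel_measurable (M i)"
    and mgf: "\<And>i. i \<in> I \<Longrightarrow> (\<integral>\<^sup>+x. ennreal (exp (l * Y i x)) \<partial>M i) \<le> ennreal (exp (l\<^sup>2 * v i))"
      "\<And>i. i \<in> I \<Longrightarrow> (\<integral>\<^sup>+x. ennreal (exp (- l * Y i x)) \<partial>M i) \<le> ennreal (exp (l\<^sup>2 * v i))"
    and l: "0 \<le> l"
  shows "measure (PiM I M) {x\<in>space (PiM I M). a \<le> \<bar>\<Sum>i\<in>I. Y i (x i)\<bar>} \<le> 2 * exp (- l * a + l\<^sup>2 * (\<Sum>i\<in>I. v i))"
proof -
  interpret product_prob_space M by (rule product_prob_space_I[OF M])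
  interpret P: prob_space "PiM I M" by (rule prob_space_PiM[OF M])
  have one: "emeasure (PiM I M) {x\<in>space (PiM I M). l * a \<le> e * (\<Sum>i\<in>I. Y i (x i))} \<le> ennreal (exp (- l * a + l\<^sup>2 * (\<Sum>i\<in>I. v i)))"
    if e: "\<And>i. i \<in> I \<Longrightarrow> (\<integral>\<^sup>+x. ennreal (exp (e * Y i x)) \<partial>M i) \<le> ennreal (exp (l\<^sup>2 * v i))" for e
  proof -
    have "emeasure (PiM I M) {x\<in>space (PiM I M). l * a \<le> e * (\<Sum>i\<in>I. Y i (x i))}
        = (\<integral>\<^sup>+x. indicator {x\<in>space (PiM I M). l * a \<le> e * (\<Sum>i\<in>I. Y i (x i))} x \<partial>PiM I M)"
      by (rule nn_integral_indicator[symmetric]) measurable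
    also have "\<dots> \<le> (\<integral>\<^sup>+x. ennreal (exp (- l * a)) * (\<Prod>i\<in>I. ennreal (exp (e * Y i (x i)))) \<partial>PiM I M)"
    proof (intro nn_integral_mono)
      fix x
      have "(\<Prod>i\<in>I. ennreal (exp (e * Y i (x i)))) = ennreal (exp (e * (\<Sum>i\<in>I. Y i (x i))))"
        using I by (simp add: prod_ennreal exp_sum sum_distrib_left)
      moreover have "indicator {x\<in>space (PiM I M). l * a \<le> e * (\<Sum>i\<in>I. Y i (x i))} x
          \<le> ennreal (exp (- l * a) * exp (e * (\<Sum>i\<in>I. Y i (x i))))"
        unfolding exp_add[symmetric] by (auto simp: indicator_def)
      ultimately show "indicator {x\<in>space (PiM I M). l * a \<le> e * (\<Sum>i\<in>I. Y i (x i))} x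
          \<le> ennreal (exp (- l * a)) * (\<Prod>i\<in>I. ennreal (exp (e * Y i (x i))))"
        by (simp add: ennreal_mult')
    qed
    also have "\<dots> = ennreal (exp (- l * a)) * (\<Prod>i\<in>I. \<integral>\<^sup>+x. ennreal (exp (e * Y i x)) \<partial>M i)"
      using Y by (subst nn_integral_cmult) (simp_all add: product_nn_integral_prod[OF I, of "\<lambda>i y. ennreal (exp (e * Y i y))"])
    also have "\<dots> \<le> ennreal (exp (- l * a)) * (\<Prod>i\<in>I. ennreal (exp (l\<^sup>2 * v i)))"
      by (intro mult_left_mono prod_mono_ennreal) (use e in auto)
    also have "\<dots> = ennreal (exp (- l * a + l\<^sup>2 * (\<Sum>i\<in>I. v i)))"
      using I by (simp add: prod_ennreal exp_add[symmetric] exp_sum[symmetric] sum_distrib_left ennreal_mult'[symmetric])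
    finally show ?thesis .
  qed
  let ?A = "\<lambda>e. {x\<in>space (PiM I M). l * a \<le> e * (\<Sum>i\<in>I. Y i (x i))}"
  have "{x\<in>space (PiM I M). a \<le> \<bar>\<Sum>i\<in>I. Y i (x i)\<bar>} \<subseteq> ?A l \<union> ?A (- l)"
    using l by (auto simp: abs_if mult_left_mono split: if_splits
        dest: mult_left_mono[OF _ l])
  then have "measure (PiM I M) {x\<in>space (PiM I M). a \<le> \<bar>\<Sum>i\<in>I. Y i (x i)\<bar>} \<le> measure (PiM I M) (?A l \<union> ?A (- l))"
    by (intro P.finite_measure_mono) measurable
  also have "\<dots> \<le> measure (PiM I M) (?A l) + measure (PiM I M) (?A (-l))"
    by (intro measure_Un_le) measurable
  also have "\<dots> \<le> exp (- l * a + l\<^sup>2 * (\<Sum>i\<in>I. v i)) + exp (- l * a + l\<^sup>2 * (\<Sum>i\<in>I. v i))"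
    using one[of l, OF mgf(1)] one[of "-l", OF mgf(2)]
    by (intro add_mono) (auto simp: P.emeasure_eq_measure)
  finally show ?thesis by simp
qed

text \<open>For negative \<open>x\<close> both sides are multiplied by \<open>1 - x\<close>: the
  left one becomes at most \<open>1\<close>, the right one is \<open>1 - x ^ 3\<close>. No lower
  bound on \<open>x\<close> is imposed, only the upper one.\<close>

lemma exp_le_quadratic:
  fixes x :: real
  assumes "x \<le> 1"
  shows "exp x \<le> 1 + x + x\<^sup>2"
proof (cases "x \<ge> 0")
  case True
  then show ?thesis using assms by (intro exp_bound) auto
next
  case False
  then have "exp x * (1 - x) \<le> exp x * exp (- x)"
    using exp_ge_add_one_self[of "-x"] by (intro mult_left_mono) auto
  then have "exp x * (1 - x) \<le> 1" by (simp add: exp_minus)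
  also have "1 \<le> (1 + x + x\<^sup>2) * (1 - x)"
    using False by (simp add: algebra_simps power2_eq_square zero_le_mult_iff mult_le_0_iff)
  finally show ?thesis using False mult_right_le_imp_le[of "exp x" "1 - x"] by auto
qed

text \<open>Bernstein's bound: the linear term vanishes by centring, and
  \<open>1 + l\<^sup>2 * v\<close> is at most its exponential. The variance rather than the supremum
  governs the exponent as long as \<open>\<bar>l\<bar> * b \<le> 1\<close>.\<close>

lemma (in prob_space) mgf_bounded:
  fixes Y :: "'a \<Rightarrow> real"
  assumes [measurable]: "Y \<in> borel_measurable M" and b: "\<And>x. x \<in> space M \<Longrightarrow> \<bar>Y x\<bar> \<le> b"
    and mean: "expectation Y = 0" and var: "expectation (\<lambda>x. (Y x)\<^sup>2) \<le> v" and l: "\<bar>l\<bar> * b \<le> 1"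
  shows "(\<integral>\<^sup>+x. ennreal (exp (l * Y x)) \<partial>M) \<le> ennreal (exp (l\<^sup>2 * v))"
proof -
  have i1: "integrable M Y" by (rule integrable_const_bound[where B=b]) (use b in auto)
  have i2: "integrable M (\<lambda>x. (Y x)\<^sup>2)"
    by (rule integrable_const_bound[where B="b\<^sup>2"]) (use b in \<open>auto intro!: AE_I2 simp: abs_le_square_iff[symmetric] intro: order_trans[OF _ abs_ge_self]\<close>)
  have lY: "l * Y x \<le> 1" if "x \<in> space M" for x
  proof -
    have "l * Y x \<le> \<bar>l\<bar> * \<bar>Y x\<bar>" by (metis abs_ge_self abs_mult)
    also have "\<dots> \<le> \<bar>l\<bar> * b" by (intro mult_left_mono b that) auto
    finally show ?thesis using l by linarith
  qed
  have "(\<integral>\<^sup>+x. ennreal (exp (l * Y x)) \<partial>M) \<le> (\<integral>\<^sup>+x. ennreal (1 + l * Y x + (l * Y x)\<^sup>2) \<partial>M)"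
    using lY by (intro nn_integral_mono ennreal_leI exp_le_quadratic)
  also have "\<dots> = ennreal (LINT x|M. 1 + l * Y x + (l * Y x)\<^sup>2)"
  proof (rule nn_integral_eq_integral)
    show "integrable M (\<lambda>x. 1 + l * Y x + (l * Y x)\<^sup>2)"
      using i1 i2 by (auto simp: power_mult_distrib)
    show "AE x in M. 0 \<le> 1 + l * Y x + (l * Y x)\<^sup>2"
    proof (rule AE_I2)
      fix x
      have "0 \<le> (1 + 2 * (l * Y x))\<^sup>2" by simp
      then show "0 \<le> 1 + l * Y x + (l * Y x)\<^sup>2" by (simp add: power2_eq_square algebra_simps)
    qed
  qed
  also have "ennreal (LINT x|M. 1 + l * Y x + (l * Y x)\<^sup>2) \<le> ennreal (exp (l\<^sup>2 * v))"
  proof (rule ennreal_leI)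
    have "(LINT x|M. 1 + l * Y x + (l * Y x)\<^sup>2) = 1 + l\<^sup>2 * expectation (\<lambda>x. (Y x)\<^sup>2)"
    using i1 i2 mean by (simp add: power_mult_distrib prob_space)
  also have "\<dots> \<le> 1 + l\<^sup>2 * v"
    using var by (simp add: mult_left_mono)
  also have "\<dots> \<le> exp (l\<^sup>2 * v)" by simp
  finally show "(LINT x|M. 1 + l * Y x + (l * Y x)\<^sup>2) \<le> exp (l\<^sup>2 * v)" .
  qed
  finally show ?thesis .
qed

lemma cmod_exp_minus_le: 
  assumes "0 \<le> u"
  shows "\<bar>exp (- u) - (1 - u)\<bar> \<le> (u::real)\<^sup>2 / 2"
proof -
  have "exp (- u) \<ge> 1 - u" using exp_ge_add_one_self[of "-u"] by simp
  moreover have "exp (- u) \<le> 1 - u + u\<^sup>2 / 2"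
  proof -
    have "exp (- u) * (1 + u + u\<^sup>2 / 2) \<le> exp (- u) * exp u"
      using exp_lower_Taylor_quadratic[OF assms] by (intro mult_left_mono) auto
    then have "exp (- u) * (1 + u + u\<^sup>2 / 2) \<le> 1" by (simp add: exp_minus)
    \<comment> \<open>The product on the right equals \<open>1 + u ^ 4 / 4\<close>.\<close>
    also have "1 \<le> (1 - u + u\<^sup>2 / 2) * (1 + u + u\<^sup>2 / 2)"
      using assms by (simp add: algebra_simps power2_eq_square)
    finally have "exp (- u) * (1 + u + u\<^sup>2 / 2) \<le> (1 - u + u\<^sup>2 / 2) * (1 + u + u\<^sup>2 / 2)" .
    moreover have "1 + u + u\<^sup>2 / 2 > 0" using assms by (smt (verit) zero_le_power2 divide_nonneg_pos)
    ultimately show ?thesis using mult_le_cancel_right_pos by blast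
  qed
  ultimately show ?thesis by linarith
qed

text \<open>Both characteristic functions are compared with \<open>1 - v / 2\<close>: the first by
  the third-order Taylor remainder of the exponential, the Gaussian one by its second-order
  remainder.\<close>

lemma (in prob_space) char_normal_approx:
  fixes Y :: "'a \<Rightarrow> real"
  assumes [measurable]: "Y \<in> borel_measurable M" and i3: "integrable M (\<lambda>x. \<bar>Y x\<bar> ^ 3)"
    and i1: "integrable M Y" and i2: "integrable M (\<lambda>x. (Y x)\<^sup>2)"
    and mean: "expectation Y = 0" and var: "expectation (\<lambda>x. (Y x)\<^sup>2) = v"
  shows "norm ((LINT x|M. iexp (Y x)) - of_real (exp (- v / 2))) \<le> expectation (\<lambda>x. \<bar>Y x\<bar> ^ 3) / 6 + v\<^sup>2 / 8"
proof -
  have v: "0 \<le> v" unfolding var[symmetric] by simp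
  have ii: "integrable M (\<lambda>x. iexp (Y x))" by (rule integrable_iexp) auto
  have iq: "integrable M (\<lambda>x. 1 + \<i> * Y x - (Y x)\<^sup>2 / 2 :: complex)"
  proof -
    have "integrable M (\<lambda>x. complex_of_real (Y x))" "integrable M (\<lambda>x. complex_of_real ((Y x)\<^sup>2))"
      using i1 i2 by (simp_all only: integrable_of_real)
    then show ?thesis by auto
  qed
  have q: "(LINT x|M. 1 + \<i> * Y x - (Y x)\<^sup>2 / 2 :: complex) = of_real (1 - v / 2)"
  proof -
    have "integrable M (\<lambda>x. complex_of_real (Y x))" "integrable M (\<lambda>x. complex_of_real ((Y x)\<^sup>2))"
      using i1 i2 by (simp_all only: integrable_of_real)
    moreover have "(LINT x|M. complex_of_real (Y x)) = 0" "(LINT x|M. complex_of_real ((Y x)\<^sup>2)) = of_real v"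
      using mean var by (simp_all only: integral_complex_of_real of_real_0)
    ultimately show ?thesis by (simp add: prob_space)
  qed
  have bd: "norm (iexp (Y x) - (1 + \<i> * Y x - (Y x)\<^sup>2 / 2)) \<le> \<bar>Y x\<bar> ^ 3 / 6" for x
    using iexp_approx1[of "Y x" 2] by (simp add: numeral_eq_Suc power2_eq_square algebra_simps)
  have "norm ((LINT x|M. iexp (Y x)) - of_real (1 - v / 2)) = norm (LINT x|M. iexp (Y x) - (1 + \<i> * Y x - (Y x)\<^sup>2 / 2))"
    unfolding q[symmetric] by (subst Bochner_Integration.integral_diff[OF ii iq]) simp
  also have "\<dots> \<le> (LINT x|M. norm (iexp (Y x) - (1 + \<i> * Y x - (Y x)\<^sup>2 / 2)))"
    by (rule integral_norm_bound)
  also have "\<dots> \<le> (LINT x|M. \<bar>Y x\<bar> ^ 3 / 6)"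
    using bd i3 by (intro integral_mono integrable_norm Bochner_Integration.integrable_diff ii iq) auto
  also have "\<dots> = expectation (\<lambda>x. \<bar>Y x\<bar> ^ 3) / 6" by simp
  finally have 1: "norm ((LINT x|M. iexp (Y x)) - of_real (1 - v / 2)) \<le> expectation (\<lambda>x. \<bar>Y x\<bar> ^ 3) / 6" .
  have "norm (complex_of_real (1 - v / 2) - of_real (exp (- v / 2))) \<le> (v / 2)\<^sup>2 / 2"
    using cmod_exp_minus_le[of "v / 2"] v
    by (simp only: of_real_diff[symmetric] norm_of_real) (simp add: abs_minus_commute)
  then have 2: "norm (complex_of_real (1 - v / 2) - of_real (exp (- v / 2))) \<le> v\<^sup>2 / 8"
    by (simp add: power2_eq_square)
  show ?thesis using norm_triangle_le[OF add_mono[OF 1 2]] by simp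
qed

text \<open>A product of numbers in the unit disc changes by at most the sum of the changes of its
  factors, so the errors of independent summands add up. This one estimate yields the normal limit
  for the sample, for the posterior, and, with zero errors, the Gaussian identity itself.\<close>

lemma PiM_char_normal_approx:
  fixes Y :: "'i \<Rightarrow> 'a \<Rightarrow> real"
  assumes I: "finite I" and M: "\<And>i. prob_space (M i)"
    and Y[measurable]: "\<And>i. i \<in> I \<Longrightarrow> Y i \<in> borel_measurable (M i)"
    and bd: "\<And>i. i \<in> I \<Longrightarrow> norm ((LINT x|M i. iexp (Y i x)) - of_real (exp (- v i / 2))) \<le> e i"
    and v: "\<And>i. i \<in> I \<Longrightarrow> 0 \<le> v i"
  shows "norm ((LINT x|PiM I M. iexp (\<Sum>i\<in>I. Y i (x i))) - of_real (exp (- (\<Sum>i\<in>I. v i) / 2))) \<le> (\<Sum>i\<in>I. e i)"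
proof -
  interpret product_prob_space M by (rule product_prob_space_I[OF M])
  have int: "integrable (M i) (\<lambda>x. iexp (Y i x))" if "i \<in> I" for i
    using that by (intro prob_space.integrable_iexp[OF M]) auto
  have "(LINT x|PiM I M. iexp (\<Sum>i\<in>I. Y i (x i))) = (LINT x|PiM I M. (\<Prod>i\<in>I. iexp (Y i (x i))))"
    using I by (simp add: exp_sum sum_distrib_left)
  also have "\<dots> = (\<Prod>i\<in>I. (LINT x|M i. iexp (Y i x)))"
    by (rule product_integral_prod[OF I int])
  finally have 1: "(LINT x|PiM I M. iexp (\<Sum>i\<in>I. Y i (x i))) = (\<Prod>i\<in>I. (LINT x|M i. iexp (Y i x)))" .
  have 2: "complex_of_real (exp (- (\<Sum>i\<in>I. v i) / 2)) = (\<Prod>i\<in>I. of_real (exp (- v i / 2)))"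
    using I by (simp only: of_real_prod[symmetric] exp_sum[symmetric] sum_negf[symmetric] sum_divide_distrib)
  have "norm ((\<Prod>i\<in>I. (LINT x|M i. iexp (Y i x))) - (\<Prod>i\<in>I. complex_of_real (exp (- v i / 2))))
     \<le> (\<Sum>i\<in>I. norm ((LINT x|M i. iexp (Y i x)) - of_real (exp (- v i / 2))))"
  proof (rule norm_prod_diff)
    fix i assume i: "i \<in> I"
    have "norm (LINT x|M i. iexp (Y i x)) \<le> (LINT x|M i. norm (iexp (Y i x)))"
      by (rule integral_norm_bound)
    also have "\<dots> = 1" using prob_space.prob_space[OF M] by simp
    finally show "norm (LINT x|M i. iexp (Y i x)) \<le> 1" .
    show "norm (complex_of_real (exp (- v i / 2))) \<le> 1" using v[OF i] by simp
  qed
  also have "\<dots> \<le> (\<Sum>i\<in>I. e i)" by (intro sum_mono bd)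
  finally show ?thesis unfolding 1 2 .
qed

section \<open>The Erlang distribution\<close>

text \<open>The index is one less than the shape: \<open>erlang k\<close> is the Gamma law of shape
  \<open>Suc k\<close> and rate one, with mean and variance \<open>Suc k\<close>. With a bin count
  as index, the added one is the Dirichlet parameter of the prior.\<close>

definition erlang :: "nat \<Rightarrow> real measure" where
  "erlang k = density lborel (erlang_density k 1)"

lemma prob_space_erlang: "prob_space (erlang k)"
  unfolding erlang_def by (rule prob_space_erlang_density) simp

lemma sets_erlang [measurable_cong, simp]: "sets (erlang k) = sets borel" and space_erlang [simp]: "space (erlang k) = UNIV"
  by (auto simp: erlang_def)

text \<open>Exponential tilting changes the rate from \<open>1\<close> to \<open>1 - a\<close>, so
  the integral is the constant \<open>c\<close> exactly. The bound on \<open>c\<close> is the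
  inequality \<open>ln (1 - a) \<ge> - a - 2 * a\<^sup>2\<close>, valid for
  \<open>\<bar>a\<bar> \<le> 1/2\<close>, multiplied by the shape.\<close>

lemma erlang_mgf:
  assumes a: "\<bar>a\<bar> \<le> 1/2"
  shows "(\<integral>\<^sup>+x. ennreal (exp (a * (x - real (Suc k)))) \<partial>erlang k) \<le> ennreal (exp (2 * a\<^sup>2 * real (Suc k)))"
proof -
  have pos: "0 < 1 - a" using a by auto
  define c where "c = exp (- a * real (Suc k)) / (1 - a) ^ Suc k"
  have c0: "0 \<le> c" unfolding c_def using pos by simp
  have "(\<integral>\<^sup>+x. ennreal (exp (a * (x - real (Suc k)))) \<partial>erlang k)
      = (\<integral>\<^sup>+x. ennreal (erlang_density k 1 x) * ennreal (exp (a * (x - real (Suc k)))) \<partial>lborel)"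
    unfolding erlang_def by (subst nn_integral_density) auto
  also have "\<dots> = (\<integral>\<^sup>+x. ennreal c * ennreal (erlang_density k (1 - a) x) \<partial>lborel)"
  proof (intro nn_integral_cong)
    fix x :: real
    have "erlang_density k 1 x * exp (a * (x - real (Suc k))) = c * erlang_density k (1 - a) x"
      using pos unfolding erlang_density_def c_def
      by (auto simp: field_simps exp_add exp_diff exp_minus)
    then show "ennreal (erlang_density k 1 x) * ennreal (exp (a * (x - real (Suc k)))) = ennreal c * ennreal (erlang_density k (1 - a) x)"
      using c0 pos by (simp add: ennreal_mult[symmetric])
  qed
  also have "\<dots> = ennreal c"
    using nn_integral_erlang_ith_moment[OF pos, of k 0] by (subst nn_integral_cmult) auto
  also have "c \<le> exp (2 * a\<^sup>2 * real (Suc k))"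
  proof -
    have "ln (1 - a) \<ge> - a - 2 * a\<^sup>2"
    proof (cases "a \<ge> 0")
      case True
      then show ?thesis using ln_one_minus_pos_lower_bound[of a] a by auto
    next
      case False
      then have "- a - a\<^sup>2 \<le> ln (1 - a)" using ln_one_plus_pos_lower_bound[of "-a"] a by auto
      then show ?thesis using zero_le_power2[of a] by linarith
    qed
    then have "exp (- a - 2 * a\<^sup>2) \<le> 1 - a" using pos by (simp add: ln_ge_iff)
    then have "exp (- a) * exp (- 2 * a\<^sup>2) \<le> 1 - a" by (simp add: exp_add[symmetric])
    then have "exp (- a) / (1 - a) \<le> exp (2 * a\<^sup>2)"
      using pos by (simp add: field_simps exp_minus)
    then have "(exp (- a) / (1 - a)) ^ Suc k \<le> exp (2 * a\<^sup>2) ^ Suc k"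
      using pos by (intro power_mono) auto
    moreover have "(exp (- a) / (1 - a)) ^ Suc k = c"
      unfolding c_def by (simp only: power_divide exp_of_nat_mult[symmetric]) (simp add: mult.commute)
    moreover have "exp (2 * a\<^sup>2) ^ Suc k = exp (2 * a\<^sup>2 * real (Suc k))"
      by (simp only: exp_of_nat_mult[symmetric]) (simp add: mult.commute)
    ultimately show ?thesis by simp
  qed
  finally show ?thesis by (simp add: ennreal_leI)
qed

lemma erlang_central_moments:
  fixes k :: nat
  defines "m \<equiv> real (Suc k)"
  shows "integrable (erlang k) (\<lambda>x. (x - m) ^ i)"
    and "(LINT x|erlang k. x - m) = 0" and "(LINT x|erlang k. (x - m)\<^sup>2) = m"
    and "(LINT x|erlang k. (x - m) ^ 4) = 3 * m\<^sup>2 + 6 * m"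
proof -
  interpret prob_space "erlang k" by (rule prob_space_erlang)
  have D: "distributed (erlang k) lborel (\<lambda>x. x) (erlang_density k 1)"
    unfolding distributed_def erlang_def by (auto simp: distr_id2)
  note mom = erlang_ith_moment_integrable[OF _ D] erlang_ith_moment[OF _ D]
  have int: "integrable (erlang k) (\<lambda>x. x ^ i)" for i using mom(1)[of i] by simp
  have int1: "integrable (erlang k) (\<lambda>x. x)" using int[of 1] by simp
  have val: "(LINT x|erlang k. x ^ i) = fact (k + i) / fact k" for i using mom(2)[of i] by simp
  have v1: "(LINT x|erlang k. x) = m"
    using val[of 1] by (simp add: m_def)
  have v2: "(LINT x|erlang k. x ^ 2) = m * (m + 1)"
  proof -
    have "fact (k + 2) = m * (m + 1) * (fact k :: real)" by (simp add: m_def numeral_eq_Suc algebra_simps)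
    then show ?thesis using val[of 2] by simp
  qed
  have v3: "(LINT x|erlang k. x ^ 3) = m * (m + 1) * (m + 2)"
  proof -
    have "fact (k + 3) = m * (m + 1) * (m + 2) * (fact k :: real)" by (simp add: m_def numeral_eq_Suc algebra_simps)
    then show ?thesis using val[of 3] by simp
  qed
  have v4: "(LINT x|erlang k. x ^ 4) = m * (m + 1) * (m + 2) * (m + 3)"
  proof -
    have "fact (k + 4) = m * (m + 1) * (m + 2) * (m + 3) * (fact k :: real)" by (simp add: m_def numeral_eq_Suc algebra_simps)
    then show ?thesis using val[of 4] by simp
  qed
  have "(x - m) ^ i = (\<Sum>j\<le>i. of_nat (i choose j) * x ^ j * (- m) ^ (i - j))" for x :: real
    using binomial_ring[of x "-m" i] by simp
  then show "integrable (erlang k) (\<lambda>x. (x - m) ^ i)" using int by simp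
  show "(LINT x|erlang k. x - m) = 0" using int1 v1 prob_space by simp
  have e2: "(x - m)\<^sup>2 = x ^ 2 - 2 * m * x + m\<^sup>2" for x by (simp add: power2_eq_square algebra_simps)
  show "(LINT x|erlang k. (x - m)\<^sup>2) = m"
    unfolding e2 using int int1 v1 v2 using prob_space by simp (simp add: power2_eq_square algebra_simps)
  have e4: "(x - m) ^ 4 = x ^ 4 - 4 * m * x ^ 3 + 6 * m\<^sup>2 * x ^ 2 - 4 * m ^ 3 * x + m ^ 4" for x
    by (simp add: numeral_eq_Suc algebra_simps)
  show "(LINT x|erlang k. (x - m) ^ 4) = 3 * m\<^sup>2 + 6 * m"
    unfolding e4 using int int1 v1 v2 v3 v4 using prob_space by simp (simp add: numeral_eq_Suc algebra_simps)
qed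

text \<open>The error depends on scale and shape only through the variance \<open>b\<close> of the
  summand, so it is uniform over bins with very different counts. The absolute third moment, for
  which there is no convenient closed form, is interpolated between the second and the fourth
  central moment.\<close>

lemma erlang_char_normal_approx:
  fixes a :: real and k :: nat
  defines "b \<equiv> a\<^sup>2 * real (Suc k)"
  shows "norm ((LINT x|erlang k. iexp (a * (x - real (Suc k)))) - of_real (exp (- b / 2))) \<le> b * sqrt b + b\<^sup>2"
proof (cases "a = 0")
  case True
  then show ?thesis using prob_space.prob_space[OF prob_space_erlang] by (simp add: b_def)
next
  case False
  interpret prob_space "erlang k" by (rule prob_space_erlang)
  define m where "m = real (Suc k)"
  have b: "b > 0" "b = a\<^sup>2 * m" using False by (auto simp: b_def m_def)
  note mom = erlang_central_moments[of k, folded m_def]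
  have i4: "integrable (erlang k) (\<lambda>x. (a * (x - m)) ^ 4)" and i2: "integrable (erlang k) (\<lambda>x. (a * (x - m))\<^sup>2)"
    and i1: "integrable (erlang k) (\<lambda>x. a * (x - m))"
    using mom(1)[of 4] mom(1)[of 2] mom(1)[of 1] by (auto simp: power_mult_distrib)
  \<comment> \<open>Arithmetic-geometric mean with the weight \<open>sqrt b\<close>, for which both
    terms have expectation of order \<open>b * sqrt b\<close>.\<close>
  have bd: "\<bar>y\<bar> ^ 3 \<le> (sqrt b * y\<^sup>2 + y ^ 4 / sqrt b) / 2" for y
  proof -
    have "0 \<le> y\<^sup>2 * (sqrt b - \<bar>y\<bar>)\<^sup>2 / sqrt b" using b by simp
    also have "\<dots> = (sqrt b * y\<^sup>2 + y ^ 4 / sqrt b) - 2 * \<bar>y\<bar> ^ 3"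
    proof -
      define q z where "q = sqrt b" and "z = \<bar>y\<bar>"
      have q: "q > 0" "y\<^sup>2 = z\<^sup>2" "y ^ 4 = z ^ 4"
        using b by (auto simp: q_def z_def power_even_abs)
      show ?thesis
        unfolding q_def[symmetric] z_def[symmetric] q(2,3)
        using q(1) by (simp add: field_simps numeral_eq_Suc)
    qed
    finally have "2 * \<bar>y\<bar> ^ 3 \<le> sqrt b * y\<^sup>2 + y ^ 4 / sqrt b" by linarith
    then show ?thesis by (simp add: field_simps)
  qed
  have i: "integrable (erlang k) (\<lambda>x. (sqrt b * (a * (x - m))\<^sup>2 + (a * (x - m)) ^ 4 / sqrt b) / 2)"
    using i2 i4 by auto
  have i3: "integrable (erlang k) (\<lambda>x. \<bar>a * (x - m)\<bar> ^ 3)"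
    by (rule Bochner_Integration.integrable_bound[OF i]) (use bd b in \<open>auto intro: order_trans[OF _ abs_ge_self]\<close>)
  have v: "(LINT x|erlang k. (a * (x - m))\<^sup>2) = b"
    using mom(3) b by (simp add: power_mult_distrib)
  have v4: "(LINT x|erlang k. (a * (x - m)) ^ 4) = a ^ 4 * (3 * m\<^sup>2 + 6 * m)"
    using mom(4) b by (simp add: power_mult_distrib)
  have m1: "m \<ge> 1" by (simp add: m_def)
  \<comment> \<open>The constant is \<open>3 + 6\<close>, since \<open>m\<close> is at most its
    square for \<open>m \<ge> 1\<close>.\<close>
  have le: "a ^ 4 * (3 * m\<^sup>2 + 6 * m) \<le> 9 * b\<^sup>2"
  proof -
    have "m \<le> m\<^sup>2" using m1 by (simp add: power2_eq_square)
    then have "a ^ 4 * (3 * m\<^sup>2 + 6 * m) \<le> a ^ 4 * (9 * m\<^sup>2)" by (intro mult_left_mono) auto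
    then show ?thesis by (simp add: b(2) power_mult_distrib mult_ac)
  qed
  have "(LINT x|erlang k. \<bar>a * (x - m)\<bar> ^ 3) \<le> (LINT x|erlang k. (sqrt b * (a * (x - m))\<^sup>2 + (a * (x - m)) ^ 4 / sqrt b) / 2)"
    by (intro integral_mono i3 i bd)
  also have "\<dots> = (sqrt b * b + a ^ 4 * (3 * m\<^sup>2 + 6 * m) / sqrt b) / 2"
    using i2 i4 v v4 by simp
  also have "\<dots> \<le> (sqrt b * b + 9 * b\<^sup>2 / sqrt b) / 2"
    using le b by (intro divide_right_mono add_left_mono) auto
  also have "9 * b\<^sup>2 / sqrt b = 9 * (b * sqrt b)"
  proof -
    have "9 * (q\<^sup>2)\<^sup>2 / q = 9 * (q\<^sup>2 * q)" if "q > 0" for q :: real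
      using that by (simp add: power2_eq_square)
    from this[of "sqrt b"] show ?thesis using b(1) by simp
  qed
  finally have "(LINT x|erlang k. \<bar>a * (x - m)\<bar> ^ 3) \<le> (sqrt b * b + 9 * (b * sqrt b)) / 2" .
  moreover have "norm ((LINT x|erlang k. iexp (a * (x - m))) - of_real (exp (- b / 2)))
     \<le> (LINT x|erlang k. \<bar>a * (x - m)\<bar> ^ 3) / 6 + b\<^sup>2 / 8"
  proof (rule char_normal_approx[OF _ i3 i1 i2 _ v])
    show "expectation (\<lambda>x. a * (x - m)) = 0" using mom(2) by simp
  qed simp
  moreover have "N \<le> p + q" if "E \<le> (p' + 9 * p) / 2" "N \<le> E / 6 + q / 8" "p' = p" "0 \<le> p" "0 \<le> q" for E N p p' q :: real
    using that by argo
  moreover have "0 \<le> b * sqrt b" "0 \<le> b\<^sup>2" using b by auto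
  ultimately show ?thesis unfolding m_def using mult.commute[of "sqrt b" b] by blast
qed

section \<open>The Dirichlet law as the law of normalised Erlang variables\<close>

text \<open>The Jacobian of a dilation, collected one coordinate at a time.\<close>

lemma nn_integral_PiM_lborel_scale:
  fixes f :: "('i \<Rightarrow> real) \<Rightarrow> ennreal"
  assumes I: "finite I" and s: "0 < s"
    and f: "f \<in> borel_measurable (\<Pi>\<^sub>M i\<in>I. lborel)"
  shows "(\<integral>\<^sup>+x. f x \<partial>(\<Pi>\<^sub>M i\<in>I. lborel)) = ennreal (s ^ card I) * (\<integral>\<^sup>+x. f (\<lambda>i\<in>I. s * x i) \<partial>(\<Pi>\<^sub>M i\<in>I. lborel))"
  using I f
proof (induction I arbitrary: f rule: finite_induct)
  case empty
  interpret product_sigma_finite "\<lambda>i::'i. lborel :: real measure" by standard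
  show ?case by (simp add: nn_integral_empty space_PiM restrict_def)
next
  case (insert i I)
  interpret product_sigma_finite "\<lambda>i::'i. lborel :: real measure" by standard
  note fm[measurable] = insert.prems
  note ins = product_nn_integral_insert[OF insert.hyps(1,2)]
  have "(\<integral>\<^sup>+x. f x \<partial>(\<Pi>\<^sub>M i\<in>insert i I. lborel)) = (\<integral>\<^sup>+x. (\<integral>\<^sup>+y. f (x(i := y)) \<partial>lborel) \<partial>(\<Pi>\<^sub>M i\<in>I. lborel))"
    by (rule ins) measurable
  also have "\<dots> = (\<integral>\<^sup>+x. ennreal s * (\<integral>\<^sup>+y. f (x(i := s * y)) \<partial>lborel) \<partial>(\<Pi>\<^sub>M i\<in>I. lborel))"
  proof (intro nn_integral_cong)
    fix x assume x: "x \<in> space (\<Pi>\<^sub>M i\<in>I. lborel :: real measure)"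
    have "(\<lambda>y. f (x(i := y))) \<in> borel_measurable lborel"
      using measurable_comp[OF measurable_component_update fm, OF x insert.hyps(2)] unfolding comp_def .
    then have [measurable]: "(\<lambda>y. f (x(i := y))) \<in> borel_measurable borel" by simp
    show "(\<integral>\<^sup>+y. f (x(i := y)) \<partial>lborel) = ennreal s * (\<integral>\<^sup>+y. f (x(i := s * y)) \<partial>lborel)"
      using nn_integral_real_affine[of "\<lambda>y. f (x(i := y))" s 0] s by simp
  qed
  also have "\<dots> = ennreal s * (\<integral>\<^sup>+x. (\<integral>\<^sup>+y. f (x(i := s * y)) \<partial>lborel) \<partial>(\<Pi>\<^sub>M i\<in>I. lborel))"
    by (rule nn_integral_cmult) measurable
  also have "(\<integral>\<^sup>+x. (\<integral>\<^sup>+y. f (x(i := s * y)) \<partial>lborel) \<partial>(\<Pi>\<^sub>M i\<in>I. lborel))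
      = ennreal (s ^ card I) * (\<integral>\<^sup>+x. (\<integral>\<^sup>+y. f ((\<lambda>i\<in>I. s * x i)(i := s * y)) \<partial>lborel) \<partial>(\<Pi>\<^sub>M i\<in>I. lborel))"
    by (rule insert.IH) measurable
  also have "(\<integral>\<^sup>+x. (\<integral>\<^sup>+y. f ((\<lambda>i\<in>I. s * x i)(i := s * y)) \<partial>lborel) \<partial>(\<Pi>\<^sub>M i\<in>I. lborel))
      = (\<integral>\<^sup>+x. (\<integral>\<^sup>+y. f (\<lambda>j\<in>insert i I. s * (x(i := y)) j) \<partial>lborel) \<partial>(\<Pi>\<^sub>M i\<in>I. lborel))"
    using insert.hyps by (intro nn_integral_cong arg_cong[of _ _ f]) (auto simp: fun_eq_iff)
  also have "\<dots> = (\<integral>\<^sup>+x. f (\<lambda>j\<in>insert i I. s * x j) \<partial>(\<Pi>\<^sub>M i\<in>insert i I. lborel))"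
    by (rule ins[symmetric]) measurable
  moreover have "ennreal s * (ennreal (s ^ card I) * z) = ennreal (s ^ card (insert i I)) * z" for z
    using insert.hyps s by (simp add: mult.assoc[symmetric] ennreal_mult'[symmetric])
  ultimately show ?case by (simp only:)
qed

lemma measurable_simplex_lift [measurable]:
  "simplex_lift (Suc m) \<in> (\<Pi>\<^sub>M i\<in>{..<m}. lborel) \<rightarrow>\<^sub>M (\<Pi>\<^sub>M i\<in>{..<Suc m}. lborel)"
proof -
  have "(\<lambda>y. if i = m then 1 - (\<Sum>j<m. y j) else y i) \<in> (\<Pi>\<^sub>M i\<in>{..<m}. lborel) \<rightarrow>\<^sub>M (lborel :: real measure)"
    if "i \<in> {..<Suc m}" for i
    using that by (cases "i = m") auto
  then show ?thesis
    unfolding simplex_lift_def[abs_def] diff_Suc_1 by (intro measurable_restrict) simp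
qed

lemma measurable_simplex_lift_component [measurable]:
  "i < Suc m \<Longrightarrow> (\<lambda>y. simplex_lift (Suc m) y i) \<in> borel_measurable (\<Pi>\<^sub>M i\<in>{..<m}. lborel)"
  using measurable_compose[OF measurable_simplex_lift measurable_component_singleton, of i] by simp

lemma sum_simplex_lift: "(\<Sum>i<Suc m. simplex_lift (Suc m) y i) = 1"
  by (simp add: simplex_lift_def)

text \<open>Integration in the coordinates total mass and proportions: the last coordinate is
  translated to become the sum, the remaining ones are scaled by it.\<close>

lemma nn_integral_simplex_polar:
  fixes F :: "(nat \<Rightarrow> real) \<Rightarrow> ennreal"
  assumes F[measurable]: "F \<in> borel_measurable (\<Pi>\<^sub>M i\<in>{..<Suc m}. lborel)"
    and F0: "\<And>x i. i < Suc m \<Longrightarrow> x i \<le> 0 \<Longrightarrow> F x = 0"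
  shows "(\<integral>\<^sup>+x. F x \<partial>(\<Pi>\<^sub>M i\<in>{..<Suc m}. lborel)) =
    (\<integral>\<^sup>+s. \<integral>\<^sup>+y. indicator {0<..} s * ennreal (s ^ m) * F (\<lambda>i\<in>{..<Suc m}. s * simplex_lift (Suc m) y i) \<partial>(\<Pi>\<^sub>M i\<in>{..<m}. lborel) \<partial>lborel)"
proof -
  interpret product_sigma_finite "\<lambda>i::nat. lborel :: real measure" by standard
  interpret S: sigma_finite_measure "\<Pi>\<^sub>M i\<in>{..<m}. lborel :: real measure" by (rule sigma_finite) simp
  interpret pair_sigma_finite "\<Pi>\<^sub>M i\<in>{..<m}. lborel :: real measure" "lborel :: real measure" ..
  have ins: "{..<Suc m} = insert m {..<m}" by auto
  have Fm[measurable]: "F \<in> borel_measurable (\<Pi>\<^sub>M i\<in>insert m {..<m}. lborel)"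
    using F unfolding ins .
  have upd[measurable]: "(\<lambda>z. F ((fst z)(m := snd z - (\<Sum>j<m. fst z j)))) \<in> borel_measurable ((\<Pi>\<^sub>M i\<in>{..<m}. lborel) \<Otimes>\<^sub>M lborel)"
    by measurable
  have "(\<integral>\<^sup>+x. F x \<partial>(\<Pi>\<^sub>M i\<in>{..<Suc m}. lborel)) = (\<integral>\<^sup>+x. (\<integral>\<^sup>+y. F (x(m := y)) \<partial>lborel) \<partial>(\<Pi>\<^sub>M i\<in>{..<m}. lborel))"
    unfolding ins by (rule product_nn_integral_insert) auto
  also have "\<dots> = (\<integral>\<^sup>+x. (\<integral>\<^sup>+s. F (x(m := s - (\<Sum>j<m. x j))) \<partial>lborel) \<partial>(\<Pi>\<^sub>M i\<in>{..<m}. lborel))"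
  proof (rule nn_integral_cong)
    fix x assume x: "x \<in> space (\<Pi>\<^sub>M i\<in>{..<m}. lborel :: real measure)"
    have "(\<lambda>y. F (x(m := y))) \<in> borel_measurable lborel"
      using measurable_comp[OF measurable_component_update Fm, OF x] unfolding comp_def by simp
    then have [measurable]: "(\<lambda>y. F (x(m := y))) \<in> borel_measurable borel" by simp
    show "(\<integral>\<^sup>+y. F (x(m := y)) \<partial>lborel) = (\<integral>\<^sup>+s. F (x(m := s - (\<Sum>j<m. x j))) \<partial>lborel)"
      using nn_integral_real_affine[of "\<lambda>y. F (x(m := y))" 1 "- (\<Sum>j<m. x j)"] by simp
  qed
  also have "\<dots> = (\<integral>\<^sup>+s. (\<integral>\<^sup>+x. F (x(m := s - (\<Sum>j<m. x j))) \<partial>(\<Pi>\<^sub>M i\<in>{..<m}. lborel)) \<partial>lborel)"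
    by (rule Fubini'[symmetric]) (use upd in \<open>simp add: case_prod_beta'\<close>)
  also have "\<dots> = (\<integral>\<^sup>+s. \<integral>\<^sup>+y. indicator {0<..} s * ennreal (s ^ m) * F (\<lambda>i\<in>{..<Suc m}. s * simplex_lift (Suc m) y i) \<partial>(\<Pi>\<^sub>M i\<in>{..<m}. lborel) \<partial>lborel)"
  proof (rule nn_integral_cong)
    fix s :: real
    have [measurable]: "(\<lambda>x. F (x(m := s - (\<Sum>j<m. x j)))) \<in> borel_measurable (\<Pi>\<^sub>M i\<in>{..<m}. lborel)"
      using measurable_compose[OF _ upd, of "\<lambda>x. (x, s)"] by simp
    show "(\<integral>\<^sup>+x. F (x(m := s - (\<Sum>j<m. x j))) \<partial>(\<Pi>\<^sub>M i\<in>{..<m}. lborel)) =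
      (\<integral>\<^sup>+y. indicator {0<..} s * ennreal (s ^ m) * F (\<lambda>i\<in>{..<Suc m}. s * simplex_lift (Suc m) y i) \<partial>(\<Pi>\<^sub>M i\<in>{..<m}. lborel))"
    proof (cases "0 < s")
      case True
      have eq: "(\<lambda>i\<in>{..<m}. s * y i)(m := s - (\<Sum>j<m. (\<lambda>i\<in>{..<m}. s * y i) j)) = (\<lambda>i\<in>{..<Suc m}. s * simplex_lift (Suc m) y i)" for y
        by (auto simp: fun_eq_iff simplex_lift_def right_diff_distrib sum_distrib_left)
      have "(\<integral>\<^sup>+x. F (x(m := s - (\<Sum>j<m. x j))) \<partial>(\<Pi>\<^sub>M i\<in>{..<m}. lborel)) =
         ennreal (s ^ m) * (\<integral>\<^sup>+y. F (\<lambda>i\<in>{..<Suc m}. s * simplex_lift (Suc m) y i) \<partial>(\<Pi>\<^sub>M i\<in>{..<m}. lborel))"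
        using nn_integral_PiM_lborel_scale[OF finite_lessThan True \<open>(\<lambda>x. F (x(m := s - (\<Sum>j<m. x j)))) \<in> _\<close>]
        by (simp only: eq card_lessThan)
      also have "\<dots> = (\<integral>\<^sup>+y. ennreal (s ^ m) * F (\<lambda>i\<in>{..<Suc m}. s * simplex_lift (Suc m) y i) \<partial>(\<Pi>\<^sub>M i\<in>{..<m}. lborel))"
        by (rule nn_integral_cmult[symmetric]) measurable
      finally show ?thesis using True by simp
    next
      case False
      have "F (x(m := s - (\<Sum>j<m. x j))) = 0" for x
      proof (cases "\<exists>j<m. x j \<le> 0")
        case True
        then obtain j where "j < m" "x j \<le> 0" by auto
        then show ?thesis using F0[of j "x(m := s - (\<Sum>j<m. x j))"] by simp
      next
        case False
        then have "0 \<le> (\<Sum>j<m. x j)" by (intro sum_nonneg) auto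
        with \<open>\<not> 0 < s\<close> show ?thesis by (intro F0[of m]) auto
      qed
      with False show ?thesis by simp
    qed
  qed
  finally show ?thesis .
qed

section \<open>Independent Erlang variables and Dirichlet conjugacy\<close>

definition erlang_product :: "nat \<Rightarrow> (nat \<Rightarrow> nat) \<Rightarrow> (nat \<Rightarrow> real) measure" where
  "erlang_product N c = (\<Pi>\<^sub>M i\<in>{..<N}. erlang (c i))"

definition normalize :: "nat \<Rightarrow> (nat \<Rightarrow> real) \<Rightarrow> nat \<Rightarrow> real" where
  "normalize N x = (\<lambda>i\<in>{..<N}. x i / (\<Sum>j<N. x j))"

lemma sets_erlang_product [measurable_cong, simp]: "sets (erlang_product N c) = sets (\<Pi>\<^sub>M i\<in>{..<N}. borel)"
  unfolding erlang_product_def by (intro sets_PiM_cong) auto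

lemma space_erlang_product [simp]: "space (erlang_product N c) = (\<Pi>\<^sub>E i\<in>{..<N}. UNIV)"
  by (simp add: erlang_product_def space_PiM)

lemma prob_space_erlang_product: "prob_space (erlang_product N c)"
  unfolding erlang_product_def by (intro prob_space_PiM prob_space_erlang)

lemma sets_PiM_lborel: "sets (\<Pi>\<^sub>M i\<in>I. lborel :: real measure) = sets (\<Pi>\<^sub>M i\<in>I. borel)"
  by (intro sets_PiM_cong) auto

lemma measurable_normalize [measurable]: "normalize N \<in> (\<Pi>\<^sub>M i\<in>{..<N}. borel) \<rightarrow>\<^sub>M (\<Pi>\<^sub>M i\<in>{..<N}. borel)"
  unfolding normalize_def[abs_def] by (intro measurable_restrict) measurable

text \<open>The usual Erlang density of shape one is positive at \<open>0\<close>. Setting it to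
  zero there makes the product density vanish off the open orthant, as integration in total mass and
  proportions demands.\<close>

definition open_erlang_density :: "nat \<Rightarrow> real \<Rightarrow> real" where
  "open_erlang_density k x = (if 0 < x then x ^ k * exp (- x) / fact k else 0)"

lemma open_erlang_density_measurable [measurable]: "open_erlang_density k \<in> borel_measurable borel"
  unfolding open_erlang_density_def by measurable

lemma erlang_eq_open_density: "erlang k = density lborel (open_erlang_density k)"
  unfolding erlang_def
proof (rule density_cong)
  show "AE x in lborel. ennreal (erlang_density k 1 x) = ennreal (open_erlang_density k x)"
    using AE_lborel_singleton[of 0]
    by eventually_elim (auto simp: erlang_density_def open_erlang_density_def)
qed auto

lemma nn_integral_erlang_product:
  assumes [measurable]: "g \<in> borel_measurable (\<Pi>\<^sub>M i\<in>{..<N}. borel)"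
  shows "(\<integral>\<^sup>+x. g x \<partial>erlang_product N c) = (\<integral>\<^sup>+x. ennreal (\<Prod>i<N. open_erlang_density (c i) (x i)) * g x \<partial>(\<Pi>\<^sub>M i\<in>{..<N}. lborel))"
proof -
  have sf: "sigma_finite_measure (density lborel (\<lambda>x. ennreal (open_erlang_density (c i) x)))" for i
    using prob_space_imp_sigma_finite[OF prob_space_erlang[of "c i"]] by (simp add: erlang_eq_open_density)
  have nn: "0 \<le> open_erlang_density k x" for k x by (simp add: open_erlang_density_def)
  have "erlang_product N c = density (\<Pi>\<^sub>M i\<in>{..<N}. lborel) (\<lambda>x. \<Prod>i<N. ennreal (open_erlang_density (c i) (x i)))"
    unfolding erlang_product_def erlang_eq_open_density
    by (rule PiM_density_lborel) (use sf in auto)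
  then show ?thesis
    using nn by (simp add: nn_integral_density prod_ennreal sets_PiM_lborel[THEN measurable_cong_sets[OF _ refl, THEN arg_cong[of _ _ "\<lambda>S. g \<in> S"]], THEN iffD2])
qed

text \<open>With all parameters equal to one the Dirichlet density is constant on the open simplex,
  and the constant is \<open>Gamma (Suc m) = fact m\<close>.\<close>

lemma nn_integral_dirichlet_1:
  assumes g[measurable]: "g \<in> borel_measurable (\<Pi>\<^sub>M i\<in>{..<Suc m}. borel)"
  shows "(\<integral>\<^sup>+h. g h \<partial>dirichlet (Suc m) (\<lambda>_. 1)) =
    ennreal (fact m) * (\<integral>\<^sup>+y. (if \<forall>i<Suc m. 0 < simplex_lift (Suc m) y i then g (simplex_lift (Suc m) y) else 0) \<partial>(\<Pi>\<^sub>M i\<in>{..<m}. lborel))"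
proof -
  have [measurable]: "simplex_lift (Suc m) \<in> (\<Pi>\<^sub>M i\<in>{..<m}. lborel) \<rightarrow>\<^sub>M (\<Pi>\<^sub>M i\<in>{..<Suc m}. borel)"
    using measurable_simplex_lift measurable_cong_sets[OF refl sets_PiM_lborel] by blast
  let ?pos = "\<lambda>y. \<forall>i<Suc m. 0 < simplex_lift (Suc m) y i"
  have dens: "ennreal (if ?pos y then Gamma (\<Sum>i<Suc m. 1) / (\<Prod>i<Suc m. Gamma 1) * (\<Prod>i<Suc m. simplex_lift (Suc m) y i powr (1 - 1)) else 0)
     = ennreal (if ?pos y then fact m else 0)" for y
  proof -
    have "(\<Prod>i<Suc m. simplex_lift (Suc m) y i powr (1 - 1)) = 1" if "?pos y"
      using that by (intro prod.neutral) (auto simp: less_le)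
    moreover have "Gamma (\<Sum>i<Suc m. 1) = (fact m :: real)"
      using Gamma_fact[of m, where ?'a=real] by (simp add: add.commute)
    ultimately show ?thesis by auto
  qed
  have "(\<integral>\<^sup>+h. g h \<partial>dirichlet (Suc m) (\<lambda>_. 1)) = (\<integral>\<^sup>+y. ennreal (if ?pos y then fact m else 0) * g (simplex_lift (Suc m) y) \<partial>(\<Pi>\<^sub>M i\<in>{..<m}. lborel))"
    proof -
    have "(\<integral>\<^sup>+h. g h \<partial>dirichlet (Suc m) (\<lambda>_. 1)) = (\<integral>\<^sup>+y. g (simplex_lift (Suc m) y) \<partial>density (\<Pi>\<^sub>M i\<in>{..<m}. lborel) (\<lambda>y. ennreal (if ?pos y then fact m else 0)))"
      unfolding dirichlet_def dens diff_Suc_1 by (rule nn_integral_distr) (simp_all add: g)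
    also have "\<dots> = (\<integral>\<^sup>+y. ennreal (if ?pos y then fact m else 0) * g (simplex_lift (Suc m) y) \<partial>(\<Pi>\<^sub>M i\<in>{..<m}. lborel))"
      by (rule nn_integral_density) measurable
    finally show ?thesis .
  qed
  also have "\<dots> = (\<integral>\<^sup>+y. ennreal (fact m) * (if ?pos y then g (simplex_lift (Suc m) y) else 0) \<partial>(\<Pi>\<^sub>M i\<in>{..<m}. lborel))"
    by (intro nn_integral_cong) auto
  also have "\<dots> = ennreal (fact m) * (\<integral>\<^sup>+y. (if ?pos y then g (simplex_lift (Suc m) y) else 0) \<partial>(\<Pi>\<^sub>M i\<in>{..<m}. lborel))"
    by (rule nn_integral_cmult) measurable
  finally show ?thesis .
qed

text \<open>Conjugacy in unnormalised form: the uniform law on the simplex, weighted with the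
  multinomial likelihood, is a multiple of the Dirichlet law with parameters \<open>1 + c i\<close>,
  which is the law of a normalised Erlang vector. The factor \<open>\<kappa>\<close> is left
  abstract because it cancels in the conditional law; only its positivity matters.\<close>

proposition dirichlet_multinomial_posterior:
  fixes c :: "nat \<Rightarrow> nat"
  obtains \<kappa> where "0 < \<kappa>" "\<And>g. g \<in> borel_measurable (\<Pi>\<^sub>M i\<in>{..<Suc m}. borel) \<Longrightarrow>
    (\<integral>\<^sup>+h. g h * ennreal (\<Prod>i<Suc m. h i ^ c i) \<partial>dirichlet (Suc m) (\<lambda>_. 1)) =
     ennreal \<kappa> * (\<integral>\<^sup>+x. g (normalize (Suc m) x) \<partial>erlang_product (Suc m) c)"
proof -
  \<comment> \<open>\<open>C\<close> is the total count, \<open>D\<close> the product of the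
    normalising constants of the Erlang densities; \<open>fact (m + C)\<close> will be the Gamma
    integral over the total mass.\<close>
  define C where "C = (\<Sum>i<Suc m. c i)"
  define D where "D = (\<Prod>i<Suc m. fact (c i) :: real)"
  have D: "D > 0" unfolding D_def by (intro prod_pos) auto
  define \<kappa> where "\<kappa> = fact m * D / fact (m + C)"
  have main: "(\<integral>\<^sup>+h. g h * ennreal (\<Prod>i<Suc m. h i ^ c i) \<partial>dirichlet (Suc m) (\<lambda>_. 1)) =
     ennreal \<kappa> * (\<integral>\<^sup>+x. g (normalize (Suc m) x) \<partial>erlang_product (Suc m) c)"
    if g[measurable]: "g \<in> borel_measurable (\<Pi>\<^sub>M i\<in>{..<Suc m}. borel)" for g
  proof -
    have gl[measurable]: "g \<in> borel_measurable (\<Pi>\<^sub>M i\<in>{..<Suc m}. lborel)"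
      using g measurable_cong_sets[OF sets_PiM_lborel refl] by blast
    let ?lift = "simplex_lift (Suc m)"
    let ?pos = "\<lambda>y. \<forall>i<Suc m. 0 < ?lift y i"
    define G where "G y = (if ?pos y then g (?lift y) * ennreal (\<Prod>i<Suc m. ?lift y i ^ c i) else 0)" for y
    have [measurable]: "(\<lambda>y. \<Prod>i<Suc m. ?lift y i ^ c i) \<in> borel_measurable (\<Pi>\<^sub>M i\<in>{..<m}. lborel)"
      by (intro borel_measurable_prod borel_measurable_power) auto
    have [measurable]: "G \<in> borel_measurable (\<Pi>\<^sub>M i\<in>{..<m}. lborel)"
      unfolding G_def by measurable
    have lhs: "(\<integral>\<^sup>+h. g h * ennreal (\<Prod>i<Suc m. h i ^ c i) \<partial>dirichlet (Suc m) (\<lambda>_. 1)) = ennreal (fact m) * (\<integral>\<^sup>+y. G y \<partial>(\<Pi>\<^sub>M i\<in>{..<m}. lborel))"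
      unfolding G_def by (subst nn_integral_dirichlet_1) auto
    have nl: "(\<lambda>x. normalize (Suc m) x) \<in> (\<Pi>\<^sub>M i\<in>{..<Suc m}. lborel) \<rightarrow>\<^sub>M (\<Pi>\<^sub>M i\<in>{..<Suc m}. borel)"
      using measurable_normalize measurable_cong_sets[OF sets_PiM_lborel refl] by blast
    have gn[measurable]: "(\<lambda>x. g (normalize (Suc m) x)) \<in> borel_measurable (\<Pi>\<^sub>M i\<in>{..<Suc m}. lborel)"
      by (rule measurable_compose[OF nl g])
    have "(\<integral>\<^sup>+x. g (normalize (Suc m) x) \<partial>erlang_product (Suc m) c) =
      (\<integral>\<^sup>+x. ennreal (\<Prod>i<Suc m. open_erlang_density (c i) (x i)) * g (normalize (Suc m) x) \<partial>(\<Pi>\<^sub>M i\<in>{..<Suc m}. lborel))"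
      by (rule nn_integral_erlang_product) measurable
    also have "\<dots> = (\<integral>\<^sup>+s. \<integral>\<^sup>+y. indicator {0<..} s * ennreal (s ^ m) *
        (ennreal (\<Prod>i<Suc m. open_erlang_density (c i) ((\<lambda>i\<in>{..<Suc m}. s * ?lift y i) i)) *
         g (normalize (Suc m) (\<lambda>i\<in>{..<Suc m}. s * ?lift y i))) \<partial>(\<Pi>\<^sub>M i\<in>{..<m}. lborel) \<partial>lborel)"
    proof (rule nn_integral_simplex_polar)
      fix x :: "nat \<Rightarrow> real" and i assume "i < Suc m" "x i \<le> 0"
      then have "(\<Prod>i<Suc m. open_erlang_density (c i) (x i)) = 0"
        by (intro prod_zero bexI[of _ i]) (auto simp: open_erlang_density_def)
      then show "ennreal (\<Prod>i<Suc m. open_erlang_density (c i) (x i)) * g (normalize (Suc m) x) = 0"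
        by (simp only: ennreal_0 mult_zero_left)
    qed measurable
    \<comment> \<open>In polar coordinates the density splits: the Jacobian \<open>s ^ m\<close> and
      the powers \<open>s ^ c i\<close> form a Gamma weight in the total mass \<open>s\<close>,
      while the proportions keep the likelihood. Normalising removes \<open>s\<close> from the
      argument of \<open>g\<close>.\<close>
    also have "\<dots> = (\<integral>\<^sup>+s. \<integral>\<^sup>+y. ennreal (s ^ (m + C) * exp (- s)) * indicator {0..} s * (ennreal (1 / D) * G y) \<partial>(\<Pi>\<^sub>M i\<in>{..<m}. lborel) \<partial>lborel)"
    proof (rule nn_integral_cong_AE)
      have "AE s in lborel. s \<noteq> (0::real)" by (rule AE_lborel_singleton)
      then show "AE s in lborel. (\<integral>\<^sup>+y. indicator {0<..} s * ennreal (s ^ m) *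
        (ennreal (\<Prod>i<Suc m. open_erlang_density (c i) ((\<lambda>i\<in>{..<Suc m}. s * ?lift y i) i)) *
         g (normalize (Suc m) (\<lambda>i\<in>{..<Suc m}. s * ?lift y i))) \<partial>(\<Pi>\<^sub>M i\<in>{..<m}. lborel))
         = (\<integral>\<^sup>+y. ennreal (s ^ (m + C) * exp (- s)) * indicator {0..} s * (ennreal (1 / D) * G y) \<partial>(\<Pi>\<^sub>M i\<in>{..<m}. lborel))"
      proof eventually_elim
        case (elim s)
        show ?case
        proof (cases "0 < s")
          case False
          then show ?thesis using elim by simp
        next
          case True
          show ?thesis
          proof (intro nn_integral_cong)
            fix y
            have norm: "normalize (Suc m) (\<lambda>i\<in>{..<Suc m}. s * ?lift y i) = ?lift y"
            proof -
              have "(\<Sum>j<Suc m. (\<lambda>i\<in>{..<Suc m}. s * ?lift y i) j) = s * (\<Sum>j<Suc m. ?lift y j)"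
                unfolding sum_distrib_left by (intro sum.cong) auto
              then have "(\<Sum>j<Suc m. (\<lambda>i\<in>{..<Suc m}. s * ?lift y i) j) = s" by (simp only: sum_simplex_lift)
              then show ?thesis
                using True by (simp only: normalize_def) (auto simp: fun_eq_iff simplex_lift_def)
            qed
            show "indicator {0<..} s * ennreal (s ^ m) *
               (ennreal (\<Prod>i<Suc m. open_erlang_density (c i) ((\<lambda>i\<in>{..<Suc m}. s * ?lift y i) i)) *
               g (normalize (Suc m) (\<lambda>i\<in>{..<Suc m}. s * ?lift y i)))
               = ennreal (s ^ (m + C) * exp (- s)) * indicator {0..} s * (ennreal (1 / D) * G y)"
            proof (cases "?pos y")
              case False
              then obtain i where i: "i < Suc m" "?lift y i \<le> 0" by (auto simp: not_less)
              then have "(\<Prod>i<Suc m. open_erlang_density (c i) ((\<lambda>i\<in>{..<Suc m}. s * ?lift y i) i)) = 0"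
                using True by (intro prod_zero bexI[of _ i]) (auto simp: open_erlang_density_def zero_less_mult_iff)
              moreover have "G y = 0" using False unfolding G_def by (rule if_not_P)
              ultimately show ?thesis by (simp only: ennreal_0 mult_zero_left mult_zero_right)
            next
              case pos: True
              have "(\<Prod>i<Suc m. open_erlang_density (c i) ((\<lambda>i\<in>{..<Suc m}. s * ?lift y i) i))
                 = (\<Prod>i<Suc m. s ^ c i * ?lift y i ^ c i * exp (- (s * ?lift y i)) / fact (c i))"
                using pos True by (intro prod.cong) (auto simp: open_erlang_density_def power_mult_distrib)
              also have "\<dots> = (\<Prod>i<Suc m. s ^ c i) * (\<Prod>i<Suc m. ?lift y i ^ c i) * (\<Prod>i<Suc m. exp (- (s * ?lift y i))) / D"
                unfolding D_def prod_dividef prod.distrib ..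
              also have "(\<Prod>i<Suc m. s ^ c i) = s ^ C" unfolding C_def by (rule power_sum[symmetric])
              also have "(\<Prod>i<Suc m. exp (- (s * ?lift y i))) = exp (- s)"
              proof -
                have "(\<Prod>i<Suc m. exp (- (s * ?lift y i))) = exp (- s * (\<Sum>i<Suc m. ?lift y i))"
                  unfolding exp_sum[OF finite_lessThan, symmetric] sum_distrib_left by simp
                then show ?thesis by (simp only: sum_simplex_lift mult_1_right)
              qed
              finally have P: "(\<Prod>i<Suc m. open_erlang_density (c i) ((\<lambda>i\<in>{..<Suc m}. s * ?lift y i) i)) = s ^ C * (\<Prod>i<Suc m. ?lift y i ^ c i) * exp (- s) / D" .
              define q where "q = (\<Prod>i<Suc m. ?lift y i ^ c i)"
              have q: "q \<ge> 0" unfolding q_def using pos by (intro prod_nonneg) (auto simp: less_imp_le)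
              have "s ^ m * (s ^ C * q * exp (- s) / D) = (s ^ (m + C) * exp (- s)) * ((1 / D) * q)"
                by (simp add: power_add)
              then have "ennreal (s ^ m) * ennreal (s ^ C * q * exp (- s) / D) = ennreal (s ^ (m + C) * exp (- s)) * (ennreal (1 / D) * ennreal q)"
              proof -
                have "0 \<le> s ^ m" "0 \<le> s ^ C * q * exp (- s) / D" "0 \<le> s ^ (m + C) * exp (- s)" "0 \<le> 1 / D" "0 \<le> 1 / D * q"
                  using True q D by auto
                then show "s ^ m * (s ^ C * q * exp (- s) / D) = (s ^ (m + C) * exp (- s)) * ((1 / D) * q) \<Longrightarrow> ?thesis"
                  using q by (simp only: ennreal_mult[symmetric])
              qed
              moreover have "a * b = c' * (d * e) \<Longrightarrow> a * (b * z) = c' * (d * (z * e))" for a b c' d e z :: ennreal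
                by (metis mult.assoc mult.commute)
              ultimately have "ennreal (s ^ m) * (ennreal (s ^ C * q * exp (- s) / D) * g (?lift y)) =
                  ennreal (s ^ (m + C) * exp (- s)) * (ennreal (1 / D) * (g (?lift y) * ennreal q))" by blast
              moreover have "G y = g (?lift y) * ennreal q" using pos unfolding G_def q_def by (rule if_P)
              moreover have "indicator {0<..} s = (1 :: ennreal)" "indicator {0..} s = (1 :: ennreal)" using True by auto
              ultimately show ?thesis
                by (simp only: P norm q_def[symmetric] mult_1_left mult_1_right)
            qed
          qed
        qed
      qed
    qed
    also have "\<dots> = (\<integral>\<^sup>+s. ennreal (s ^ (m + C) * exp (- s)) * indicator {0..} s * (\<integral>\<^sup>+y. ennreal (1 / D) * G y \<partial>(\<Pi>\<^sub>M i\<in>{..<m}. lborel)) \<partial>lborel)"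
      by (intro nn_integral_cong nn_integral_cmult) measurable
    also have "\<dots> = (\<integral>\<^sup>+s. ennreal (s ^ (m + C) * exp (- s)) * indicator {0..} s \<partial>lborel) * (\<integral>\<^sup>+y. ennreal (1 / D) * G y \<partial>(\<Pi>\<^sub>M i\<in>{..<m}. lborel))"
      by (rule nn_integral_multc) measurable
    also have "\<dots> = ennreal (fact (m + C)) * (ennreal (1 / D) * (\<integral>\<^sup>+y. G y \<partial>(\<Pi>\<^sub>M i\<in>{..<m}. lborel)))"
      by (simp add: nn_intergal_power_times_exp_Ici nn_integral_cmult ennreal_of_nat_eq_real_of_nat)
    finally have rhs: "(\<integral>\<^sup>+x. g (normalize (Suc m) x) \<partial>erlang_product (Suc m) c) = \<dots>" .
    have "ennreal \<kappa> * (ennreal (fact (m + C)) * ennreal (1 / D)) = ennreal (fact m)"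
      using D by (simp add: ennreal_mult'[symmetric] \<kappa>_def)
    then show ?thesis unfolding lhs rhs by (metis mult.assoc)
  qed
  show thesis
    by (rule that[OF _ main]) (use D in \<open>auto simp: \<kappa>_def\<close>)
qed

section \<open>Dyadic bins and Haar coefficients\<close>

text \<open>Bins are open on the left, whence the ceiling minus one; truncated subtraction sends
  \<open>x = 0\<close> to bin \<open>0\<close>, in agreement with the closed first bin.\<close>

definition bin_of :: "nat \<Rightarrow> real \<Rightarrow> nat" where
  "bin_of m x = nat \<lceil>x * 2 ^ m\<rceil> - 1"

text \<open>The right end of the bin of \<open>x\<close> at level \<open>m\<close>. As bins contain
  their right end, a function constant on bins may be evaluated there.\<close>

definition dyadic_ceiling :: "nat \<Rightarrow> real \<Rightarrow> real" where
  "dyadic_ceiling m x = of_int \<lceil>x * 2 ^ m\<rceil> / 2 ^ m"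

lemma bin_of_less: "x \<le> 1 \<Longrightarrow> bin_of m x < 2 ^ m"
proof -
  assume "x \<le> 1"
  then have "\<lceil>x * 2 ^ m\<rceil> \<le> 2 ^ m" by (simp add: ceiling_le_iff)
  then have "nat \<lceil>x * 2 ^ m\<rceil> \<le> 2 ^ m" by (simp add: nat_le_iff)
  then show ?thesis unfolding bin_of_def using zero_less_power[of "2::nat" m] by linarith
qed

lemma dyadic_ceiling_eq: "0 < x \<Longrightarrow> dyadic_ceiling m x = (real (bin_of m x) + 1) / 2 ^ m"
proof -
  assume "0 < x"
  then have "0 < \<lceil>x * 2 ^ m\<rceil>" by simp
  then have "int (bin_of m x) + 1 = \<lceil>x * 2 ^ m\<rceil>" unfolding bin_of_def by linarith
  then have "real_of_int (int (bin_of m x) + 1) = of_int \<lceil>x * 2 ^ m\<rceil>" by (simp only:)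
  then have "real (bin_of m x) + 1 = of_int \<lceil>x * 2 ^ m\<rceil>" by simp
  then show ?thesis by (simp add: dyadic_ceiling_def)
qed

lemma mem_dyadic_bin_iff:
  assumes "0 \<le> x"
  shows "x \<in> dyadic_bin m j \<longleftrightarrow> bin_of m x = j"
proof (cases "x = 0")
  case True
  then show ?thesis by (auto simp: dyadic_bin_def bin_of_def divide_less_0_iff)
next
  case False
  then have x: "0 < x" using assms by simp
  then have c: "0 < \<lceil>x * 2 ^ m\<rceil>" by simp
  have "bin_of m x = j \<longleftrightarrow> \<lceil>x * 2 ^ m\<rceil> = int j + 1"
    unfolding bin_of_def using c by linarith
  also have "\<dots> \<longleftrightarrow> real j < x * 2 ^ m \<and> x * 2 ^ m \<le> real j + 1"
    by (simp add: ceiling_eq_iff)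
  also have "\<dots> \<longleftrightarrow> x \<in> dyadic_bin m j"
    using x by (auto simp: dyadic_bin_def field_simps)
  finally show ?thesis by simp
qed

text \<open>A grid point of level \<open>l\<close> is also one of the finer level \<open>m\<close>,
  and rounding up to a grid does not change comparison with its points.\<close>

lemma dyadic_le_iff:
  assumes "l \<le> m"
  shows "x \<le> real a / 2 ^ l \<longleftrightarrow> dyadic_ceiling m x \<le> real a / 2 ^ l"
proof -
  have eq: "real a / 2 ^ l = of_int (int (a * 2 ^ (m - l))) / 2 ^ m"
  proof -
    have "(2::real) ^ m = 2 ^ l * 2 ^ (m - l)" using assms by (simp flip: power_add)
    then show ?thesis by simp
  qed
  show ?thesis
    unfolding eq dyadic_ceiling_def by (simp add: pos_le_divide_eq divide_le_cancel ceiling_le_iff del: of_nat_mult of_int_of_nat_eq)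
qed

lemma haar_dyadic_ceiling:
  assumes "0 \<le> l" "l < int m"
  shows "haar l k (dyadic_ceiling m x) = haar l k x"
proof -
  define p where "p = Suc (nat l)"
  have p: "p \<le> m" using assms by (auto simp: p_def)
  have e: "real k / 2 ^ nat l = real (2 * k) / 2 ^ p" "(real k + 1/2) / 2 ^ nat l = real (2 * k + 1) / 2 ^ p"
     "(real k + 1) / 2 ^ nat l = real (2 * k + 2) / 2 ^ p"
    by (auto simp: p_def field_simps)
  have "dyadic_ceiling m x \<in> {real a / 2 ^ p <.. real b / 2 ^ p} \<longleftrightarrow> x \<in> {real a / 2 ^ p <.. real b / 2 ^ p}" for a b
    unfolding greaterThanAtMost_iff not_le[symmetric] dyadic_le_iff[OF p, symmetric] ..
  moreover have "l \<noteq> -1" using assms by simp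
  ultimately show ?thesis unfolding haar_def e by (simp only: indicator_def if_False)
qed

text \<open>Strict positivity of \<open>x\<close> matters: at \<open>0\<close> every Haar function
  of nonnegative level vanishes, although \<open>0\<close> lies in the first bin, where the function
  with \<open>k = 0\<close> does not.\<close>

lemma haar_bin:
  assumes "0 \<le> l" "l < int m" "0 < x"
  shows "haar l k x = haar l k ((real (bin_of m x) + 1) / 2 ^ m)"
  using haar_dyadic_ceiling[OF assms(1,2), of k x] dyadic_ceiling_eq[OF assms(3), of m] by simp

lemma haar_bin_value:
  assumes "0 \<le> l" "m = Suc (nat l)"
  shows "haar l k ((real j + 1) / 2 ^ m) = (if j = 2 * k then 2 powr (l / 2) else if j = 2 * k + 1 then - (2 powr (l / 2)) else 0)"
proof -
  have e: "real k / 2 ^ nat l = real (2 * k) / 2 ^ m" "(real k + 1/2) / 2 ^ nat l = real (2 * k + 1) / 2 ^ m"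
     "(real k + 1) / 2 ^ nat l = real (2 * k + 2) / 2 ^ m"
    by (auto simp: assms(2) field_simps)
  have "(real j + 1) / 2 ^ m \<in> {real a / 2 ^ m <.. real b / 2 ^ m} \<longleftrightarrow> a < j + 1 \<and> j + 1 \<le> b" for a b
  proof -
    have "real j + 1 = real (j + 1)" by simp
    then show ?thesis
      by (simp only: greaterThanAtMost_iff divide_less_cancel divide_le_cancel of_nat_less_iff of_nat_le_iff) simp
  qed
  then have m: "(real j + 1) / 2 ^ m \<in> {real (2 * k) / 2 ^ m <.. real (2 * k + 1) / 2 ^ m} \<longleftrightarrow> j = 2 * k"
      "(real j + 1) / 2 ^ m \<in> {real (2 * k + 1) / 2 ^ m <.. real (2 * k + 2) / 2 ^ m} \<longleftrightarrow> j = 2 * k + 1"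
    by (simp_all only:) presburger+
  have "l \<noteq> -1" using assms(1) by simp
  then show ?thesis unfolding haar_def e indicator_def m by simp
qed

lemma abs_haar_le: "0 \<le> l \<Longrightarrow> \<bar>haar l k x\<bar> \<le> 2 powr (l / 2)"
  unfolding haar_def by (auto simp: indicator_def abs_mult)

lemma haar_measurable [measurable]: "haar l k \<in> borel_measurable borel"
  unfolding haar_def[abs_def] by measurable

lemma dyadic_bin_measurable [measurable]: "dyadic_bin m j \<in> sets borel"
  unfolding dyadic_bin_def by (cases "j = 0") simp_all

lemma dyadic_bin_subset: "j < 2 ^ m \<Longrightarrow> dyadic_bin m j \<subseteq> {0..1}"
proof -
  assume "j < 2 ^ m"
  then have "real j + 1 \<le> 2 ^ m" by (metis Suc_leI of_nat_Suc of_nat_le_iff of_nat_numeral of_nat_power add.commute)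
  then have 1: "(real j + 1) / 2 ^ m \<le> 1" by simp
  moreover have 2: "0 \<le> real j / 2 ^ m" by simp
  ultimately show ?thesis
    using order_trans[OF _ 1] order.strict_implies_order[OF order.strict_trans1[OF 2]] by (auto simp: dyadic_bin_def)
qed

lemma measure_dyadic_bin: "measure lborel (dyadic_bin m j) = 1 / 2 ^ m"
  by (auto simp: dyadic_bin_def field_simps)

lemma finite_measure_unit_leb: "finite_measure unit_leb" 
  by (rule finite_measureI) (simp add: emeasure_restrict_space space_restrict_space)

lemma measure_unit_leb_bin: "j < 2 ^ m \<Longrightarrow> measure unit_leb (dyadic_bin m j) = 1 / 2 ^ m"
  using dyadic_bin_subset[of j m] by (simp add: measure_restrict_space measure_dyadic_bin)

lemma AE_unit_leb_pos: "AE x in unit_leb. 0 < x \<and> x \<le> 1"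
proof -
  have "AE x in lborel. x \<in> {0..1::real} \<longrightarrow> 0 < x \<and> x \<le> 1"
    using AE_lborel_singleton[of "0::real"] by eventually_elim auto
  then show ?thesis by (subst AE_restrict_space_iff) auto
qed

section \<open>Integrals and sums of functions constant on dyadic bins\<close>

lemma integral_bin_function:
  fixes F :: "real \<Rightarrow> real"
  assumes F: "\<And>x. 0 < x \<Longrightarrow> x \<le> 1 \<Longrightarrow> F x = c (bin_of m x)" and Fm[measurable]: "F \<in> borel_measurable unit_leb"
  shows "(LINT x|unit_leb. F x) = (\<Sum>j<2 ^ m. c j) / 2 ^ m" "integrable unit_leb F"
proof -
  interpret finite_measure unit_leb by (rule finite_measure_unit_leb)
  have mb[measurable]: "dyadic_bin m j \<in> sets unit_leb" if "j < 2 ^ m" for j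
    using that dyadic_bin_subset[of j m] by (auto simp: sets_restrict_space_iff)
  have eq: "F x = (\<Sum>j<2 ^ m. c j * indicator (dyadic_bin m j) x)" if "0 < x" "x \<le> 1" for x
  proof -
    have "(\<Sum>j<2 ^ m. c j * indicator (dyadic_bin m j) x) = (\<Sum>j<2 ^ m. if bin_of m x = j then c j else 0)"
      using that by (intro sum.cong) (auto simp: mem_dyadic_bin_iff indicator_def)
    also have "\<dots> = c (bin_of m x)" using bin_of_less[OF that(2)] by (simp add: sum.delta)
    finally show ?thesis using F that by simp
  qed
  have int: "integrable unit_leb (\<lambda>x. c j * indicator (dyadic_bin m j) x :: real)" if "j < 2 ^ m" for j
    using mb[OF that] by (auto simp: emeasure_eq_measure)
  have ae: "AE x in unit_leb. F x = (\<Sum>j<2 ^ m. c j * indicator (dyadic_bin m j) x)"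
    using AE_unit_leb_pos by eventually_elim (use eq in auto)
  have m2: "(\<lambda>x. \<Sum>j<2 ^ m. c j * indicator (dyadic_bin m j) x :: real) \<in> borel_measurable unit_leb"
    using int by (intro borel_measurable_sum borel_measurable_integrable) auto
  have "(LINT x|unit_leb. F x) = (LINT x|unit_leb. (\<Sum>j<2 ^ m. c j * indicator (dyadic_bin m j) x))"
    by (rule integral_cong_AE[OF _ m2 ae]) measurable
  also have "\<dots> = (\<Sum>j<2 ^ m. LINT x|unit_leb. c j * indicator (dyadic_bin m j) x)"
    by (rule Bochner_Integration.integral_sum) (use int in auto)
  also have "\<dots> = (\<Sum>j<2 ^ m. c j * (1 / 2 ^ m))"
  proof (intro sum.cong refl)
    fix j assume "j \<in> {..<(2::nat) ^ m}"
    then have j: "j < 2 ^ m" by simp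
    have "dyadic_bin m j \<inter> space unit_leb = dyadic_bin m j"
      using dyadic_bin_subset[OF j] by (auto simp: space_restrict_space)
    then show "(LINT x|unit_leb. c j * indicator (dyadic_bin m j) x) = c j * (1 / 2 ^ m)"
      using mb[OF j] measure_unit_leb_bin[OF j] by simp
  qed
  finally show "(LINT x|unit_leb. F x) = (\<Sum>j<2 ^ m. c j) / 2 ^ m"
    by (simp add: sum_divide_distrib)
  show "integrable unit_leb F"
  proof -
    have "integrable unit_leb (\<lambda>x. \<Sum>j<2 ^ m. c j * indicator (dyadic_bin m j) x :: real)"
      by (rule Bochner_Integration.integrable_sum) (use int in simp)
    then show ?thesis by (rule integrable_cong_AE[OF Fm m2 ae, THEN iffD2])
  qed
qed

lemma measurable_unit_leb: "f \<in> borel_measurable borel \<Longrightarrow> f \<in> borel_measurable unit_leb"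
  by (auto intro: measurable_restrict_space1)

text \<open>The Haar function takes its two nonzero values on sets of measure
  \<open>1 / (2 * 2 ^ nat l)\<close> each. Identity, square and absolute value for
  \<open>\<phi>\<close> give the vanishing mean, the unit norm and the first absolute
  moment.\<close>

lemma integral_haar_comp:
  assumes l: "0 \<le> l" "k < 2 ^ nat l" and [measurable]: "\<phi> \<in> borel_measurable borel" and \<phi>: "\<phi> 0 = (0::real)"
  shows "(LINT x|unit_leb. \<phi> (haar l k x)) = (\<phi> (2 powr (l / 2)) + \<phi> (- (2 powr (l / 2)))) / (2 * 2 ^ nat l)"
proof -
  define m where "m = Suc (nat l)"
  have "(LINT x|unit_leb. \<phi> (haar l k x)) = (\<Sum>j<2 ^ m. \<phi> (haar l k ((real j + 1) / 2 ^ m))) / 2 ^ m"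
  proof (rule integral_bin_function(1))
    show "\<phi> (haar l k x) = \<phi> (haar l k ((real (bin_of m x) + 1) / 2 ^ m))" if "0 < x" for x
      using haar_bin[of l m x k] l that by (simp add: m_def)
  qed (rule measurable_unit_leb, measurable)
  also have "(\<Sum>j<2 ^ m. \<phi> (haar l k ((real j + 1) / 2 ^ m))) = (\<Sum>j\<in>{2 * k, 2 * k + 1}. \<phi> (haar l k ((real j + 1) / 2 ^ m)))"
    using l \<phi> haar_bin_value[OF l(1) m_def, of k]
    by (intro sum.mono_neutral_right) (auto simp: m_def)
  also have "\<dots> = \<phi> (2 powr (l / 2)) + \<phi> (- (2 powr (l / 2)))"
    using haar_bin_value[OF l(1) m_def, of k "2 * k"] haar_bin_value[OF l(1) m_def, of k "2 * k + 1"] by simp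
  finally show ?thesis by (simp add: m_def)
qed

text \<open>The sum over bins of any finer level \<open>m\<close> is \<open>2 ^ m\<close> times the
  integral, so discrete orthogonality is inherited from the continuous one.\<close>

lemma sum_haar_bin:
  assumes l: "0 \<le> l" "l < int m" "k < 2 ^ nat l" and [measurable]: "\<phi> \<in> borel_measurable borel" and \<phi>: "\<phi> 0 = (0::real)"
  shows "(\<Sum>j<2 ^ m. \<phi> (haar l k ((real j + 1) / 2 ^ m))) = 2 ^ m * (\<phi> (2 powr (l / 2)) + \<phi> (- (2 powr (l / 2)))) / (2 * 2 ^ nat l)"
proof -
  have "(LINT x|unit_leb. \<phi> (haar l k x)) = (\<Sum>j<2 ^ m. \<phi> (haar l k ((real j + 1) / 2 ^ m))) / 2 ^ m"
  proof (rule integral_bin_function(1))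
    show "\<phi> (haar l k x) = \<phi> (haar l k ((real (bin_of m x) + 1) / 2 ^ m))" if "0 < x" for x
      using haar_bin[of l m x k] l that by simp
  qed (rule measurable_unit_leb, measurable)
  then show ?thesis using integral_haar_comp[OF l(1,3) assms(4) \<phi>] by (simp add: field_simps)
qed

lemma powr_half_square: "0 \<le> l \<Longrightarrow> (2 powr (real_of_int l / 2))\<^sup>2 = 2 ^ nat l"
  by (simp add: power2_eq_square powr_add[symmetric] powr_realpow[symmetric])

lemma sum_haar_bin_eq_0:
  assumes "0 \<le> l" "l < int m" "k < 2 ^ nat l"
  shows "(\<Sum>j<2 ^ m. haar l k ((real j + 1) / 2 ^ m)) = 0"
  using sum_haar_bin[OF assms, of "\<lambda>x. x"] by simp

lemma sum_haar_bin_sq: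
  assumes "0 \<le> l" "l < int m" "k < 2 ^ nat l"
  shows "(\<Sum>j<2 ^ m. (haar l k ((real j + 1) / 2 ^ m))\<^sup>2) = 2 ^ m"
  using sum_haar_bin[OF assms, of "\<lambda>x. x\<^sup>2"] powr_half_square[OF assms(1)] by simp

lemma sum_abs_haar_bin_le:
  assumes "0 \<le> l" "l < int m" "k < 2 ^ nat l"
  shows "(\<Sum>j<2 ^ m. \<bar>haar l k ((real j + 1) / 2 ^ m)\<bar>) \<le> 2 ^ m"
proof -
  have "(\<Sum>j<2 ^ m. \<bar>haar l k ((real j + 1) / 2 ^ m)\<bar>) = 2 ^ m * (2 powr (l / 2)) / 2 ^ nat l"
    using sum_haar_bin[OF assms, of "\<lambda>x. \<bar>x\<bar>"] by simp
  also have "\<dots> \<le> 2 ^ m * 2 ^ nat l / 2 ^ nat l"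
  proof (intro divide_right_mono mult_left_mono)
    have "2 powr (l / 2) \<le> 2 powr (real (nat l))" using assms(1) by (intro powr_mono) auto
    then show "2 powr (l / 2) \<le> 2 ^ nat l" by (simp add: powr_realpow)
  qed auto
  finally show ?thesis by simp
qed

lemma integral_haar_eq_0: "0 \<le> l \<Longrightarrow> k < 2 ^ nat l \<Longrightarrow> (LINT x|unit_leb. haar l k x) = 0"
  using integral_haar_comp[of l k "\<lambda>x. x"] by simp

section \<open>Haar coefficients of histograms\<close>

lemma histogram_bin:
  assumes "0 \<le> x" "x \<le> 1"
  shows "histogram L h x = 2 ^ L * h (bin_of L x)"
proof -
  have "(\<Sum>k<2 ^ L. h k * indicator (dyadic_bin L k) x) = (\<Sum>k<2 ^ L. if bin_of L x = k then h k else 0)"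
    using assms by (intro sum.cong) (auto simp: mem_dyadic_bin_iff indicator_def)
  then show ?thesis unfolding histogram_def using bin_of_less[OF assms(2), of L] by (simp add: sum.delta)
qed

lemma histogram_measurable [measurable]: "histogram L h \<in> borel_measurable borel"
  unfolding histogram_def[abs_def] by measurable

lemma bin_of_Suc_div:
  assumes "0 < x" "x \<le> 1"
  shows "bin_of L x = bin_of (Suc L) x div 2"
proof -
  have "x \<in> dyadic_bin (Suc L) (bin_of (Suc L) x)" using assms mem_dyadic_bin_iff by simp
  then have 1: "real (bin_of (Suc L) x) < x * 2 ^ Suc L" "x * 2 ^ Suc L \<le> real (bin_of (Suc L) x) + 1"
    using assms by (auto simp: dyadic_bin_def field_simps split: if_splits)
  define q where "q = bin_of (Suc L) x div 2"
  have "real (2 * q) \<le> real (bin_of (Suc L) x)" "real (bin_of (Suc L) x) \<le> real (2 * q + 1)"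
    unfolding q_def of_nat_le_iff by simp_all
  then have "real q < x * 2 ^ L" "x * 2 ^ L \<le> real q + 1"
    using 1 by simp_all
  then have "x \<in> dyadic_bin L q" using assms by (auto simp: dyadic_bin_def field_simps)
  then show ?thesis using mem_dyadic_bin_iff[of x L q] assms by (simp add: q_def)
qed

lemma inner_histogram_haar:
  assumes "0 \<le> l" "l < int L"
  shows "inner_L2 (histogram L h) (haar l k) = (\<Sum>j<2 ^ L. h j * haar l k ((real j + 1) / 2 ^ L))"
proof -
  have "inner_L2 (histogram L h) (haar l k) = (\<Sum>j<2 ^ L. 2 ^ L * h j * haar l k ((real j + 1) / 2 ^ L)) / 2 ^ L"
    unfolding inner_L2_def
  proof (rule integral_bin_function(1))
    show "histogram L h x * haar l k x = 2 ^ L * h (bin_of L x) * haar l k ((real (bin_of L x) + 1) / 2 ^ L)" if "0 < x" "x \<le> 1" for x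
      using haar_bin[OF assms, of x k] histogram_bin[of x L h] that by simp
  qed (rule measurable_unit_leb, measurable)
  then show ?thesis by (simp add: sum_divide_distrib)
qed

text \<open>The support of this Haar function is a single bin of the histogram, and the function
  integrates to zero over it. Hence the posterior is degenerate at the top level of the credible
  set, and that level has to be treated separately.\<close>

lemma inner_histogram_haar_level:
  assumes "k < 2 ^ L"
  shows "inner_L2 (histogram L h) (haar (int L) k) = 0"
proof -
  \<comment> \<open>A Haar function of level \<open>L\<close> is constant only on bins of the next
    level, each of which lies in the histogram bin \<open>j div 2\<close>.\<close>
  let ?m = "Suc L"
  have "inner_L2 (histogram L h) (haar (int L) k) = (\<Sum>j<2 ^ ?m. 2 ^ L * h (j div 2) * haar (int L) k ((real j + 1) / 2 ^ ?m)) / 2 ^ ?m"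
    unfolding inner_L2_def
  proof (rule integral_bin_function(1))
    show "histogram L h x * haar (int L) k x = 2 ^ L * h (bin_of ?m x div 2) * haar (int L) k ((real (bin_of ?m x) + 1) / 2 ^ ?m)" if "0 < x" "x \<le> 1" for x
      using haar_bin[of "int L" ?m x k] histogram_bin[of x L h] bin_of_Suc_div[of x L] that by simp
  qed (rule measurable_unit_leb, measurable)
  also have "(\<Sum>j<2 ^ ?m. 2 ^ L * h (j div 2) * haar (int L) k ((real j + 1) / 2 ^ ?m))
      = (\<Sum>j\<in>{2 * k, 2 * k + 1}. 2 ^ L * h (j div 2) * haar (int L) k ((real j + 1) / 2 ^ ?m))"
    using assms haar_bin_value[of "int L" ?m k] by (intro sum.mono_neutral_right) auto
  also have "\<dots> = 0"
    using haar_bin_value[of "int L" ?m k "2 * k"] haar_bin_value[of "int L" ?m k "2 * k + 1"] by simp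
  finally show ?thesis by simp
qed

lemma inner_histogram_haar_minus_1: "inner_L2 (histogram L h) (haar (-1) k) = (\<Sum>j<2 ^ L. h j)"
proof -
  have "inner_L2 (histogram L h) (haar (-1) k) = (\<Sum>j<2 ^ L. 2 ^ L * h j) / 2 ^ L"
    unfolding inner_L2_def
  proof (rule integral_bin_function(1))
    show "histogram L h x * haar (-1) k x = 2 ^ L * h (bin_of L x)" if "0 < x" "x \<le> 1" for x
      using histogram_bin[of x L h] that by (simp add: haar_def)
  qed (rule measurable_unit_leb, measurable)
  then show ?thesis by (simp add: sum_divide_distrib)
qed

section \<open>The posterior on cells of equal bin counts\<close>

lemma L2_integrable:
  assumes "g \<in> L2"
  shows "integrable unit_leb g"
proof -
  interpret finite_measure unit_leb by (rule finite_measure_unit_leb)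
  have [measurable]: "g \<in> borel_measurable unit_leb" and sq: "integrable unit_leb (\<lambda>x. (g x)\<^sup>2)"
    using assms by (auto simp: L2_def)
  show ?thesis
  proof (rule Bochner_Integration.integrable_bound[of _ "\<lambda>x. 1 + (g x)\<^sup>2"])
    show "integrable unit_leb (\<lambda>x. 1 + (g x)\<^sup>2)" using sq by auto
    have "\<bar>y\<bar> \<le> 1 + y\<^sup>2" for y :: real
      using zero_le_power2[of "\<bar>y\<bar> - 1"] by (simp add: power2_eq_square algebra_simps)
    then show "AE x in unit_leb. norm (g x) \<le> norm (1 + (g x)\<^sup>2)"
      by (intro AE_I2) (simp add: add_nonneg_nonneg)
  qed measurable
qed

lemma bounded_in_L2:
  assumes [measurable]: "f \<in> borel_measurable unit_leb" and B: "\<And>x. x \<in> {0..1} \<Longrightarrow> \<bar>f x\<bar> \<le> B"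
  shows "f \<in> L2"
proof -
  interpret finite_measure unit_leb by (rule finite_measure_unit_leb)
  have "integrable unit_leb (\<lambda>x. (f x)\<^sup>2)"
  proof (rule integrable_const_bound[where B="B\<^sup>2"])
    show "AE x in unit_leb. norm ((f x)\<^sup>2) \<le> B\<^sup>2"
    proof (rule AE_I2)
      fix x assume "x \<in> space unit_leb"
      then have "\<bar>f x\<bar> \<le> B" using B by (simp add: space_restrict_space)
      then have "\<bar>f x\<bar>\<^sup>2 \<le> B\<^sup>2" by (intro power_mono) auto
      then show "norm ((f x)\<^sup>2) \<le> B\<^sup>2" by simp
    qed
  qed measurable
  then show ?thesis by (simp add: L2_def)
qed

lemma haar_in_L2: "0 \<le> l \<Longrightarrow> haar l k \<in> L2"
  by (rule bounded_in_L2[of _ "2 powr (l / 2)"]) (auto intro: measurable_unit_leb abs_haar_le)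

lemma haar_minus_1_in_L2: "haar (-1) k \<in> L2"
  by (rule bounded_in_L2[of _ 1]) (auto intro: measurable_unit_leb simp: haar_def)

lemma haar_index_in_L2: "(l, k) \<in> haar_index \<Longrightarrow> haar l k \<in> L2"
  by (auto simp: haar_index_def haar_in_L2 haar_minus_1_in_L2)

lemma histogram_in_L2: "histogram L h \<in> L2"
proof (rule bounded_in_L2)
  show "histogram L h \<in> borel_measurable unit_leb" by (rule measurable_unit_leb) measurable
  fix x :: real assume "x \<in> {0..1}"
  then have x: "0 \<le> x" "x \<le> 1" by auto
  have "\<bar>h (bin_of L x)\<bar> \<le> (\<Sum>j<2 ^ L. \<bar>h j\<bar>)"
    using bin_of_less[OF x(2), of L] by (intro member_le_sum) auto
  then show "\<bar>histogram L h x\<bar> \<le> 2 ^ L * (\<Sum>j<2 ^ L. \<bar>h j\<bar>)"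
    unfolding histogram_bin[OF x] by (simp add: abs_mult)
qed

lemma inner_L2_histogram:
  assumes "g \<in> L2"
  shows "inner_L2 (histogram L h) g = (\<Sum>k<2 ^ L. h k * (2 ^ L * (LINT x|unit_leb. indicator (dyadic_bin L k) x * g x)))"
proof -
  have [measurable]: "g \<in> borel_measurable unit_leb" using assms by (simp add: L2_def)
  have ig: "integrable unit_leb (\<lambda>x. indicator (dyadic_bin L k) x * g x)" for k
  proof -
    have [measurable]: "(indicator (dyadic_bin L k) :: real \<Rightarrow> real) \<in> borel_measurable unit_leb"
      by (rule measurable_unit_leb) measurable
    show ?thesis
    proof (rule Bochner_Integration.integrable_bound[OF L2_integrable[OF assms]])
      show "(\<lambda>x. indicator (dyadic_bin L k) x * g x) \<in> borel_measurable unit_leb" by measurable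
    qed (auto simp: indicator_def)
  qed
  have "inner_L2 (histogram L h) g = (LINT x|unit_leb. (\<Sum>k<2 ^ L. h k * (2 ^ L * (indicator (dyadic_bin L k) x * g x))))"
    unfolding inner_L2_def histogram_def
    by (intro Bochner_Integration.integral_cong refl) (simp only: sum_distrib_left sum_distrib_right mult_ac)
  also have "\<dots> = (\<Sum>k<2 ^ L. LINT x|unit_leb. h k * (2 ^ L * (indicator (dyadic_bin L k) x * g x)))"
    by (rule Bochner_Integration.integral_sum) (use ig in simp)
  finally show ?thesis by simp
qed

lemma space_L2_borel [simp]: "space L2_borel = L2"
  unfolding L2_borel_def by (rule space_measure_of) auto

lemma inner_L2_measurable:
  assumes "g \<in> L2"
  shows "(\<lambda>f. inner_L2 f g) \<in> borel_measurable L2_borel"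
proof (rule measurableI)
  fix B :: "real set" assume "B \<in> sets borel"
  then have "{f \<in> L2. inner_L2 f g \<in> B} \<in> sets L2_borel"
    unfolding L2_borel_def using assms by (subst sets_measure_of) (auto intro!: sigma_sets.Basic)
  moreover have "(\<lambda>f. inner_L2 f g) -` B \<inter> space L2_borel = {f \<in> L2. inner_L2 f g \<in> B}" by auto
  ultimately show "(\<lambda>f. inner_L2 f g) -` B \<inter> space L2_borel \<in> sets L2_borel" by simp
qed simp

lemma measurable_histogram [measurable]: "histogram L \<in> (\<Pi>\<^sub>M i\<in>{..<2 ^ L}. borel) \<rightarrow>\<^sub>M L2_borel"
  unfolding L2_borel_def
proof (rule measurable_measure_of)
  fix Y assume "Y \<in> {{f \<in> L2. inner_L2 f g \<in> B} | g B. g \<in> L2 \<and> B \<in> sets borel}"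
  then obtain g B where g: "g \<in> L2" and [measurable]: "B \<in> sets borel" and Y: "Y = {f \<in> L2. inner_L2 f g \<in> B}" by auto
  have "histogram L -` Y \<inter> space (\<Pi>\<^sub>M i\<in>{..<2 ^ L}. borel) =
      {h \<in> space (\<Pi>\<^sub>M i\<in>{..<2 ^ L}. borel). (\<Sum>k<2 ^ L. h k * (2 ^ L * (LINT x|unit_leb. indicator (dyadic_bin L k) x * g x))) \<in> B}"
    unfolding Y by (auto simp: histogram_in_L2 inner_L2_histogram[OF g])
  also have "\<dots> \<in> sets (\<Pi>\<^sub>M i\<in>{..<2 ^ L}. borel)" by measurable
  finally show "histogram L -` Y \<inter> space (\<Pi>\<^sub>M i\<in>{..<2 ^ L}. borel) \<in> sets (\<Pi>\<^sub>M i\<in>{..<2 ^ L}. borel)" .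
qed (auto simp: histogram_in_L2)

lemma sets_dirichlet [measurable_cong, simp]: "sets (dirichlet N a) = sets (\<Pi>\<^sub>M i\<in>{..<N}. borel)"
  by (simp add: dirichlet_def)

text \<open>Positive weights allow the product of the \<open>ennreal\<close> factors of the
  likelihood to be read as the real product.\<close>

lemma dirichlet_1_pos: "AE h in dirichlet (Suc m) (\<lambda>_. 1). \<forall>i<Suc m. 0 < h i"
proof -
  have [measurable]: "Measurable.pred (\<Pi>\<^sub>M i\<in>{..<Suc m}. borel) (\<lambda>h. \<forall>i<Suc m. (0::real) < h i)"
  proof -
    have "{h \<in> space (\<Pi>\<^sub>M i\<in>{..<Suc m}. borel). \<forall>i\<in>{..<Suc m}. (0::real) < h i} \<in> sets (\<Pi>\<^sub>M i\<in>{..<Suc m}. borel)"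
      by (intro sets.sets_Collect_finite_All borel_measurable_less measurable_component_singleton) auto
    moreover have "{h \<in> space (\<Pi>\<^sub>M i\<in>{..<Suc m}. borel). \<forall>i\<in>{..<Suc m}. (0::real) < h i} =
        {h \<in> space (\<Pi>\<^sub>M i\<in>{..<Suc m}. borel). \<forall>i<Suc m. (0::real) < h i}" by blast
    ultimately show ?thesis unfolding pred_def by (rule back_subst)
  qed
  define X where "X = {h \<in> space (\<Pi>\<^sub>M i\<in>{..<Suc m}. borel). \<not> (\<forall>i<Suc m. (0::real) < h i)}"
  have X: "X \<in> sets (\<Pi>\<^sub>M i\<in>{..<Suc m}. borel)" unfolding X_def by measurable
  have "emeasure (dirichlet (Suc m) (\<lambda>_. 1)) X = (\<integral>\<^sup>+h. indicator X h \<partial>dirichlet (Suc m) (\<lambda>_. 1))"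
    using X by (intro nn_integral_indicator[symmetric]) simp
  also have "\<dots> = ennreal (fact m) * (\<integral>\<^sup>+y. (if \<forall>i<Suc m. 0 < simplex_lift (Suc m) y i then indicator X (simplex_lift (Suc m) y) else 0) \<partial>(\<Pi>\<^sub>M i\<in>{..<m}. lborel))"
    using X by (intro nn_integral_dirichlet_1 borel_measurable_indicator)
  also have "(\<lambda>y. if \<forall>i<Suc m. 0 < simplex_lift (Suc m) y i then indicator X (simplex_lift (Suc m) y) else 0) = (\<lambda>y. 0 :: ennreal)"
    by (auto simp: fun_eq_iff X_def)
  finally have "emeasure (dirichlet (Suc m) (\<lambda>_. 1)) X = 0" by simp
  then show ?thesis
    using X by (intro AE_I[where N=X]) (auto simp: X_def sets_eq_imp_space_eq[OF sets_dirichlet])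
qed

lemma prod_group_count:
  fixes b :: "nat \<Rightarrow> nat" and n N :: nat and h :: "nat \<Rightarrow> real"
  assumes "b \<in> {..<n} \<rightarrow> {..<N}"
  shows "(\<Prod>i<n. h (b i)) = (\<Prod>j<N. h j ^ card {i \<in> {..<n}. b i = j})"
proof -
  have "(\<Prod>j<N. h j ^ card {i \<in> {..<n}. b i = j}) = (\<Prod>j<N. \<Prod>i\<in>{i \<in> {..<n}. b i = j}. h (b i))"
    by (intro prod.cong refl) (simp add: prod_constant)
  also have "\<dots> = (\<Prod>i<n. h (b i))"
  proof -
    have "b ` {..<n} \<subseteq> {..<N}" using assms by auto
    then show ?thesis using prod.group[of "{..<n}" "{..<N}" b "\<lambda>i. h (b i)"] by simp
  qed
  finally show ?thesis ..
qed

text \<open>While the observations stay in prescribed bins the likelihood depends on them only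
  through the counts. On such a cell the joint law is therefore a product of an Erlang image and
  Lebesgue measure, and comparing it with the disintegration identifies the kernel, almost
  everywhere with respect to Lebesgue measure and not merely the marginal law of the data.\<close>

lemma posterior_on_cell:
  assumes post: "is_posterior L n K" and S: "S \<in> sets L2_borel" and b: "b \<in> {..<n} \<rightarrow> {..<2 ^ L}"
  defines "c \<equiv> \<lambda>j. card {i \<in> {..<n}. b i = j}"
  shows "AE x in (\<Pi>\<^sub>M i\<in>{..<n}. lborel). x \<in> (\<Pi>\<^sub>E i\<in>{..<n}. dyadic_bin L (b i)) \<longrightarrow>
     emeasure (K x) S = emeasure (erlang_product (2 ^ L) c) {g \<in> space (erlang_product (2 ^ L) c). histogram L (normalize (2 ^ L) g) \<in> S}"
proof -
  let ?N = "2 ^ L :: nat"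
  obtain m where m: "?N = Suc m" using not0_implies_Suc[of ?N] by auto
  let ?D = "dirichlet ?N (\<lambda>_. 1)" and ?lam = "\<Pi>\<^sub>M i\<in>{..<n}. lborel :: real measure"
  define B where "B = (\<Pi>\<^sub>E i\<in>{..<n}. dyadic_bin L (b i))"
  define Q where "Q = emeasure (erlang_product ?N c) {g \<in> space (erlang_product ?N c). histogram L (normalize ?N g) \<in> S}"
  define J where "J = histogram_model L n"
  interpret E: prob_space "erlang_product ?N c" by (rule prob_space_erlang_product)
  interpret ps: product_sigma_finite "\<lambda>i::nat. lborel :: real measure" by standard
  interpret lam: sigma_finite_measure ?lam by (rule ps.sigma_finite) simp
  have Bm[measurable]: "B \<in> sets ?lam" unfolding B_def by (intro sets_PiM_I_finite) auto
  have S_m[measurable]: "S \<in> sets L2_borel" by fact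
  have Kk: "K \<in> data_space n \<rightarrow>\<^sub>M prob_algebra L2_borel"
    and KJ: "\<And>T. T \<in> sets (data_space n) \<Longrightarrow> emeasure J (S \<times> T) = (\<integral>\<^sup>+y\<in>T. emeasure (K y) S \<partial>distr J (data_space n) snd)"
    using post S unfolding is_posterior_def conditional_law_def J_def by auto
  have KS: "(\<lambda>y. emeasure (K y) S) \<in> borel_measurable (data_space n)"
    using measurable_prob_algebraD[OF Kk] S by (rule measurable_emeasure_kernel)
  have KSl[measurable]: "(\<lambda>y. emeasure (K y) S) \<in> borel_measurable ?lam"
    using KS measurable_cong_sets[OF sets_PiM_lborel refl] by blast
  obtain \<kappa> where \<kappa>: "0 < \<kappa>" and \<kappa>g: "\<And>g. g \<in> borel_measurable (\<Pi>\<^sub>M i\<in>{..<?N}. borel) \<Longrightarrow>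
    (\<integral>\<^sup>+h. g h * ennreal (\<Prod>i<?N. h i ^ c i) \<partial>?D) = ennreal \<kappa> * (\<integral>\<^sup>+x. g (normalize ?N x) \<partial>erlang_product ?N c)"
    using dirichlet_multinomial_posterior[of m c] unfolding m by blast
  \<comment> \<open>This constant, made of the histogram heights and the conjugacy factor, appears
    on both sides of the disintegration and cancels because it is neither zero nor infinite.\<close>
  define A where "A = ennreal ((2 ^ L) ^ n) * ennreal \<kappa>"
  have A: "A \<noteq> 0" "A \<noteq> \<top>" using \<kappa> by (auto simp: A_def ennreal_mult_eq_top_iff)
  define W where "W = (\<lambda>(h, x). \<Prod>i<n. ennreal (histogram L h (x i)))"
  have W1[measurable]: "(\<lambda>z. histogram L (fst z) (snd z i)) \<in> borel_measurable (?D \<Otimes>\<^sub>M ?lam)" if "i < n" for i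
  proof -
    have comp: "(\<lambda>z. snd z i) \<in> borel_measurable (?D \<Otimes>\<^sub>M ?lam)"
      using measurable_compose[OF measurable_snd measurable_component_singleton, of i "{..<n}" ?D "\<lambda>_. lborel :: real measure"] that by simp
    have "(\<lambda>z. fst z k) \<in> borel_measurable (?D \<Otimes>\<^sub>M ?lam)" if "k < 2 ^ L" for k
      using measurable_compose[OF measurable_fst, of "\<lambda>h. h k" borel ?D ?lam] that by simp
    then show ?thesis
      unfolding histogram_def
      by (intro borel_measurable_times borel_measurable_const borel_measurable_sum measurable_compose[OF comp borel_measurable_indicator]) auto
  qed
  have W_m[measurable]: "W \<in> borel_measurable (?D \<Otimes>\<^sub>M ?lam)"
    unfolding W_def case_prod_beta' by (intro borel_measurable_prod_ennreal measurable_compose[OF W1 measurable_ennreal]) auto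
  have map_m: "(\<lambda>(h, x). (histogram L h, x)) \<in> (?D \<Otimes>\<^sub>M ?lam) \<rightarrow>\<^sub>M (L2_borel \<Otimes>\<^sub>M data_space n)"
  proof -
    have "(\<lambda>z. histogram L (fst z)) \<in> (?D \<Otimes>\<^sub>M ?lam) \<rightarrow>\<^sub>M L2_borel"
      by (rule measurable_compose[OF measurable_fst]) simp
    moreover have "snd \<in> (?D \<Otimes>\<^sub>M ?lam) \<rightarrow>\<^sub>M data_space n"
      using measurable_snd[of ?D ?lam] measurable_cong_sets[OF refl sets_PiM_lborel] by blast
    ultimately show ?thesis unfolding case_prod_beta' by measurable
  qed
  \<comment> \<open>The factorisation of the joint law on the cell, applied once with the indicator
    of \<open>S\<close> and once with the constant \<open>1\<close> in the role of
    \<open>F\<close>.\<close>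
  have J_int: "(\<integral>\<^sup>+z. F (fst z) * G (snd z) \<partial>J) = A * (\<integral>\<^sup>+g. F (histogram L (normalize ?N g)) \<partial>erlang_product ?N c) * (\<integral>\<^sup>+x. G x \<partial>?lam)"
    if F[measurable]: "F \<in> borel_measurable L2_borel" and G: "G \<in> borel_measurable (data_space n)" and GB: "\<And>x. x \<notin> B \<Longrightarrow> G x = 0" for F G
  proof -
    have Gl[measurable]: "G \<in> borel_measurable ?lam" using G measurable_cong_sets[OF sets_PiM_lborel refl] by blast
    have FG: "(\<lambda>z. F (fst z) * G (snd z)) \<in> borel_measurable (L2_borel \<Otimes>\<^sub>M data_space n)"
      using F G by measurable
    have FG': "(\<lambda>z. F (histogram L (fst z)) * G (snd z)) \<in> borel_measurable (?D \<Otimes>\<^sub>M ?lam)"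
      using measurable_compose[OF map_m FG] by (simp add: case_prod_beta')
    have "(\<integral>\<^sup>+z. F (fst z) * G (snd z) \<partial>J) = (\<integral>\<^sup>+z. F (histogram L (fst z)) * G (snd z) \<partial>density (?D \<Otimes>\<^sub>M ?lam) W)"
      unfolding J_def histogram_model_def W_def
      using map_m FG by (subst nn_integral_distr) (simp_all add: case_prod_beta')
    also have "\<dots> = (\<integral>\<^sup>+z. W z * (F (histogram L (fst z)) * G (snd z)) \<partial>(?D \<Otimes>\<^sub>M ?lam))"
      by (rule nn_integral_density[OF W_m FG'])
    also have "\<dots> = (\<integral>\<^sup>+h. \<integral>\<^sup>+x. W (h, x) * (F (histogram L h) * G x) \<partial>?lam \<partial>?D)"
      using lam.nn_integral_fst[of "\<lambda>z. W z * (F (histogram L (fst z)) * G (snd z))" ?D] FG' W_m by simp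
    also have "\<dots> = (\<integral>\<^sup>+h. (F (histogram L h) * ennreal (\<Prod>i<?N. h i ^ c i)) * (ennreal ((2 ^ L) ^ n) * (\<integral>\<^sup>+x. G x \<partial>?lam)) \<partial>?D)"
    proof (rule nn_integral_cong_AE)
      have "AE h in ?D. \<forall>i<?N. 0 < h i" unfolding m by (rule dirichlet_1_pos)
      then show "AE h in ?D. (\<integral>\<^sup>+x. W (h, x) * (F (histogram L h) * G x) \<partial>?lam) =
         (F (histogram L h) * ennreal (\<Prod>i<?N. h i ^ c i)) * (ennreal ((2 ^ L) ^ n) * (\<integral>\<^sup>+x. G x \<partial>?lam))"
      proof eventually_elim
        case (elim h)
        have W: "W (h, x) = ennreal ((2 ^ L) ^ n) * ennreal (\<Prod>i<?N. h i ^ c i)" if "x \<in> B" for x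
        proof -
          have hx: "histogram L h (x i) = 2 ^ L * h (b i)" if i: "i < n" for i
          proof -
            have bi: "b i < 2 ^ L" using b i by auto
            have xi: "x i \<in> dyadic_bin L (b i)" using \<open>x \<in> B\<close> i unfolding B_def by (auto dest: PiE_mem)
            then have "x i \<in> {0..1}" using dyadic_bin_subset[OF bi] by blast
            then show ?thesis using xi mem_dyadic_bin_iff[of "x i" L "b i"] histogram_bin[of "x i" L h] by auto
          qed
          have "W (h, x) = (\<Prod>i<n. ennreal (2 ^ L * h (b i)))"
            unfolding W_def using hx by simp
          also have "\<dots> = ennreal (\<Prod>i<n. 2 ^ L * h (b i))"
            by (rule prod_ennreal) (use elim b in \<open>auto simp: less_imp_le Pi_def\<close>)
          also have "(\<Prod>i<n. 2 ^ L * h (b i)) = (2 ^ L) ^ n * (\<Prod>i<?N. h i ^ c i)"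
            by (simp add: prod.distrib prod_group_count[OF b] c_def)
          also have "ennreal \<dots> = ennreal ((2 ^ L) ^ n) * ennreal (\<Prod>i<?N. h i ^ c i)"
            by (rule ennreal_mult') simp
          finally show ?thesis .
        qed
        have "(\<integral>\<^sup>+x. W (h, x) * (F (histogram L h) * G x) \<partial>?lam) =
            (\<integral>\<^sup>+x. (ennreal ((2 ^ L) ^ n) * ennreal (\<Prod>i<?N. h i ^ c i) * F (histogram L h)) * G x \<partial>?lam)"
        proof (rule nn_integral_cong)
          fix x
          show "W (h, x) * (F (histogram L h) * G x) = (ennreal ((2 ^ L) ^ n) * ennreal (\<Prod>i<?N. h i ^ c i) * F (histogram L h)) * G x"
            using W[of x] GB[of x] by (cases "x \<in> B") (simp_all add: mult.assoc)
        qed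
        also have "\<dots> = (ennreal ((2 ^ L) ^ n) * ennreal (\<Prod>i<?N. h i ^ c i) * F (histogram L h)) * (\<integral>\<^sup>+x. G x \<partial>?lam)"
          by (rule nn_integral_cmult) measurable
        finally show ?case by (simp add: mult_ac)
      qed
    qed
    also have "\<dots> = (\<integral>\<^sup>+h. F (histogram L h) * ennreal (\<Prod>i<?N. h i ^ c i) \<partial>?D) * (ennreal ((2 ^ L) ^ n) * (\<integral>\<^sup>+x. G x \<partial>?lam))"
      by (rule nn_integral_multc) measurable
    also have "(\<integral>\<^sup>+h. F (histogram L h) * ennreal (\<Prod>i<?N. h i ^ c i) \<partial>?D) = ennreal \<kappa> * (\<integral>\<^sup>+g. F (histogram L (normalize ?N g)) \<partial>erlang_product ?N c)"
      by (rule \<kappa>g) measurable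
    finally show ?thesis by (simp add: A_def mult_ac)
  qed
  have J_sets: "sets J = sets (L2_borel \<Otimes>\<^sub>M data_space n)" by (simp add: J_def histogram_model_def)
  have key: "Q * emeasure ?lam T = (\<integral>\<^sup>+y. emeasure (K y) S * indicator T y \<partial>?lam)" if T: "T \<in> sets (data_space n)" "T \<subseteq> B" for T
  proof -
    have ST: "S \<times> T \<in> sets J" unfolding J_sets using S T by auto
    have "emeasure J (S \<times> T) = (\<integral>\<^sup>+z. indicator S (fst z) * indicator T (snd z) \<partial>J)"
      unfolding nn_integral_indicator[OF ST, symmetric] by (rule nn_integral_cong) (auto simp: indicator_def)
    also have "\<dots> = A * (\<integral>\<^sup>+g. indicator S (histogram L (normalize ?N g)) \<partial>erlang_product ?N c) * (\<integral>\<^sup>+x. indicator T x \<partial>?lam)"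
      by (rule J_int) (use T in \<open>auto simp: indicator_def\<close>)
    also have "(\<integral>\<^sup>+g. indicator S (histogram L (normalize ?N g)) \<partial>erlang_product ?N c) = Q"
    proof -
      have hs: "{g \<in> space (erlang_product ?N c). histogram L (normalize ?N g) \<in> S} \<in> sets (erlang_product ?N c)" by measurable
      show ?thesis unfolding Q_def nn_integral_indicator[OF hs, symmetric]
        by (rule nn_integral_cong) (auto simp: indicator_def)
    qed
    also have "(\<integral>\<^sup>+x. indicator T x \<partial>?lam) = emeasure ?lam T"
      using T by (intro nn_integral_indicator) (simp add: sets_PiM_lborel)
    finally have 1: "emeasure J (S \<times> T) = A * Q * emeasure ?lam T" .
    have sndm: "snd \<in> J \<rightarrow>\<^sub>M data_space n"
      using measurable_snd[of L2_borel "data_space n"] measurable_cong_sets[OF J_sets refl] by blast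
    have "emeasure J (S \<times> T) = (\<integral>\<^sup>+z. 1 * (emeasure (K (snd z)) S * indicator T (snd z)) \<partial>J)"
      unfolding KJ[OF T(1)] using KS T(1) by (subst nn_integral_distr[OF sndm]) auto
    also have "\<dots> = A * (\<integral>\<^sup>+g. 1 \<partial>erlang_product ?N c) * (\<integral>\<^sup>+y. emeasure (K y) S * indicator T y \<partial>?lam)"
      by (rule J_int[of "\<lambda>_. 1"]) (use T KS in \<open>auto simp: indicator_def\<close>)
    also have "(\<integral>\<^sup>+g. 1 \<partial>erlang_product ?N c) = 1" using E.emeasure_space_1 by simp
    finally have 2: "emeasure J (S \<times> T) = A * (\<integral>\<^sup>+y. emeasure (K y) S * indicator T y \<partial>?lam)" by simp
    from 1 2 have "A * (Q * emeasure ?lam T) = A * (\<integral>\<^sup>+y. emeasure (K y) S * indicator T y \<partial>?lam)" by (simp add: mult.assoc)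
    then show ?thesis using A by (simp add: ennreal_mult_cancel_left)
  qed
  \<comment> \<open>Equal integrals over all measurable subsets of the cell mean equal densities,
    and sigma-finiteness makes these equal almost everywhere.\<close>
  have "density ?lam (\<lambda>y. indicator B y * emeasure (K y) S) = density ?lam (\<lambda>y. indicator B y * Q)"
  proof (rule measure_eqI)
    fix T assume "T \<in> sets (density ?lam (\<lambda>y. indicator B y * emeasure (K y) S))"
    then have T[measurable]: "T \<in> sets ?lam" by simp
    have TB: "T \<inter> B \<in> sets (data_space n)" using T Bm by (auto simp: sets_PiM_lborel)
    have "emeasure (density ?lam (\<lambda>y. indicator B y * emeasure (K y) S)) T = (\<integral>\<^sup>+y. emeasure (K y) S * indicator (T \<inter> B) y \<partial>?lam)"
      by (subst emeasure_density) (auto intro!: nn_integral_cong simp: indicator_def)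
    also have "\<dots> = Q * emeasure ?lam (T \<inter> B)" using key[OF TB] by simp
    also have "\<dots> = (\<integral>\<^sup>+y. Q * indicator (T \<inter> B) y \<partial>?lam)" by (rule nn_integral_cmult_indicator[symmetric]) measurable
    also have "\<dots> = emeasure (density ?lam (\<lambda>y. indicator B y * Q)) T"
      by (subst emeasure_density) (auto intro!: nn_integral_cong simp: indicator_def)
    finally show "emeasure (density ?lam (\<lambda>y. indicator B y * emeasure (K y) S)) T = emeasure (density ?lam (\<lambda>y. indicator B y * Q)) T" .
  qed simp
  then have "AE y in ?lam. indicator B y * emeasure (K y) S = indicator B y * Q"
    by (intro lam.density_unique) measurable
  then show ?thesis
    unfolding Q_def[symmetric] B_def[symmetric] by eventually_elim auto
qed

definition bin_count :: "nat \<Rightarrow> nat \<Rightarrow> (nat \<Rightarrow> real) \<Rightarrow> nat \<Rightarrow> nat" where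
  "bin_count L n x j = card {i \<in> {..<n}. bin_of L (x i) = j}"

text \<open>The identification has an exceptional null set for each measurable set, whereas a
  credible set varies with the sample. Coding it by \<open>e x\<close> in a countable
  \<open>E\<close>, together with the finitely many bin patterns, leaves countably many null
  sets.\<close>

lemma posterior_AE:
  assumes post: "is_posterior L n K" and E: "countable E" and S: "\<And>e. e \<in> E \<Longrightarrow> S e \<in> sets L2_borel" and e: "\<And>x. e x \<in> E"
  shows "AE x in (\<Pi>\<^sub>M i\<in>{..<n}. lborel). (\<forall>i<n. x i \<in> {0..1}) \<longrightarrow>
     emeasure (K x) (S (e x)) = emeasure (erlang_product (2 ^ L) (bin_count L n x))
        {g \<in> space (erlang_product (2 ^ L) (bin_count L n x)). histogram L (normalize (2 ^ L) g) \<in> S (e x)}"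
proof -
  let ?P = "\<lambda>c S. emeasure (erlang_product (2 ^ L) c) {g \<in> space (erlang_product (2 ^ L) c). histogram L (normalize (2 ^ L) g) \<in> S}"
  have "AE x in (\<Pi>\<^sub>M i\<in>{..<n}. lborel). \<forall>z \<in> (\<Pi>\<^sub>E i\<in>{..<n}. {..<2 ^ L}) \<times> E.
     x \<in> (\<Pi>\<^sub>E i\<in>{..<n}. dyadic_bin L (fst z i)) \<longrightarrow> emeasure (K x) (S (snd z)) = ?P (\<lambda>j. card {i \<in> {..<n}. fst z i = j}) (S (snd z))"
  proof (subst AE_ball_countable)
    show "countable ((\<Pi>\<^sub>E i\<in>{..<n}. {..<(2::nat) ^ L}) \<times> E)"
      by (intro countable_SIGMA countable_PiE E) auto
    show "\<forall>z\<in>(\<Pi>\<^sub>E i\<in>{..<n}. {..<2 ^ L}) \<times> E. AE x in (\<Pi>\<^sub>M i\<in>{..<n}. lborel). 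
       x \<in> (\<Pi>\<^sub>E i\<in>{..<n}. dyadic_bin L (fst z i)) \<longrightarrow> emeasure (K x) (S (snd z)) = ?P (\<lambda>j. card {i \<in> {..<n}. fst z i = j}) (S (snd z))"
      using posterior_on_cell[OF post S] by (auto simp: PiE_def)
  qed
  moreover have "AE x in (\<Pi>\<^sub>M i\<in>{..<n}. lborel :: real measure). x \<in> (\<Pi>\<^sub>E i\<in>{..<n}. UNIV)"
    by (rule AE_I2) (simp add: space_PiM)
  ultimately show ?thesis
  proof eventually_elim
    case (elim x)
    show ?case
    proof
      assume x: "\<forall>i<n. x i \<in> {0..1}"
      define b where "b = (\<lambda>i\<in>{..<n}. bin_of L (x i))"
      have "b \<in> (\<Pi>\<^sub>E i\<in>{..<n}. {..<2 ^ L})" unfolding b_def using x bin_of_less by auto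
      moreover have "x \<in> (\<Pi>\<^sub>E i\<in>{..<n}. dyadic_bin L (b i))"
        using elim(2) x mem_dyadic_bin_iff by (auto simp: b_def PiE_def)
      moreover have "(\<lambda>j. card {i \<in> {..<n}. b i = j}) = bin_count L n x"
        unfolding bin_count_def b_def by (intro ext arg_cong[of _ _ card]) auto
      ultimately show "emeasure (K x) (S (e x)) = ?P (bin_count L n x) (S (e x))"
        using elim(1)[rule_format, of "(b, e x)"] e by auto
    qed
  qed
qed

section \<open>Supremum norm bounds from Haar coefficients\<close>

text \<open>Nonnegative weights that are constant on bins preserve the sign of the bin integrals;
  indicators of unions of bins are the case of interest.\<close>

lemma bin_integral_sum:
  fixes g :: "real \<Rightarrow> real"
  assumes g: "integrable unit_leb g" and c: "\<And>j. 0 \<le> c j" "\<And>j. c j \<le> 1"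
    and neg: "\<And>j. j < 2 ^ m \<Longrightarrow> (LINT x|unit_leb. indicator (dyadic_bin m j) x * g x) \<le> 0"
  shows "(LINT x|unit_leb. c (bin_of m x) * g x) \<le> 0" 
    and "(\<lambda>x. c (bin_of m x) * g x) \<in> borel_measurable unit_leb"
proof -
  have gm[measurable]: "g \<in> borel_measurable unit_leb" using g by simp
  have ind[measurable]: "(indicator (dyadic_bin m j) :: real \<Rightarrow> real) \<in> borel_measurable unit_leb" for j
    by (rule measurable_unit_leb) measurable
  have ig: "integrable unit_leb (\<lambda>x. indicator (dyadic_bin m k) x * g x)" for k
  proof (rule Bochner_Integration.integrable_bound[OF g])
    show "(\<lambda>x. indicator (dyadic_bin m k) x * g x) \<in> borel_measurable unit_leb" by measurable
  qed (auto simp: indicator_def)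
  have eq: "c (bin_of m x) * g x = (\<Sum>j<2 ^ m. c j * (indicator (dyadic_bin m j) x * g x))" if "x \<in> space unit_leb" for x
  proof -
    have x: "0 \<le> x" "x \<le> 1" using that by (auto simp: space_restrict_space)
    have "(\<Sum>j<2 ^ m. c j * (indicator (dyadic_bin m j) x * g x)) = (\<Sum>j<2 ^ m. if bin_of m x = j then c j * g x else 0)"
      using x by (intro sum.cong) (auto simp: mem_dyadic_bin_iff indicator_def)
    also have "\<dots> = c (bin_of m x) * g x" using bin_of_less[OF x(2), of m] by (simp add: sum.delta)
    finally show ?thesis ..
  qed
  have "(LINT x|unit_leb. c (bin_of m x) * g x) = (LINT x|unit_leb. (\<Sum>j<2 ^ m. c j * (indicator (dyadic_bin m j) x * g x)))"
    by (rule Bochner_Integration.integral_cong) (use eq in auto)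
  also have "\<dots> = (\<Sum>j<2 ^ m. LINT x|unit_leb. c j * (indicator (dyadic_bin m j) x * g x))"
    by (rule Bochner_Integration.integral_sum) (use ig in simp)
  also have "\<dots> = (\<Sum>j<2 ^ m. c j * (LINT x|unit_leb. indicator (dyadic_bin m j) x * g x))" by simp
  also have "\<dots> \<le> 0" using c neg by (intro sum_nonpos mult_nonneg_nonpos) auto
  finally show "(LINT x|unit_leb. c (bin_of m x) * g x) \<le> 0" .
  have "(\<lambda>x. \<Sum>j<2 ^ m. c j * (indicator (dyadic_bin m j) x * g x)) \<in> borel_measurable unit_leb" by measurable
  then show "(\<lambda>x. c (bin_of m x) * g x) \<in> borel_measurable unit_leb"
    using eq by (subst measurable_cong) auto
qed

text \<open>The sign passes from bins to open sets by exhausting them with bins, then to Borel sets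
  by outer regularity, and is finally applied to the set where \<open>g\<close> is positive. It
  replaces a differentiation theorem for the bin averages.\<close>

lemma AE_nonpos_of_bins:
  fixes g :: "real \<Rightarrow> real"
  assumes g: "integrable unit_leb g"
    and neg: "\<And>m j. j < 2 ^ m \<Longrightarrow> (LINT x|unit_leb. indicator (dyadic_bin m j) x * g x) \<le> 0"
  shows "AE x in unit_leb. g x \<le> 0"
proof -
  have gm[measurable]: "g \<in> borel_measurable unit_leb" using g by simp
  have ind_m: "(\<lambda>x. indicator U x * g x) \<in> borel_measurable unit_leb" if "U \<in> sets borel" for U
    by (rule borel_measurable_times[OF measurable_unit_leb gm]) (use that in measurable)
  have int_dom: "(\<lambda>k. LINT x|unit_leb. s k x * g x) \<longlonglongrightarrow> (LINT x|unit_leb. t x * g x)"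
    if "\<And>k. (\<lambda>x. s k x * g x) \<in> borel_measurable unit_leb" "(\<lambda>x. t x * g x) \<in> borel_measurable unit_leb"
      "\<And>k x. \<bar>s k x\<bar> \<le> 1" "\<And>x. x \<in> {0<..1} \<Longrightarrow> (\<lambda>k. s k x) \<longlonglongrightarrow> t x" for s t
  proof (rule integral_dominated_convergence[where w="\<lambda>x. \<bar>g x\<bar>"])
    show "AE x in unit_leb. (\<lambda>k. s k x * g x) \<longlonglongrightarrow> t x * g x"
      using AE_unit_leb_pos by eventually_elim (intro tendsto_mult tendsto_const that(4), simp)
    show "AE x in unit_leb. norm (s k x * g x) \<le> \<bar>g x\<bar>" for k
      using mult_right_mono[OF that(3)[of k]] by (auto simp: abs_mult)
  qed (use that g in auto)
  have open_le: "(LINT x|unit_leb. indicator U x * g x) \<le> 0" if U: "open U" for U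
  proof (rule LIMSEQ_le_const2)
    \<comment> \<open>The weight selects the bins contained in \<open>U\<close>. The bin of a fixed
      point shrinks to it, so the weights converge pointwise to the indicator of
      \<open>U\<close>.\<close>
    let ?c = "\<lambda>m j. of_bool (dyadic_bin m j \<subseteq> U) :: real"
    show "(\<lambda>m. LINT x|unit_leb. ?c m (bin_of m x) * g x) \<longlonglongrightarrow> (LINT x|unit_leb. indicator U x * g x)"
    proof (rule int_dom)
      show "(\<lambda>x. ?c m (bin_of m x) * g x) \<in> borel_measurable unit_leb" for m
        by (rule bin_integral_sum(2)[OF g _ _ neg]) auto
      show "(\<lambda>x. indicator U x * g x) \<in> borel_measurable unit_leb" using U by (intro ind_m) auto
      fix x :: real assume x: "x \<in> {0<..1}"
      have mem: "x \<in> dyadic_bin m (bin_of m x)" for m using x mem_dyadic_bin_iff by auto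
      show "(\<lambda>m. ?c m (bin_of m x)) \<longlonglongrightarrow> indicator U x"
      proof (cases "x \<in> U")
        case False
        then have "\<not> dyadic_bin m (bin_of m x) \<subseteq> U" for m using mem by blast
        then show ?thesis using False by simp
      next
        case True
        then obtain e where e: "e > 0" "ball x e \<subseteq> U" using U by (auto simp: open_contains_ball)
        have "(\<lambda>m. 1 / 2 ^ m :: real) \<longlonglongrightarrow> 0" by real_asymp
        then have "\<forall>\<^sub>F m in sequentially. (1 / 2 ^ m :: real) < e" using e by (intro order_tendstoD) auto
        then have "\<forall>\<^sub>F m in sequentially. ?c m (bin_of m x) = indicator U x"
        proof eventually_elim
          case (elim m)
          have "dist x y \<le> 1 / 2 ^ m" if "y \<in> dyadic_bin m (bin_of m x)" for y
            using that mem[of m] by (auto simp: dyadic_bin_def dist_real_def add_divide_distrib abs_le_iff split: if_splits)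
          then have *: "dyadic_bin m (bin_of m x) \<subseteq> ball x e" using elim by (meson le_less_trans mem_ball subsetI)
          then have "dyadic_bin m (bin_of m x) \<subseteq> U" using e(2) by (rule subset_trans)
          then show ?case using True by simp
        qed
        then show ?thesis by (rule tendsto_eventually)
      qed
    qed auto
    show "\<exists>N. \<forall>m\<ge>N. (LINT x|unit_leb. ?c m (bin_of m x) * g x) \<le> 0"
      by (intro exI allI impI bin_integral_sum(1)[OF g _ _ neg]) auto
  qed
  have borel_le: "(LINT x|unit_leb. indicator A x * g x) \<le> 0" if A: "A \<in> sets borel" for A
  proof -
    have "\<exists>U. open U \<and> A \<subseteq> U \<and> emeasure lborel (U - A) < ennreal (1 / 2 ^ k)" for k :: nat
    proof -
      have "0 < (1 / 2 ^ k :: real)" by simp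
      then obtain U where "open U" "A \<subseteq> U" "emeasure lborel (U - A) < ennreal (1 / 2 ^ k)"
        by (rule outer_regular_lborel[OF A])
      then show ?thesis by (intro exI conjI)
    qed
    then obtain U where U: "\<And>k. open (U k)" "\<And>k. A \<subseteq> U k" "\<And>k. emeasure lborel (U k - A) < ennreal (1 / 2 ^ k)"
      using choice[of "\<lambda>k U. open U \<and> A \<subseteq> U \<and> emeasure lborel (U - A) < ennreal (1 / 2 ^ k)"] by blast
    \<comment> \<open>Finite intersections keep the approximating sets open and make them decrease
      to \<open>W\<close>, which contains \<open>A\<close> and differs from it by a null
      set.\<close>
    define V where "V k = (\<Inter>i\<le>k. U i)" for k
    define W where "W = (\<Inter>i. U i)"
    have V: "open (V k)" for k unfolding V_def using U by (intro open_INT) auto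
    have W_m[measurable]: "W \<in> sets borel" unfolding W_def using U by (intro sets.countable_INT) auto
    have lim: "(\<lambda>k. indicator (V k) x :: real) \<longlonglongrightarrow> indicator W x" for x
    proof (cases "x \<in> W")
      case True
      then show ?thesis by (auto simp: V_def W_def)
    next
      case False
      then obtain i where "x \<notin> U i" by (auto simp: W_def)
      then have "\<forall>\<^sub>F k in sequentially. (indicator (V k) x :: real) = indicator W x"
        using False by (auto intro!: eventually_sequentiallyI[of i] simp: V_def indicator_def)
      then show ?thesis by (rule tendsto_eventually)
    qed
    have "(\<lambda>k. LINT x|unit_leb. indicator (V k) x * g x) \<longlonglongrightarrow> (LINT x|unit_leb. indicator W x * g x)"
    proof (rule int_dom)
      show "(\<lambda>x. indicator (V k) x * g x) \<in> borel_measurable unit_leb" for k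
        using V[of k] by (intro ind_m) simp
      show "(\<lambda>x. indicator W x * g x) \<in> borel_measurable unit_leb" by (intro ind_m W_m)
    qed (use lim in \<open>simp_all add: indicator_def\<close>)
    then have W_le: "(LINT x|unit_leb. indicator W x * g x) \<le> 0"
      by (rule LIMSEQ_le_const2) (use open_le[OF V] in auto)
    have "emeasure lborel (W - A) \<le> ennreal (1 / 2 ^ k)" for k
    proof -
      have "emeasure lborel (W - A) \<le> emeasure lborel (U k - A)"
        using A U(1) by (intro emeasure_mono) (auto simp: W_def)
      then show ?thesis using U(3)[of k] by (auto intro: order_trans less_imp_le)
    qed
    then have "emeasure lborel (W - A) = 0"
    proof -
      assume le: "\<And>k. emeasure lborel (W - A) \<le> ennreal (1 / 2 ^ k)"
      have "(\<lambda>k. ennreal (1 / 2 ^ k)) \<longlonglongrightarrow> ennreal 0" by (intro tendsto_ennrealI) real_asymp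
      then have "emeasure lborel (W - A) \<le> ennreal 0"
        by (rule LIMSEQ_le_const) (use le in auto)
      then show ?thesis by simp
    qed
    then have "AE x in lborel. x \<notin> W - A" using A by (intro AE_not_in) (auto simp: null_sets_def)
    then have "AE x in lborel. x \<in> {0..1} \<longrightarrow> x \<notin> W - A" by eventually_elim auto
    then have ae: "AE x in unit_leb. x \<notin> W - A" by (subst AE_restrict_space_iff) auto
    have "(LINT x|unit_leb. indicator A x * g x) = (LINT x|unit_leb. indicator W x * g x)"
    proof (rule integral_cong_AE[OF ind_m[OF A] ind_m[OF W_m]])
      show "AE x in unit_leb. indicator A x * g x = indicator W x * g x"
        using ae by eventually_elim (use U(2) in \<open>auto simp: indicator_def W_def\<close>)
    qed
    then show ?thesis using W_le by simp
  qed
  define A where "A = {x \<in> space unit_leb. 0 < g x}"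
  have A: "A \<in> sets borel"
  proof -
    have "A \<in> sets unit_leb" unfolding A_def by measurable
    then show ?thesis by (auto simp: sets_restrict_space)
  qed
  have ii: "integrable unit_leb (\<lambda>x. indicator A x * g x)"
    by (rule Bochner_Integration.integrable_bound[OF g ind_m[OF A]]) (auto simp: indicator_def)
  have nn: "0 \<le> indicator A x * g x" for x by (auto simp: A_def indicator_def)
  have "(LINT x|unit_leb. indicator A x * g x) = 0"
    using borel_le[OF A] nn by (intro antisym Bochner_Integration.integral_nonneg) auto
  then have "AE x in unit_leb. indicator A x * g x = 0"
    using nn by (subst (asm) integral_nonneg_eq_0_iff_AE[OF ii]) auto
  then show ?thesis
    using AE_space by eventually_elim (auto simp: A_def indicator_def split: if_splits)
qed

section \<open>Bin averages as telescoping sums of Haar coefficients\<close>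

definition bin_average :: "(real \<Rightarrow> real) \<Rightarrow> nat \<Rightarrow> nat \<Rightarrow> real" where
  "bin_average h m j = 2 ^ m * (LINT x|unit_leb. indicator (dyadic_bin m j) x * h x)"

lemma integrable_bin_mult:
  assumes h: "integrable unit_leb (h :: real \<Rightarrow> real)"
  shows "integrable unit_leb (\<lambda>x. indicator (dyadic_bin m k) x * h x)"
proof (rule Bochner_Integration.integrable_bound[OF h])
  have [measurable]: "h \<in> borel_measurable unit_leb" using h by simp
  show "(\<lambda>x. indicator (dyadic_bin m k) x * h x) \<in> borel_measurable unit_leb"
    by (rule borel_measurable_times[OF measurable_unit_leb]) measurable
qed (auto simp: indicator_def)

text \<open>One martingale step: passing from a bin to its left or right half changes the average by
  plus or minus the Haar coefficient of that bin, scaled by \<open>2 powr (m / 2)\<close>.\<close>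

lemma bin_average_split:
  assumes h: "integrable unit_leb h" and j: "j < 2 ^ m"
  shows "bin_average h m j = (bin_average h (Suc m) (2 * j) + bin_average h (Suc m) (2 * j + 1)) / 2"
    and "2 powr (m / 2) * inner_L2 h (haar (int m) j) = (bin_average h (Suc m) (2 * j) - bin_average h (Suc m) (2 * j + 1)) / 2"
proof -
  have hm[measurable]: "h \<in> borel_measurable unit_leb" using h by simp
  note int = integrable_bin_mult[OF h]
  have ind: "indicator (dyadic_bin m j) x = (indicator (dyadic_bin (Suc m) (2 * j)) x + indicator (dyadic_bin (Suc m) (2 * j + 1)) x :: real)"
    if "0 < x" "x \<le> 1" for x
  proof -
    have "bin_of m x = j \<longleftrightarrow> bin_of (Suc m) x = 2 * j \<or> bin_of (Suc m) x = 2 * j + 1"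
    proof -
      define b where "b = bin_of (Suc m) x"
      have "bin_of m x = b div 2" using bin_of_Suc_div[OF that, of m] by (simp only: b_def)
      then show ?thesis unfolding b_def[symmetric] by presburger
    qed
    then show ?thesis using that by (auto simp: indicator_def mem_dyadic_bin_iff)
  qed
  have hind: "haar (int m) j x = 2 powr (m / 2) * (indicator (dyadic_bin (Suc m) (2 * j)) x - indicator (dyadic_bin (Suc m) (2 * j + 1)) x)"
    if "0 < x" "x \<le> 1" for x
    using haar_bin[of "int m" "Suc m" x j] haar_bin_value[of "int m" "Suc m" j "bin_of (Suc m) x"] that
    by (auto simp: indicator_def mem_dyadic_bin_iff)
  have "(LINT x|unit_leb. indicator (dyadic_bin m j) x * h x) =
     (LINT x|unit_leb. indicator (dyadic_bin (Suc m) (2 * j)) x * h x + indicator (dyadic_bin (Suc m) (2 * j + 1)) x * h x)"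
  proof (rule integral_cong_AE)
    show "AE x in unit_leb. indicator (dyadic_bin m j) x * h x = indicator (dyadic_bin (Suc m) (2 * j)) x * h x + indicator (dyadic_bin (Suc m) (2 * j + 1)) x * h x"
      using AE_unit_leb_pos by eventually_elim (use ind in \<open>simp add: distrib_right\<close>)
  qed (use int in auto)
  also have "\<dots> = (LINT x|unit_leb. indicator (dyadic_bin (Suc m) (2 * j)) x * h x) + (LINT x|unit_leb. indicator (dyadic_bin (Suc m) (2 * j + 1)) x * h x)"
    by (rule Bochner_Integration.integral_add[OF int int])
  finally show "bin_average h m j = (bin_average h (Suc m) (2 * j) + bin_average h (Suc m) (2 * j + 1)) / 2"
    by (simp add: bin_average_def algebra_simps)
  have "inner_L2 h (haar (int m) j) =
     (LINT x|unit_leb. 2 powr (m / 2) * (indicator (dyadic_bin (Suc m) (2 * j)) x * h x - indicator (dyadic_bin (Suc m) (2 * j + 1)) x * h x))"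
    unfolding inner_L2_def
  proof (rule integral_cong_AE)
    show "AE x in unit_leb. h x * haar (int m) j x = 2 powr (m / 2) * (indicator (dyadic_bin (Suc m) (2 * j)) x * h x - indicator (dyadic_bin (Suc m) (2 * j + 1)) x * h x)"
      using AE_unit_leb_pos by eventually_elim (subst hind, simp, simp, simp add: algebra_simps)
    show "(\<lambda>x. h x * haar (int m) j x) \<in> borel_measurable unit_leb"
      by (rule borel_measurable_times[OF hm measurable_unit_leb]) measurable
  qed (use int in auto)
  also have "\<dots> = 2 powr (m / 2) * ((LINT x|unit_leb. indicator (dyadic_bin (Suc m) (2 * j)) x * h x) - (LINT x|unit_leb. indicator (dyadic_bin (Suc m) (2 * j + 1)) x * h x))"
    using Bochner_Integration.integral_diff[OF int int, of "Suc m" "2 * j" "Suc m" "2 * j + 1"] by simp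
  finally have "2 powr (m / 2) * inner_L2 h (haar (int m) j) = (2 powr (m / 2))\<^sup>2 * ((LINT x|unit_leb. indicator (dyadic_bin (Suc m) (2 * j)) x * h x) - (LINT x|unit_leb. indicator (dyadic_bin (Suc m) (2 * j + 1)) x * h x))"
    by (simp add: power2_eq_square)
  also have "(2 powr (m / 2))\<^sup>2 = 2 ^ m" using powr_half_square[of "int m"] by simp
  finally show "2 powr (m / 2) * inner_L2 h (haar (int m) j) = (bin_average h (Suc m) (2 * j) - bin_average h (Suc m) (2 * j + 1)) / 2"
    by (simp add: bin_average_def algebra_simps)
qed

text \<open>On a given bin only one Haar function per level is nonzero, so each level contributes
  one coefficient, however many it has.\<close>

lemma abs_bin_average_le:
  assumes h: "integrable unit_leb h"
    and b: "\<And>l k. (l, k) \<in> haar_index \<Longrightarrow> \<bar>inner_L2 h (haar l k)\<bar> \<le> b l"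
  shows "j < 2 ^ m \<Longrightarrow> \<bar>bin_average h m j\<bar> \<le> b (-1) + (\<Sum>l<m. 2 powr (l / 2) * b (int l))"
proof (induction m arbitrary: j)
  case 0
  have "bin_average h 0 0 = inner_L2 h (haar (-1) 0)"
    by (simp add: bin_average_def inner_L2_def dyadic_bin_def haar_def mult.commute)
  then show ?case using 0 b[of "-1" 0] by (simp add: haar_index_def)
next
  case (Suc m)
  define i where "i = j div 2"
  have i: "i < 2 ^ m" using Suc.prems by (auto simp: i_def)
  have ji: "j = 2 * i \<or> j = 2 * i + 1" unfolding i_def by presburger
  note sp = bin_average_split[OF h i]
  have "\<bar>inner_L2 h (haar (int m) i)\<bar> \<le> b (int m)"
    using i by (intro b) (auto simp: haar_index_def)
  then have "\<bar>2 powr (m / 2) * inner_L2 h (haar (int m) i)\<bar> \<le> 2 powr (m / 2) * b (int m)"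
    by (simp add: abs_mult)
  moreover have "\<bar>bin_average h (Suc m) j\<bar> \<le> \<bar>bin_average h m i\<bar> + \<bar>2 powr (m / 2) * inner_L2 h (haar (int m) i)\<bar>"
    using ji unfolding sp by (auto simp: field_simps)
  ultimately show ?case using Suc.IH[OF i] by simp
qed

text \<open>A bound on all bin averages of \<open>h\<close> and of \<open>- h\<close> bounds the
  function almost everywhere. Convergence of the Haar series does not enter.\<close>

proposition esssup_le_haar_sum:
  assumes h: "h \<in> L2"
    and b: "\<And>l k. (l, k) \<in> haar_index \<Longrightarrow> \<bar>inner_L2 h (haar l k)\<bar> \<le> b l"
    and B: "\<And>m. b (-1) + (\<Sum>l<m. 2 powr (real l / 2) * b (int l)) \<le> B"
  shows "esssup unit_leb (\<lambda>t. ennreal \<bar>h t\<bar>) \<le> ennreal B"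
proof -
  interpret finite_measure unit_leb by (rule finite_measure_unit_leb)
  have hi: "integrable unit_leb h" by (rule L2_integrable[OF h])
  have hm[measurable]: "h \<in> borel_measurable unit_leb" using h by (simp add: L2_def)
  have neg: "(LINT x|unit_leb. indicator (dyadic_bin m j) x * (e * h x - B)) \<le> 0" if "\<bar>e\<bar> = 1" and j: "j < 2 ^ m" for e m j
  proof -
    have c: "integrable unit_leb (\<lambda>x. B)" by simp
    have "(LINT x|unit_leb. indicator (dyadic_bin m j) x * (e * h x - B))
       = (LINT x|unit_leb. e * (indicator (dyadic_bin m j) x * h x) - indicator (dyadic_bin m j) x * B)"
      by (simp add: algebra_simps)
    also have "\<dots> = e * (LINT x|unit_leb. indicator (dyadic_bin m j) x * h x) - (LINT x|unit_leb. indicator (dyadic_bin m j) x * B)"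
      using integrable_bin_mult[OF hi, of m j] integrable_bin_mult[OF c, of m j]
      by (subst Bochner_Integration.integral_diff) auto
    also have "(LINT x|unit_leb. indicator (dyadic_bin m j) x * B) = (1 / 2 ^ m) * B"
    proof -
      have "dyadic_bin m j \<inter> space unit_leb = dyadic_bin m j"
        using dyadic_bin_subset[OF j] by (auto simp: space_restrict_space)
      then show ?thesis using measure_unit_leb_bin[OF j] by simp
    qed
    also have "e * (LINT x|unit_leb. indicator (dyadic_bin m j) x * h x) = (1 / 2 ^ m) * (e * bin_average h m j)"
      by (simp add: bin_average_def)
    also have "(1 / 2 ^ m) * (e * bin_average h m j) - (1 / 2 ^ m) * B = (1 / 2 ^ m) * (e * bin_average h m j - B)"
      by (simp add: right_diff_distrib)
    also have "\<dots> \<le> 0"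
    proof (rule mult_nonneg_nonpos)
      have "e * bin_average h m j \<le> \<bar>e * bin_average h m j\<bar>" by simp
      also have "\<dots> = \<bar>bin_average h m j\<bar>" using that by (simp add: abs_mult)
      also have "\<dots> \<le> B" using abs_bin_average_le[OF hi b j] B[of m] by auto
      finally show "e * bin_average h m j - B \<le> 0" by simp
    qed simp
    finally show ?thesis .
  qed
  have "AE x in unit_leb. 1 * h x - B \<le> 0" "AE x in unit_leb. (-1) * h x - B \<le> 0"
    by (rule AE_nonpos_of_bins; use neg[of 1] neg[of "-1"] hi in simp)+
  then have "AE x in unit_leb. ennreal \<bar>h x\<bar> \<le> ennreal B"
    by eventually_elim (auto intro!: ennreal_leI)
  then show ?thesis by (intro esssup_I) measurable
qed

section \<open>Asymptotics of the resolution level\<close>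

locale resolution_rate =
  fixes \<gamma> :: real and L :: "nat \<Rightarrow> nat"
  assumes gamma: "1/2 < \<gamma>" "\<gamma> \<le> 1"
    and L_rate: "(\<lambda>n. 2 ^ L n :: real) \<in> \<Theta>(\<lambda>n. (real n / ln (real n)) powr (1 / (2 * \<gamma> + 1)))"
begin

definition "\<beta> = 1 / (2 * \<gamma> + 1)"

text \<open>Here \<open>1/2 < \<gamma>\<close> gives an exponent below \<open>1/2\<close>, so that
  the number of bins stays below the order of \<open>sqrt n\<close>.\<close>

lemma beta: "0 < \<beta>" "\<beta> < 1/2"
  using gamma by (auto simp: \<beta>_def field_simps)

lemma rate_bounds:
  obtains a b where "0 < a" "0 < b"
    "\<forall>\<^sub>F n in sequentially. a * (real n / ln (real n)) powr \<beta> \<le> 2 ^ L n \<and> 2 ^ L n \<le> b * (real n / ln (real n)) powr \<beta>"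
proof -
  have "(\<lambda>n. 2 ^ L n :: real) \<in> O(\<lambda>n. (real n / ln (real n)) powr \<beta>)" "(\<lambda>n. 2 ^ L n :: real) \<in> \<Omega>(\<lambda>n. (real n / ln (real n)) powr \<beta>)"
    using L_rate by (auto simp: \<beta>_def bigtheta_def)
  then obtain a b where ab: "b > 0" "\<forall>\<^sub>F n in sequentially. norm (2 ^ L n :: real) \<le> b * norm ((real n / ln (real n)) powr \<beta>)"
      "a > 0" "\<forall>\<^sub>F n in sequentially. norm (2 ^ L n :: real) \<ge> a * norm ((real n / ln (real n)) powr \<beta>)"
    by (auto elim!: landau_o.bigE landau_omega.bigE)
  show thesis
    by (rule that[OF ab(3,1)]) (use ab(2,4) in \<open>eventually_elim, auto\<close>)
qed

lemma L_at_top: "filterlim L at_top sequentially"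
proof -
  obtain a b where a: "0 < a" and ev: "\<forall>\<^sub>F n in sequentially. a * (real n / ln (real n)) powr \<beta> \<le> 2 ^ L n \<and> 2 ^ L n \<le> b * (real n / ln (real n)) powr \<beta>"
    by (rule rate_bounds)
  have "filterlim (\<lambda>n. a * (real n / ln (real n)) powr \<beta>) at_top sequentially"
    using a beta by real_asymp
  show ?thesis
    unfolding filterlim_at_top
  proof
    fix Z :: nat
    have "\<forall>\<^sub>F n in sequentially. 2 ^ Z \<le> a * (real n / ln (real n)) powr \<beta>"
      using \<open>filterlim (\<lambda>n. a * _ n) at_top sequentially\<close> by (auto simp: filterlim_at_top)
    with ev show "\<forall>\<^sub>F n in sequentially. Z \<le> L n"
    proof eventually_elim
      case (elim n)
      then have "(2::real) ^ Z \<le> 2 ^ L n" by linarith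
      then show ?case by simp
    qed
  qed
qed

text \<open>The total number of pseudo-observations contributed by the prior, measured against the
  scale of the fluctuations.\<close>

lemma bins_over_sqrt: "(\<lambda>n. 2 ^ L n / sqrt (real n)) \<longlonglongrightarrow> 0"
proof -
  obtain a b where b: "0 < b" and ev: "\<forall>\<^sub>F n in sequentially. a * (real n / ln (real n)) powr \<beta> \<le> 2 ^ L n \<and> 2 ^ L n \<le> b * (real n / ln (real n)) powr \<beta>"
    by (rule rate_bounds)
  show ?thesis
  proof (rule tendsto_sandwich[of "\<lambda>_. 0"])
    show "(\<lambda>n. b * (real n / ln (real n)) powr \<beta> / sqrt (real n)) \<longlonglongrightarrow> 0"
      using b beta by real_asymp
    show "\<forall>\<^sub>F n in sequentially. 2 ^ L n / sqrt (real n) \<le> b * (real n / ln (real n)) powr \<beta> / sqrt (real n)"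
      using ev by eventually_elim (auto intro: divide_right_mono)
  qed auto
qed

lemma eventually_bins_le: "0 < e \<Longrightarrow> \<forall>\<^sub>F n in sequentially. 2 ^ L n \<le> e * sqrt (real n)"
proof -
  assume "0 < e"
  then have "\<forall>\<^sub>F n in sequentially. 2 ^ L n / sqrt (real n) < e" by (intro order_tendstoD(2)[OF bins_over_sqrt])
  then show ?thesis using eventually_gt_at_top[of 0]
    by eventually_elim (simp add: divide_less_eq)
qed

lemma ln_le_level: obtains C where "0 < C" "\<forall>\<^sub>F n in sequentially. ln (real n) \<le> C * real (L n)"
proof -
  obtain a b where a: "0 < a" and ev: "\<forall>\<^sub>F n in sequentially. a * (real n / ln (real n)) powr \<beta> \<le> 2 ^ L n \<and> 2 ^ L n \<le> b * (real n / ln (real n)) powr \<beta>"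
    by (rule rate_bounds)
  \<comment> \<open>Halving the exponent absorbs the logarithm and the constant.\<close>
  have "\<forall>\<^sub>F n in sequentially. real n powr (\<beta> / 2) \<le> a * (real n / ln (real n)) powr \<beta>"
    using a beta by real_asymp
  with ev have "\<forall>\<^sub>F n in sequentially. ln (real n) \<le> (2 / \<beta> * ln 2) * real (L n)"
    using eventually_gt_at_top[of 1]
  proof eventually_elim
    case (elim n)
    then have "real n powr (\<beta> / 2) \<le> 2 ^ L n" by linarith
    then have "ln (real n powr (\<beta> / 2)) \<le> ln (2 ^ L n)" using elim by (subst ln_le_cancel_iff) auto
    then have "\<beta> / 2 * ln (real n) \<le> real (L n) * ln 2" using elim by (simp add: ln_powr ln_realpow)
    then show ?case using beta by (simp add: field_simps)
  qed
  then show thesis using beta by (intro that[of "2 / \<beta> * ln 2"]) auto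
qed

lemma level_le_ln: "\<forall>\<^sub>F n in sequentially. real (L n) \<le> ln (real n)"
  using eventually_bins_le[OF zero_less_one] eventually_gt_at_top[of 1]
proof eventually_elim
  case (elim n)
  then have "ln (2 ^ L n) \<le> ln (sqrt (real n))" by (subst ln_le_cancel_iff) auto
  then have "real (L n) * ln 2 \<le> ln (real n) / 2" using elim by (simp add: ln_realpow ln_sqrt)
  moreover have "1 / 2 \<le> ln (2::real)" using ln_2_less_1 ln2_ge_two_thirds by simp
  then have "real (L n) * (1 / 2) \<le> real (L n) * ln 2" by (intro mult_left_mono) auto
  ultimately show ?case by linarith
qed

text \<open>The exponents balance: \<open>\<beta> * (\<gamma> + 1/2) = 1/2\<close>, so the bias at
  the top level, scaled by \<open>sqrt n\<close>, is of order \<open>sqrt (ln n)\<close>, and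
  \<open>ln n\<close> is at most a multiple of \<open>L n\<close>.\<close>

lemma bias_bound: obtains C where "0 < C"
  "\<forall>\<^sub>F n in sequentially. sqrt (real n) * 2 powr (- real (L n) * (\<gamma> + 1/2)) \<le> C * sqrt (real (L n))"
proof -
  obtain a b where a: "0 < a" and ev: "\<forall>\<^sub>F n in sequentially. a * (real n / ln (real n)) powr \<beta> \<le> 2 ^ L n \<and> 2 ^ L n \<le> b * (real n / ln (real n)) powr \<beta>"
    by (rule rate_bounds)
  obtain C where C: "0 < C" and evC: "\<forall>\<^sub>F n in sequentially. ln (real n) \<le> C * real (L n)" by (rule ln_le_level)
  let ?p = "- (\<gamma> + 1/2)"
  have bp: "\<beta> * ?p = - (1 / 2)" "\<beta> * (- \<gamma> - 1 / 2) = - (1 / 2)" using gamma by (simp_all add: \<beta>_def field_simps)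
  have "\<forall>\<^sub>F n in sequentially. sqrt (real n) * 2 powr (- real (L n) * (\<gamma> + 1/2)) \<le> (a powr ?p * sqrt C) * sqrt (real (L n))"
    using ev evC eventually_gt_at_top[of 2]
  proof eventually_elim
    case (elim n)
    have ln: "0 < ln (real n)" "0 < real n / ln (real n)" using elim by auto
    have "2 powr (- real (L n) * (\<gamma> + 1/2)) = (2 ^ L n) powr ?p"
      by (simp add: powr_realpow[symmetric] powr_powr algebra_simps)
    also have "\<dots> \<le> (a * (real n / ln (real n)) powr \<beta>) powr ?p"
      using elim a ln gamma by (intro powr_mono2') auto
    also have "\<dots> = a powr ?p * (real n / ln (real n)) powr (- (1/2))"
      using a ln by (simp add: powr_mult powr_powr bp)
    also have "(real n / ln (real n)) powr (- (1/2)) = sqrt (ln (real n)) / sqrt (real n)"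
      using ln by (simp add: powr_minus powr_half_sqrt real_sqrt_divide field_simps)
    finally have "sqrt (real n) * 2 powr (- real (L n) * (\<gamma> + 1/2)) \<le> sqrt (real n) * (a powr ?p * (sqrt (ln (real n)) / sqrt (real n)))"
      by (intro mult_left_mono) auto
    also have "\<dots> = a powr ?p * sqrt (ln (real n))" using elim by simp
    also have "\<dots> \<le> a powr ?p * sqrt (C * real (L n))"
      using elim by (intro mult_left_mono) auto
    finally show ?case by (simp add: real_sqrt_mult)
  qed
  then show thesis using a C by (intro that[of "a powr ?p * sqrt C"]) auto
qed

text \<open>The exponents combine as
  \<open>1/2 - \<beta> / 2 = \<gamma> / (2 * \<gamma> + 1)\<close>; the remaining logarithm is
  matched by the bound of \<open>L n\<close> by \<open>ln n\<close>.\<close>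

lemma stochastic_rate: obtains C where "0 < C"
  "\<forall>\<^sub>F n in sequentially. 2 powr (real (L n) / 2) * sqrt (real (L n)) / sqrt (real n) \<le> C * (ln (real n) / real n) powr (\<gamma> / (2 * \<gamma> + 1))"
proof -
  obtain a b where b: "0 < b" and ev: "\<forall>\<^sub>F n in sequentially. a * (real n / ln (real n)) powr \<beta> \<le> 2 ^ L n \<and> 2 ^ L n \<le> b * (real n / ln (real n)) powr \<beta>"
    by (rule rate_bounds)
  have "\<forall>\<^sub>F n in sequentially. 2 powr (real (L n) / 2) * sqrt (real (L n)) / sqrt (real n) \<le> b powr (1/2) * (ln (real n) / real n) powr (\<gamma> / (2 * \<gamma> + 1))"
    using ev level_le_ln eventually_gt_at_top[of 2]
  proof eventually_elim
    case (elim n)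
    have ln: "0 < ln (real n)" "0 < real n / ln (real n)" "0 < ln (real n) / real n" using elim by auto
    have "2 powr (real (L n) / 2) = (2 ^ L n) powr (1 / 2)"
      by (simp add: powr_realpow[symmetric] powr_powr)
    also have "\<dots> \<le> (b * (real n / ln (real n)) powr \<beta>) powr (1 / 2)"
      using elim by (intro powr_mono2) auto
    also have "\<dots> = b powr (1 / 2) * (real n / ln (real n)) powr (\<beta> / 2)"
      using b ln by (simp add: powr_mult powr_powr)
    also have "(real n / ln (real n)) powr (\<beta> / 2) = (ln (real n) / real n) powr (- \<beta> / 2)"
      using ln by (simp add: powr_minus powr_divide)
    finally have "2 powr (real (L n) / 2) * (sqrt (real (L n)) / sqrt (real n))
       \<le> (b powr (1 / 2) * (ln (real n) / real n) powr (- \<beta> / 2)) * (sqrt (ln (real n)) / sqrt (real n))"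
      using elim by (intro mult_mono divide_right_mono) auto
    also have "sqrt (ln (real n)) / sqrt (real n) = (ln (real n) / real n) powr (1 / 2)"
      using ln by (simp add: powr_half_sqrt real_sqrt_divide)
    also have "(b powr (1 / 2) * (ln (real n) / real n) powr (- \<beta> / 2)) * (ln (real n) / real n) powr (1 / 2)
        = b powr (1 / 2) * (ln (real n) / real n) powr (- \<beta> / 2 + 1 / 2)"
      by (simp only: powr_add mult.assoc)
    also have "- \<beta> / 2 + 1 / 2 = \<gamma> / (2 * \<gamma> + 1)" using gamma by (simp add: \<beta>_def field_simps)
    finally show ?case by simp
  qed
  then show thesis using b by (intro that[of "b powr (1/2)"]) auto
qed

lemma smooth_rate: obtains C where "0 < C"
  "\<forall>\<^sub>F n in sequentially. 2 powr (- real (L n) * \<gamma>) \<le> C * (ln (real n) / real n) powr (\<gamma> / (2 * \<gamma> + 1))"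
proof -
  obtain a b where a: "0 < a" and ev: "\<forall>\<^sub>F n in sequentially. a * (real n / ln (real n)) powr \<beta> \<le> 2 ^ L n \<and> 2 ^ L n \<le> b * (real n / ln (real n)) powr \<beta>"
    by (rule rate_bounds)
  have "\<forall>\<^sub>F n in sequentially. 2 powr (- real (L n) * \<gamma>) \<le> a powr (- \<gamma>) * (ln (real n) / real n) powr (\<gamma> / (2 * \<gamma> + 1))"
    using ev eventually_gt_at_top[of 2]
  proof eventually_elim
    case (elim n)
    have ln: "0 < ln (real n)" "0 < real n / ln (real n)" using elim by auto
    have "2 powr (- real (L n) * \<gamma>) = (2 ^ L n) powr (- \<gamma>)"
      by (simp add: powr_realpow[symmetric] powr_powr)
    also have "\<dots> \<le> (a * (real n / ln (real n)) powr \<beta>) powr (- \<gamma>)"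
      using elim a ln gamma by (intro powr_mono2') auto
    also have "\<dots> = a powr (- \<gamma>) * (real n / ln (real n)) powr (- (\<beta> * \<gamma>))"
      using a ln by (simp add: powr_mult powr_powr)
    also have "(real n / ln (real n)) powr (- (\<beta> * \<gamma>)) = (ln (real n) / real n) powr (\<beta> * \<gamma>)"
      using ln by (simp add: powr_minus powr_divide)
    finally show ?case by (simp add: \<beta>_def)
  qed
  then show thesis using a by (intro that[of "a powr (- \<gamma>)"]) auto
qed

end

section \<open>Sampling from a density with a modulus of continuity of power type\<close>

locale hoelder_density =
  fixes f0 :: "real \<Rightarrow> real" and \<gamma> :: real
  assumes gamma_pos: "0 < \<gamma>"
    and f0_density: "(LINT x:{0..1}|lborel. f0 x) = 1"
    and f0_lower: "\<exists>c>0. \<forall>x\<in>{0..1}. c \<le> f0 x"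
    and f0_hoelder: "bdd_above {\<bar>f0 x - f0 y\<bar> / \<bar>x - y\<bar> powr \<gamma> | x y. x \<in> {0..1} \<and> y \<in> {0..1} \<and> x \<noteq> y}"
begin

definition "H = Sup {\<bar>f0 x - f0 y\<bar> / \<bar>x - y\<bar> powr \<gamma> | x y. x \<in> {0..1} \<and> y \<in> {0..1} \<and> x \<noteq> y}"
definition "F = Sup (f0 ` {0..1})"
definition "P0 = density lborel (\<lambda>x. ennreal (f0 x) * indicator {0..1} x)"
text \<open>A Borel function on the whole line with the same density; the values of
  \<open>f0\<close> outside the unit interval are unconstrained.\<close>

definition "f1 x = f0 x * indicator {0..1} x"

lemma hoelder: "x \<in> {0..1} \<Longrightarrow> y \<in> {0..1} \<Longrightarrow> \<bar>f0 x - f0 y\<bar> \<le> H * \<bar>x - y\<bar> powr \<gamma>"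
proof (cases "x = y")
  case False
  assume xy: "x \<in> {0..1}" "y \<in> {0..1}"
  then have "\<bar>f0 x - f0 y\<bar> / \<bar>x - y\<bar> powr \<gamma> \<le> H"
    unfolding H_def using False by (intro cSup_upper f0_hoelder) auto
  then show ?thesis using False by (simp add: pos_divide_le_eq)
qed simp

lemma H_nonneg: "0 \<le> H"
proof -
  have "\<bar>f0 0 - f0 1\<bar> \<le> H * \<bar>0 - 1\<bar> powr \<gamma>" by (rule hoelder) auto
  then show ?thesis by simp
qed

lemma f0_continuous: "continuous_on {0..1} f0"
  unfolding continuous_on_def
proof
  fix x :: real assume x: "x \<in> {0..1}"
  have l: "((\<lambda>y. H * \<bar>y - x\<bar> powr \<gamma>) \<longlongrightarrow> H * 0) (at x within {0..1})"
  proof (intro tendsto_mult tendsto_const tendsto_zero_powrI)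
    have "((\<lambda>y. \<bar>y - x\<bar>) \<longlongrightarrow> \<bar>x - x\<bar>) (at x within {0..1})" by (intro tendsto_intros)
    then show "((\<lambda>y. \<bar>y - x\<bar>) \<longlongrightarrow> 0) (at x within {0..1})" by simp
  qed (use gamma_pos in auto)
  have "((\<lambda>y. f0 y - f0 x) \<longlongrightarrow> 0) (at x within {0..1})"
    by (rule Lim_null_comparison[where g="\<lambda>y. H * \<bar>y - x\<bar> powr \<gamma>"])
      (use l x hoelder in \<open>auto simp: eventually_at_filter\<close>)
  then show "(f0 \<longlongrightarrow> f0 x) (at x within {0..1})" by (simp add: Lim_null[symmetric] LIM_zero_iff)
qed

lemma f0_le_F: "x \<in> {0..1} \<Longrightarrow> f0 x \<le> F"
  unfolding F_def
  by (intro cSup_upper imageI bounded_imp_bdd_above compact_imp_bounded compact_continuous_image f0_continuous) auto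

lemma f0_nonneg: "x \<in> {0..1} \<Longrightarrow> 0 \<le> f0 x"
proof -
  assume x: "x \<in> {0..1}"
  obtain c where "0 < c" "\<forall>x\<in>{0..1}. c \<le> f0 x" using f0_lower by auto
  then show ?thesis using x by (meson less_imp_le order_trans)
qed

lemma f1_measurable [measurable]: "f1 \<in> borel_measurable borel"
  using borel_measurable_continuous_on_indicator[OF _ f0_continuous] unfolding f1_def[abs_def] by (simp add: mult.commute)

lemma f1_bounds: "0 \<le> f1 x" "x \<in> {0..1} \<Longrightarrow> f1 x \<le> F"
  using f0_nonneg f0_le_F by (auto simp: f1_def indicator_def)

lemma f0_measurable_unit: "f0 \<in> borel_measurable unit_leb"
  by (rule measurable_cong[THEN iffD1, OF _ measurable_unit_leb[OF f1_measurable]])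
    (auto simp: f1_def space_restrict_space)

lemma f0_in_L2: "f0 \<in> L2"
  by (rule bounded_in_L2[OF f0_measurable_unit, of F]) (use f0_nonneg f0_le_F in auto)

lemma integrable_f1: "integrable lborel f1" and integral_f1: "(LINT x|lborel. f1 x) = 1"
proof -
  show *: "(LINT x|lborel. f1 x) = 1"
    using f0_density unfolding set_lebesgue_integral_def f1_def by (simp add: mult.commute)
  \<comment> \<open>A function that is not integrable has integral \<open>0\<close> by convention,
    so the value \<open>1\<close> forces integrability.\<close>
  show "integrable lborel f1" using * not_integrable_integral_eq by fastforce
qed

lemma P0_eq: "P0 = density lborel (\<lambda>x. ennreal (f1 x))"
proof -
  have "(\<lambda>x. ennreal (f0 x) * indicator {0..1} x) = (\<lambda>x. ennreal (f1 x))"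
    by (auto simp: fun_eq_iff f1_def indicator_def)
  then show ?thesis by (simp add: P0_def)
qed

lemma sets_P0 [measurable_cong, simp]: "sets P0 = sets borel" and space_P0 [simp]: "space P0 = UNIV"
  by (auto simp: P0_def)

lemma prob_space_P0: "prob_space P0"
proof
  have "emeasure P0 (space P0) = (\<integral>\<^sup>+x. ennreal (f1 x) \<partial>lborel)"
    unfolding P0_eq by (simp add: emeasure_density)
  also have "\<dots> = ennreal 1"
    using nn_integral_eq_integral[OF integrable_f1] f1_bounds integral_f1 by simp
  finally show "emeasure P0 (space P0) = 1" by simp
qed

sublocale P0: prob_space P0 by (rule prob_space_P0)

lemma measure_P0_UNIV [simp]: "measure P0 UNIV = 1"
  using P0.prob_space by simp

lemma AE_P0: "AE x in P0. 0 < x \<and> x \<le> 1"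
  unfolding P0_eq
proof (subst AE_density)
  show "AE x in lborel. 0 < ennreal (f1 x) \<longrightarrow> 0 < x \<and> x \<le> 1"
    using AE_lborel_singleton[of 0] by eventually_elim (auto simp: f1_def indicator_def split: if_splits)
qed simp

lemma integral_P0:
  assumes [measurable]: "g \<in> borel_measurable borel"
  shows "(LINT x|P0. g x) = inner_L2 f0 g"
proof -
  have "(LINT x|P0. g x) = (LINT x|lborel. f1 x * g x)"
    unfolding P0_eq using f1_bounds by (subst integral_real_density) auto
  also have "\<dots> = inner_L2 f0 g"
    unfolding inner_L2_def by (subst integral_restrict_space) (auto simp: f1_def intro!: Bochner_Integration.integral_cong)
  finally show ?thesis .
qed

lemma F_ge_1: "1 \<le> F"
proof -
  have "(LINT x|lborel. f1 x) \<le> (LINT x|lborel. F * indicator {0..1::real} x)"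
  proof (rule Bochner_Integration.integral_mono[OF integrable_f1])
    show "f1 x \<le> F * indicator {0..1::real} x" for x
      using f1_bounds(2)[of x] by (auto simp: f1_def indicator_def)
  qed simp
  then show ?thesis using integral_f1 by simp
qed

definition "\<theta> l k = inner_L2 f0 (haar l k)"

lemma expectation_haar: "P0.expectation (haar l k) = \<theta> l k"
  unfolding \<theta>_def by (rule integral_P0) measurable

lemma haar_bounded: "\<bar>haar l k x\<bar> \<le> max 1 (2 powr (l / 2))"
  unfolding haar_def by (auto simp: indicator_def abs_mult)

lemma integrable_haar_P0: "integrable P0 (haar l k)"
  by (rule P0.integrable_const_bound[where B="max 1 (2 powr (l / 2))"]) (use haar_bounded in auto)

lemma theta_minus_1: "\<theta> (-1) k = 1"
proof -
  have "P0.expectation (haar (-1) k) = P0.expectation (\<lambda>_. 1)"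
  proof (rule integral_cong_AE)
    show "AE x in P0. haar (-1) k x = 1" using AE_P0 by eventually_elim (simp add: haar_def)
  qed auto
  then show ?thesis by (simp add: expectation_haar)
qed

text \<open>As the Haar function has mean zero, \<open>f0\<close> may be recentred at the left end
  \<open>?y\<close> of the support. There it oscillates by at most
  \<open>H * 2 powr (- l * \<gamma>)\<close>, and the absolute integral of the Haar function
  contributes the remaining \<open>2 powr (- l / 2)\<close>.\<close>

lemma abs_theta_le:
  assumes l: "0 \<le> l" "k < 2 ^ nat l"
  shows "\<bar>\<theta> l k\<bar> \<le> H * 2 powr (- l * (\<gamma> + 1/2))"
proof -
  let ?y = "real k / 2 ^ nat l"
  have "real k \<le> 2 ^ nat l" using l by (metis less_imp_le of_nat_le_iff of_nat_numeral of_nat_power)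
  then have y: "?y \<in> {0..1}" by simp
  have hm[measurable]: "haar l k \<in> borel_measurable unit_leb" by (rule measurable_unit_leb) measurable
  have i1: "integrable unit_leb (\<lambda>x. f0 x * haar l k x)"
  proof -
    interpret finite_measure unit_leb by (rule finite_measure_unit_leb)
    have [measurable]: "f0 \<in> borel_measurable unit_leb" by (rule f0_measurable_unit)
    show ?thesis
      by (rule integrable_const_bound[where B="F * 2 powr (l / 2)"])
        (use abs_haar_le[OF l(1)] f0_le_F f0_nonneg F_ge_1 in \<open>auto simp: abs_mult space_restrict_space intro!: AE_I2 mult_mono\<close>)
  qed
  have i2: "integrable unit_leb (haar l k)" by (intro L2_integrable haar_in_L2 l)
  have "\<theta> l k = (LINT x|unit_leb. f0 x * haar l k x) - f0 ?y * (LINT x|unit_leb. haar l k x)"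
    using integral_haar_eq_0[OF l] by (simp add: \<theta>_def inner_L2_def)
  also have "\<dots> = (LINT x|unit_leb. f0 x * haar l k x - f0 ?y * haar l k x)"
    using i1 i2 by simp
  also have "\<bar>\<dots>\<bar> \<le> (LINT x|unit_leb. \<bar>f0 x * haar l k x - f0 ?y * haar l k x\<bar>)"
    by (rule integral_abs_bound)
  also have "\<dots> \<le> (LINT x|unit_leb. H * (1 / 2 ^ nat l) powr \<gamma> * \<bar>haar l k x\<bar>)"
  proof (rule integral_mono)
    fix x assume "x \<in> space unit_leb"
    then have x: "x \<in> {0..1}" by (simp add: space_restrict_space)
    show "\<bar>f0 x * haar l k x - f0 ?y * haar l k x\<bar> \<le> H * (1 / 2 ^ nat l) powr \<gamma> * \<bar>haar l k x\<bar>"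
    proof (cases "haar l k x = 0")
      case False
      then have "real k / 2 ^ nat l < x" "x \<le> (real k + 1) / 2 ^ nat l"
      proof -
        define a b c where "a = real k / 2 ^ nat l" and "b = (real k + 1/2) / 2 ^ nat l" and "c = (real k + 1) / 2 ^ nat l"
        have abc: "a \<le> b" "b \<le> c" unfolding a_def b_def c_def by (auto intro: divide_right_mono)
        have "haar l k x = 2 powr (l / 2) * (indicator {a<..b} x - indicator {b<..c} x)"
          using l unfolding haar_def a_def b_def c_def by simp
        then have "x \<in> {a<..c}" using False abc by (cases "a < x"; cases "x \<le> c") (auto simp: indicator_def)
        then show "real k / 2 ^ nat l < x" "x \<le> (real k + 1) / 2 ^ nat l" by (auto simp: a_def c_def)
      qed
      then have "\<bar>x - ?y\<bar> \<le> 1 / 2 ^ nat l" by (auto simp: add_divide_distrib)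
      then have "\<bar>x - ?y\<bar> powr \<gamma> \<le> (1 / 2 ^ nat l) powr \<gamma>" using gamma_pos by (intro powr_mono2) auto
      then have "\<bar>f0 x - f0 ?y\<bar> \<le> H * (1 / 2 ^ nat l) powr \<gamma>"
        using hoelder[OF x y] H_nonneg by (meson mult_left_mono order_trans)
      then have "\<bar>f0 x - f0 ?y\<bar> * \<bar>haar l k x\<bar> \<le> H * (1 / 2 ^ nat l) powr \<gamma> * \<bar>haar l k x\<bar>" by (intro mult_right_mono) auto
      then show ?thesis by (simp only: abs_mult[symmetric] left_diff_distrib)
    qed simp
  qed (use i1 i2 in auto)
  also have "\<dots> = H * ((1 / 2 ^ nat l) powr \<gamma> * (2 powr (l / 2) / 2 ^ nat l))"
    using integral_haar_comp[OF l, of abs] by simp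
  also have "(1 / 2 ^ nat l) powr \<gamma> * (2 powr (l / 2) / 2 ^ nat l) = 2 powr (- l * (\<gamma> + 1/2))"
  proof -
    have "(2::real) ^ nat l = 2 powr l" using l by (simp add: powr_realpow[symmetric])
    moreover have "(1 / 2 powr l) powr \<gamma> = 2 powr (- l * \<gamma>)" by (simp add: powr_minus_divide[symmetric] powr_powr)
    ultimately show ?thesis by (simp add: powr_diff[symmetric] powr_add[symmetric] algebra_simps)
  qed
  finally show ?thesis by simp
qed

lemma expectation_sq_le:
  assumes [measurable]: "g \<in> borel_measurable borel" and "integrable unit_leb (\<lambda>x. (g x)\<^sup>2)"
  shows "P0.expectation (\<lambda>x. (g x)\<^sup>2) \<le> F * (LINT x|unit_leb. (g x)\<^sup>2)"
proof -
  have "P0.expectation (\<lambda>x. (g x)\<^sup>2) = (LINT x|unit_leb. f0 x * (g x)\<^sup>2)"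
    by (subst integral_P0) (auto simp: inner_L2_def)
  also have "\<dots> \<le> (LINT x|unit_leb. F * (g x)\<^sup>2)"
  proof (rule integral_mono)
    have [measurable]: "f0 \<in> borel_measurable unit_leb" "g \<in> borel_measurable unit_leb"
      by (auto intro: f0_measurable_unit measurable_unit_leb)
    have "integrable unit_leb (\<lambda>x. F * (g x)\<^sup>2)" using assms by simp
    then show "integrable unit_leb (\<lambda>x. f0 x * (g x)\<^sup>2)"
    proof (rule Bochner_Integration.integrable_bound)
      show "AE x in unit_leb. norm (f0 x * (g x)\<^sup>2) \<le> norm (F * (g x)\<^sup>2)"
      proof (rule AE_I2)
        fix x assume "x \<in> space unit_leb"
        then have "x \<in> {0..1}" by (simp add: space_restrict_space)
        then have "\<bar>f0 x\<bar> \<le> \<bar>F\<bar>" using f0_le_F f0_nonneg by fastforce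
        then show "norm (f0 x * (g x)\<^sup>2) \<le> norm (F * (g x)\<^sup>2)" by (simp add: abs_mult mult_right_mono)
      qed
    qed measurable
  qed (use assms f0_le_F in \<open>auto simp: space_restrict_space intro!: mult_right_mono\<close>)
  finally show ?thesis by simp
qed

text \<open>The unit norm of the Haar function and the upper bound of the density make this uniform
  in the level, in contrast to the supremum, which grows like \<open>2 powr (l / 2)\<close>.\<close>

lemma haar_variance_le:
  assumes "0 \<le> l" "k < 2 ^ nat l"
  shows "P0.expectation (\<lambda>x. (haar l k x - \<theta> l k)\<^sup>2) \<le> F"
proof -
  have i2: "integrable unit_leb (\<lambda>x. (haar l k x)\<^sup>2)" using haar_in_L2[OF assms(1)] by (simp add: L2_def)
  have p2: "integrable P0 (\<lambda>x. (haar l k x)\<^sup>2)"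
    by (rule P0.integrable_const_bound[where B="(max 1 (2 powr (l / 2)))\<^sup>2"])
      (use haar_bounded[of l k] in \<open>auto simp: abs_le_square_iff[symmetric]\<close>)
  have "P0.expectation (\<lambda>x. (haar l k x - \<theta> l k)\<^sup>2) = P0.expectation (\<lambda>x. (haar l k x)\<^sup>2) - (\<theta> l k)\<^sup>2"
    using P0.variance_eq[OF integrable_haar_P0 p2] by (simp add: expectation_haar)
  also have "\<dots> \<le> F * (LINT x|unit_leb. (haar l k x)\<^sup>2)"
    using expectation_sq_le[OF haar_measurable i2] zero_le_power2[of "\<theta> l k"] by linarith
  also have "(LINT x|unit_leb. (haar l k x)\<^sup>2) = 1"
    using integral_haar_comp[OF assms, of "\<lambda>x. x\<^sup>2"] powr_half_square[OF assms(1)] by simp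
  finally show ?thesis by simp
qed

lemma indicator_sq: "(indicator A x :: real)\<^sup>2 = indicator A x"
  by (simp add: indicator_def)

definition "q m j = measure P0 (dyadic_bin m j)"

text \<open>The upper bound controls the bin counts; strict positivity, from the lower bound on the
  density, makes the Gaussian limit nondegenerate.\<close>

lemma q_bounds:
  assumes "j < 2 ^ m"
  shows "q m j \<le> F / 2 ^ m" "0 < q m j"
proof -
  have 1: "q m j = (LINT x|unit_leb. f0 x * indicator (dyadic_bin m j) x)"
    using integral_P0[of "indicator (dyadic_bin m j)"] by (simp add: q_def inner_L2_def)
  have sp: "dyadic_bin m j \<inter> space unit_leb = dyadic_bin m j"
    using dyadic_bin_subset[OF assms] by (auto simp: space_restrict_space)
  then have sp': "dyadic_bin m j \<inter> {0..1} = dyadic_bin m j" by (simp add: space_restrict_space)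
  have "P0.expectation (\<lambda>x. (indicator (dyadic_bin m j) x)\<^sup>2) \<le> F * (LINT x|unit_leb. (indicator (dyadic_bin m j) x)\<^sup>2)"
    by (rule expectation_sq_le) (auto simp: indicator_sq intro!: L2_integrable bounded_in_L2[where B=1] measurable_unit_leb)
  then show "q m j \<le> F / 2 ^ m"
    using measure_unit_leb_bin[OF assms] by (simp only: indicator_sq q_def integral_indicator Bochner_Integration.integral_indicator sp) simp
  obtain c where c: "c > 0" "\<And>x. x \<in> {0..1} \<Longrightarrow> c \<le> f0 x" using f0_lower by auto
  have ii: "integrable unit_leb (indicator (dyadic_bin m j) :: real \<Rightarrow> real)"
    by (rule L2_integrable, rule bounded_in_L2[where B=1]) (auto intro: measurable_unit_leb)
  have [measurable]: "f0 \<in> borel_measurable unit_leb" "(indicator (dyadic_bin m j) :: real \<Rightarrow> real) \<in> borel_measurable unit_leb"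
    by (auto intro: f0_measurable_unit measurable_unit_leb)
  have "c / 2 ^ m = (LINT x|unit_leb. c * indicator (dyadic_bin m j) x)"
    using measure_unit_leb_bin[OF assms] by (simp add: sp sp')
  also have "\<dots> \<le> (LINT x|unit_leb. f0 x * indicator (dyadic_bin m j) x)"
  proof (rule integral_mono)
    have "integrable unit_leb (\<lambda>x. F * indicator (dyadic_bin m j) x)" using ii by simp
    then show "integrable unit_leb (\<lambda>x. f0 x * indicator (dyadic_bin m j) x)"
    proof (rule Bochner_Integration.integrable_bound)
      show "AE x in unit_leb. norm (f0 x * indicator (dyadic_bin m j) x) \<le> norm (F * indicator (dyadic_bin m j) x)"
      proof (rule AE_I2)
        fix x assume "x \<in> space unit_leb"
        then have "x \<in> {0..1}" by (simp add: space_restrict_space)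
        then have "\<bar>f0 x\<bar> \<le> \<bar>F\<bar>" using f0_le_F f0_nonneg by fastforce
        then show "norm (f0 x * indicator (dyadic_bin m j) x) \<le> norm (F * indicator (dyadic_bin m j) x)" by (simp add: indicator_def)
      qed
    qed measurable
    show "c * indicator (dyadic_bin m j) x \<le> f0 x * indicator (dyadic_bin m j) x" if "x \<in> space unit_leb" for x
      using that c(2)[of x] by (simp add: space_restrict_space indicator_def)
  qed (use ii in simp)
  finally have "c / 2 ^ m \<le> q m j" using 1 by simp
  moreover have "0 < c / 2 ^ m" using c(1) by simp
  ultimately show "0 < q m j" by linarith
qed

lemma expectation_bin_function:
  fixes g :: "real \<Rightarrow> real"
  assumes [measurable]: "g \<in> borel_measurable borel" and g: "\<And>x. 0 < x \<Longrightarrow> x \<le> 1 \<Longrightarrow> g x = c (bin_of m x)"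
  shows "P0.expectation g = (\<Sum>j<2 ^ m. c j * q m j)"
proof -
  have "P0.expectation g = P0.expectation (\<lambda>x. \<Sum>j<2 ^ m. c j * indicator (dyadic_bin m j) x)"
  proof (rule integral_cong_AE)
    show "AE x in P0. g x = (\<Sum>j<2 ^ m. c j * indicator (dyadic_bin m j) x)"
      using AE_P0
    proof eventually_elim
      case (elim x)
      have "(\<Sum>j<2 ^ m. c j * indicator (dyadic_bin m j) x) = (\<Sum>j<2 ^ m. if bin_of m x = j then c j else 0)"
        using elim by (intro sum.cong) (auto simp: mem_dyadic_bin_iff indicator_def)
      also have "\<dots> = g x" using g[of x] bin_of_less[of x m] elim by (simp add: sum.delta)
      finally show ?case ..
    qed
  next
    show "(\<lambda>x. \<Sum>j<2 ^ m. c j * indicator (dyadic_bin m j) x) \<in> borel_measurable P0" by measurable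
  qed measurable
  also have "\<dots> = (\<Sum>j<2 ^ m. P0.expectation (\<lambda>x. c j * indicator (dyadic_bin m j) x))"
    by (rule Bochner_Integration.integral_sum) (simp add: P0.emeasure_eq_measure integrable_mult_right)
  finally show ?thesis by (simp add: q_def)
qed

section \<open>Deviation bounds for a sample of size n\<close>

definition P :: "nat \<Rightarrow> (nat \<Rightarrow> real) measure" where "P n = (\<Pi>\<^sub>M i\<in>{..<n}. P0)"

lemma sets_P [measurable_cong, simp]: "sets (P n) = sets (data_space n)"
  unfolding P_def by (intro sets_PiM_cong) auto

lemma space_P [simp]: "space (P n) = (\<Pi>\<^sub>E i\<in>{..<n}. UNIV)"
  by (simp add: P_def space_PiM)

lemma prob_space_P: "prob_space (P n)"
  unfolding P_def by (intro prob_space_PiM prob_space_P0)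

sublocale P: prob_space "P n" for n by (rule prob_space_P)

lemma sample_chernoff:
  assumes [measurable]: "g \<in> borel_measurable borel" and b: "\<And>x. \<bar>g x - P0.expectation g\<bar> \<le> b"
    and gi: "integrable P0 g"
    and v: "P0.expectation (\<lambda>x. (g x - P0.expectation g)\<^sup>2) \<le> v" and l: "0 \<le> l" "l * b \<le> 1"
  shows "measure (P n) {x \<in> space (P n). a \<le> \<bar>(\<Sum>i<n. g (x i)) - n * P0.expectation g\<bar>} \<le> 2 * exp (- l * a + l\<^sup>2 * (n * v))"
proof -
  define Y where "Y x = g x - P0.expectation g" for x
  have Ym[measurable]: "Y \<in> borel_measurable borel" unfolding Y_def by measurable
  have mean: "P0.expectation Y = 0" unfolding Y_def using gi by simp
  have var: "P0.expectation (\<lambda>x. (Y x)\<^sup>2) \<le> v" using v by (simp add: Y_def)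
  have mgf: "(\<integral>\<^sup>+x. ennreal (exp (e * Y x)) \<partial>P0) \<le> ennreal (exp (l\<^sup>2 * v))" if "e = l \<or> e = - l" for e
    using P0.mgf_bounded[of Y b v e] mean var b l that by (auto simp: Y_def)
  have "measure (P n) {x \<in> space (P n). a \<le> \<bar>\<Sum>i\<in>{..<n}. Y (x i)\<bar>} \<le> 2 * exp (- l * a + l\<^sup>2 * (\<Sum>i\<in>{..<n}. v))"
    unfolding P_def
  proof (rule PiM_chernoff)
    show "(\<integral>\<^sup>+x. ennreal (exp (l * Y x)) \<partial>P0) \<le> ennreal (exp (l\<^sup>2 * v))"
      "(\<integral>\<^sup>+x. ennreal (exp (- l * Y x)) \<partial>P0) \<le> ennreal (exp (l\<^sup>2 * v))" by (rule mgf; simp)+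
  qed (use prob_space_P0 l in auto)
  moreover have "(\<Sum>i\<in>{..<n}. Y (x i)) = (\<Sum>i<n. g (x i)) - n * P0.expectation g" for x
    by (simp add: Y_def sum_subtractf)
  ultimately show ?thesis by simp
qed

text \<open>Bernstein's bound with parameter \<open>t / sqrt n\<close>. The deviation of a Haar
  function from its mean is at most \<open>2 * 2 powr (l / 2)\<close>, and the condition on
  \<open>t\<close> is the resulting admissibility of the parameter.\<close>

lemma haar_chernoff:
  assumes l: "0 \<le> l" "k < 2 ^ nat l" and n: "0 < n" and t: "0 \<le> t" "2 * t * 2 powr (l / 2) \<le> sqrt (real n)"
  shows "measure (P n) {x \<in> space (P n). a \<le> sqrt (real n) * \<bar>empirical_coeff n x l k - \<theta> l k\<bar>} \<le> 2 * exp (- t * a + t\<^sup>2 * F)"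
proof -
  define s where "s = sqrt (real n)"
  have s: "s > 0" "s * s = real n" using n by (auto simp: s_def)
  have th: "\<bar>\<theta> l k\<bar> \<le> 2 powr (l / 2)"
  proof -
    have "\<bar>P0.expectation (haar l k)\<bar> \<le> P0.expectation (\<lambda>x. \<bar>haar l k x\<bar>)" by (rule integral_abs_bound)
    also have "\<dots> \<le> P0.expectation (\<lambda>x. 2 powr (l / 2))"
      using integrable_haar_P0 abs_haar_le[OF l(1)] by (intro integral_mono) auto
    finally show ?thesis by (simp add: expectation_haar)
  qed
  have "measure (P n) {x \<in> space (P n). s * a \<le> \<bar>(\<Sum>i<n. haar l k (x i)) - n * P0.expectation (haar l k)\<bar>}
      \<le> 2 * exp (- (t / s) * (s * a) + (t / s)\<^sup>2 * (n * F))"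
  proof (rule sample_chernoff[where g="haar l k" and b="2 * 2 powr (l / 2)"])
    show "\<bar>haar l k x - P0.expectation (haar l k)\<bar> \<le> 2 * 2 powr (l / 2)" for x
      using th abs_haar_le[OF l(1), of k x] unfolding expectation_haar by linarith
    show "P0.expectation (\<lambda>x. (haar l k x - P0.expectation (haar l k))\<^sup>2) \<le> F"
      using haar_variance_le[OF l] by (simp add: expectation_haar)
    show "t / s * (2 * 2 powr (l / 2)) \<le> 1" using t(2) s(1) by (simp add: s_def[symmetric] field_simps)
  qed (use integrable_haar_P0 t s in auto)
  also have "- (t / s) * (s * a) + (t / s)\<^sup>2 * (n * F) = - t * a + t\<^sup>2 * F"
  proof -
    have "(t / s) * (s * a) = t * a" using s(1) by simp
    moreover have "(t / s)\<^sup>2 * (n * F) = t\<^sup>2 * F"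
      unfolding s(2)[symmetric] using s(1) by (simp add: power2_eq_square)
    ultimately show ?thesis by simp
  qed
  also have "{x \<in> space (P n). s * a \<le> \<bar>(\<Sum>i<n. haar l k (x i)) - n * P0.expectation (haar l k)\<bar>}
     = {x \<in> space (P n). a \<le> sqrt (real n) * \<bar>empirical_coeff n x l k - \<theta> l k\<bar>}"
  proof (intro Collect_cong conj_cong refl)
    fix x
    have "(\<Sum>i<n. haar l k (x i)) - n * P0.expectation (haar l k) = n * (empirical_coeff n x l k - \<theta> l k)"
      using n by (simp add: empirical_coeff_def expectation_haar field_simps)
    then have "\<bar>(\<Sum>i<n. haar l k (x i)) - n * P0.expectation (haar l k)\<bar> = s * (s * \<bar>empirical_coeff n x l k - \<theta> l k\<bar>)"
      using s by (simp add: abs_mult mult.assoc[symmetric])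
    then show "(s * a \<le> \<bar>(\<Sum>i<n. haar l k (x i)) - n * P0.expectation (haar l k)\<bar>) = (a \<le> sqrt (real n) * \<bar>empirical_coeff n x l k - \<theta> l k\<bar>)"
      using s(1) by (simp add: s_def[symmetric])
  qed
  finally show ?thesis .
qed

lemma real_bin_count: "real (bin_count m n x j) = (\<Sum>i<n. of_bool (bin_of m (x i) = j))"
  unfolding bin_count_def by (simp add: Int_def of_bool_def sum.If_cases lessThan_def)

text \<open>Negative points are put into bin \<open>0\<close> by \<open>bin_of\<close>, so counts
  equal sums of bin indicators on the almost sure event built into the statement. The variance of an
  indicator is at most its mean.\<close>

lemma bin_count_chernoff:
  assumes j: "j < 2 ^ m" and t: "0 \<le> t" "t \<le> 1"
  shows "measure (P n) {x \<in> space (P n). (\<forall>i<n. 0 < x i \<and> x i \<le> 1) \<and> a \<le> \<bar>real (bin_count m n x j) - n * q m j\<bar>} \<le> 2 * exp (- t * a + t\<^sup>2 * (n * q m j))"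
proof -
  let ?g = "indicator (dyadic_bin m j) :: real \<Rightarrow> real"
  have E: "P0.expectation ?g = q m j" by (simp add: q_def)
  have q01: "0 \<le> q m j" "q m j \<le> 1" by (auto simp: q_def)
  have "measure (P n) {x \<in> space (P n). (\<forall>i<n. 0 < x i \<and> x i \<le> 1) \<and> a \<le> \<bar>real (bin_count m n x j) - n * q m j\<bar>}
     \<le> measure (P n) {x \<in> space (P n). a \<le> \<bar>(\<Sum>i<n. ?g (x i)) - n * P0.expectation ?g\<bar>}"
  proof (rule P.finite_measure_mono)
    have "(\<lambda>x. \<Sum>i<n. ?g (x i)) \<in> borel_measurable (P n)"
      by (intro borel_measurable_sum measurable_compose[of _ _ borel, OF _ borel_measurable_indicator]) (auto simp: P_def)
    then show "{x \<in> space (P n). a \<le> \<bar>(\<Sum>i<n. ?g (x i)) - n * P0.expectation ?g\<bar>} \<in> sets (P n)"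
      by (intro borel_measurable_le) auto
    show "{x \<in> space (P n). (\<forall>i<n. 0 < x i \<and> x i \<le> 1) \<and> a \<le> \<bar>real (bin_count m n x j) - n * q m j\<bar>} \<subseteq>
       {x \<in> space (P n). a \<le> \<bar>(\<Sum>i<n. ?g (x i)) - n * P0.expectation ?g\<bar>}"
    proof safe
      fix x assume x: "\<forall>i<n. 0 < x i \<and> x i \<le> 1" and a: "a \<le> \<bar>real (bin_count m n x j) - n * q m j\<bar>"
      have "(\<Sum>i<n. ?g (x i)) = real (bin_count m n x j)"
        unfolding real_bin_count using x by (intro sum.cong) (auto simp: indicator_def mem_dyadic_bin_iff)
      then show "a \<le> \<bar>(\<Sum>i<n. ?g (x i)) - n * P0.expectation ?g\<bar>" using a E by simp
    qed
  qed
  also have "\<dots> \<le> 2 * exp (- t * a + t\<^sup>2 * (n * q m j))"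
  proof (rule sample_chernoff[where g="?g" and b=1])
    show "\<bar>?g x - P0.expectation ?g\<bar> \<le> 1" for x unfolding E using q01 by (auto simp: indicator_def)
    have "P0.expectation (\<lambda>x. (?g x - P0.expectation ?g)\<^sup>2) = P0.expectation (\<lambda>x. (?g x)\<^sup>2) - (P0.expectation ?g)\<^sup>2"
      by (rule P0.variance_eq) (simp_all add: indicator_sq P0.emeasure_eq_measure)
    then show "P0.expectation (\<lambda>x. (?g x - P0.expectation ?g)\<^sup>2) \<le> q m j"
      by (simp add: indicator_sq q_def)
  qed (use t in \<open>simp_all add: P0.emeasure_eq_measure\<close>)
  finally show ?thesis .
qed

end

section \<open>Typical samples\<close>

lemma bin_of_measurable [measurable]: "bin_of m \<in> borel \<rightarrow>\<^sub>M count_space UNIV"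
  unfolding bin_of_def[abs_def] by measurable

lemma real_bin_count_measurable [measurable]:
  "(\<lambda>x. real (bin_count m n x j)) \<in> borel_measurable (\<Pi>\<^sub>M i\<in>{..<n}. borel)"
proof -
  have "(\<lambda>x. \<Sum>i<n. of_bool (bin_of m (x i) = j) :: real) \<in> borel_measurable (\<Pi>\<^sub>M i\<in>{..<n}. borel)"
  proof (rule borel_measurable_sum)
    fix i assume "i \<in> {..<n}"
    have "(\<lambda>x. of_bool (bin_of m x = j) :: real) \<in> borel_measurable borel" by measurable
    then show "(\<lambda>x. of_bool (bin_of m (x i) = j) :: real) \<in> borel_measurable (\<Pi>\<^sub>M i\<in>{..<n}. borel)"
      using measurable_compose[OF measurable_component_singleton[of i "{..<n}" "\<lambda>_. borel"]] \<open>i \<in> {..<n}\<close> by blast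
  qed
  moreover have "real (bin_count m n x j) = (\<Sum>i<n. of_bool (bin_of m (x i) = j))" for x
    unfolding bin_count_def by (simp add: Int_def of_bool_def sum.If_cases lessThan_def)
  ultimately show ?thesis by simp
qed

lemma empirical_coeff_measurable [measurable]:
  "(\<lambda>x. empirical_coeff n x l k) \<in> borel_measurable (\<Pi>\<^sub>M i\<in>{..<n}. borel)"
  unfolding empirical_coeff_def
proof (intro borel_measurable_divide borel_measurable_sum)
  fix i assume "i \<in> {..<n}"
  then show "(\<lambda>x. haar l k (x i)) \<in> borel_measurable (\<Pi>\<^sub>M i\<in>{..<n}. borel)"
    using measurable_compose[OF measurable_component_singleton[of i "{..<n}" "\<lambda>_. borel"] haar_measurable] by blast
qed simp

text \<open>Level \<open>l\<close> has \<open>2 ^ l\<close> functions, each failing with probability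
  at most \<open>2 * (1/4) ^ l\<close>, because \<open>exp 1 \<ge> 2\<close>; the levels sum to a
  geometric tail. It is applied to the sampling law as well as to the Erlang laws.\<close>

lemma (in prob_space) haar_union_bound:
  fixes J m :: nat and B :: "nat \<Rightarrow> nat \<Rightarrow> 'a \<Rightarrow> bool"
  assumes meas: "\<And>l k. J < l \<Longrightarrow> l \<le> m \<Longrightarrow> k < 2 ^ l \<Longrightarrow> {x \<in> space M. B l k x} \<in> events"
    and bd: "\<And>l k. J < l \<Longrightarrow> l \<le> m \<Longrightarrow> k < 2 ^ l \<Longrightarrow> prob {x \<in> space M. B l k x} \<le> 2 * exp (- 2 * real l)"
  shows "prob {x \<in> space M. \<exists>l k. J < l \<and> l \<le> m \<and> k < 2 ^ l \<and> B l k x} \<le> 2 / 2 ^ J"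
    and "{x \<in> space M. \<exists>l k. J < l \<and> l \<le> m \<and> k < 2 ^ l \<and> B l k x} \<in> events"
proof -
  have eq: "{x \<in> space M. \<exists>l k. J < l \<and> l \<le> m \<and> k < 2 ^ l \<and> B l k x} = (\<Union>l\<in>{J<..m}. \<Union>k\<in>{..<2 ^ l}. {x \<in> space M. B l k x})"
    by auto
  have m1: "(\<Union>k\<in>{..<2 ^ l}. {x \<in> space M. B l k x}) \<in> events" if "l \<in> {J<..m}" for l
    using that meas by (intro sets.finite_UN) auto
  show "{x \<in> space M. \<exists>l k. J < l \<and> l \<le> m \<and> k < 2 ^ l \<and> B l k x} \<in> events"
    unfolding eq by (rule sets.finite_UN) (use m1 in auto)
  have e4: "exp (- 2 * real l) \<le> (1 / 4) ^ l" for l :: nat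
  proof -
    have "(2::real) \<le> exp 1" using exp_ge_add_one_self[of 1] by simp
    then have "2 * 2 \<le> exp 1 * exp (1::real)" by (intro mult_mono) auto
    then have "4 \<le> exp (2::real)" by (simp add: exp_add[symmetric])
    then have "exp (- 2) \<le> (1 / 4 :: real)" by (simp add: exp_minus field_simps)
    then have "exp (- 2) ^ l \<le> (1 / 4 :: real) ^ l" by (intro power_mono) auto
    then show ?thesis by (simp add: exp_of_nat_mult[symmetric] mult.commute)
  qed
  have "prob (\<Union>l\<in>{J<..m}. \<Union>k\<in>{..<2 ^ l}. {x \<in> space M. B l k x}) \<le> (\<Sum>l\<in>{J<..m}. prob (\<Union>k\<in>{..<2 ^ l}. {x \<in> space M. B l k x}))"
    using m1 by (intro finite_measure_subadditive_finite) auto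
  also have "\<dots> \<le> (\<Sum>l\<in>{J<..m}. 2 * (1 / 2) ^ l)"
  proof (rule sum_mono)
    fix l assume l: "l \<in> {J<..m}"
    have "prob (\<Union>k\<in>{..<2 ^ l}. {x \<in> space M. B l k x}) \<le> (\<Sum>k<2 ^ l. prob {x \<in> space M. B l k x})"
      using meas l by (intro finite_measure_subadditive_finite) auto
    also have "\<dots> \<le> (\<Sum>k<(2::nat) ^ l. 2 * (1 / 4) ^ l)"
    proof (rule sum_mono)
      fix k assume "k \<in> {..<(2::nat) ^ l}"
      then have "prob {x \<in> space M. B l k x} \<le> 2 * exp (- 2 * real l)" using bd[of l k] l by auto
      then show "prob {x \<in> space M. B l k x} \<le> 2 * (1 / 4) ^ l" using e4[of l] by linarith
    qed
    also have "\<dots> = 2 * ((2 * (1 / 4)) ^ l)" unfolding power_mult_distrib by simp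
    finally show "prob (\<Union>k\<in>{..<2 ^ l}. {x \<in> space M. B l k x}) \<le> 2 * (1 / 2) ^ l" by simp
  qed
  also have "\<dots> \<le> 2 / 2 ^ J"
  proof (induction m)
    case (Suc m)
    show ?case
    proof (cases "J \<le> m")
      case True
      have "(\<Sum>l\<in>{J<..n}. 2 * (1 / 2 :: real) ^ l) = 2 / 2 ^ J - 2 / 2 ^ n" if "J \<le> n" for n
        using that
      proof (induction n rule: dec_induct)
        case (step n)
        then have "{J<..Suc n} = insert (Suc n) {J<..n}" by auto
        then show ?case using step by (simp add: power_divide)
      qed simp
      then have "(\<Sum>l\<in>{J<..Suc m}. 2 * (1 / 2 :: real) ^ l) = 2 / 2 ^ J - 2 / 2 ^ Suc m" using True by simp
      then show ?thesis by simp
    qed simp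
  qed simp
  finally show "prob {x \<in> space M. \<exists>l k. J < l \<and> l \<le> m \<and> k < 2 ^ l \<and> B l k x} \<le> 2 / 2 ^ J" unfolding eq .
qed

locale histogram_setting = hoelder_density f0 \<gamma> + resolution_rate \<gamma> L
  for f0 :: "real \<Rightarrow> real" and \<gamma> :: real and L :: "nat \<Rightarrow> nat" +
  fixes w :: "int \<Rightarrow> real"
  assumes w_mono: "mono_on {-1..} w"
    and w_ge_1: "\<And>l. l \<ge> -1 \<Longrightarrow> w l \<ge> 1"
    and w_ratio_lim: "filterlim (\<lambda>l. w l / sqrt (real_of_int l)) at_top at_top"
begin

text \<open>A fine bin has expected count at most \<open>F * n / 2 ^ L n\<close>, and twice this
  amount is allowed as deviation, hence the factor \<open>3\<close>. The constant \<open>V0\<close>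
  bounds the posterior variance of one scaled coefficient: \<open>C0 + 1\<close> comes from count
  plus prior unit, and \<open>2 * (1 + C0\<^sup>2)\<close> from squaring a Haar value minus its
  empirical mean.\<close>

definition "C0 = 3 * F"
definition "V0 = 2 * (C0 + 1) * (1 + C0\<^sup>2)"

lemma C0_ge: "3 \<le> C0" using F_ge_1 by (simp add: C0_def)

lemma F_le_V0: "F \<le> V0"
proof -
  have "F * 1 \<le> (2 * (C0 + 1)) * (1 + C0\<^sup>2)"
    using F_ge_1 by (intro mult_mono) (auto simp: C0_def)
  then show ?thesis by (simp add: V0_def)
qed

text \<open>Each condition has one use: positions in the unit interval validate the bin formulas,
  the bound on the fine counts controls posterior variances, the coarse frequencies fix the limit
  covariance, and the last condition disposes of the level \<open>L n\<close>. The exponent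
  \<open>3/4\<close> may be anything strictly between \<open>1/2\<close> and
  \<open>1\<close>.\<close>

definition good :: "nat \<Rightarrow> nat \<Rightarrow> (nat \<Rightarrow> real) set" where
  "good J n = {x \<in> space (P n). (\<forall>i<n. 0 < x i \<and> x i \<le> 1) \<and>
     (\<forall>j<2 ^ L n. real (bin_count (L n) n x j) \<le> C0 * real n / 2 ^ L n) \<and>
     (\<forall>j<2 ^ Suc J. \<bar>real (bin_count (Suc J) n x j) - real n * q (Suc J) j\<bar> \<le> real n powr (3/4)) \<and>
     (\<forall>k<2 ^ L n. sqrt (real n) * \<bar>empirical_coeff n x (int (L n)) k - \<theta> (int (L n)) k\<bar> \<le> (F + 2) * sqrt (real (L n)))}"

lemma component_P: "i < n \<Longrightarrow> (\<lambda>x. x i) \<in> borel_measurable (P n)"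
  using measurable_component_singleton[of i "{..<n}" "\<lambda>_. borel"] measurable_cong_sets[OF sets_P refl] by blast

lemma AE_P_pos: "AE x in P n. \<forall>i<n. 0 < x i \<and> x i \<le> 1"
proof -
  have "AE x in P n. \<forall>i\<in>{..<n}. 0 < x i \<and> x i \<le> 1"
    unfolding P_def using AE_P0
    by (intro AE_finite_allI AE_PiM_component) (auto intro: prob_space_P0)
  then show ?thesis by (simp add: Ball_def)
qed

lemma unit_sample_sets: "{x \<in> space (P n). \<forall>i<n. 0 < x i \<and> x i \<le> 1} \<in> sets (P n)"
proof -
  have "{x \<in> space (P n). \<forall>i\<in>{..<n}. 0 < x i \<and> x i \<le> 1} \<in> sets (P n)"
    by (intro sets.sets_Collect_finite_All sets.sets_Collect_conj borel_measurable_less borel_measurable_le component_P borel_measurable_const) auto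
  moreover have "{x \<in> space (P n). \<forall>i\<in>{..<n}. 0 < x i \<and> x i \<le> 1} = {x \<in> space (P n). \<forall>i<n. 0 < x i \<and> x i \<le> 1}" by auto
  ultimately show ?thesis by argo
qed

definition "bad1 n j = {x \<in> space (P n). (\<forall>i<n. 0 < x i \<and> x i \<le> 1) \<and> 2 * F * real n / 2 ^ L n \<le> \<bar>real (bin_count (L n) n x j) - real n * q (L n) j\<bar>}"
definition "bad2 J n j = {x \<in> space (P n). (\<forall>i<n. 0 < x i \<and> x i \<le> 1) \<and> real n powr (3/4) \<le> \<bar>real (bin_count (Suc J) n x j) - real n * q (Suc J) j\<bar>}"
definition "bad3 n k = {x \<in> space (P n). (F + 2) * sqrt (real (L n)) \<le> sqrt (real n) * \<bar>empirical_coeff n x (int (L n)) k - \<theta> (int (L n)) k\<bar>}"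

lemma bad_sets: "bad1 n j \<in> sets (P n)" "bad2 J n j \<in> sets (P n)" "bad3 n k \<in> sets (P n)"
proof -
  have "{x \<in> space (P n). a \<le> \<bar>real (bin_count m n x j) - b\<bar>} \<in> sets (P n)" for a b m j by measurable
  then have "{x \<in> space (P n). \<forall>i<n. 0 < x i \<and> x i \<le> 1} \<inter> {x \<in> space (P n). a \<le> \<bar>real (bin_count m n x j) - b\<bar>} \<in> sets (P n)" for a b m j
    using unit_sample_sets by blast
  then show "bad1 n j \<in> sets (P n)" "bad2 J n j \<in> sets (P n)"
    unfolding bad1_def bad2_def by (simp_all add: Collect_conj_eq[symmetric] Int_def conj_ac cong: conj_cong)
  show "bad3 n k \<in> sets (P n)" unfolding bad3_def by measurable
qed

lemma good_sets: "good J n \<in> sets (P n)"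
proof -
  have 1: "{x \<in> space (P n). \<forall>j\<in>{..<2 ^ L n}. real (bin_count (L n) n x j) \<le> C0 * real n / 2 ^ L n} \<in> sets (P n)"
    by (intro sets.sets_Collect_finite_All borel_measurable_le) auto
  have 2: "{x \<in> space (P n). \<forall>j\<in>{..<2 ^ Suc J}. \<bar>real (bin_count (Suc J) n x j) - real n * q (Suc J) j\<bar> \<le> real n powr (3/4)} \<in> sets (P n)"
    by (intro sets.sets_Collect_finite_All borel_measurable_le borel_measurable_abs borel_measurable_diff) auto
  have 3: "{x \<in> space (P n). \<forall>k\<in>{..<2 ^ L n}. sqrt (real n) * \<bar>empirical_coeff n x (int (L n)) k - \<theta> (int (L n)) k\<bar> \<le> (F + 2) * sqrt (real (L n))} \<in> sets (P n)"
    by (intro sets.sets_Collect_finite_All borel_measurable_le borel_measurable_times borel_measurable_abs borel_measurable_diff) auto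
  show ?thesis
    using sets.Int[OF unit_sample_sets[of n] sets.Int[OF 1 sets.Int[OF 2 3]]]
    by (rule back_subst[of "\<lambda>X. X \<in> sets (P n)"]) (auto simp: good_def)
qed

lemma good_prob: "(\<lambda>n. measure (P n) (good J n)) \<longlonglongrightarrow> 1"
proof -
  \<comment> \<open>The three terms bound the failures of the fine counts, the coarse counts and the
    top-level coefficients, with Chernoff parameters \<open>1\<close>, \<open>1 / sqrt n\<close> and
    \<open>sqrt (L n)\<close>.\<close>
  define e where "e n = 2 * sqrt (real n) * exp (- sqrt (real n)) + 2 ^ Suc J * (2 * exp (1 - real n powr (1/4))) + 2 * exp (- real (L n))" for n
  have "(\<lambda>n. 2 * sqrt (real n) * exp (- sqrt (real n))) \<longlonglongrightarrow> 0" "(\<lambda>n. 2 ^ Suc J * (2 * exp (1 - real n powr (1/4)))) \<longlonglongrightarrow> 0"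
    by real_asymp+
  moreover have "(\<lambda>n. 2 * exp (- real (L n))) \<longlonglongrightarrow> 0"
  proof -
    have "(\<lambda>m::nat. 2 * exp (- real m)) \<longlonglongrightarrow> 0" by real_asymp
    from filterlim_compose[OF this L_at_top] show ?thesis .
  qed
  ultimately have e0: "(\<lambda>n. 1 - e n) \<longlonglongrightarrow> 1 - (0 + 0 + 0)" unfolding e_def by (intro tendsto_intros)
  \<comment> \<open>The factor \<open>1/2\<close> makes the parameter \<open>sqrt (L n)\<close>
    admissible: \<open>2 * sqrt (L n) * 2 powr (L n / 2)\<close> is at most
    \<open>2 * 2 ^ L n\<close>.\<close>
  have "\<forall>\<^sub>F n in sequentially. 2 ^ L n \<le> (1/2) * sqrt (real n)" by (rule eventually_bins_le) simp
  then have "\<forall>\<^sub>F n in sequentially. 1 - e n \<le> measure (P n) (good J n)"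
    using eventually_gt_at_top[of 0]
  proof eventually_elim
    case (elim n)
    have n: "0 < real n" "0 < sqrt (real n)" using elim by auto
    have le_sqrt: "2 ^ L n \<le> sqrt (real n)" using elim n(2) by linarith
    define U where "U = {x \<in> space (P n). \<not> (\<forall>i<n. 0 < x i \<and> x i \<le> 1)}"
    have U: "U \<in> sets (P n)" 
      using sets.Diff[OF sets.top unit_sample_sets[of n]] by (rule back_subst[of "\<lambda>X. X \<in> sets (P n)"]) (auto simp: U_def)
    have U0: "measure (P n) U = 0"
      using AE_P_pos[of n] AE_iff_measurable[OF U, of "\<lambda>x. \<forall>i<n. 0 < x i \<and> x i \<le> 1"] by (simp add: U_def measure_def)
    have sub: "space (P n) - good J n \<subseteq> U \<union> (\<Union>j\<in>{..<2 ^ L n}. bad1 n j) \<union> (\<Union>j\<in>{..<2 ^ Suc J}. bad2 J n j) \<union> (\<Union>k\<in>{..<2 ^ L n}. bad3 n k)"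
    proof
      fix x assume x: "x \<in> space (P n) - good J n"
      show "x \<in> U \<union> (\<Union>j\<in>{..<2 ^ L n}. bad1 n j) \<union> (\<Union>j\<in>{..<2 ^ Suc J}. bad2 J n j) \<union> (\<Union>k\<in>{..<2 ^ L n}. bad3 n k)"
      proof (cases "x \<in> U")
        case False
        then have xU: "\<forall>i<n. 0 < x i \<and> x i \<le> 1" using x by (auto simp: U_def)
        then consider j where "j < 2 ^ L n" "C0 * real n / 2 ^ L n < real (bin_count (L n) n x j)"
          | j where "j < 2 ^ Suc J" "real n powr (3/4) < \<bar>real (bin_count (Suc J) n x j) - real n * q (Suc J) j\<bar>"
          | k where "k < 2 ^ L n" "(F + 2) * sqrt (real (L n)) < sqrt (real n) * \<bar>empirical_coeff n x (int (L n)) k - \<theta> (int (L n)) k\<bar>"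
          using x by (auto simp: good_def not_le)
        then show ?thesis
        proof cases
          case 1
          have "real n * q (L n) j \<le> real n * (F / 2 ^ L n)" using q_bounds(1)[OF 1(1)] by (intro mult_left_mono) auto
          then have "2 * F * real n / 2 ^ L n \<le> \<bar>real (bin_count (L n) n x j) - real n * q (L n) j\<bar>"
            using 1(2)
          proof -
            define z where "z = F * real n / 2 ^ L n"
            have "real n * q (L n) j \<le> z" "3 * z < real (bin_count (L n) n x j)" "2 * F * real n / 2 ^ L n = 2 * z"
              using 1(2) \<open>real n * q (L n) j \<le> _\<close> by (simp_all add: z_def C0_def mult_ac)
            then show ?thesis by linarith
          qed
          then have "x \<in> bad1 n j" using x xU by (simp add: bad1_def)
          then show ?thesis using 1(1) by blast
        next
          case 2
          then have "x \<in> bad2 J n j" using x xU by (simp add: bad2_def)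
          then show ?thesis using 2(1) by blast
        next
          case 3
          then have "x \<in> bad3 n k" using x by (simp add: bad3_def)
          then show ?thesis using 3(1) by blast
        qed
      qed simp
    qed
    have b1: "measure (P n) (bad1 n j) \<le> 2 * exp (- sqrt (real n))" if "j < 2 ^ L n" for j
    proof -
      have "measure (P n) (bad1 n j) \<le> 2 * exp (- 1 * (2 * F * real n / 2 ^ L n) + 1\<^sup>2 * (n * q (L n) j))"
        unfolding bad1_def by (rule bin_count_chernoff[OF that]) auto
      also have "\<dots> \<le> 2 * exp (- (F * real n / 2 ^ L n))"
      proof -
        define z where "z = F * real n / 2 ^ L n"
        have z: "real n * q (L n) j \<le> z" "2 * F * real n / 2 ^ L n = 2 * z"
          using mult_left_mono[OF q_bounds(1)[OF that], of "real n"] by (simp_all add: z_def mult_ac)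
        show ?thesis unfolding z(2) z_def[symmetric] using z(1) by simp
      qed
      also have "\<dots> \<le> 2 * exp (- sqrt (real n))"
      proof -
        have "sqrt (real n) * 2 ^ L n \<le> sqrt (real n) * sqrt (real n)" using le_sqrt by (intro mult_left_mono) auto
        also have "\<dots> \<le> F * real n" using mult_right_mono[OF F_ge_1, of "real n"] by simp
        finally show ?thesis by (simp add: pos_le_divide_eq)
      qed
      finally show ?thesis .
    qed
    have b2: "measure (P n) (bad2 J n j) \<le> 2 * exp (1 - real n powr (1/4))" if "j < 2 ^ Suc J" for j
    proof -
      have sq: "(1 / sqrt (real n)) * real n powr (3/4) = real n powr (1/4)"
        using n by (simp add: powr_half_sqrt[symmetric] powr_diff[symmetric])
      have "q (Suc J) j \<le> 1" by (simp add: q_def)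
      have "measure (P n) (bad2 J n j) \<le> 2 * exp (- (1 / sqrt (real n)) * real n powr (3/4) + (1 / sqrt (real n))\<^sup>2 * (n * q (Suc J) j))"
        unfolding bad2_def by (rule bin_count_chernoff[OF that]) (use elim in auto)
      also have "\<dots> = 2 * exp (q (Suc J) j - real n powr (1/4))"
        using sq n by (simp add: power_divide)
      also have "\<dots> \<le> 2 * exp (1 - real n powr (1/4))" using \<open>q (Suc J) j \<le> 1\<close> by simp
      finally show ?thesis .
    qed
    have b3: "measure (P n) (bad3 n k) \<le> 2 * exp (- 2 * real (L n))" if "k < 2 ^ L n" for k
    proof -
      \<comment> \<open>The threshold factor \<open>F + 2\<close> leaves the exponent
        \<open>- 2 * L n\<close> after the variance term, enough for a union over
        \<open>2 ^ L n \<le> exp (L n)\<close> coefficients.\<close>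
      have "measure (P n) (bad3 n k) \<le> 2 * exp (- sqrt (real (L n)) * ((F + 2) * sqrt (real (L n))) + (sqrt (real (L n)))\<^sup>2 * F)"
        unfolding bad3_def
      proof (rule haar_chernoff)
        have "sqrt (real (L n)) \<le> sqrt (2 ^ L n)" using less_exp[of "L n"] by (simp add: less_imp_le)
        moreover have "2 powr (real_of_int (int (L n)) / 2) = sqrt (2 ^ L n)"
          by (simp add: powr_half_sqrt[symmetric] powr_realpow[symmetric] powr_powr)
        ultimately have "sqrt (real (L n)) * 2 powr (real_of_int (int (L n)) / 2) \<le> sqrt (2 ^ L n) * sqrt (2 ^ L n)"
          by (intro mult_mono) auto
        then show "2 * sqrt (real (L n)) * 2 powr (real_of_int (int (L n)) / 2) \<le> sqrt (real n)" using elim by simp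
      qed (use that elim in auto)
      also have "- sqrt (real (L n)) * ((F + 2) * sqrt (real (L n))) + (sqrt (real (L n)))\<^sup>2 * F = - 2 * real (L n)"
      proof -
        have "r * ((F + 2) * r) = (F + 2) * r\<^sup>2" for r :: real by (simp add: power2_eq_square)
        then show ?thesis by (simp add: algebra_simps)
      qed
      finally show ?thesis .
    qed
    have ex: "(2::real) ^ L n \<le> exp (real (L n))"
    proof -
      have "(2::real) ^ L n \<le> exp 1 ^ L n" using exp_ge_add_one_self[of 1] by (intro power_mono) auto
      then show ?thesis by (simp add: exp_of_nat_mult[symmetric])
    qed
    have "measure (P n) (space (P n) - good J n) \<le> measure (P n) (U \<union> (\<Union>j\<in>{..<2 ^ L n}. bad1 n j) \<union> (\<Union>j\<in>{..<2 ^ Suc J}. bad2 J n j) \<union> (\<Union>k\<in>{..<2 ^ L n}. bad3 n k))"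
      using U bad_sets by (intro P.finite_measure_mono sub sets.Un sets.finite_UN) auto
    also have "\<dots> \<le> measure (P n) U + measure (P n) (\<Union>j\<in>{..<2 ^ L n}. bad1 n j) + measure (P n) (\<Union>j\<in>{..<2 ^ Suc J}. bad2 J n j) + measure (P n) (\<Union>k\<in>{..<2 ^ L n}. bad3 n k)"
      using U bad_sets by (intro order_trans[OF measure_Un_le] add_mono order_refl sets.Un sets.finite_UN) auto
    also have "\<dots> \<le> 0 + (\<Sum>j<(2::nat) ^ L n. 2 * exp (- sqrt (real n))) + (\<Sum>j<(2::nat) ^ Suc J. 2 * exp (1 - real n powr (1/4))) + (\<Sum>k<(2::nat) ^ L n. 2 * exp (- 2 * real (L n)))"
    proof (intro add_mono)
      show "measure (P n) U \<le> 0" using U0 by simp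
      show "measure (P n) (\<Union>j\<in>{..<2 ^ L n}. bad1 n j) \<le> (\<Sum>j<(2::nat) ^ L n. 2 * exp (- sqrt (real n)))"
        using bad_sets b1 by (intro order_trans[OF P.finite_measure_subadditive_finite] sum_mono) auto
      show "measure (P n) (\<Union>j\<in>{..<2 ^ Suc J}. bad2 J n j) \<le> (\<Sum>j<(2::nat) ^ Suc J. 2 * exp (1 - real n powr (1/4)))"
        using bad_sets b2 by (intro order_trans[OF P.finite_measure_subadditive_finite] sum_mono) auto
      show "measure (P n) (\<Union>k\<in>{..<2 ^ L n}. bad3 n k) \<le> (\<Sum>k<(2::nat) ^ L n. 2 * exp (- 2 * real (L n)))"
        using bad_sets b3 by (intro order_trans[OF P.finite_measure_subadditive_finite] sum_mono) auto
    qed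
    also have "\<dots> = 2 ^ L n * (2 * exp (- sqrt (real n))) + 2 ^ Suc J * (2 * exp (1 - real n powr (1/4))) + 2 ^ L n * (2 * exp (- 2 * real (L n)))"
      by simp
    also have "\<dots> \<le> e n"
    proof -
      have "2 ^ L n * (2 * exp (- sqrt (real n))) \<le> sqrt (real n) * (2 * exp (- sqrt (real n)))"
        using le_sqrt by (intro mult_right_mono) auto
      moreover have "2 ^ L n * (2 * exp (- 2 * real (L n))) \<le> exp (real (L n)) * (2 * exp (- 2 * real (L n)))"
        using ex by (intro mult_right_mono) auto
      moreover have "exp (real (L n)) * (2 * exp (- 2 * real (L n))) = 2 * exp (- real (L n))"
        by (simp add: exp_add[symmetric])
      moreover have "sqrt (real n) * (2 * exp (- sqrt (real n))) = 2 * sqrt (real n) * exp (- sqrt (real n))" by simp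
      ultimately show ?thesis unfolding e_def by linarith
    qed
    finally have "measure (P n) (space (P n) - good J n) \<le> e n" .
    then show ?case using P.prob_compl[OF good_sets[of J n]] by linarith
  qed
  then show ?thesis
    using e0 P.prob_le_1 by (intro tendsto_sandwich[OF _ _ e0[simplified] tendsto_const]) auto
qed

end

section \<open>The Gaussian limit\<close>

abbreviation gauss_product :: "nat \<Rightarrow> (nat \<Rightarrow> real) measure" where
  "gauss_product N \<equiv> (\<Pi>\<^sub>M i\<in>{..<N}. std_normal_distribution)"

lemma prob_space_gauss_product: "prob_space (gauss_product N)"
  by (intro prob_space_PiM prob_space_normal_density) simp

lemma sets_gauss_product [measurable_cong]: "sets (gauss_product N) = sets (\<Pi>\<^sub>M i\<in>{..<N}. borel)"
  by (intro sets_PiM_cong) auto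

text \<open>The normal approximation of product characteristic functions with all errors zero is an
  identity.\<close>

lemma gauss_product_char:
  "(LINT x|gauss_product N. iexp (\<Sum>c<N. a c * x c)) = of_real (exp (- (\<Sum>c<N. (a c)\<^sup>2) / 2))"
proof -
  have "norm ((LINT x|gauss_product N. iexp (\<Sum>c\<in>{..<N}. a c * x c)) - of_real (exp (- (\<Sum>c\<in>{..<N}. (a c)\<^sup>2) / 2))) \<le> (\<Sum>c\<in>{..<N}. 0 :: real)"
  proof (rule PiM_char_normal_approx)
    show "norm ((LINT x|std_normal_distribution. iexp (a c * x)) - of_real (exp (- (a c)\<^sup>2 / 2))) \<le> 0" for c
      using fun_cong[OF char_std_normal_distribution, of "a c"] by (simp add: char_def)
  qed (auto intro: prob_space_normal_density)
  then show ?thesis by simp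
qed

text \<open>By uniqueness of characteristic functions the linear form has the law of a positive
  multiple of one standard normal variable.\<close>

lemma gauss_product_no_atoms:
  assumes pos: "0 < (\<Sum>c<N. (a c)\<^sup>2)"
  shows "measure (gauss_product N) {x \<in> space (gauss_product N). (\<Sum>c<N. a c * x c) = y} = 0"
proof -
  interpret G: prob_space "gauss_product N" by (rule prob_space_gauss_product)
  interpret S: prob_space std_normal_distribution by (rule prob_space_normal_density) simp
  define s where "s = sqrt (\<Sum>c<N. (a c)\<^sup>2)"
  have s: "0 < s" "s\<^sup>2 = (\<Sum>c<N. (a c)\<^sup>2)" using pos by (auto simp: s_def)
  define X where "X x = (\<Sum>c<N. a c * x c)" for x
  have X[measurable]: "X \<in> borel_measurable (gauss_product N)" unfolding X_def by measurable
  have "distr (gauss_product N) borel X = distr std_normal_distribution borel (\<lambda>x. s * x)"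
  proof (rule Levy_uniqueness)
    show "real_distribution (distr (gauss_product N) borel X)" by (rule G.real_distribution_distr) measurable
    show "real_distribution (distr std_normal_distribution borel (\<lambda>x. s * x))" by (rule S.real_distribution_distr) measurable
    show "char (distr (gauss_product N) borel X) = char (distr std_normal_distribution borel (\<lambda>x. s * x))"
    proof
      fix t
      have "char (distr (gauss_product N) borel X) t = (LINT x|gauss_product N. iexp (\<Sum>c<N. (t * a c) * x c))"
        unfolding char_def by (subst integral_distr) (auto simp: X_def sum_distrib_left mult.assoc)
      also have "\<dots> = of_real (exp (- (\<Sum>c<N. (t * a c)\<^sup>2) / 2))" by (rule gauss_product_char)
      also have "(\<Sum>c<N. (t * a c)\<^sup>2) = (t * s)\<^sup>2" by (simp add: power_mult_distrib s sum_distrib_left)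
      also have "complex_of_real (exp (- (t * s)\<^sup>2 / 2)) = char std_normal_distribution (t * s)"
        by (simp add: char_std_normal_distribution)
      also have "\<dots> = char (distr std_normal_distribution borel (\<lambda>x. s * x)) t"
        unfolding char_def by (subst integral_distr) (auto simp: mult.assoc)
      finally show "char (distr (gauss_product N) borel X) t = char (distr std_normal_distribution borel (\<lambda>x. s * x)) t" .
    qed
  qed
  then have "measure (distr (gauss_product N) borel X) {y} = measure (distr std_normal_distribution borel (\<lambda>x. s * x)) {y}" by simp
  also have "\<dots> = measure std_normal_distribution {x. s * x = y}"
    by (simp add: measure_distr vimage_def)
  also have "{x. s * x = y} = {y / s}" using s(1) by (auto simp: field_simps)
  also have "measure std_normal_distribution {y / s} = 0"
    by (simp add: measure_def emeasure_density nn_integral_indicator_singleton)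
  finally have "measure (distr (gauss_product N) borel X) {y} = 0" .
  moreover have "measure (distr (gauss_product N) borel X) {y} = measure (gauss_product N) {x \<in> space (gauss_product N). X x = y}"
    by (subst measure_distr) (auto intro!: arg_cong[of _ _ "measure _"])
  ultimately show ?thesis by (simp add: X_def)
qed

context histogram_setting
begin

text \<open>Level \<open>-1\<close> is left out: there histograms, \<open>f0\<close> and the
  empirical measure of a sample in the unit interval all have coefficient \<open>1\<close>.\<close>

definition I :: "nat \<Rightarrow> (nat \<times> nat) set" where "I J = {(l, k). l \<le> J \<and> k < 2 ^ l}"

definition val :: "nat \<Rightarrow> nat \<times> nat \<Rightarrow> nat \<Rightarrow> real" where
  "val m i j = haar (int (fst i)) (snd i) ((real j + 1) / 2 ^ m)"

definition th :: "nat \<times> nat \<Rightarrow> real" where "th i = \<theta> (int (fst i)) (snd i)"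
definition wt :: "nat \<times> nat \<Rightarrow> real" where "wt i = w (int (fst i))"

text \<open>The P0-Brownian bridge on levels up to \<open>J\<close>, realised as a linear image of
  independent normals, one for each cell of level \<open>Suc J\<close>. Haar functions of these
  levels are constant on the cells, so the covariances are those of the Haar functions under
  \<open>P0\<close>.\<close>

definition Y :: "nat \<Rightarrow> nat \<times> nat \<Rightarrow> (nat \<Rightarrow> real) \<Rightarrow> real" where
  "Y J i x = (\<Sum>c<2 ^ Suc J. (sqrt (q (Suc J) c) * (val (Suc J) i c - th i)) * x c)"

text \<open>The variance under \<open>P0\<close> of the Haar combination with coefficients
  \<open>t\<close>, and at the same time that of the corresponding combination of the
  \<open>Y J i\<close>.\<close>

definition sig2 :: "nat \<Rightarrow> (nat \<times> nat \<Rightarrow> real) \<Rightarrow> real" where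
  "sig2 J t = (\<Sum>c<2 ^ Suc J. q (Suc J) c * (\<Sum>i\<in>I J. t i * (val (Suc J) i c - th i))\<^sup>2)"

abbreviation "gauss J \<equiv> gauss_product (2 ^ Suc J)"

text \<open>As a function of \<open>s\<close>, the distribution function of the Gaussian maximum
  over levels up to \<open>J\<close>, weighted by \<open>w\<close>.\<close>

definition FJ :: "nat \<Rightarrow> real \<Rightarrow> real" where
  "FJ J s = measure (gauss J) {x \<in> space (gauss J). \<forall>i\<in>I J. \<bar>Y J i x\<bar> \<le> s * wt i}"

lemma finite_I [simp]: "finite (I J)"
proof -
  have "I J \<subseteq> {..J} \<times> {..<2 ^ J}"
    unfolding I_def by (auto intro: less_le_trans power_increasing)
  then show ?thesis by (rule finite_subset) auto
qed

lemma I_0: "(0, 0) \<in> I J" by (simp add: I_def)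

lemma wt_ge_1: "1 \<le> wt i" unfolding wt_def by (rule w_ge_1) simp

lemma haar_val: "fst i < m \<Longrightarrow> 0 < x \<Longrightarrow> haar (int (fst i)) (snd i) x = val m i (bin_of m x)"
  unfolding val_def by (rule haar_bin) auto

lemma q_nonneg: "0 \<le> q m c" by (simp add: q_def)

lemma Y_measurable [measurable]: "Y J i \<in> borel_measurable (gauss J)"
  unfolding Y_def[abs_def] by measurable

lemma Y_char: "(LINT x|gauss J. iexp (\<Sum>i\<in>I J. t i * Y J i x)) = of_real (exp (- sig2 J t / 2))"
proof -
  have "(\<Sum>i\<in>I J. t i * Y J i x) = (\<Sum>c<2 ^ Suc J. (sqrt (q (Suc J) c) * (\<Sum>i\<in>I J. t i * (val (Suc J) i c - th i))) * x c)" for x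
    unfolding Y_def sum_distrib_left sum_distrib_right by (subst sum.swap) (simp add: mult_ac)
  then have "(LINT x|gauss J. iexp (\<Sum>i\<in>I J. t i * Y J i x))
     = of_real (exp (- (\<Sum>c<2 ^ Suc J. (sqrt (q (Suc J) c) * (\<Sum>i\<in>I J. t i * (val (Suc J) i c - th i)))\<^sup>2) / 2))"
    by (simp only: gauss_product_char)
  then show ?thesis by (simp only: power_mult_distrib real_sqrt_pow2[OF q_nonneg] sig2_def)
qed

text \<open>The Haar function takes different values on two cells of positive mass, so it cannot
  equal its mean on both and the variance is positive.\<close>

lemma Y_no_atoms:
  assumes i: "i \<in> I J"
  shows "measure (gauss J) {x \<in> space (gauss J). Y J i x = y} = 0"
  unfolding Y_def
proof (rule gauss_product_no_atoms)
  let ?m = "Suc J"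
  let ?z = "\<lambda>c. (sqrt (q ?m c) * (val ?m i c - th i))\<^sup>2"
  obtain l k where lk: "i = (l, k)" "l \<le> J" "k < 2 ^ l" using i by (auto simp: I_def)
  \<comment> \<open>\<open>c1\<close> and \<open>c2\<close> index the first cells of level
    \<open>Suc J\<close> in the left and the right half of the support.\<close>
  define c1 where "c1 = (2 * k) * 2 ^ (J - l)"
  define c2 where "c2 = (2 * k + 1) * 2 ^ (J - l)"
  have J: "2 ^ Suc J = (2 * 2 ^ l) * (2::nat) ^ (J - l)" using lk by (simp flip: power_add)
  have "2 * k + 1 < 2 * 2 ^ l" using lk by linarith
  then have c: "c1 < 2 ^ ?m" "c2 < 2 ^ ?m" unfolding J c1_def c2_def by (intro mult_strict_right_mono; simp)+
  have e: "real c1 / 2 ^ ?m = real k / 2 ^ l" "real c2 / 2 ^ ?m = (real k + 1/2) / 2 ^ l"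
  proof -
    have "(2::real) ^ Suc J = (2 * 2 ^ l) * 2 ^ (J - l)" using lk by (simp flip: power_add)
    then show "real c1 / 2 ^ ?m = real k / 2 ^ l" "real c2 / 2 ^ ?m = (real k + 1/2) / 2 ^ l"
      by (simp_all add: c1_def c2_def field_simps)
  qed
  have step: "1 / 2 ^ ?m \<le> (1/2) / (2::real) ^ l"
  proof -
    have "(2::real) ^ l \<le> 2 ^ J" using lk by (intro power_increasing) auto
    then show ?thesis by (simp add: field_simps)
  qed
  define p d h where "p = real k / 2 ^ l" and "d = 1 / (2::real) ^ ?m" and "h = (1/2) / (2::real) ^ l"
  have dh: "0 < d" "d \<le> h" using step by (auto simp: d_def h_def)
  have pts: "(real c1 + 1) / 2 ^ ?m = p + d" "(real c2 + 1) / 2 ^ ?m = p + h + d"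
    "(real k + 1/2) / 2 ^ l = p + h" "(real k + 1) / 2 ^ l = p + 2 * h"
    using e by (simp_all only: add_divide_distrib p_def d_def h_def)
  have hv: "haar (int l) k x = 2 powr (l / 2) * (indicator {p<..p + h} x - indicator {p + h<..p + 2 * h} x)" for x
    unfolding haar_def nat_int p_def[symmetric] pts(3,4) by simp
  have v1: "val ?m i c1 = 2 powr (l / 2)" and v2: "val ?m i c2 = - (2 powr (l / 2))"
    unfolding val_def lk fst_conv snd_conv pts(1,2) hv using dh by (simp_all add: indicator_def)
  have "val ?m i c1 \<noteq> val ?m i c2"
    unfolding v1 v2 using powr_gt_zero[of 2 "real l / 2"] by linarith
  then have "\<exists>c<2 ^ ?m. 0 < ?z c"
  proof (cases "val ?m i c1 = th i")
    case True
    then have "0 < ?z c2" using \<open>val ?m i c1 \<noteq> val ?m i c2\<close> q_bounds(2)[OF c(2)] by auto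
    then show ?thesis using c by blast
  next
    case False
    then have "0 < ?z c1" using q_bounds(2)[OF c(1)] by auto
    then show ?thesis using c by blast
  qed
  then show "0 < (\<Sum>c<2 ^ Suc J. (sqrt (q ?m c) * (val ?m i c - th i))\<^sup>2)"
    by (auto intro!: sum_pos2)
qed

lemma FJ_mono: "s \<le> s' \<Longrightarrow> FJ J s \<le> FJ J s'"
proof -
  assume s: "s \<le> s'"
  interpret G: prob_space "gauss J" by (rule prob_space_gauss_product)
  have "s * wt i \<le> s' * wt i" for i using s wt_ge_1[of i] by (intro mult_right_mono) auto
  then show ?thesis unfolding FJ_def
    by (intro G.finite_measure_mono sets.sets_Collect_finite_All borel_measurable_le borel_measurable_abs Y_measurable borel_measurable_const)
      (auto intro: order_trans)
qed

text \<open>An atom of the maximum would be one of some \<open>\<bar>Y J i\<bar>\<close>. So the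
  distribution function is continuous, it vanishes at \<open>0\<close>, and the intermediate value
  theorem yields a positive radius.\<close>

lemma FJ_quantile:
  assumes "0 < p" "p < 1"
  obtains s where "0 < s" "FJ J s = p"
proof -
  interpret G: prob_space "gauss J" by (rule prob_space_gauss_product)
  define V where "V x = Max ((\<lambda>i. \<bar>Y J i x\<bar> / wt i) ` I J)" for x
  have V[measurable]: "V \<in> borel_measurable (gauss J)"
    unfolding V_def
    by (intro borel_measurable_Max finite_I borel_measurable_divide borel_measurable_abs Y_measurable borel_measurable_const)
  let ?D = "distr (gauss J) borel V"
  interpret D: real_distribution ?D by (rule G.real_distribution_distr) measurable
  have V_le: "V x \<le> s \<longleftrightarrow> (\<forall>i\<in>I J. \<bar>Y J i x\<bar> \<le> s * wt i)" for x s
  proof -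
    have "V x \<le> s \<longleftrightarrow> (\<forall>i\<in>I J. \<bar>Y J i x\<bar> / wt i \<le> s)" unfolding V_def using I_0[of J] by (subst Max_le_iff) auto
    also have "\<dots> \<longleftrightarrow> (\<forall>i\<in>I J. \<bar>Y J i x\<bar> \<le> s * wt i)"
      using wt_ge_1 by (intro ball_cong refl pos_divide_le_eq) (auto intro: less_le_trans[OF zero_less_one])
    finally show ?thesis .
  qed
  have cdf: "cdf ?D s = FJ J s" for s
  proof -
    have "cdf ?D s = measure (gauss J) (V -` {..s} \<inter> space (gauss J))"
      unfolding cdf_def by (rule measure_distr[OF V]) simp
    also have "V -` {..s} \<inter> space (gauss J) = {x \<in> space (gauss J). \<forall>i\<in>I J. \<bar>Y J i x\<bar> \<le> s * wt i}"
      using V_le by auto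
    finally show ?thesis unfolding FJ_def .
  qed
  have atom: "measure (gauss J) {x \<in> space (gauss J). V x = s} = 0" for s
  proof -
    have sets1: "{x \<in> space (gauss J). Y J i x = y} \<in> sets (gauss J)" for i y by measurable
    have "{x \<in> space (gauss J). V x = s} \<subseteq> (\<Union>i\<in>I J. {x \<in> space (gauss J). Y J i x = s * wt i} \<union> {x \<in> space (gauss J). Y J i x = - (s * wt i)})"
    proof
      fix x assume x: "x \<in> {x \<in> space (gauss J). V x = s}"
      have "Max ((\<lambda>i. \<bar>Y J i x\<bar> / wt i) ` I J) \<in> (\<lambda>i. \<bar>Y J i x\<bar> / wt i) ` I J"
        using I_0[of J] by (intro Max_in) auto
      then obtain i where i: "i \<in> I J" "s = \<bar>Y J i x\<bar> / wt i" using x by (auto simp: V_def)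
      then have "\<bar>Y J i x\<bar> = s * wt i" using wt_ge_1[of i] by simp
      then show "x \<in> (\<Union>i\<in>I J. {x \<in> space (gauss J). Y J i x = s * wt i} \<union> {x \<in> space (gauss J). Y J i x = - (s * wt i)})"
        using i(1) x by (intro UN_I[of i]) (auto simp: abs_if split: if_splits)
    qed
    then have "measure (gauss J) {x \<in> space (gauss J). V x = s} \<le> measure (gauss J) (\<Union>i\<in>I J. {x \<in> space (gauss J). Y J i x = s * wt i} \<union> {x \<in> space (gauss J). Y J i x = - (s * wt i)})"
      using sets1 by (intro G.finite_measure_mono sets.finite_UN sets.Un) auto
    also have "\<dots> \<le> (\<Sum>i\<in>I J. measure (gauss J) ({x \<in> space (gauss J). Y J i x = s * wt i} \<union> {x \<in> space (gauss J). Y J i x = - (s * wt i)}))"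
      using sets1 by (intro G.finite_measure_subadditive_finite) auto
    also have "\<dots> \<le> (\<Sum>i\<in>I J. measure (gauss J) {x \<in> space (gauss J). Y J i x = s * wt i} + measure (gauss J) {x \<in> space (gauss J). Y J i x = - (s * wt i)})"
      using sets1 by (intro sum_mono measure_Un_le) auto
    also have "\<dots> = 0" by (intro sum.neutral ballI) (simp only: Y_no_atoms)
    finally show ?thesis by (simp add: measure_le_0_iff)
  qed
  have isC: "isCont (cdf ?D) s" for s
  proof -
    have "measure ?D {s} = measure (gauss J) (V -` {s} \<inter> space (gauss J))" by (rule measure_distr[OF V]) simp
    also have "V -` {s} \<inter> space (gauss J) = {x \<in> space (gauss J). V x = s}" by auto
    finally have "measure ?D {s} = 0" by (simp only: atom)
    then show ?thesis using D.isCont_cdf by blast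
  qed
  have zero: "cdf ?D 0 = 0"
  proof -
    have "cdf ?D 0 = measure (gauss J) {x \<in> space (gauss J). \<forall>i\<in>I J. \<bar>Y J i x\<bar> \<le> 0 * wt i}" unfolding cdf FJ_def ..
    also have "\<dots> \<le> measure (gauss J) {x \<in> space (gauss J). Y J (0, 0) x = 0}"
    proof (rule G.finite_measure_mono)
      show "{x \<in> space (gauss J). Y J (0, 0) x = 0} \<in> sets (gauss J)" by measurable
    qed (use I_0[of J] in auto)
    also have "\<dots> = 0" by (rule Y_no_atoms[OF I_0])
    finally show ?thesis using D.cdf_nonneg[of 0] by simp
  qed
  have "\<forall>\<^sub>F s in at_top. p < cdf ?D s" using D.cdf_lim_at_top_prob assms(2) by (rule order_tendstoD)
  then obtain b where b: "0 < b" "p < cdf ?D b"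
    by (metis (no_types, lifting) eventually_at_top_linorder gt_ex less_le_trans linorder_le_cases max.cobounded1 max.strict_coboundedI2 max.cobounded2 less_max_iff_disj)
  have "\<exists>s\<ge>0. s \<le> b \<and> cdf ?D s = p"
    by (rule IVT) (use assms zero b isC in \<open>simp_all del: power_Suc\<close>)
  then obtain s where s: "0 \<le> s" "cdf ?D s = p" by auto
  then have "s \<noteq> 0" using zero assms by auto
  then have "0 < s" using s(1) by simp
  moreover have "FJ J s = p" using s(2) unfolding cdf .
  ultimately show thesis by (rule that)
qed

section \<open>The empirical Haar coefficients\<close>

definition Z :: "nat \<Rightarrow> nat \<times> nat \<Rightarrow> (nat \<Rightarrow> real) \<Rightarrow> real" where
  "Z n i x = sqrt (real n) * (empirical_coeff n x (int (fst i)) (snd i) - th i)"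

lemma Z_measurable [measurable]: "Z n i \<in> borel_measurable (P n)"
  unfolding Z_def[abs_def] by measurable

text \<open>Central limit theorem for one fixed linear combination: the summands
  \<open>g (x d) / sqrt n\<close> are bounded, centred and have variance
  \<open>sig2 J t / n\<close>.\<close>

lemma Z_char: "(\<lambda>n. LINT x|P n. iexp (\<Sum>i\<in>I J. t i * Z n i x)) \<longlonglongrightarrow> of_real (exp (- sig2 J t / 2))"
proof -
  define g where "g x = (\<Sum>i\<in>I J. t i * (haar (int (fst i)) (snd i) x - th i))" for x
  define b where "b = (\<Sum>i\<in>I J. \<bar>t i\<bar> * (max 1 (2 powr (real_of_int (int (fst i)) / 2)) + \<bar>th i\<bar>))"
  have g[measurable]: "g \<in> borel_measurable borel" unfolding g_def[abs_def] by measurable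
  have hb: "\<bar>haar (int a) c x\<bar> \<le> max 1 (2 powr (real a / 2))" for a c x
    using haar_bounded[of "int a" c x] by simp
  have gb: "\<bar>g x\<bar> \<le> b" for x
    unfolding g_def b_def
    by (intro order_trans[OF sum_abs] sum_mono)
      (auto simp: abs_mult intro!: mult_left_mono order_trans[OF abs_triangle_ineq4] add_mono hb)
  have b0: "0 \<le> b" using gb[of 0] by linarith
  have g0: "P0.expectation g = 0"
  proof -
    have "P0.expectation g = (\<Sum>i\<in>I J. t i * (P0.expectation (haar (int (fst i)) (snd i)) - th i))"
      unfolding g_def by (subst Bochner_Integration.integral_sum) (auto simp: integrable_haar_P0)
    then show ?thesis by (simp add: expectation_haar th_def)
  qed
  have g2: "P0.expectation (\<lambda>x. (g x)\<^sup>2) = sig2 J t"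
  proof -
    have "P0.expectation (\<lambda>x. (g x)\<^sup>2) = (\<Sum>c<2 ^ Suc J. (\<Sum>i\<in>I J. t i * (val (Suc J) i c - th i))\<^sup>2 * q (Suc J) c)"
    proof (rule expectation_bin_function)
      fix x :: real assume x: "0 < x" "x \<le> 1"
      have "g x = (\<Sum>i\<in>I J. t i * (val (Suc J) i (bin_of (Suc J) x) - th i))"
        unfolding g_def using x by (intro sum.cong refl) (subst haar_val[of _ "Suc J"], auto simp: I_def)
      then show "(g x)\<^sup>2 = (\<Sum>i\<in>I J. t i * (val (Suc J) i (bin_of (Suc J) x) - th i))\<^sup>2" by simp
    qed measurable
    then show ?thesis by (simp add: sig2_def mult.commute)
  qed
  have sig0: "0 \<le> sig2 J t" unfolding g2[symmetric] by simp
  \<comment> \<open>The error of one summand times \<open>n\<close>; its cubic part leaves order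
    \<open>1 / sqrt n\<close>.\<close>
  define er where "er n = real n * ((b / sqrt (real n)) ^ 3 / 6 + (sig2 J t / real n)\<^sup>2 / 8)" for n
  have bound: "norm ((LINT x|P n. iexp (\<Sum>i\<in>I J. t i * Z n i x)) - of_real (exp (- sig2 J t / 2))) \<le> er n" if n: "0 < n" for n
  proof -
    define G where "G x = g x / sqrt (real n)" for x
    have [measurable]: "G \<in> borel_measurable borel" unfolding G_def[abs_def] by measurable
    have Gb: "\<bar>G x\<bar> \<le> b / sqrt (real n)" for x unfolding G_def using gb[of x] by (simp add: divide_right_mono)
    have Gk: "\<bar>G x\<bar> ^ k \<le> (b / sqrt (real n)) ^ k" for x k by (intro power_mono Gb) simp
    have iG: "integrable P0 (\<lambda>x. \<bar>G x\<bar> ^ 3)" "integrable P0 G" "integrable P0 (\<lambda>x. (G x)\<^sup>2)"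
    proof -
      show "integrable P0 (\<lambda>x. \<bar>G x\<bar> ^ 3)"
        by (rule P0.integrable_const_bound[where B="(b / sqrt (real n)) ^ 3"]) (use Gk[of _ 3] in \<open>simp, measurable\<close>)
      show "integrable P0 G"
        by (rule P0.integrable_const_bound[where B="b / sqrt (real n)"]) (use Gb in \<open>simp, measurable\<close>)
      show "integrable P0 (\<lambda>x. (G x)\<^sup>2)"
        by (rule P0.integrable_const_bound[where B="(b / sqrt (real n)) ^ 2"]) (use Gk[of _ 2] in \<open>simp, measurable\<close>)
    qed
    have meanG: "P0.expectation G = 0" unfolding G_def using g0 by simp
    have varG: "P0.expectation (\<lambda>x. (G x)\<^sup>2) = sig2 J t / real n"
      unfolding G_def using g2 by (simp add: power_divide)
    have "norm ((LINT x|P0. iexp (G x)) - of_real (exp (- (sig2 J t / real n) / 2))) \<le> P0.expectation (\<lambda>x. \<bar>G x\<bar> ^ 3) / 6 + (sig2 J t / real n)\<^sup>2 / 8"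
      by (rule P0.char_normal_approx[OF _ iG(1,2,3) meanG varG]) measurable
    moreover have "P0.expectation (\<lambda>x. \<bar>G x\<bar> ^ 3) \<le> P0.expectation (\<lambda>x. (b / sqrt (real n)) ^ 3)"
      by (intro integral_mono iG(1) Gk) simp
    ultimately have one: "norm ((LINT x|P0. iexp (G x)) - of_real (exp (- (sig2 J t / real n) / 2))) \<le> (b / sqrt (real n)) ^ 3 / 6 + (sig2 J t / real n)\<^sup>2 / 8"
      by simp
    have "norm ((LINT x|P n. iexp (\<Sum>d\<in>{..<n}. G (x d))) - of_real (exp (- (\<Sum>d\<in>{..<n}. sig2 J t / real n) / 2))) \<le> (\<Sum>d\<in>{..<n}. (b / sqrt (real n)) ^ 3 / 6 + (sig2 J t / real n)\<^sup>2 / 8)"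
      unfolding P_def by (rule PiM_char_normal_approx) (use one prob_space_P0 sig0 in auto)
    moreover have "(\<Sum>d\<in>{..<n}. G (x d)) = (\<Sum>i\<in>I J. t i * Z n i x)" for x
    proof -
      have "(\<Sum>i\<in>I J. t i * Z n i x) = (\<Sum>i\<in>I J. \<Sum>d<n. t i * (haar (int (fst i)) (snd i) (x d) - th i) / sqrt (real n))"
      proof (intro sum.cong refl)
        fix i
        have "Z n i x = (\<Sum>d<n. haar (int (fst i)) (snd i) (x d) - th i) / sqrt (real n)"
        proof -
          have "r * (S / r\<^sup>2 - u) = (S - r\<^sup>2 * u) / r" if "r > 0" for r S u :: real
            using that by (simp add: field_simps power2_eq_square)
          from this[of "sqrt (real n)"] show ?thesis
            using n by (simp add: Z_def empirical_coeff_def sum_subtractf)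
        qed
        then show "t i * Z n i x = (\<Sum>d<n. t i * (haar (int (fst i)) (snd i) (x d) - th i) / sqrt (real n))"
          by (simp add: sum_distrib_left sum_divide_distrib)
      qed
      also have "\<dots> = (\<Sum>d<n. G (x d))" unfolding G_def g_def sum_divide_distrib by (rule sum.swap)
      finally show ?thesis by simp
    qed
    ultimately show ?thesis using n by (simp add: er_def)
  qed
  have "er \<longlonglongrightarrow> 0"
  proof -
    have "(\<lambda>n. real n * ((b / sqrt (real n)) ^ 3 / 6 + (sg / real n)\<^sup>2 / 8)) \<longlonglongrightarrow> 0" for sg :: real
    proof -
      have "(\<lambda>n. b ^ 3 / 6 * (1 / sqrt (real n)) + sg\<^sup>2 / 8 * (1 / real n)) \<longlonglongrightarrow> b ^ 3 / 6 * 0 + sg\<^sup>2 / 8 * 0"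
        by (intro tendsto_intros) real_asymp+
      moreover have "\<forall>\<^sub>F n in sequentially. b ^ 3 / 6 * (1 / sqrt (real n)) + sg\<^sup>2 / 8 * (1 / real n) = real n * ((b / sqrt (real n)) ^ 3 / 6 + (sg / real n)\<^sup>2 / 8)"
        using eventually_gt_at_top[of 0]
      proof eventually_elim
        case (elim n)
        define r where "r = sqrt (real n)"
        have r: "r > 0" "real n = r\<^sup>2" using elim by (auto simp: r_def)
        show ?case unfolding r_def[symmetric] r(2) using r(1) by (simp add: field_simps power2_eq_square power3_eq_cube)
      qed
      ultimately show ?thesis by (simp add: tendsto_cong)
    qed
    then show ?thesis unfolding er_def .
  qed
  then have "(\<lambda>n. (LINT x|P n. iexp (\<Sum>i\<in>I J. t i * Z n i x)) - of_real (exp (- sig2 J t / 2))) \<longlonglongrightarrow> 0"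
    by (rule Lim_null_comparison[rotated]) (rule eventually_mono[OF eventually_gt_at_top[of 0] bound])
  then show ?thesis by (simp add: LIM_zero_iff)
qed

lemma Z_box:
  assumes "0 \<le> s"
  shows "(\<lambda>n. measure (P n) {x \<in> space (P n). \<forall>i\<in>I J. \<bar>Z n i x\<bar> \<le> s * wt i}) \<longlonglongrightarrow> FJ J s"
proof -
  interpret box_limit P "gauss J" by (rule box_limit.intro) (rule prob_space_P, rule prob_space_gauss_product)
  show ?thesis
    unfolding FJ_def
  proof (rule box_probability_tendsto)
    show "(\<lambda>n. LINT x|P n. iexp (\<Sum>i\<in>I J. t i * Z n i x)) \<longlonglongrightarrow> (LINT x|gauss J. iexp (\<Sum>i\<in>I J. t i * Y J i x))" for t
      unfolding Y_char by (rule Z_char)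
    show "0 \<le> s * wt i" for i using assms wt_ge_1[of i] by auto
    show "measure (gauss J) {x \<in> space (gauss J). Y J i x = y} = 0" if "i \<in> I J" for i y by (rule Y_no_atoms[OF that])
  qed (rule finite_I Z_measurable Y_measurable)+
qed

lemma Z_box_sets: "{x \<in> space (P n). \<forall>i\<in>I J. \<bar>Z n i x\<bar> \<le> s * wt i} \<in> sets (P n)"
  by (intro sets.sets_Collect_finite_All borel_measurable_le borel_measurable_abs Z_measurable) auto

text \<open>For different \<open>J\<close> the Gaussian vectors live on different spaces, so the
  comparison is made between sampling probabilities, where more levels mean a smaller event, and
  passed to the limit.\<close>

lemma FJ_le_F0: "0 \<le> s \<Longrightarrow> FJ J s \<le> FJ 0 s"
proof (rule LIMSEQ_le[OF Z_box Z_box])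
  have "I 0 \<subseteq> I J" by (auto simp: I_def)
  then show "\<exists>N. \<forall>n\<ge>N. measure (P n) {x \<in> space (P n). \<forall>i\<in>I J. \<bar>Z n i x\<bar> \<le> s * wt i} \<le> measure (P n) {x \<in> space (P n). \<forall>i\<in>I 0. \<bar>Z n i x\<bar> \<le> s * wt i}"
    by (intro exI allI impI P.finite_measure_mono Z_box_sets) auto
qed auto

text \<open>With Chernoff parameter \<open>sqrt l\<close> the exponent is at most
  \<open>- (2 * V0 + 2) * l + F * l\<close>, and \<open>F \<le> 2 * V0\<close> leaves
  \<open>- 2 * l\<close>. The constant is dictated by the posterior side, whose variance proxy is
  \<open>2 * V0\<close>, so that one choice of \<open>J\<close> serves both.\<close>

lemma freq_tail:
  assumes s: "\<And>l. J < l \<Longrightarrow> (2 * V0 + 2) * sqrt (real l) \<le> s * w (int l)"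
  shows "\<forall>\<^sub>F n in sequentially. measure (P n) {x \<in> space (P n). \<forall>i\<in>I J. \<bar>Z n i x\<bar> \<le> s * wt i} - 2 / 2 ^ J
     \<le> measure (P n) {x \<in> space (P n). \<forall>i\<in>I (L n). \<bar>Z n i x\<bar> \<le> s * wt i}"
proof -
  have "\<forall>\<^sub>F n in sequentially. 2 ^ L n \<le> (1/2) * sqrt (real n)" by (rule eventually_bins_le) simp
  then show ?thesis using eventually_gt_at_top[of 0]
  proof eventually_elim
    case (elim n)
    define B where "B l k x \<longleftrightarrow> s * w (int l) \<le> sqrt (real n) * \<bar>empirical_coeff n x (int l) k - \<theta> (int l) k\<bar>" for l k x
    define T where "T = {x \<in> space (P n). \<exists>l k. J < l \<and> l \<le> L n \<and> k < 2 ^ l \<and> B l k x}"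
    have Bm: "{x \<in> space (P n). B l k x} \<in> sets (P n)" for l k unfolding B_def by measurable
    have bd: "measure (P n) {x \<in> space (P n). B l k x} \<le> 2 * exp (- 2 * real l)" if l: "J < l" "l \<le> L n" "k < 2 ^ l" for l k
    proof -
      have "measure (P n) {x \<in> space (P n). B l k x} \<le> 2 * exp (- sqrt (real l) * (s * w (int l)) + (sqrt (real l))\<^sup>2 * F)"
        unfolding B_def
      proof (rule haar_chernoff)
        have "sqrt (real l) \<le> sqrt (2 ^ L n)"
        proof -
          have "real l \<le> 2 ^ l" using less_exp[of l] by (simp add: less_imp_le)
          also have "(2::real) ^ l \<le> 2 ^ L n" using l by (intro power_increasing) auto
          finally show ?thesis by simp
        qed
        moreover have "2 powr (real_of_int (int l) / 2) \<le> sqrt (2 ^ L n)"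
        proof -
          have "2 powr (real_of_int (int l) / 2) \<le> 2 powr (real (L n) / 2)" using l by (intro powr_mono) auto
          also have "\<dots> = sqrt (2 ^ L n)" by (simp add: powr_half_sqrt[symmetric] powr_realpow[symmetric] powr_powr)
          finally show ?thesis .
        qed
        ultimately have "sqrt (real l) * 2 powr (real_of_int (int l) / 2) \<le> sqrt (2 ^ L n) * sqrt (2 ^ L n)"
          by (intro mult_mono) auto
        then show "2 * sqrt (real l) * 2 powr (real_of_int (int l) / 2) \<le> sqrt (real n)" using elim by simp
      qed (use l elim in auto)
      also have "\<dots> \<le> 2 * exp (- 2 * real l)"
      proof -
        have "sqrt (real l) * ((2 * V0 + 2) * sqrt (real l)) \<le> sqrt (real l) * (s * w (int l))"
          by (rule mult_left_mono[OF s[OF l(1)]]) simp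
        moreover have "sqrt (real l) * ((2 * V0 + 2) * sqrt (real l)) = 2 * V0 * real l + 2 * real l"
        proof -
          have "r * ((2 * V0 + 2) * r) = (2 * V0 + 2) * (r * r)" for r :: real by (simp only: mult_ac)
          then show ?thesis by (simp add: distrib_right)
        qed
        moreover have "real l * F \<le> 2 * V0 * real l"
        proof -
          have "F \<le> 2 * V0" using F_le_V0 F_ge_1 by linarith
          then have "real l * F \<le> real l * (2 * V0)" by (intro mult_left_mono) auto
          then show ?thesis by (simp add: mult_ac)
        qed
        ultimately show ?thesis by simp
      qed
      finally show ?thesis .
    qed
    have T: "measure (P n) T \<le> 2 / 2 ^ J" "T \<in> sets (P n)"
      unfolding T_def using P.haar_union_bound[where J=J and m="L n" and B=B and n=n] Bm bd by blast+
    have sub: "{x \<in> space (P n). \<forall>i\<in>I J. \<bar>Z n i x\<bar> \<le> s * wt i} \<subseteq> {x \<in> space (P n). \<forall>i\<in>I (L n). \<bar>Z n i x\<bar> \<le> s * wt i} \<union> T"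
    proof
      fix x assume x: "x \<in> {x \<in> space (P n). \<forall>i\<in>I J. \<bar>Z n i x\<bar> \<le> s * wt i}"
      show "x \<in> {x \<in> space (P n). \<forall>i\<in>I (L n). \<bar>Z n i x\<bar> \<le> s * wt i} \<union> T"
      proof (rule ccontr)
        assume "x \<notin> {x \<in> space (P n). \<forall>i\<in>I (L n). \<bar>Z n i x\<bar> \<le> s * wt i} \<union> T"
        then obtain l k where lk: "l \<le> L n" "k < 2 ^ l" "s * wt (l, k) < \<bar>Z n (l, k) x\<bar>" and xT: "x \<notin> T"
          using x by (auto simp: I_def not_le)
        have "J < l"
        proof (rule ccontr)
          assume "\<not> J < l"
          then have "(l, k) \<in> I J" using lk by (auto simp: I_def)
          then show False using x lk(3) by force
        qed
        moreover have "B l k x" using lk(3) by (simp add: B_def Z_def wt_def th_def abs_mult)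
        ultimately show False using xT x lk by (auto simp: T_def)
      qed
    qed
    have "measure (P n) {x \<in> space (P n). \<forall>i\<in>I J. \<bar>Z n i x\<bar> \<le> s * wt i} \<le> measure (P n) ({x \<in> space (P n). \<forall>i\<in>I (L n). \<bar>Z n i x\<bar> \<le> s * wt i} \<union> T)"
      using Z_box_sets T(2) by (intro P.finite_measure_mono sub sets.Un)
    also have "\<dots> \<le> measure (P n) {x \<in> space (P n). \<forall>i\<in>I (L n). \<bar>Z n i x\<bar> \<le> s * wt i} + measure (P n) T"
      using Z_box_sets T(2) by (intro measure_Un_le)
    finally show ?case using T(1) by linarith
  qed
qed

end

section \<open>Concentration and normality of the posterior on typical samples\<close>

lemma sum_bin_count:
  fixes \<phi> :: "nat \<Rightarrow> real"
  assumes "\<And>i. i < n \<Longrightarrow> x i \<le> 1"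
  shows "(\<Sum>j<2 ^ m. real (bin_count m n x j) * \<phi> j) = (\<Sum>i<n. \<phi> (bin_of m (x i)))"
proof -
  have im: "(\<lambda>i. bin_of m (x i)) ` {..<n} \<subseteq> {..<2 ^ m}" using assms bin_of_less by auto
  have "(\<Sum>i<n. \<phi> (bin_of m (x i))) = (\<Sum>j<2 ^ m. \<Sum>i\<in>{i \<in> {..<n}. bin_of m (x i) = j}. \<phi> (bin_of m (x i)))"
    using sum.group[OF finite_lessThan finite_lessThan im, of "\<lambda>i. \<phi> (bin_of m (x i))"] by simp
  also have "\<dots> = (\<Sum>j<2 ^ m. real (bin_count m n x j) * \<phi> j)"
    by (intro sum.cong refl) (simp add: bin_count_def)
  finally show ?thesis by simp
qed

lemma finite_haar_index_le: "finite {(l, k) \<in> haar_index. l \<le> int L}"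
proof -
  have "{(l, k) \<in> haar_index. l \<le> int L} \<subseteq> {-1..int L} \<times> {..<2 ^ L}"
  proof (rule subsetI)
    fix p assume p: "p \<in> {(l, k) \<in> haar_index. l \<le> int L}"
    obtain l k where lk: "(l, k) \<in> haar_index" "l \<le> int L" and p_eq: "p = (l, k)" using p by auto
    then have "nat l \<le> L" by auto
    then have "(2::nat) ^ nat l \<le> 2 ^ L" by (intro power_increasing) auto
    then have "k < 2 ^ L" using lk by (auto simp: haar_index_def intro: order.strict_trans2)
    then show "p \<in> {-1..int L} \<times> {..<2 ^ L}" unfolding p_eq using lk by (auto simp: haar_index_def)
  qed
  then show ?thesis by (rule finite_subset) auto
qed

context histogram_setting
begin

lemma credible_iff:
  assumes n: "0 < n"
  shows "f \<in> credible_set w m n r x \<longleftrightarrow> f \<in> L2 \<and> (\<forall>(l, k)\<in>{(l, k) \<in> haar_index. l \<le> int m}. \<bar>inner_L2 f (haar l k) - empirical_coeff n x l k\<bar> \<le> r * w l / sqrt (real n))"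
proof -
  let ?A = "{(l, k) \<in> haar_index. l \<le> int m}"
  have ne: "?A \<noteq> {}" by (auto simp: haar_index_def intro!: exI[of _ "-1"] exI[of _ 0])
  have w0: "0 < w l" if "(l, k) \<in> ?A" for l k
    using that w_ge_1[of l] by (auto simp: haar_index_def)
  have "(MAX (l, k)\<in>?A. \<bar>inner_L2 f (haar l k) - empirical_coeff n x l k\<bar> / w l) \<le> r / sqrt (real n) \<longleftrightarrow>
     (\<forall>(l, k)\<in>?A. \<bar>inner_L2 f (haar l k) - empirical_coeff n x l k\<bar> / w l \<le> r / sqrt (real n))"
    using finite_haar_index_le[of m] ne by (subst Max_le_iff) auto
  also have "\<dots> \<longleftrightarrow> (\<forall>(l, k)\<in>?A. \<bar>inner_L2 f (haar l k) - empirical_coeff n x l k\<bar> \<le> r * w l / sqrt (real n))"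
    by (intro ball_cong refl) (use w0 in \<open>auto simp: pos_divide_le_eq mult.commute\<close>)
  finally show ?thesis by (simp add: credible_set_def)
qed

lemma coeff_box_sets:
  "{f \<in> L2. \<forall>(l, k)\<in>{(l, k) \<in> haar_index. l \<le> int m}. \<bar>inner_L2 f (haar l k) - e (l, k)\<bar> \<le> b (l, k)} \<in> sets L2_borel"
proof -
  have "{f \<in> space L2_borel. \<forall>i\<in>{(l, k) \<in> haar_index. l \<le> int m}. \<bar>inner_L2 f (haar (fst i) (snd i)) - e i\<bar> \<le> b i} \<in> sets L2_borel"
    using haar_index_in_L2
    by (intro sets.sets_Collect_finite_All finite_haar_index_le borel_measurable_le borel_measurable_abs borel_measurable_diff inner_L2_measurable borel_measurable_const) auto
  then show ?thesis by (simp add: case_prod_beta')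
qed

lemma credible_set_sets: "0 < n \<Longrightarrow> credible_set w m n r x \<in> sets L2_borel"
proof -
  assume "0 < n"
  then have "credible_set w m n r x = {f \<in> L2. \<forall>(l, k)\<in>{(l, k) \<in> haar_index. l \<le> int m}. \<bar>inner_L2 f (haar l k) - empirical_coeff n x l k\<bar> \<le> r * w l / sqrt (real n)}"
    by (intro set_eqI) (simp only: credible_iff mem_Collect_eq)
  then show ?thesis
    using coeff_box_sets[of m "\<lambda>i. empirical_coeff n x (fst i) (snd i)" "\<lambda>i. r * w (fst i) / sqrt (real n)"] by (simp only: fst_conv snd_conv)
qed

section \<open>Erlang vectors attached to a fixed sample\<close>

abbreviation "N n x \<equiv> bin_count (L n) n x"
abbreviation "E n x \<equiv> erlang_product (2 ^ L n) (N n x)"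

definition mm :: "nat \<Rightarrow> (nat \<Rightarrow> real) \<Rightarrow> nat \<times> nat \<Rightarrow> real" where
  "mm n x i = empirical_coeff n x (int (fst i)) (snd i)"

text \<open>The linear part of the scaled posterior coefficient minus the empirical one, as in the
  delta method for a ratio: subtracting \<open>mm n x i\<close> from the Haar values accounts for
  the fluctuation of the normalising sum.\<close>

definition W :: "nat \<Rightarrow> (nat \<Rightarrow> real) \<Rightarrow> nat \<times> nat \<Rightarrow> (nat \<Rightarrow> real) \<Rightarrow> real" where
  "W n x i g = (\<Sum>j<2 ^ L n. (val (L n) i j - mm n x i) / sqrt (real n) * (g j - real (Suc (N n x j))))"

definition Xi :: "nat \<Rightarrow> (nat \<Rightarrow> real) \<Rightarrow> (nat \<Rightarrow> real) \<Rightarrow> real" where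
  "Xi n x g = (\<Sum>j<2 ^ L n. g j - real (Suc (N n x j)))"

text \<open>The posterior mass in its Erlang representation, defined for every sample; a posterior
  kernel agrees with it only almost surely.\<close>

definition post :: "nat \<Rightarrow> real \<Rightarrow> (nat \<Rightarrow> real) \<Rightarrow> real" where
  "post n s x = measure (E n x) {g \<in> space (E n x). histogram (L n) (normalize (2 ^ L n) g) \<in> credible_set w (L n) n s x}"

lemma prob_space_E: "prob_space (E n x)" by (rule prob_space_erlang_product)

lemma component_E: "j < 2 ^ L n \<Longrightarrow> (\<lambda>g. g j) \<in> borel_measurable (E n x)"
  using measurable_component_singleton[of j "{..<2 ^ L n}" "\<lambda>_. borel"] measurable_cong_sets[OF sets_erlang_product refl] by blast

lemma W_measurable [measurable]: "W n x i \<in> borel_measurable (E n x)"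
  unfolding W_def[abs_def] by (intro borel_measurable_sum borel_measurable_times borel_measurable_diff borel_measurable_const component_E) auto

lemma Xi_measurable [measurable]: "Xi n x \<in> borel_measurable (E n x)"
  unfolding Xi_def[abs_def] by (intro borel_measurable_sum borel_measurable_diff borel_measurable_const component_E) auto

lemma goodD:
  assumes "x \<in> good J n"
  shows "\<And>i. i < n \<Longrightarrow> 0 < x i" "\<And>i. i < n \<Longrightarrow> x i \<le> 1"
    "\<And>j. j < 2 ^ L n \<Longrightarrow> real (N n x j) \<le> C0 * real n / 2 ^ L n"
    "\<And>j. j < 2 ^ Suc J \<Longrightarrow> \<bar>real (bin_count (Suc J) n x j) - real n * q (Suc J) j\<bar> \<le> real n powr (3/4)"
    "\<And>k. k < 2 ^ L n \<Longrightarrow> sqrt (real n) * \<bar>empirical_coeff n x (int (L n)) k - \<theta> (int (L n)) k\<bar> \<le> (F + 2) * sqrt (real (L n))"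
  using assms by (auto simp: good_def)

lemma mm_eq:
  assumes x: "x \<in> good J n" and n: "0 < n" and m: "fst i < m"
  shows "mm n x i = (\<Sum>j<2 ^ m. real (bin_count m n x j) * val m i j) / real n"
proof -
  have "(\<Sum>j<2 ^ m. real (bin_count m n x j) * val m i j) = (\<Sum>d<n. val m i (bin_of m (x d)))"
    by (rule sum_bin_count) (rule goodD(2)[OF x])
  also have "\<dots> = (\<Sum>d<n. haar (int (fst i)) (snd i) (x d))"
    using goodD(1)[OF x] by (intro sum.cong refl) (simp add: haar_val[OF m, symmetric])
  finally show ?thesis by (simp add: mm_def empirical_coeff_def)
qed

lemma sum_N: "x \<in> good J n \<Longrightarrow> (\<Sum>j<2 ^ L n. real (N n x j)) = real n"
  using sum_bin_count[of n x "L n" "\<lambda>_. 1"] goodD(2) by simp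

text \<open>Uniform in level and location because the fine counts are bounded by
  \<open>C0 * n / 2 ^ L n\<close> and the absolute Haar values sum to at most
  \<open>2 ^ L n\<close>.\<close>

lemma mm_bound:
  assumes x: "x \<in> good J n" and n: "0 < n" and i: "fst i < L n" "snd i < 2 ^ fst i"
  shows "\<bar>mm n x i\<bar> \<le> C0"
proof -
  have "\<bar>mm n x i\<bar> = \<bar>\<Sum>j<2 ^ L n. real (N n x j) * val (L n) i j\<bar> / real n"
    unfolding mm_eq[OF x n i(1)] using n by simp
  also have "\<dots> \<le> (\<Sum>j<2 ^ L n. \<bar>real (N n x j) * val (L n) i j\<bar>) / real n"
    by (intro divide_right_mono sum_abs) auto
  also have "\<dots> \<le> (\<Sum>j<2 ^ L n. (C0 * real n / 2 ^ L n) * \<bar>val (L n) i j\<bar>) / real n"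
  proof (intro divide_right_mono sum_mono)
    fix j assume "j \<in> {..<(2::nat) ^ L n}"
    then show "\<bar>real (N n x j) * val (L n) i j\<bar> \<le> (C0 * real n / 2 ^ L n) * \<bar>val (L n) i j\<bar>"
      using mult_right_mono[OF goodD(3)[OF x], of j "\<bar>val (L n) i j\<bar>"] by (simp add: abs_mult)
  qed simp
  also have "\<dots> = (C0 / 2 ^ L n) * (\<Sum>j<2 ^ L n. \<bar>val (L n) i j\<bar>)"
    unfolding sum_distrib_left[symmetric] using n by simp
  also have "\<dots> \<le> (C0 / 2 ^ L n) * 2 ^ L n"
    unfolding val_def using C0_ge i by (intro mult_left_mono sum_abs_haar_bin_le) auto
  finally show ?thesis by simp
qed

lemma Suc_N_le:
  assumes x: "x \<in> good J n" and n: "0 < n" "2 ^ L n \<le> real n" and j: "j < 2 ^ L n"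
  shows "real (Suc (N n x j)) / real n \<le> (C0 + 1) / 2 ^ L n"
proof -
  have "real (Suc (N n x j)) / real n \<le> (C0 * real n / 2 ^ L n + 1) / real n"
    using goodD(3)[OF x j] by (intro divide_right_mono) auto
  also have "\<dots> = C0 / 2 ^ L n + 1 / real n" using n by (simp add: add_divide_distrib)
  also have "\<dots> \<le> C0 / 2 ^ L n + 1 / 2 ^ L n" using n by (intro add_left_mono divide_left_mono) auto
  finally show ?thesis by (simp add: add_divide_distrib)
qed

text \<open>This computation produces \<open>V0\<close>: the squared Haar values average to one, and
  the empirical mean contributes at most \<open>C0\<^sup>2\<close>.\<close>

lemma W_variance:
  assumes x: "x \<in> good J n" and n: "0 < n" "2 ^ L n \<le> real n" and i: "fst i < L n" "snd i < 2 ^ fst i"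
  shows "(\<Sum>j<2 ^ L n. ((val (L n) i j - mm n x i) / sqrt (real n))\<^sup>2 * real (Suc (N n x j))) \<le> V0"
proof -
  let ?m = "mm n x i"
  have "(\<Sum>j<2 ^ L n. ((val (L n) i j - ?m) / sqrt (real n))\<^sup>2 * real (Suc (N n x j)))
      = (\<Sum>j<2 ^ L n. (val (L n) i j - ?m)\<^sup>2 * (real (Suc (N n x j)) / real n))"
    by (intro sum.cong refl) (simp add: power_divide)
  also have "\<dots> \<le> (\<Sum>j<2 ^ L n. (2 * (val (L n) i j)\<^sup>2 + 2 * ?m\<^sup>2) * ((C0 + 1) / 2 ^ L n))"
  proof (intro sum_mono mult_mono)
    fix j assume "j \<in> {..<(2::nat) ^ L n}"
    then show "real (Suc (N n x j)) / real n \<le> (C0 + 1) / 2 ^ L n" using Suc_N_le[OF x n] by auto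
    show "(val (L n) i j - ?m)\<^sup>2 \<le> 2 * (val (L n) i j)\<^sup>2 + 2 * ?m\<^sup>2"
      using zero_le_power2[of "val (L n) i j + ?m"] by (simp add: power2_eq_square algebra_simps)
  qed auto
  also have "\<dots> = (2 * (\<Sum>j<2 ^ L n. (val (L n) i j)\<^sup>2) + 2 ^ L n * (2 * ?m\<^sup>2)) * ((C0 + 1) / 2 ^ L n)"
    by (simp only: sum_distrib_right[symmetric] sum.distrib sum_distrib_left[symmetric] sum_constant card_lessThan of_nat_power of_nat_numeral) (simp add: mult.assoc)
  also have "(\<Sum>j<2 ^ L n. (val (L n) i j)\<^sup>2) = 2 ^ L n"
    unfolding val_def using i by (intro sum_haar_bin_sq) auto
  also have "(2 * 2 ^ L n + 2 ^ L n * (2 * ?m\<^sup>2)) * ((C0 + 1) / 2 ^ L n) = 2 * (C0 + 1) * (1 + ?m\<^sup>2)"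
    by (simp add: field_simps)
  also have "\<dots> \<le> 2 * (C0 + 1) * (1 + C0\<^sup>2)"
  proof -
    have "?m\<^sup>2 \<le> C0\<^sup>2" using mm_bound[OF x n(1) i] C0_ge by (intro abs_le_square_iff[THEN iffD1]) auto
    then show ?thesis using C0_ge by (intro mult_left_mono) auto
  qed
  finally show ?thesis by (simp add: V0_def)
qed

lemma erlang_linear_chernoff:
  assumes a: "\<And>j. j < M \<Longrightarrow> \<bar>t * a j\<bar> \<le> 1/2" and t: "0 \<le> t"
  shows "measure (erlang_product M c) {g \<in> space (erlang_product M c). r \<le> \<bar>\<Sum>j<M. a j * (g j - real (Suc (c j)))\<bar>}
     \<le> 2 * exp (- t * r + t\<^sup>2 * (\<Sum>j<M. 2 * (a j)\<^sup>2 * real (Suc (c j))))"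
  unfolding erlang_product_def
proof (rule PiM_chernoff[OF finite_lessThan prob_space_erlang _ _ _ t])
  fix j assume "j \<in> {..<M}"
  then have a': "\<bar>t * a j\<bar> \<le> 1/2" "\<bar>- t * a j\<bar> \<le> 1/2" using a by auto
  show "(\<lambda>y. a j * (y - real (Suc (c j)))) \<in> borel_measurable (erlang (c j))" by measurable
  show "(\<integral>\<^sup>+x. ennreal (exp (t * (a j * (x - real (Suc (c j)))))) \<partial>erlang (c j)) \<le> ennreal (exp (t\<^sup>2 * (2 * (a j)\<^sup>2 * real (Suc (c j)))))"
    using erlang_mgf[OF a'(1), of "c j"] by (simp add: power_mult_distrib mult_ac)
  show "(\<integral>\<^sup>+x. ennreal (exp (- t * (a j * (x - real (Suc (c j)))))) \<partial>erlang (c j)) \<le> ennreal (exp (t\<^sup>2 * (2 * (a j)\<^sup>2 * real (Suc (c j)))))"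
    using erlang_mgf[OF a'(2), of "c j"] by (simp add: power_mult_distrib mult_ac)
qed

lemma Xi_tail:
  assumes X: "\<forall>\<^sub>F n in sequentially. X n \<in> good J n" and e: "0 < e" "e \<le> 1"
  shows "(\<lambda>n. measure (E n (X n)) {g \<in> space (E n (X n)). e * real n \<le> \<bar>Xi n (X n) g\<bar>}) \<longlonglongrightarrow> 0"
proof (rule tendsto_sandwich[OF _ _ tendsto_const])
  show "(\<lambda>n. 2 * exp (- (e\<^sup>2 / 16) * real n)) \<longlonglongrightarrow> 0" using e by real_asymp
  have "\<forall>\<^sub>F n in sequentially. 2 ^ L n \<le> 1 * sqrt (real n)" by (rule eventually_bins_le) simp
  then show "\<forall>\<^sub>F n in sequentially. measure (E n (X n)) {g \<in> space (E n (X n)). e * real n \<le> \<bar>Xi n (X n) g\<bar>} \<le> 2 * exp (- (e\<^sup>2 / 16) * real n)"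
    using X eventually_gt_at_top[of 0]
  proof eventually_elim
    case (elim n)
    have "sqrt (real n) \<le> real n" using elim by (intro real_le_lsqrt) (auto simp: power2_eq_square)
    then have M: "2 ^ L n \<le> real n" using elim by linarith
    \<comment> \<open>The parameter \<open>e / 8\<close> balances linear gain
      \<open>e\<^sup>2 * n / 8\<close> against a variance term of at most half of it, since the
      proxies sum to at most \<open>4 * n\<close>.\<close>
    have "measure (E n (X n)) {g \<in> space (E n (X n)). e * real n \<le> \<bar>\<Sum>j<2 ^ L n. 1 * (g j - real (Suc (N n (X n) j)))\<bar>}
      \<le> 2 * exp (- (e / 8) * (e * real n) + (e / 8)\<^sup>2 * (\<Sum>j<2 ^ L n. 2 * 1\<^sup>2 * real (Suc (N n (X n) j))))"
      by (rule erlang_linear_chernoff) (use e in auto)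
    also have "(\<Sum>j<2 ^ L n. 2 * 1\<^sup>2 * real (Suc (N n (X n) j))) = 2 * (2 ^ L n + real n)"
      using sum_N[OF elim(2)] by (simp add: sum_distrib_left[symmetric] sum.distrib)
    also have "2 * exp (- (e / 8) * (e * real n) + (e / 8)\<^sup>2 * (2 * (2 ^ L n + real n))) \<le> 2 * exp (- (e\<^sup>2 / 16) * real n)"
    proof -
      have "(e / 8)\<^sup>2 * (2 * (2 ^ L n + real n)) \<le> (e / 8)\<^sup>2 * (4 * real n)" using M by (intro mult_left_mono) auto
      moreover have "(e / 8)\<^sup>2 * (4 * real n) = (e\<^sup>2 / 16) * real n" by (simp add: power_divide)
      moreover have "- (e / 8) * (e * real n) = - 2 * ((e\<^sup>2 / 16) * real n)" by (simp add: power2_eq_square)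
      ultimately have "- (e / 8) * (e * real n) + (e / 8)\<^sup>2 * (2 * (2 ^ L n + real n)) \<le> - (e\<^sup>2 / 16) * real n" by linarith
      then show ?thesis by (simp only: exp_le_cancel_iff mult_le_cancel_left_pos zero_less_numeral)
    qed
    finally show ?case by (simp add: Xi_def)
  qed
qed auto

text \<open>Posterior counterpart of the sampling tail bound, again with parameter
  \<open>sqrt l\<close>. It stops at level \<open>L n - 1\<close>, above which the posterior carries
  no randomness in the credible set.\<close>

lemma W_tail:
  assumes X: "\<forall>\<^sub>F n in sequentially. X n \<in> good J n"
    and s: "\<And>l. J < l \<Longrightarrow> (2 * V0 + 2) * sqrt (real l) \<le> s * w (int l)"
  shows "\<forall>\<^sub>F n in sequentially. measure (E n (X n)) {g \<in> space (E n (X n)). \<exists>l k. J < l \<and> l \<le> L n - 1 \<and> k < 2 ^ l \<and> s * w (int l) \<le> \<bar>W n (X n) (l, k) g\<bar>} \<le> 2 / 2 ^ J"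
proof -
  have C: "0 < 1 + C0" using C0_ge by simp
  \<comment> \<open>The Erlang bound needs parameter times coefficient to be at most
    \<open>1/2\<close>, while \<open>sqrt l * \<bar>val - mm\<bar>\<close> can be as large as
    \<open>(1 + C0) * 2 ^ L n\<close>.\<close>
  have "\<forall>\<^sub>F n in sequentially. 2 ^ L n \<le> 1 / (2 * (1 + C0)) * sqrt (real n)" using C by (intro eventually_bins_le) simp
  moreover have "\<forall>\<^sub>F n in sequentially. 2 ^ L n \<le> 1 * sqrt (real n)" by (rule eventually_bins_le) simp
  ultimately show ?thesis using X eventually_gt_at_top[of 0]
  proof eventually_elim
    case (elim n)
    interpret E: prob_space "E n (X n)" by (rule prob_space_E)
    have n: "0 < n" by fact
    have "sqrt (real n) \<le> real n" using elim by (intro real_le_lsqrt) (auto simp: power2_eq_square)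
    then have M: "2 ^ L n \<le> real n" using elim by linarith
    have M2: "(1 + C0) * 2 ^ L n \<le> sqrt (real n) / 2" using elim(1) C by (simp add: field_simps)
    show ?case
    proof (rule E.haar_union_bound(1))
      show "{g \<in> space (E n (X n)). s * w (int l) \<le> \<bar>W n (X n) (l, k) g\<bar>} \<in> sets (E n (X n))" for l k by measurable
      fix l k assume l: "J < l" "l \<le> L n - 1" and k: "k < (2::nat) ^ l"
      then have lL: "l < L n" by auto
      let ?i = "(l, k)"
      have "measure (E n (X n)) {g \<in> space (E n (X n)). s * w (int l) \<le> \<bar>W n (X n) ?i g\<bar>}
        \<le> 2 * exp (- sqrt (real l) * (s * w (int l)) + (sqrt (real l))\<^sup>2 * (\<Sum>j<2 ^ L n. 2 * ((val (L n) ?i j - mm n (X n) ?i) / sqrt (real n))\<^sup>2 * real (Suc (N n (X n) j))))"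
        unfolding W_def
      proof (rule erlang_linear_chernoff)
        fix j
        have sl: "sqrt (real l) \<le> sqrt (2 ^ L n)"
        proof -
          have "real l \<le> 2 ^ l" using less_exp[of l] by (simp add: less_imp_le)
          also have "(2::real) ^ l \<le> 2 ^ L n" using lL by (intro power_increasing) auto
          finally show ?thesis by simp
        qed
        have v: "\<bar>val (L n) ?i j\<bar> \<le> sqrt (2 ^ L n)"
        proof -
          have "\<bar>val (L n) ?i j\<bar> \<le> 2 powr (real_of_int (int l) / 2)" unfolding val_def fst_conv snd_conv by (rule abs_haar_le) simp
          also have "\<dots> \<le> 2 powr (real (L n) / 2)" using lL by (intro powr_mono) auto
          also have "\<dots> = sqrt (2 ^ L n)" by (simp add: powr_half_sqrt[symmetric] powr_realpow[symmetric] powr_powr)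
          finally show ?thesis .
        qed
        have m: "\<bar>mm n (X n) ?i\<bar> \<le> C0" by (rule mm_bound[OF elim(3) n]) (use lL k in auto)
        have one: "1 \<le> sqrt ((2::real) ^ L n)" by simp
        have "\<bar>val (L n) ?i j - mm n (X n) ?i\<bar> \<le> sqrt (2 ^ L n) + C0 * sqrt (2 ^ L n)"
          using v m one C0_ge mult_left_mono[OF one, of C0] by linarith
        then have "sqrt (real l) * \<bar>val (L n) ?i j - mm n (X n) ?i\<bar> \<le> sqrt (2 ^ L n) * (sqrt (2 ^ L n) + C0 * sqrt (2 ^ L n))"
          using sl by (intro mult_mono) auto
        also have "\<dots> = (1 + C0) * 2 ^ L n"
        proof -
          have "r * (r + C0 * r) = (1 + C0) * (r * r)" for r by (simp add: algebra_simps)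
          from this[of "sqrt (2 ^ L n)"] show ?thesis by simp
        qed
        also have "\<dots> \<le> sqrt (real n) / 2" by (rule M2)
        finally have "sqrt (real l) * \<bar>val (L n) ?i j - mm n (X n) ?i\<bar> / sqrt (real n) \<le> 1 / 2"
          using n by (simp add: field_simps)
        then show "\<bar>sqrt (real l) * ((val (L n) ?i j - mm n (X n) ?i) / sqrt (real n))\<bar> \<le> 1 / 2"
          by (simp add: abs_mult)
      qed simp
      also have "\<dots> \<le> 2 * exp (- 2 * real l)"
      proof -
        have "(\<Sum>j<2 ^ L n. 2 * ((val (L n) ?i j - mm n (X n) ?i) / sqrt (real n))\<^sup>2 * real (Suc (N n (X n) j))) \<le> 2 * V0"
          using W_variance[OF elim(3) n M, of ?i] lL k by (simp add: sum_distrib_left[symmetric] mult.assoc)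
        then have "(sqrt (real l))\<^sup>2 * (\<Sum>j<2 ^ L n. 2 * ((val (L n) ?i j - mm n (X n) ?i) / sqrt (real n))\<^sup>2 * real (Suc (N n (X n) j))) \<le> (sqrt (real l))\<^sup>2 * (2 * V0)"
          by (intro mult_left_mono) auto
        moreover have "(sqrt (real l))\<^sup>2 * (2 * V0) = 2 * V0 * real l" by simp
        moreover have "sqrt (real l) * ((2 * V0 + 2) * sqrt (real l)) \<le> sqrt (real l) * (s * w (int l))"
          by (rule mult_left_mono[OF s[OF l(1)]]) simp
        moreover have "sqrt (real l) * ((2 * V0 + 2) * sqrt (real l)) = 2 * V0 * real l + 2 * real l"
        proof -
          have "r * ((2 * V0 + 2) * r) = (2 * V0 + 2) * (r * r)" for r :: real by (simp only: mult_ac)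
          then show ?thesis by (simp add: distrib_right)
        qed
        ultimately have "- sqrt (real l) * (s * w (int l)) + (sqrt (real l))\<^sup>2 * (\<Sum>j<2 ^ L n. 2 * ((val (L n) ?i j - mm n (X n) ?i) / sqrt (real n))\<^sup>2 * real (Suc (N n (X n) j))) \<le> - 2 * real l"
          by linarith
        then show ?thesis by simp
      qed
      finally show "measure (E n (X n)) {g \<in> space (E n (X n)). s * w (int l) \<le> \<bar>W n (X n) ?i g\<bar>} \<le> 2 * exp (- 2 * real l)" .
    qed
  qed
qed

lemma coarse_frequency:
  assumes X: "\<forall>\<^sub>F n in sequentially. X n \<in> good J n" and c: "c < 2 ^ Suc J"
  shows "(\<lambda>n. real (bin_count (Suc J) n (X n) c) / real n) \<longlonglongrightarrow> q (Suc J) c"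
proof -
  have "(\<lambda>n. real (bin_count (Suc J) n (X n) c) / real n - q (Suc J) c) \<longlonglongrightarrow> 0"
  proof (rule Lim_null_comparison)
    show "(\<lambda>n. real n powr (- 1/4)) \<longlonglongrightarrow> 0" by real_asymp
    show "\<forall>\<^sub>F n in sequentially. norm (real (bin_count (Suc J) n (X n) c) / real n - q (Suc J) c) \<le> real n powr (- 1/4)"
      using X eventually_gt_at_top[of 0]
    proof eventually_elim
      case (elim n)
      have "norm (real (bin_count (Suc J) n (X n) c) / real n - q (Suc J) c) = \<bar>real (bin_count (Suc J) n (X n) c) - real n * q (Suc J) c\<bar> / real n"
      proof -
        have "real (bin_count (Suc J) n (X n) c) / real n - q (Suc J) c = (real (bin_count (Suc J) n (X n) c) - real n * q (Suc J) c) / real n"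
          using elim by (simp add: diff_divide_distrib)
        then show ?thesis by (simp add: abs_divide)
      qed
      also have "\<dots> \<le> real n powr (3/4) / real n" using goodD(4)[OF elim(1) c] by (intro divide_right_mono) auto
      also have "\<dots> = real n powr (- 1/4)" using elim powr_diff[of "real n" "3/4" 1] by simp
      finally show ?case by simp
    qed
  qed
  then show ?thesis by (simp add: LIM_zero_iff)
qed

text \<open>Empirical coefficients of levels up to \<open>J\<close> are linear in the frequencies of
  the cells of level \<open>Suc J\<close>, which converge along good samples.\<close>

lemma mm_tendsto:
  assumes X: "\<forall>\<^sub>F n in sequentially. X n \<in> good J n" and i: "i \<in> I J"
  shows "(\<lambda>n. mm n (X n) i) \<longlonglongrightarrow> th i"
proof -
  have l: "fst i < Suc J" using i by (auto simp: I_def)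
  have "(\<lambda>n. \<Sum>c<2 ^ Suc J. (real (bin_count (Suc J) n (X n) c) / real n) * val (Suc J) i c) \<longlonglongrightarrow> (\<Sum>c<2 ^ Suc J. q (Suc J) c * val (Suc J) i c)"
    by (intro tendsto_sum tendsto_mult tendsto_const coarse_frequency[OF X]) auto
  moreover have "(\<Sum>c<2 ^ Suc J. q (Suc J) c * val (Suc J) i c) = th i"
  proof -
    have "P0.expectation (haar (int (fst i)) (snd i)) = (\<Sum>c<2 ^ Suc J. val (Suc J) i c * q (Suc J) c)"
      by (rule expectation_bin_function) (use haar_val[OF l] in auto)
    then show ?thesis by (simp add: expectation_haar th_def mult.commute)
  qed
  moreover have "\<forall>\<^sub>F n in sequentially. (\<Sum>c<2 ^ Suc J. (real (bin_count (Suc J) n (X n) c) / real n) * val (Suc J) i c) = mm n (X n) i"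
    using X eventually_gt_at_top[of 0]
    by eventually_elim (simp add: mm_eq[OF _ _ l] sum_divide_distrib del: sum.lessThan_Suc power_Suc)
  ultimately show ?thesis by (simp add: tendsto_cong)
qed

lemma eventually_level_gt: "\<forall>\<^sub>F n in sequentially. J < L n"
  using L_at_top[unfolded filterlim_at_top, rule_format, of "Suc J"] by (simp add: Suc_le_eq)

text \<open>Along a deterministic sequence of good samples this is a triangular array of
  independent, not identically distributed summands. The variances \<open>b n j\<close> are
  uniformly bounded by \<open>be n\<close>, of order \<open>1 / 2 ^ L n\<close>, so the array is
  asymptotically negligible, and their sum converges to \<open>sig2 J t\<close>.\<close>

lemma W_char:
  assumes X: "\<forall>\<^sub>F n in sequentially. X n \<in> good J n"
  shows "(\<lambda>n. LINT g|E n (X n). iexp (\<Sum>i\<in>I J. t i * W n (X n) i g)) \<longlonglongrightarrow> of_real (exp (- sig2 J t / 2))"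
proof -
  define T where "T = (\<Sum>i\<in>I J. \<bar>t i\<bar> * (max 1 (2 powr (real (fst i) / 2)) + C0))"
  define al where "al n j = (\<Sum>i\<in>I J. t i * (val (L n) i j - mm n (X n) i))" for n j
  define b where "b n j = (al n j / sqrt (real n))\<^sup>2 * real (Suc (N n (X n) j))" for n j
  define be where "be n = T\<^sup>2 * (C0 + 1) / 2 ^ L n" for n
  have T0: "0 \<le> T" unfolding T_def using C0_ge by (intro sum_nonneg mult_nonneg_nonneg) auto
  have b0: "0 \<le> b n j" for n j unfolding b_def by simp
  have ev: "\<forall>\<^sub>F n in sequentially. X n \<in> good J n \<and> 0 < n \<and> 2 ^ L n \<le> real n \<and> J < L n"
  proof -
    have "\<forall>\<^sub>F n in sequentially. 2 ^ L n \<le> 1 * sqrt (real n)" by (rule eventually_bins_le) simp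
    then show ?thesis using X eventually_gt_at_top[of 0] eventually_level_gt[of J]
    proof eventually_elim
      case (elim n)
      have "sqrt (real n) \<le> real n" using elim by (intro real_le_lsqrt) (auto simp: power2_eq_square)
      then have "2 ^ L n \<le> real n" using elim by linarith
      with elim show ?case by blast
    qed
  qed
  have al_le: "\<bar>al n j\<bar> \<le> T" if g: "X n \<in> good J n" "0 < n" "J < L n" for n j
    unfolding al_def T_def
  proof (intro order_trans[OF sum_abs] sum_mono)
    fix i assume i: "i \<in> I J"
    have "\<bar>mm n (X n) i\<bar> \<le> C0" using i g by (intro mm_bound[OF g(1,2)]) (auto simp: I_def)
    moreover have "\<bar>val (L n) i j\<bar> \<le> max 1 (2 powr (real (fst i) / 2))"
      unfolding val_def using haar_bounded[of "int (fst i)" "snd i"] by simp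
    ultimately have "\<bar>val (L n) i j - mm n (X n) i\<bar> \<le> max 1 (2 powr (real (fst i) / 2)) + C0" by linarith
    then show "\<bar>t i * (val (L n) i j - mm n (X n) i)\<bar> \<le> \<bar>t i\<bar> * (max 1 (2 powr (real (fst i) / 2)) + C0)"
      unfolding abs_mult by (intro mult_left_mono) auto
  qed
  have al_sq: "(al n j)\<^sup>2 \<le> T\<^sup>2" if "X n \<in> good J n" "0 < n" "J < L n" for n j
    using al_le[OF that] T0 by (intro abs_le_square_iff[THEN iffD1]) auto
  have b_le: "b n j \<le> be n" if g: "X n \<in> good J n" "0 < n" "2 ^ L n \<le> real n" "J < L n" and j: "j < 2 ^ L n" for n j
  proof -
    have "b n j = (al n j)\<^sup>2 * (real (Suc (N n (X n) j)) / real n)" unfolding b_def by (simp add: power_divide)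
    also have "\<dots> \<le> T\<^sup>2 * ((C0 + 1) / 2 ^ L n)"
      using al_sq[OF g(1,2,4)] Suc_N_le[OF g(1-3) j] by (intro mult_mono) auto
    finally show ?thesis by (simp add: be_def)
  qed
  have be0: "be \<longlonglongrightarrow> 0"
  proof -
    have "(\<lambda>m::nat. 1 / 2 ^ m :: real) \<longlonglongrightarrow> 0" by real_asymp
    from tendsto_mult_left[OF this, of "T\<^sup>2 * (C0 + 1)"] have "(\<lambda>m::nat. T\<^sup>2 * (C0 + 1) / 2 ^ m) \<longlonglongrightarrow> 0" by simp
    from filterlim_compose[OF this L_at_top] show ?thesis unfolding be_def .
  qed
  \<comment> \<open>The shape \<open>1 + N\<close> splits each variance. The part from the counts is
    rewritten over the coarse cells, whose frequencies converge; the part from the prior is at most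
    \<open>T\<^sup>2 * 2 ^ L n / n\<close>.\<close>
  have sb: "(\<lambda>n. \<Sum>j<2 ^ L n. b n j) \<longlonglongrightarrow> sig2 J t"
  proof -
    have 1: "(\<lambda>n. \<Sum>c<2 ^ Suc J. (real (bin_count (Suc J) n (X n) c) / real n) * (\<Sum>i\<in>I J. t i * (val (Suc J) i c - mm n (X n) i))\<^sup>2) \<longlonglongrightarrow> sig2 J t"
      unfolding sig2_def
      by (intro tendsto_sum tendsto_mult tendsto_power tendsto_const tendsto_diff coarse_frequency[OF X] mm_tendsto[OF X]) auto
    have 2: "(\<lambda>n. (\<Sum>j<2 ^ L n. (al n j)\<^sup>2) / real n) \<longlonglongrightarrow> 0"
    proof (rule Lim_null_comparison)
      have "(\<lambda>n. T\<^sup>2 * (2 ^ L n / sqrt (real n)) * (1 / sqrt (real n))) \<longlonglongrightarrow> T\<^sup>2 * 0 * 0"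
        by (intro tendsto_mult tendsto_const bins_over_sqrt) real_asymp
      then show "(\<lambda>n. T\<^sup>2 * (2 ^ L n / sqrt (real n)) * (1 / sqrt (real n))) \<longlonglongrightarrow> 0" by simp
      show "\<forall>\<^sub>F n in sequentially. norm ((\<Sum>j<2 ^ L n. (al n j)\<^sup>2) / real n) \<le> T\<^sup>2 * (2 ^ L n / sqrt (real n)) * (1 / sqrt (real n))"
        using ev
      proof eventually_elim
        case (elim n)
        have "(\<Sum>j<2 ^ L n. (al n j)\<^sup>2) \<le> (\<Sum>j<(2::nat) ^ L n. T\<^sup>2)" using elim al_sq by (intro sum_mono) auto
        then have "(\<Sum>j<2 ^ L n. (al n j)\<^sup>2) / real n \<le> 2 ^ L n * T\<^sup>2 / real n" by (intro divide_right_mono) auto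
        moreover have "0 \<le> (\<Sum>j<2 ^ L n. (al n j)\<^sup>2)" by (intro sum_nonneg) auto
        moreover have "T\<^sup>2 * (2 ^ L n / sqrt (real n)) * (1 / sqrt (real n)) = 2 ^ L n * T\<^sup>2 / real n" by simp
        ultimately show ?case by (simp add: mult.commute)
      qed
    qed
    have eq: "\<forall>\<^sub>F n in sequentially. (\<Sum>c<2 ^ Suc J. (real (bin_count (Suc J) n (X n) c) / real n) * (\<Sum>i\<in>I J. t i * (val (Suc J) i c - mm n (X n) i))\<^sup>2)
       + (\<Sum>j<2 ^ L n. (al n j)\<^sup>2) / real n = (\<Sum>j<2 ^ L n. b n j)"
      using ev
    proof eventually_elim
      case (elim n)
      then have g: "X n \<in> good J n" "0 < n" "J < L n" by auto
      \<comment> \<open>Sums over fine bins and over coarse cells are both read as one sum over the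
        observations, which is independent of the grid.\<close>
      let ?G = "\<lambda>x. (\<Sum>i\<in>I J. t i * (haar (int (fst i)) (snd i) x - mm n (X n) i))\<^sup>2"
      have G: "?G y = (\<Sum>i\<in>I J. t i * (val m i (bin_of m y) - mm n (X n) i))\<^sup>2" if "0 < y" "J < m" for y m
        by (intro arg_cong[of _ _ "\<lambda>z. z\<^sup>2"] sum.cong refl) (use that in \<open>subst haar_val[of _ m], auto simp: I_def\<close>)
      have sum_G: "(\<Sum>c<2 ^ m. real (bin_count m n (X n) c) * (\<Sum>i\<in>I J. t i * (val m i c - mm n (X n) i))\<^sup>2) = (\<Sum>d<n. ?G (X n d))" if "J < m" for m
      proof -
        have "(\<Sum>c<2 ^ m. real (bin_count m n (X n) c) * (\<Sum>i\<in>I J. t i * (val m i c - mm n (X n) i))\<^sup>2)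
          = (\<Sum>d<n. (\<Sum>i\<in>I J. t i * (val m i (bin_of m (X n d)) - mm n (X n) i))\<^sup>2)"
          by (rule sum_bin_count) (rule goodD(2)[OF g(1)])
        also have "\<dots> = (\<Sum>d<n. ?G (X n d))"
          by (intro sum.cong refl G[symmetric] that goodD(1)[OF g(1)]) simp
        finally show ?thesis .
      qed
      have "(\<Sum>c<2 ^ Suc J. (real (bin_count (Suc J) n (X n) c) / real n) * (\<Sum>i\<in>I J. t i * (val (Suc J) i c - mm n (X n) i))\<^sup>2)
         = (\<Sum>c<2 ^ Suc J. real (bin_count (Suc J) n (X n) c) * (\<Sum>i\<in>I J. t i * (val (Suc J) i c - mm n (X n) i))\<^sup>2) / real n"
        by (simp only: sum_divide_distrib times_divide_eq_left)
      also have "\<dots> = (\<Sum>d<n. ?G (X n d)) / real n"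
        unfolding sum_G[of "Suc J", OF lessI] ..
      also have "(\<Sum>d<n. ?G (X n d)) = (\<Sum>j<2 ^ L n. real (N n (X n) j) * (al n j)\<^sup>2)"
        unfolding al_def sum_G[OF g(3)] ..
      finally have 3: "(\<Sum>c<2 ^ Suc J. (real (bin_count (Suc J) n (X n) c) / real n) * (\<Sum>i\<in>I J. t i * (val (Suc J) i c - mm n (X n) i))\<^sup>2)
         = (\<Sum>j<2 ^ L n. real (N n (X n) j) * (al n j)\<^sup>2) / real n" .
      have "(\<Sum>j<2 ^ L n. b n j) = (\<Sum>j<2 ^ L n. (real (N n (X n) j) * (al n j)\<^sup>2 + (al n j)\<^sup>2) / real n)"
        unfolding b_def by (intro sum.cong refl) (simp add: power_divide algebra_simps)
      then show ?case unfolding 3 by (simp add: sum_divide_distrib[symmetric] sum.distrib add_divide_distrib)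
    qed
    from tendsto_add[OF 1 2] eq show ?thesis by (simp add: tendsto_cong)
  qed
  \<comment> \<open>One factor of each error is estimated by the uniform bound \<open>be n\<close>,
    so the total error is a null sequence times the convergent sum of variances.\<close>
  have bound: "\<forall>\<^sub>F n in sequentially. norm ((LINT g|E n (X n). iexp (\<Sum>i\<in>I J. t i * W n (X n) i g)) - of_real (exp (- (\<Sum>j<2 ^ L n. b n j) / 2)))
      \<le> (sqrt (be n) + be n) * (\<Sum>j<2 ^ L n. b n j)"
    using ev
  proof eventually_elim
    case (elim n)
    then have g: "X n \<in> good J n" "0 < n" "2 ^ L n \<le> real n" "J < L n" by auto
    have lin: "(\<Sum>i\<in>I J. t i * W n (X n) i y) = (\<Sum>j\<in>{..<2 ^ L n}. (al n j / sqrt (real n)) * (y j - real (Suc (N n (X n) j))))" for y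
    proof -
      have "(\<Sum>i\<in>I J. t i * W n (X n) i y) = (\<Sum>i\<in>I J. \<Sum>j<2 ^ L n. t i * ((val (L n) i j - mm n (X n) i) / sqrt (real n) * (y j - real (Suc (N n (X n) j)))))"
        unfolding W_def sum_distrib_left ..
      also have "\<dots> = (\<Sum>j<2 ^ L n. \<Sum>i\<in>I J. t i * ((val (L n) i j - mm n (X n) i) / sqrt (real n) * (y j - real (Suc (N n (X n) j)))))"
        by (rule sum.swap)
      also have "\<dots> = (\<Sum>j<2 ^ L n. (al n j / sqrt (real n)) * (y j - real (Suc (N n (X n) j))))"
        unfolding al_def by (simp only: sum_divide_distrib sum_distrib_right times_divide_eq_left times_divide_eq_right mult.assoc)
      finally show ?thesis .
    qed
    have "norm ((LINT y|E n (X n). iexp (\<Sum>j\<in>{..<2 ^ L n}. (al n j / sqrt (real n)) * (y j - real (Suc (N n (X n) j))))) - of_real (exp (- (\<Sum>j\<in>{..<2 ^ L n}. b n j) / 2)))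
       \<le> (\<Sum>j\<in>{..<2 ^ L n}. b n j * sqrt (b n j) + (b n j)\<^sup>2)"
      unfolding erlang_product_def
    proof (rule PiM_char_normal_approx[OF finite_lessThan prob_space_erlang])
      fix j
      show "norm ((LINT y|erlang (N n (X n) j). iexp ((al n j / sqrt (real n)) * (y - real (Suc (N n (X n) j))))) - of_real (exp (- b n j / 2))) \<le> b n j * sqrt (b n j) + (b n j)\<^sup>2"
        unfolding b_def by (rule erlang_char_normal_approx)
      show "0 \<le> b n j" by (rule b0)
      show "(\<lambda>y. (al n j / sqrt (real n)) * (y - real (Suc (N n (X n) j)))) \<in> borel_measurable (erlang (N n (X n) j))" by measurable
    qed
    also have "\<dots> \<le> (\<Sum>j\<in>{..<2 ^ L n}. (sqrt (be n) + be n) * b n j)"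
    proof (rule sum_mono)
      fix j assume "j \<in> {..<(2::nat) ^ L n}"
      then have bl: "b n j \<le> be n" using b_le[OF g] by simp
      have "b n j * sqrt (b n j) \<le> b n j * sqrt (be n)" using bl b0 by (intro mult_left_mono) auto
      moreover have "(b n j)\<^sup>2 \<le> b n j * be n" unfolding power2_eq_square using bl b0 by (intro mult_left_mono) auto
      ultimately show "b n j * sqrt (b n j) + (b n j)\<^sup>2 \<le> (sqrt (be n) + be n) * b n j" by (simp add: algebra_simps)
    qed
    finally show ?case unfolding lin sum_distrib_left .
  qed
  have "(\<lambda>n. (sqrt (be n) + be n) * (\<Sum>j<2 ^ L n. b n j)) \<longlonglongrightarrow> (sqrt 0 + 0) * sig2 J t"
    by (intro tendsto_mult tendsto_add tendsto_real_sqrt be0 sb)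
  then have "(\<lambda>n. (sqrt (be n) + be n) * (\<Sum>j<2 ^ L n. b n j)) \<longlonglongrightarrow> 0" by simp
  from Lim_null_comparison[OF bound this]
  have d: "(\<lambda>n. (LINT g|E n (X n). iexp (\<Sum>i\<in>I J. t i * W n (X n) i g)) - of_real (exp (- (\<Sum>j<2 ^ L n. b n j) / 2))) \<longlonglongrightarrow> 0" .
  have "(\<lambda>n. complex_of_real (exp (- (\<Sum>j<2 ^ L n. b n j) / 2))) \<longlonglongrightarrow> of_real (exp (- sig2 J t / 2))"
    by (intro tendsto_of_real tendsto_exp tendsto_divide tendsto_minus sb tendsto_const) simp
  from tendsto_add[OF d this] show ?thesis by simp
qed

lemma W_box:
  assumes X: "\<forall>\<^sub>F n in sequentially. X n \<in> good J n" and s: "0 \<le> s"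
  shows "(\<lambda>n. measure (E n (X n)) {g \<in> space (E n (X n)). \<forall>i\<in>I J. \<bar>W n (X n) i g\<bar> \<le> s * wt i}) \<longlonglongrightarrow> FJ J s"
proof -
  interpret box_limit "\<lambda>n. E n (X n)" "gauss J" by (rule box_limit.intro) (rule prob_space_E, rule prob_space_gauss_product)
  show ?thesis
    unfolding FJ_def
  proof (rule box_probability_tendsto)
    show "(\<lambda>n. LINT g|E n (X n). iexp (\<Sum>i\<in>I J. t i * W n (X n) i g)) \<longlonglongrightarrow> (LINT x|gauss J. iexp (\<Sum>i\<in>I J. t i * Y J i x))" for t
      unfolding Y_char by (rule W_char[OF X])
    show "0 \<le> s * wt i" for i using s wt_ge_1[of i] by auto
    show "measure (gauss J) {x \<in> space (gauss J). Y J i x = y} = 0" if "i \<in> I J" for i y by (rule Y_no_atoms[OF that])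
  qed (rule finite_I W_measurable Y_measurable)+
qed

end

context histogram_setting
begin

section \<open>From Erlang vectors to the posterior mass of credible sets\<close>

lemma sum_eq_Xi: "x \<in> good J n \<Longrightarrow> (\<Sum>j<2 ^ L n. g j) = real n + 2 ^ L n + Xi n x g"
  using sum_N[of x J n] by (simp add: Xi_def sum_subtractf sum.distrib)

text \<open>An exact linearisation of the ratio, using that the Haar values sum to zero over bins
  and to \<open>n * mm n x i\<close> when weighted with the counts. The term with
  \<open>2 ^ L n\<close> is the shift caused by the prior.\<close>

lemma coeff_identity:
  assumes x: "x \<in> good J n" and n: "0 < n" and i: "fst i < L n" "snd i < 2 ^ fst i" and S: "(\<Sum>j<2 ^ L n. g j) \<noteq> 0"
  shows "(\<Sum>j<2 ^ L n. g j / (\<Sum>j<2 ^ L n. g j) * val (L n) i j) - mm n x i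
     = (sqrt (real n) * W n x i g - mm n x i * 2 ^ L n) / (\<Sum>j<2 ^ L n. g j)"
proof -
  define S where "S = (\<Sum>j<2 ^ L n. g j)"
  let ?m = "mm n x i"
  have S0: "S \<noteq> 0" using S by (simp add: S_def)
  have v0: "(\<Sum>j<2 ^ L n. val (L n) i j) = 0"
    unfolding val_def using i by (intro sum_haar_bin_eq_0) auto
  have vN: "(\<Sum>j<2 ^ L n. real (N n x j) * val (L n) i j) = real n * ?m"
    using mm_eq[OF x n i(1)] n by simp
  have "sqrt (real n) * W n x i g = (\<Sum>j<2 ^ L n. (val (L n) i j - ?m) * (g j - real (Suc (N n x j))))"
    unfolding W_def sum_distrib_left using n by (intro sum.cong refl) simp
  also have "\<dots> = (\<Sum>j<2 ^ L n. g j * val (L n) i j) - ?m * S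
      - ((\<Sum>j<2 ^ L n. real (N n x j) * val (L n) i j) + (\<Sum>j<2 ^ L n. val (L n) i j) - ?m * (\<Sum>j<2 ^ L n. real (N n x j)) - ?m * 2 ^ L n)"
  proof -
    have "(val (L n) i j - ?m) * (g j - real (Suc (N n x j))) = g j * val (L n) i j - ?m * g j
      - (real (N n x j) * val (L n) i j + val (L n) i j - ?m * real (N n x j) - ?m)" for j
      by (simp add: algebra_simps)
    then have "(\<Sum>j<2 ^ L n. (val (L n) i j - ?m) * (g j - real (Suc (N n x j)))) = (\<Sum>j<2 ^ L n. g j * val (L n) i j - ?m * g j
      - (real (N n x j) * val (L n) i j + val (L n) i j - ?m * real (N n x j) - ?m))" by (simp only:)
    also have "\<dots> = (\<Sum>j<2 ^ L n. g j * val (L n) i j) - ?m * S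
      - ((\<Sum>j<2 ^ L n. real (N n x j) * val (L n) i j) + (\<Sum>j<2 ^ L n. val (L n) i j) - ?m * (\<Sum>j<2 ^ L n. real (N n x j)) - (\<Sum>j<(2::nat) ^ L n. ?m))"
      unfolding S_def sum_distrib_left by (simp only: sum_subtractf sum.distrib)
    finally show ?thesis by (simp add: mult.commute)
  qed
  also have "\<dots> = (\<Sum>j<2 ^ L n. g j * val (L n) i j) - ?m * S + ?m * 2 ^ L n"
    unfolding vN v0 sum_N[OF x] by simp
  finally have W: "sqrt (real n) * W n x i g - ?m * 2 ^ L n = (\<Sum>j<2 ^ L n. g j * val (L n) i j) - ?m * S" by simp
  have "(\<Sum>j<2 ^ L n. g j / S * val (L n) i j) = (\<Sum>j<2 ^ L n. g j * val (L n) i j) / S"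
    by (simp add: sum_divide_distrib)
  then show ?thesis unfolding W S_def[symmetric] using S0 by (simp add: diff_divide_distrib)
qed

text \<open>The normalising sum differs from \<open>n\<close> by a relative error of order
  \<open>e\<close>, and the prior shift is at most \<open>e * sqrt n\<close>. Hence constraints on
  the coefficient and on \<open>W\<close> imply each other at slightly different radii; since
  \<open>wt i \<ge> 1\<close>, the additive error can be absorbed into the weight.\<close>

lemma coeff_close:
  assumes x: "x \<in> good J n" and n: "0 < n" and e: "0 < e" "e \<le> 1/2"
    and M: "2 ^ L n \<le> e * real n" "C0 * 2 ^ L n \<le> e * sqrt (real n)" and Xi: "\<bar>Xi n x g\<bar> < e * real n"
    and i: "fst i < L n" "snd i < 2 ^ fst i" and s: "0 \<le> s"
  defines "D \<equiv> \<bar>(\<Sum>j<2 ^ L n. g j / (\<Sum>j<2 ^ L n. g j) * val (L n) i j) - mm n x i\<bar>"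
  shows "D \<le> s * wt i / sqrt (real n) \<Longrightarrow> \<bar>W n x i g\<bar> \<le> (s * (1 + 2 * e) + e) * wt i"
    and "\<bar>W n x i g\<bar> \<le> s' * wt i \<Longrightarrow> s' + e \<le> s * (1 - e) \<Longrightarrow> D \<le> s * wt i / sqrt (real n)"
    and "0 < (\<Sum>j<2 ^ L n. g j)"
proof -
  define S where "S = (\<Sum>j<2 ^ L n. g j)"
  define r where "r = sqrt (real n)"
  have r: "0 < r" "r * r = real n" using n by (auto simp: r_def)
  have Seq: "S = real n + 2 ^ L n + Xi n x g" unfolding S_def by (rule sum_eq_Xi[OF x])
  have M0: "(0::real) \<le> 2 ^ L n" by simp
  have S_le: "S \<le> real n * (1 + 2 * e)" using Seq M(1) Xi by (simp add: algebra_simps)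
  have S_ge: "real n * (1 - e) \<le> S"
  proof -
    have "- (e * real n) \<le> Xi n x g" using Xi by (simp add: abs_less_iff)
    moreover have "real n * (1 - e) = real n - e * real n" by (simp add: algebra_simps)
    ultimately show ?thesis using Seq M0 by linarith
  qed
  have "0 < real n * (1 - e)" using n e by (intro mult_pos_pos) auto
  then have S0: "0 < S" using S_ge by linarith
  show "0 < (\<Sum>j<2 ^ L n. g j)" using S0 by (simp add: S_def)
  have wt1: "1 \<le> wt i" by (rule wt_ge_1)
  have m: "\<bar>mm n x i * 2 ^ L n\<bar> \<le> e * r"
  proof -
    have "\<bar>mm n x i * 2 ^ L n\<bar> \<le> C0 * 2 ^ L n" unfolding abs_mult using mm_bound[OF x n i] by (simp add: mult_right_mono)
    then show ?thesis using M(2) by (simp add: r_def)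
  qed
  have D: "D * S = \<bar>r * W n x i g - mm n x i * 2 ^ L n\<bar>"
  proof -
    have "D = \<bar>(r * W n x i g - mm n x i * 2 ^ L n) / S\<bar>"
      unfolding D_def r_def S_def using S0 by (subst coeff_identity[OF x n i]) (auto simp: S_def)
    then show ?thesis using S0 by simp
  qed
  have rW: "r * \<bar>W n x i g\<bar> = \<bar>r * W n x i g\<bar>" using r by (simp add: abs_mult)
  show "\<bar>W n x i g\<bar> \<le> (s * (1 + 2 * e) + e) * wt i" if d: "D \<le> s * wt i / sqrt (real n)"
  proof -
    have "D * S \<le> (s * wt i / r) * (real n * (1 + 2 * e))"
    proof (rule mult_mono)
      show "D \<le> s * wt i / r" using d by (simp add: r_def)
      show "0 \<le> s * wt i / r" using s wt1 r by simp
    qed (use S_le S0 in auto)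
    also have "\<dots> = r * (s * wt i * (1 + 2 * e))" using r by (simp add: r(2)[symmetric])
    finally have "r * \<bar>W n x i g\<bar> \<le> r * (s * wt i * (1 + 2 * e)) + e * r" using D rW m by linarith
    also have "\<dots> = r * (s * wt i * (1 + 2 * e) + e)" by (simp add: algebra_simps)
    finally have "\<bar>W n x i g\<bar> \<le> s * wt i * (1 + 2 * e) + e" using r(1) by simp
    also have "\<dots> \<le> s * wt i * (1 + 2 * e) + e * wt i" using e wt1 by simp
    finally show ?thesis by (simp add: algebra_simps)
  qed
  show "D \<le> s * wt i / sqrt (real n)" if W: "\<bar>W n x i g\<bar> \<le> s' * wt i" and s': "s' + e \<le> s * (1 - e)"
  proof -
    have "D * S \<le> r * \<bar>W n x i g\<bar> + e * r" using D rW m by linarith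
    also have "\<dots> \<le> r * (s' * wt i) + r * (e * wt i)"
    proof (rule add_mono)
      show "r * \<bar>W n x i g\<bar> \<le> r * (s' * wt i)" using W r by (intro mult_left_mono) auto
      have "e * 1 \<le> e * wt i" using wt1 e(1) less_imp_le by (intro mult_left_mono) blast+
      from mult_left_mono[OF this, of r] have "r * (e * 1) \<le> r * (e * wt i)" using r(1) by linarith
      then show "e * r \<le> r * (e * wt i)" by (simp add: mult.commute)
    qed
    also have "\<dots> = r * wt i * (s' + e)" by (simp add: algebra_simps)
    also have "\<dots> \<le> r * wt i * (s * (1 - e))" using s' r(1) wt1 by (intro mult_left_mono) auto
    also have "\<dots> = (s * wt i / r) * (real n * (1 - e))" using r by (simp add: r(2)[symmetric])
    also have "\<dots> \<le> (s * wt i / r) * S" using S_ge s wt1 r by (intro mult_left_mono) auto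
    finally show ?thesis using mult_right_le_imp_le[OF _ S0] by (simp only: r_def)
  qed
qed

text \<open>The levels behave in three ways: \<open>-1\<close> is satisfied automatically, those
  below \<open>L n\<close> are governed by the Erlang ratios, and \<open>L n\<close> leaves a
  condition on the sample that does not involve \<open>g\<close>.\<close>

lemma histogram_credible_iff:
  assumes x: "x \<in> good J n" and n: "0 < n" and s: "0 \<le> s" and S: "0 < (\<Sum>j<2 ^ L n. g j)"
  shows "histogram (L n) (normalize (2 ^ L n) g) \<in> credible_set w (L n) n s x \<longleftrightarrow>
     (\<forall>i. fst i < L n \<and> snd i < 2 ^ fst i \<longrightarrow>
        \<bar>(\<Sum>j<2 ^ L n. g j / (\<Sum>j<2 ^ L n. g j) * val (L n) i j) - mm n x i\<bar> \<le> s * wt i / sqrt (real n)) \<and>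
     (\<forall>k<2 ^ L n. \<bar>empirical_coeff n x (int (L n)) k\<bar> \<le> s * w (int (L n)) / sqrt (real n))"
proof -
  let ?h = "normalize (2 ^ L n) g"
  let ?f = "histogram (L n) ?h"
  define Q where "Q l k \<longleftrightarrow> \<bar>inner_L2 ?f (haar l k) - empirical_coeff n x l k\<bar> \<le> s * w l / sqrt (real n)" for l k
  have hj: "?h j = g j / (\<Sum>j<2 ^ L n. g j)" if "j < 2 ^ L n" for j using that by (simp add: normalize_def)
  have m1: "Q (-1) 0"
  proof -
    have "inner_L2 ?f (haar (-1) 0) = (\<Sum>j<2 ^ L n. g j / (\<Sum>j<2 ^ L n. g j))"
      unfolding inner_histogram_haar_minus_1 using hj by (intro sum.cong) auto
    also have "\<dots> = 1" using S by (simp add: sum_divide_distrib[symmetric])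
    finally have "inner_L2 ?f (haar (-1) 0) = 1" .
    moreover have "empirical_coeff n x (-1) 0 = 1"
      unfolding empirical_coeff_def using goodD(1,2)[OF x] n by (simp add: haar_def less_imp_le)
    moreover have "0 \<le> s * w (-1) / sqrt (real n)" using s w_ge_1[of "-1"] by simp
    ultimately show ?thesis by (simp add: Q_def)
  qed
  have lev: "Q (int (L n)) k \<longleftrightarrow> \<bar>empirical_coeff n x (int (L n)) k\<bar> \<le> s * w (int (L n)) / sqrt (real n)" if "k < 2 ^ L n" for k
    unfolding Q_def inner_histogram_haar_level[OF that] by simp
  have fine: "Q (int (fst i)) (snd i) \<longleftrightarrow> \<bar>(\<Sum>j<2 ^ L n. g j / (\<Sum>j<2 ^ L n. g j) * val (L n) i j) - mm n x i\<bar> \<le> s * wt i / sqrt (real n)"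
    if "fst i < L n" for i
  proof -
    have "inner_L2 ?f (haar (int (fst i)) (snd i)) = (\<Sum>j<2 ^ L n. g j / (\<Sum>j<2 ^ L n. g j) * val (L n) i j)"
      using that hj by (subst inner_histogram_haar) (auto simp: val_def intro!: sum.cong)
    then show ?thesis by (simp add: Q_def mm_def wt_def)
  qed
  have "?f \<in> credible_set w (L n) n s x \<longleftrightarrow> (\<forall>(l, k)\<in>{(l, k) \<in> haar_index. l \<le> int (L n)}. Q l k)"
    unfolding credible_iff[OF n] Q_def using histogram_in_L2 by simp
  also have "\<dots> \<longleftrightarrow> (\<forall>i. fst i < L n \<and> snd i < 2 ^ fst i \<longrightarrow> Q (int (fst i)) (snd i)) \<and> (\<forall>k<2 ^ L n. Q (int (L n)) k)"
  proof (intro iffI conjI allI impI)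
    assume all: "\<forall>(l, k)\<in>{(l, k) \<in> haar_index. l \<le> int (L n)}. Q l k"
    show "Q (int (fst i)) (snd i)" if "fst i < L n \<and> snd i < 2 ^ fst i" for i
      using all that by (auto simp: haar_index_def)
    show "Q (int (L n)) k" if "k < 2 ^ L n" for k
      using all that by (auto simp: haar_index_def)
  next
    assume a: "(\<forall>i. fst i < L n \<and> snd i < 2 ^ fst i \<longrightarrow> Q (int (fst i)) (snd i)) \<and> (\<forall>k<2 ^ L n. Q (int (L n)) k)"
    show "\<forall>(l, k)\<in>{(l, k) \<in> haar_index. l \<le> int (L n)}. Q l k"
    proof (rule ballI)
      fix p assume p: "p \<in> {(l, k) \<in> haar_index. l \<le> int (L n)}"
      obtain l k where lk: "p = (l, k)" "(l, k) \<in> haar_index" "l \<le> int (L n)" using p by auto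
      consider "l = -1" "k = 0" | "0 \<le> l" "l < int (L n)" "k < 2 ^ nat l" | "l = int (L n)" "k < 2 ^ L n"
        using lk by (fastforce simp: haar_index_def)
      then have "Q l k"
      proof cases
        case 2
        then show ?thesis using a[THEN conjunct1, rule_format, of "(nat l, k)"] by auto
      qed (use m1 a in auto)
      then show "case p of (l, k) \<Rightarrow> Q l k" by (simp add: lk(1))
    qed
  qed
  finally show ?thesis using fine lev by auto
qed

lemma eventually_close:
  assumes e: "0 < e"
  shows "\<forall>\<^sub>F n in sequentially. 0 < n \<and> 2 ^ L n \<le> e * real n \<and> C0 * 2 ^ L n \<le> e * sqrt (real n)"
proof -
  have C: "0 < C0" using C0_ge by simp
  have "\<forall>\<^sub>F n in sequentially. 2 ^ L n \<le> (e / C0) * sqrt (real n)" using e C by (intro eventually_bins_le) simp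
  moreover have "\<forall>\<^sub>F n in sequentially. 2 ^ L n \<le> e * sqrt (real n)" by (rule eventually_bins_le[OF e])
  ultimately show ?thesis using eventually_gt_at_top[of 0]
  proof eventually_elim
    case (elim n)
    have "sqrt (real n) \<le> real n" using elim by (intro real_le_lsqrt) (auto simp: power2_eq_square)
    then have "e * sqrt (real n) \<le> e * real n" using e by (intro mult_left_mono) auto
    then show ?case using elim C by (auto simp: field_simps)
  qed
qed

lemma post_set_measurable:
  assumes "0 < n"
  shows "{g \<in> space (E n x). histogram (L n) (normalize (2 ^ L n) g) \<in> credible_set w (L n) n s x} \<in> sets (E n x)"
proof -
  have "(\<lambda>g. histogram (L n) (normalize (2 ^ L n) g)) \<in> E n x \<rightarrow>\<^sub>M L2_borel" by measurable
  from measurable_sets[OF this credible_set_sets[OF assms, of "L n" s x]] show ?thesis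
    by (simp add: vimage_def Int_def conj_commute)
qed

lemma W_box_sets: "{g \<in> space (E n x). \<forall>i\<in>I J. \<bar>W n x i g\<bar> \<le> s * wt i} \<in> sets (E n x)"
  by (intro sets.sets_Collect_finite_All borel_measurable_le borel_measurable_abs W_measurable) auto

text \<open>Discarding the levels above \<open>J\<close> only enlarges the credible set, so the
  Gaussian limit on finitely many levels suffices. The gap between \<open>s\<close> and
  \<open>s'\<close> pays for the linearisation.\<close>

lemma post_upper:
  assumes X: "\<forall>\<^sub>F n in sequentially. X n \<in> good J n" and s: "0 \<le> s" "s < s'" and p: "FJ J s' < p"
  shows "\<forall>\<^sub>F n in sequentially. post n s (X n) < p"
proof -
  \<comment> \<open>The largest \<open>e\<close> up to \<open>1/2\<close> with
    \<open>s * (1 + 2 * e) + e \<le> s'\<close>.\<close>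
  define e where "e = min (1/2) ((s' - s) / (2 * s + 1))"
  have e0: "0 < e" unfolding e_def using s by simp
  have e1: "e \<le> 1/2" unfolding e_def by (rule min.cobounded1)
  note e = e0 e1
  have se: "s * (1 + 2 * e) + e \<le> s'"
  proof -
    have "e \<le> (s' - s) / (2 * s + 1)" unfolding e_def by (rule min.cobounded2)
    then have "e * (2 * s + 1) \<le> s' - s" using s by (subst (asm) pos_le_divide_eq) auto
    then show ?thesis by (simp add: algebra_simps)
  qed
  have "(\<lambda>n. measure (E n (X n)) {g \<in> space (E n (X n)). e * real n \<le> \<bar>Xi n (X n) g\<bar>} + measure (E n (X n)) {g \<in> space (E n (X n)). \<forall>i\<in>I J. \<bar>W n (X n) i g\<bar> \<le> s' * wt i}) \<longlonglongrightarrow> 0 + FJ J s'"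
    using e s by (intro tendsto_add Xi_tail[OF X] W_box[OF X]) auto
  then have "\<forall>\<^sub>F n in sequentially. measure (E n (X n)) {g \<in> space (E n (X n)). e * real n \<le> \<bar>Xi n (X n) g\<bar>} + measure (E n (X n)) {g \<in> space (E n (X n)). \<forall>i\<in>I J. \<bar>W n (X n) i g\<bar> \<le> s' * wt i} < p"
    using p by (intro order_tendstoD) auto
  then show ?thesis
    using X eventually_close[OF e(1)] eventually_level_gt[of J]
  proof eventually_elim
    case (elim n)
    interpret E: prob_space "E n (X n)" by (rule prob_space_E)
    let ?Xi = "{g \<in> space (E n (X n)). e * real n \<le> \<bar>Xi n (X n) g\<bar>}"
    let ?W = "{g \<in> space (E n (X n)). \<forall>i\<in>I J. \<bar>W n (X n) i g\<bar> \<le> s' * wt i}"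
    have Xm: "?Xi \<in> sets (E n (X n))" by measurable
    have "post n s (X n) \<le> measure (E n (X n)) (?Xi \<union> ?W)"
      unfolding post_def
    proof (rule E.finite_measure_mono)
      show "?Xi \<union> ?W \<in> sets (E n (X n))" using Xm W_box_sets by (intro sets.Un) auto
      show "{g \<in> space (E n (X n)). histogram (L n) (normalize (2 ^ L n) g) \<in> credible_set w (L n) n s (X n)} \<subseteq> ?Xi \<union> ?W"
      proof
        fix g assume g: "g \<in> {g \<in> space (E n (X n)). histogram (L n) (normalize (2 ^ L n) g) \<in> credible_set w (L n) n s (X n)}"
        show "g \<in> ?Xi \<union> ?W"
        proof (cases "g \<in> ?Xi")
          case False
          then have xi: "\<bar>Xi n (X n) g\<bar> < e * real n" using g by auto
          have n: "0 < n" and M: "2 ^ L n \<le> e * real n" "C0 * 2 ^ L n \<le> e * sqrt (real n)" using elim by auto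
          have "\<bar>W n (X n) i g\<bar> \<le> s' * wt i" if i: "i \<in> I J" for i
          proof -
            have i': "fst i < L n" "snd i < 2 ^ fst i" using i elim by (auto simp: I_def)
            note cc = coeff_close[OF elim(2) n e M xi i' s(1)]
            have "\<bar>W n (X n) i g\<bar> \<le> (s * (1 + 2 * e) + e) * wt i"
              using g i' by (intro cc(1) histogram_credible_iff[OF elim(2) n s(1) cc(3), THEN iffD1, THEN conjunct1, rule_format]) auto
            also have "\<dots> \<le> s' * wt i" using se wt_ge_1[of i] by (intro mult_right_mono) auto
            finally show ?thesis .
          qed
          then show ?thesis using g by auto
        qed simp
      qed
    qed
    also have "\<dots> \<le> measure (E n (X n)) ?Xi + measure (E n (X n)) ?W"
      using Xm W_box_sets by (rule measure_Un_le)
    finally show ?case using elim(1) by linarith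
  qed
qed

text \<open>Noise and bias at the top level are both of order \<open>sqrt (L n)\<close> after
  scaling, and \<open>w (L n)\<close> exceeds any multiple of this. The degenerate level therefore
  imposes no constraint for large \<open>n\<close>, however small the fixed radius.\<close>

lemma level_coefficient_small:
  assumes s: "0 < s"
  shows "\<forall>\<^sub>F n in sequentially. \<forall>x\<in>good J n. \<forall>k<2 ^ L n. \<bar>empirical_coeff n x (int (L n)) k\<bar> \<le> s * w (int (L n)) / sqrt (real n)"
proof -
  obtain C where C: "0 < C" and bias: "\<forall>\<^sub>F n in sequentially. sqrt (real n) * 2 powr (- real (L n) * (\<gamma> + 1/2)) \<le> C * sqrt (real (L n))"
    by (rule bias_bound)
  define B where "B = (F + 2 + H * C) / s"
  have "filterlim (\<lambda>n. int (L n)) at_top sequentially"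
    by (rule filterlim_compose[OF filterlim_int_sequentially L_at_top])
  from filterlim_compose[OF w_ratio_lim this]
  have "\<forall>\<^sub>F n in sequentially. B \<le> w (int (L n)) / sqrt (real_of_int (int (L n)))" by (simp add: filterlim_at_top)
  then show ?thesis using bias eventually_level_gt[of 0] eventually_gt_at_top[of 0]
  proof eventually_elim
    case (elim n)
    show ?case
    proof (intro ballI allI impI)
      fix x and k :: nat assume x: "x \<in> good J n" and k: "k < 2 ^ L n"
      have "sqrt (real n) * \<bar>\<theta> (int (L n)) k\<bar> \<le> sqrt (real n) * (H * 2 powr (- real (L n) * (\<gamma> + 1/2)))"
        using abs_theta_le[of "int (L n)" k] k by (intro mult_left_mono) auto
      also have "\<dots> = H * (sqrt (real n) * 2 powr (- real (L n) * (\<gamma> + 1/2)))" by simp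
      also have "\<dots> \<le> H * (C * sqrt (real (L n)))" using elim H_nonneg by (intro mult_left_mono) auto
      finally have 1: "sqrt (real n) * \<bar>\<theta> (int (L n)) k\<bar> \<le> H * C * sqrt (real (L n))" by simp
      have "sqrt (real n) * \<bar>empirical_coeff n x (int (L n)) k\<bar> \<le> sqrt (real n) * \<bar>empirical_coeff n x (int (L n)) k - \<theta> (int (L n)) k\<bar> + sqrt (real n) * \<bar>\<theta> (int (L n)) k\<bar>"
        unfolding distrib_left[symmetric] by (intro mult_left_mono) auto
      also have "\<dots> \<le> (F + 2) * sqrt (real (L n)) + H * C * sqrt (real (L n))" using goodD(5)[OF x k] 1 by linarith
      also have "\<dots> = s * (B * sqrt (real (L n)))" using s by (simp add: B_def distrib_right)
      also have "\<dots> \<le> s * w (int (L n))" using elim s by (intro mult_left_mono) (auto simp: field_simps)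
      finally show "\<bar>empirical_coeff n x (int (L n)) k\<bar> \<le> s * w (int (L n)) / sqrt (real n)"
        using elim by (simp add: pos_le_divide_eq mult.commute)
    qed
  qed
qed

text \<open>Here the levels above \<open>J\<close> cannot be dropped: those below \<open>L n\<close>
  cost at most \<open>2 / 2 ^ J\<close> of probability, and the level \<open>L n\<close> is
  satisfied on every good sample.\<close>

lemma post_lower:
  assumes X: "\<forall>\<^sub>F n in sequentially. X n \<in> good J n" and s: "0 < s'" "s' < s"
    and tail: "\<And>l. J < l \<Longrightarrow> (2 * V0 + 2) * sqrt (real l) \<le> s' * w (int l)" and p: "p + 2 / 2 ^ J < FJ J s'"
  shows "\<forall>\<^sub>F n in sequentially. p < post n s (X n)"
proof -
  \<comment> \<open>The largest \<open>e\<close> up to \<open>1/2\<close> with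
    \<open>s' + e \<le> s * (1 - e)\<close>.\<close>
  define e where "e = min (1/2) ((s - s') / (1 + s))"
  have e0: "0 < e" unfolding e_def using s by simp
  have e1: "e \<le> 1/2" unfolding e_def by (rule min.cobounded1)
  note e = e0 e1
  have se: "s' + e \<le> s * (1 - e)"
  proof -
    have "e \<le> (s - s') / (1 + s)" unfolding e_def by (rule min.cobounded2)
    then have "e * (1 + s) \<le> s - s'" using s by (subst (asm) pos_le_divide_eq) auto
    then show ?thesis by (simp add: algebra_simps)
  qed
  have tl: "\<forall>\<^sub>F n in sequentially. measure (E n (X n)) {g \<in> space (E n (X n)). \<exists>l k. J < l \<and> l \<le> L n - 1 \<and> k < 2 ^ l \<and> s' * w (int l) \<le> \<bar>W n (X n) (l, k) g\<bar>} \<le> 2 / 2 ^ J"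
    by (rule W_tail[OF X]) (fact tail)
  have s_pos: "0 < s" using s by simp
  have "(\<lambda>n. measure (E n (X n)) {g \<in> space (E n (X n)). \<forall>i\<in>I J. \<bar>W n (X n) i g\<bar> \<le> s' * wt i} - measure (E n (X n)) {g \<in> space (E n (X n)). e * real n \<le> \<bar>Xi n (X n) g\<bar>}) \<longlonglongrightarrow> FJ J s' - 0"
    using e s by (intro tendsto_diff Xi_tail[OF X] W_box[OF X]) auto
  then have "\<forall>\<^sub>F n in sequentially. p + 2 / 2 ^ J < measure (E n (X n)) {g \<in> space (E n (X n)). \<forall>i\<in>I J. \<bar>W n (X n) i g\<bar> \<le> s' * wt i} - measure (E n (X n)) {g \<in> space (E n (X n)). e * real n \<le> \<bar>Xi n (X n) g\<bar>}"
    using p by (intro order_tendstoD) auto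
  then show ?thesis
    using X eventually_close[OF e(1)] tl level_coefficient_small[OF s_pos, of J]
  proof eventually_elim
    case (elim n)
    interpret E: prob_space "E n (X n)" by (rule prob_space_E)
    let ?Xi = "{g \<in> space (E n (X n)). e * real n \<le> \<bar>Xi n (X n) g\<bar>}"
    let ?W = "{g \<in> space (E n (X n)). \<forall>i\<in>I J. \<bar>W n (X n) i g\<bar> \<le> s' * wt i}"
    let ?T = "{g \<in> space (E n (X n)). \<exists>l k. J < l \<and> l \<le> L n - 1 \<and> k < 2 ^ l \<and> s' * w (int l) \<le> \<bar>W n (X n) (l, k) g\<bar>}"
    let ?Q = "{g \<in> space (E n (X n)). histogram (L n) (normalize (2 ^ L n) g) \<in> credible_set w (L n) n s (X n)}"
    have n: "0 < n" and M: "2 ^ L n \<le> e * real n" "C0 * 2 ^ L n \<le> e * sqrt (real n)" using elim by auto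
    have Xm: "?Xi \<in> sets (E n (X n))" by measurable
    have Tm: "?T \<in> sets (E n (X n))"
    proof -
      have "?T = (\<Union>l\<in>{J<..L n - 1}. \<Union>k\<in>{..<2 ^ l}. {g \<in> space (E n (X n)). s' * w (int l) \<le> \<bar>W n (X n) (l, k) g\<bar>})" by auto
      moreover have "{g \<in> space (E n (X n)). s' * w (int l) \<le> \<bar>W n (X n) (l, k) g\<bar>} \<in> sets (E n (X n))" for l k by measurable
      ultimately show ?thesis by (simp only:) (intro sets.finite_UN finite_greaterThanAtMost finite_lessThan)
    qed
    have Qm: "?Q \<in> sets (E n (X n))" by (rule post_set_measurable[OF n])
    have sub: "?W \<subseteq> ?Q \<union> ?Xi \<union> ?T"
    proof
      fix g assume g: "g \<in> ?W"
      show "g \<in> ?Q \<union> ?Xi \<union> ?T"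
      proof (cases "g \<in> ?Xi \<or> g \<in> ?T")
        case False
        then have xi: "\<bar>Xi n (X n) g\<bar> < e * real n" and nT: "g \<notin> ?T" using g by auto
        have sp: "g \<in> space (E n (X n))" using g by auto
        have S: "0 < (\<Sum>j<2 ^ L n. g j)"
        proof -
          have "0 < real n * (1 - e)" using n e by (intro mult_pos_pos) auto
          moreover have "- (e * real n) \<le> Xi n (X n) g" using xi by (simp add: abs_less_iff)
          moreover have "real n * (1 - e) = real n - e * real n" "(0::real) \<le> 2 ^ L n" by (simp_all add: algebra_simps)
          ultimately show ?thesis unfolding sum_eq_Xi[OF elim(2)] by linarith
        qed
        have D: "\<bar>(\<Sum>j<2 ^ L n. g j / (\<Sum>j<2 ^ L n. g j) * val (L n) i j) - mm n (X n) i\<bar> \<le> s * wt i / sqrt (real n)"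
          if i: "fst i < L n" "snd i < 2 ^ fst i" for i
        proof (rule coeff_close(2)[OF elim(2) n e M xi i _ _ se])
          show "0 \<le> s" using s by simp
          show "\<bar>W n (X n) i g\<bar> \<le> s' * wt i"
          proof (cases "fst i \<le> J")
            case True
            then have "i \<in> I J" using i by (cases i) (auto simp: I_def)
            then show ?thesis using g by auto
          next
            case False
            obtain l k where lk: "i = (l, k)" by (cases i)
            have "\<not> (s' * w (int l) \<le> \<bar>W n (X n) (l, k) g\<bar>)"
            proof
              assume "s' * w (int l) \<le> \<bar>W n (X n) (l, k) g\<bar>"
              moreover have "J < l" "l \<le> L n - 1" "k < 2 ^ l" using i False lk by auto
              ultimately have "g \<in> ?T" using sp by blast
              then show False using nT by blast
            qed
            then show ?thesis by (simp add: lk wt_def)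
          qed
        qed
        have "g \<in> ?Q"
          proof (rule CollectI, rule conjI[OF sp], rule histogram_credible_iff[OF elim(2) n _ S, THEN iffD2], goal_cases)
          case 1
          then show ?case using s by simp
        next
          case 2
          then show ?case using D elim(5) elim(2) by blast
        qed
        then show ?thesis by blast
      qed auto
    qed
    have "measure (E n (X n)) ?W \<le> measure (E n (X n)) (?Q \<union> ?Xi \<union> ?T)"
      using Qm Xm Tm by (intro E.finite_measure_mono sub sets.Un)
    also have "\<dots> \<le> measure (E n (X n)) ?Q + measure (E n (X n)) ?Xi + measure (E n (X n)) ?T"
      using Qm Xm Tm by (intro order_trans[OF measure_Un_le] add_mono order_refl measure_Un_le sets.Un)
    finally show ?case using elim(1,4) unfolding post_def by linarith
  qed
qed

text \<open>If uniformity failed for infinitely many \<open>n\<close>, a sequence of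
  counterexamples, completed by arbitrary good samples elsewhere, would contradict the hypothesis.
  Good samples exist eventually because their probability tends to one.\<close>

lemma good_uniform:
  assumes "\<And>X. \<forall>\<^sub>F n in sequentially. X n \<in> good J n \<Longrightarrow> \<forall>\<^sub>F n in sequentially. Q n (X n)"
  shows "\<forall>\<^sub>F n in sequentially. \<forall>x\<in>good J n. Q n x"
proof -
  define X where "X n = (if \<exists>x\<in>good J n. \<not> Q n x then SOME x. x \<in> good J n \<and> \<not> Q n x else SOME x. x \<in> good J n)" for n
  have "\<forall>\<^sub>F n in sequentially. 0 < measure (P n) (good J n)"
    by (rule order_tendstoD(1)[OF good_prob]) simp
  then have ne: "\<forall>\<^sub>F n in sequentially. good J n \<noteq> {}" by eventually_elim auto
  have bad: "X n \<in> good J n \<and> \<not> Q n (X n)" if "\<exists>x\<in>good J n. \<not> Q n x" for n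
  proof -
    have "\<exists>x. x \<in> good J n \<and> \<not> Q n x" using that by blast
    from someI_ex[OF this] show ?thesis using that by (simp add: X_def)
  qed
  have "\<forall>\<^sub>F n in sequentially. X n \<in> good J n"
    using ne
  proof eventually_elim
    case (elim n)
    show ?case
    proof (cases "\<exists>x\<in>good J n. \<not> Q n x")
      case False
      then show ?thesis using elim some_in_eq[of "good J n"] by (simp add: X_def)
    qed (use bad in blast)
  qed
  from assms[OF this] show ?thesis by eventually_elim (use bad in blast)
qed

section \<open>Fixed radii around the posterior quantile\<close>

definition FT :: "nat \<Rightarrow> real \<Rightarrow> (nat \<Rightarrow> real) set" where
  "FT n s = {x \<in> space (P n). \<forall>i\<in>I (L n). \<bar>Z n i x\<bar> \<le> s * wt i}"

text \<open>The tail level \<open>J\<close> has to be fixed before the quantiles: \<open>s0\<close>, obtained from level \<open>0\<close> alone,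
  bounds all of them from below.\<close>

lemma quantile_bracket:
  assumes a: "0 < a" "a < 1" and \<eta>: "0 < \<eta>" "\<eta> < a" "\<eta> < 1 - a"
  obtains s1 s2 J where "0 < s1" "s1 < s2"
    "\<forall>\<^sub>F n in sequentially. \<forall>x\<in>good J n. post n s1 x < a" "\<forall>\<^sub>F n in sequentially. \<forall>x\<in>good J n. a < post n s2 x"
    "\<forall>\<^sub>F n in sequentially. a - 2 * \<eta> \<le> measure (P n) (FT n s1)" "\<forall>\<^sub>F n in sequentially. measure (P n) (FT n s2) \<le> a + 2 * \<eta>"
proof -
  \<comment> \<open>Half of \<open>a - \<eta>\<close> leaves a strict gap whatever \<open>J\<close>
    will be: \<open>FJ J s0 \<le> FJ 0 s0 < FJ J s1\<close>, hence \<open>s0 < s1\<close>.\<close>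
  obtain s0 where s0: "0 < s0" "FJ 0 s0 = (a - \<eta>) / 2" using FJ_quantile[of "(a - \<eta>) / 2" 0] a \<eta> by auto
  have "\<forall>\<^sub>F l in at_top. (2 * V0 + 2) / s0 \<le> w l / sqrt (real_of_int l)"
    using w_ratio_lim by (simp add: filterlim_at_top)
  then obtain l0 :: int where l0: "\<And>l. l0 \<le> l \<Longrightarrow> (2 * V0 + 2) / s0 \<le> w l / sqrt (real_of_int l)"
    by (auto simp: eventually_at_top_linorder)
  have "(\<lambda>m. 2 / 2 ^ m :: real) \<longlonglongrightarrow> 0" by real_asymp
  then have "\<forall>\<^sub>F m in sequentially. (2 / 2 ^ m :: real) < \<eta> / 4" using \<eta> by (intro order_tendstoD) auto
  then obtain J0 where J0: "\<And>m. J0 \<le> m \<Longrightarrow> (2 / 2 ^ m :: real) < \<eta> / 4" by (auto simp: eventually_sequentially)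
  define J where "J = max J0 (nat l0)"
  have J: "2 / 2 ^ J < \<eta> / 4" using J0[of J] by (simp add: J_def)
  have tail0: "(2 * V0 + 2) * sqrt (real l) \<le> s0 * w (int l)" if "J < l" for l
  proof -
    have "l0 \<le> int l" "0 < sqrt (real l)" using that by (auto simp: J_def)
    then show ?thesis using l0[of "int l"] s0(1) by (simp add: field_simps)
  qed
  \<comment> \<open>Of four ordered quantiles the outer two become the radii; the inner two leave
    room for the linearisation. The level \<open>a + \<eta> / 2\<close> stays above \<open>a\<close>
    after the tail cost \<open>\<eta> / 4\<close>.\<close>
  obtain s1 where s1: "0 < s1" "FJ J s1 = a - \<eta>" using FJ_quantile[of "a - \<eta>" J] a \<eta> by auto
  obtain s1' where s1': "0 < s1'" "FJ J s1' = a - \<eta> / 2" using FJ_quantile[of "a - \<eta> / 2" J] a \<eta> by auto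
  obtain s2' where s2': "0 < s2'" "FJ J s2' = a + \<eta> / 2" using FJ_quantile[of "a + \<eta> / 2" J] a \<eta> by auto
  obtain s2 where s2: "0 < s2" "FJ J s2 = a + \<eta>" using FJ_quantile[of "a + \<eta>" J] a \<eta> by auto
  have lt: "s < s'" if "FJ J s < FJ J s'" for s s'
    using FJ_mono[of s' s J] that by (cases "s' \<le> s") auto
  have "FJ J s0 < FJ J s1" using FJ_le_F0[of s0 J] s0 s1 a \<eta> by simp
  then have o: "s0 < s1" by (rule lt)
  have o1: "s1 < s1'" "s1' < s2'" "s2' < s2" using s1 s1' s2' s2 \<eta> by - (rule lt, simp)+
  have tail: "(2 * V0 + 2) * sqrt (real l) \<le> s * w (int l)" if "J < l" "s0 \<le> s" for l s
  proof -
    have "s0 * w (int l) \<le> s * w (int l)" using that w_ge_1[of "int l"] by (intro mult_right_mono) auto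
    then show ?thesis using tail0[OF that(1)] by linarith
  qed
  show thesis
  proof (rule that[of s1 s2 J])
    show "0 < s1" "s1 < s2" using s1 o1 by auto
    show "\<forall>\<^sub>F n in sequentially. \<forall>x\<in>good J n. post n s1 x < a"
      by (rule good_uniform, rule post_upper[where s'=s1']) (use s1 s1' o1 \<eta> in auto)
    show "\<forall>\<^sub>F n in sequentially. \<forall>x\<in>good J n. a < post n s2 x"
      by (rule good_uniform, rule post_lower[where s'=s2']) (use s2' o o1 \<eta> J tail in auto)
    show "\<forall>\<^sub>F n in sequentially. a - 2 * \<eta> \<le> measure (P n) (FT n s1)"
    proof -
      have "(\<lambda>n. measure (P n) {x \<in> space (P n). \<forall>i\<in>I J. \<bar>Z n i x\<bar> \<le> s1 * wt i}) \<longlonglongrightarrow> a - \<eta>"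
        using Z_box[of s1 J] s1 by simp
      then have "\<forall>\<^sub>F n in sequentially. a - \<eta> - \<eta> / 4 < measure (P n) {x \<in> space (P n). \<forall>i\<in>I J. \<bar>Z n i x\<bar> \<le> s1 * wt i}"
        using \<eta> by (intro order_tendstoD) auto
      moreover have "\<forall>\<^sub>F n in sequentially. measure (P n) {x \<in> space (P n). \<forall>i\<in>I J. \<bar>Z n i x\<bar> \<le> s1 * wt i} - 2 / 2 ^ J \<le> measure (P n) (FT n s1)"
        unfolding FT_def by (rule freq_tail) (use tail o in auto)
      ultimately show ?thesis by eventually_elim (use J \<eta> in linarith)
    qed
    show "\<forall>\<^sub>F n in sequentially. measure (P n) (FT n s2) \<le> a + 2 * \<eta>"
    proof -
      have "(\<lambda>n. measure (P n) {x \<in> space (P n). \<forall>i\<in>I J. \<bar>Z n i x\<bar> \<le> s2 * wt i}) \<longlonglongrightarrow> a + \<eta>"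
        using Z_box[of s2 J] s2 by simp
      then have "\<forall>\<^sub>F n in sequentially. measure (P n) {x \<in> space (P n). \<forall>i\<in>I J. \<bar>Z n i x\<bar> \<le> s2 * wt i} < a + 2 * \<eta>"
        using \<eta> by (intro order_tendstoD) auto
      then show ?thesis using eventually_level_gt[of J]
      proof eventually_elim
        case (elim n)
        have "I J \<subseteq> I (L n)" using elim by (auto simp: I_def)
        then have "measure (P n) (FT n s2) \<le> measure (P n) {x \<in> space (P n). \<forall>i\<in>I J. \<bar>Z n i x\<bar> \<le> s2 * wt i}"
          unfolding FT_def by (intro P.finite_measure_mono Z_box_sets) auto
        then show ?case using elim by linarith
      qed
    qed
  qed
qed

end

section \<open>Diameters of the credible sets\<close>

text \<open>The constant \<open>4\<close> is one for which the induction closes, as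
  \<open>4 \<le> 3 * sqrt 2\<close>.\<close>

lemma sum_powr_half_le: "(\<Sum>l\<le>m. 2 powr (real l / 2)) \<le> 4 * 2 powr (real m / 2)"
proof (induction m)
  case (Suc m)
  have s: "4 / 3 \<le> sqrt (2::real)" by (rule real_le_rsqrt) (simp add: power2_eq_square)
  have "2 powr (real (Suc m) / 2) = 2 powr (real m / 2) * sqrt 2"
    by (simp add: powr_add[symmetric] powr_half_sqrt[symmetric] add_divide_distrib add.commute)
  moreover have "2 powr (real m / 2) * (4 / 3) \<le> 2 powr (real m / 2) * sqrt 2"
    using s by (intro mult_left_mono) auto
  ultimately show ?case using Suc by (simp only: sum.atMost_Suc)
qed simp

text \<open>The explicit remainder makes the induction work; truncated subtraction turns the right
  side into \<open>0\<close> as long as the sum is empty.\<close>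

lemma sum_tail_le: "(\<Sum>l<M. if m < l then (3 / 4 :: real) ^ (l - m) else 0) \<le> 3 - 3 * (3 / 4) ^ (M - 1 - m)"
proof (induction M)
  case (Suc M)
  show ?case
  proof (cases "m < M")
    case True
    then have "M - m = Suc (M - 1 - m)" by simp
    then show ?thesis using Suc True by simp
  qed (use Suc in auto)
qed simp

lemma L2_diff: "f \<in> L2 \<Longrightarrow> g \<in> L2 \<Longrightarrow> (\<lambda>t. f t - g t) \<in> L2"
proof -
  assume f: "f \<in> L2" and g: "g \<in> L2"
  then have [measurable]: "f \<in> borel_measurable unit_leb" "g \<in> borel_measurable unit_leb" by (auto simp: L2_def)
  have "integrable unit_leb (\<lambda>x. (f x - g x)\<^sup>2)"
  proof (rule Bochner_Integration.integrable_bound)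
    show "integrable unit_leb (\<lambda>x. 2 * (f x)\<^sup>2 + 2 * (g x)\<^sup>2)" using f g by (auto simp: L2_def)
    have "(f x - g x)\<^sup>2 \<le> 2 * (f x)\<^sup>2 + 2 * (g x)\<^sup>2" for x
      using zero_le_power2[of "f x + g x"] by (simp add: power2_eq_square algebra_simps)
    then show "AE x in unit_leb. norm ((f x - g x)\<^sup>2) \<le> norm (2 * (f x)\<^sup>2 + 2 * (g x)\<^sup>2)" by simp
  qed measurable
  then show ?thesis by (simp add: L2_def)
qed

lemma L2_mult_integrable: "f \<in> L2 \<Longrightarrow> g \<in> L2 \<Longrightarrow> integrable unit_leb (\<lambda>t. f t * g t)"
proof -
  assume f: "f \<in> L2" and g: "g \<in> L2"
  then have [measurable]: "f \<in> borel_measurable unit_leb" "g \<in> borel_measurable unit_leb" by (auto simp: L2_def)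
  show ?thesis
  proof (rule Bochner_Integration.integrable_bound)
    show "integrable unit_leb (\<lambda>x. (f x)\<^sup>2 + (g x)\<^sup>2)" using f g by (auto simp: L2_def)
    have "\<bar>f x * g x\<bar> \<le> (f x)\<^sup>2 + (g x)\<^sup>2" for x
      using sum_squares_bound[of "\<bar>f x\<bar>" "\<bar>g x\<bar>"] mult_nonneg_nonneg[OF abs_ge_zero abs_ge_zero, of "f x" "g x"] unfolding abs_mult power2_abs by linarith
    then show "AE x in unit_leb. norm (f x * g x) \<le> norm ((f x)\<^sup>2 + (g x)\<^sup>2)" by simp
  qed measurable
qed

lemma inner_L2_diff: "f \<in> L2 \<Longrightarrow> g \<in> L2 \<Longrightarrow> h \<in> L2 \<Longrightarrow> inner_L2 (\<lambda>t. f t - g t) h = inner_L2 f h - inner_L2 g h"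
  unfolding inner_L2_def by (simp add: left_diff_distrib L2_mult_integrable)

lemma credible_set_mono: "r \<le> r' \<Longrightarrow> credible_set w m n r x \<subseteq> credible_set w m n r' x"
proof -
  assume "r \<le> r'"
  then have "r / sqrt (real n) \<le> r' / sqrt (real n)" by (intro divide_right_mono) auto
  then show ?thesis unfolding credible_set_def using order_trans by blast
qed

lemma empirical_coeff_restrict: "empirical_coeff n (restrict x {..<n}) = empirical_coeff n x"
  by (simp add: empirical_coeff_def fun_eq_iff)

lemma credible_set_restrict: "credible_set w m n r (restrict x {..<n}) = credible_set w m n r x"
  by (simp add: credible_set_def empirical_coeff_restrict)

context histogram_setting
begin

text \<open>Up to level \<open>L n\<close> two members differ by at most twice the radius around the
  empirical coefficient, with \<open>w\<close> bounded by its value at the top level; beyond it the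
  smoothness constraint takes over. The geometric sums give \<open>10 = 2 * (4 + 1)\<close>, the
  extra one for level \<open>-1\<close>, and \<open>6 = 2 * 3\<close>, because
  \<open>2 powr (- \<gamma>) \<le> 3/4\<close>.\<close>

lemma sup_diameter_le:
  assumes n: "0 < n" and L: "0 < L n" and r: "0 \<le> r" and u: "u = w (int (L n)) / sqrt (real (L n))"
    and A: "A \<subseteq> credible_set w (L n) n r x \<inter> smooth_set \<gamma> u"
  shows "sup_diameter A \<le> ennreal (10 * r * u * (2 powr (real (L n) / 2) * sqrt (real (L n)) / sqrt (real n)) + 6 * u * 2 powr (- real (L n) * \<gamma>))"
    (is "_ \<le> ennreal ?B")
  unfolding sup_diameter_def
proof (intro SUP_least)
  fix f g assume "f \<in> A" "g \<in> A"
  then have f: "f \<in> credible_set w (L n) n r x" "f \<in> smooth_set \<gamma> u" and g: "g \<in> credible_set w (L n) n r x" "g \<in> smooth_set \<gamma> u"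
    using A by auto
  have L2: "f \<in> L2" "g \<in> L2" using f g by (auto simp: smooth_set_def)
  define m where "m = L n"
  define a where "a = 2 * r * w (int m) / sqrt (real n)"
  define b where "b l = (if l \<le> int m then a else 2 * u * 2 powr (- real_of_int l * (\<gamma> + 1/2)))" for l :: int
  have w1: "1 \<le> w (int m)" by (rule w_ge_1) simp
  have u0: "0 \<le> u" using u w1 by (simp add: m_def)
  have wu: "w (int m) = u * sqrt (real m)" using u L by (simp add: m_def)
  have a0: "0 \<le> a" using r w1 by (simp add: a_def)
  have coeff: "\<bar>inner_L2 (\<lambda>t. f t - g t) (haar l k)\<bar> \<le> b l" if lk: "(l, k) \<in> haar_index" for l k
  proof -
    let ?f = "inner_L2 f (haar l k)" and ?g = "inner_L2 g (haar l k)"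
    have eq: "inner_L2 (\<lambda>t. f t - g t) (haar l k) = ?f - ?g"
      using L2 haar_index_in_L2[OF lk] by (rule inner_L2_diff)
    show ?thesis
    proof (cases "l \<le> int m")
      case True
      let ?e = "empirical_coeff n x l k"
      have p: "(l, k) \<in> {(l, k) \<in> haar_index. l \<le> int (L n)}" using True lk by (simp add: m_def)
      have "\<bar>?f - ?e\<bar> \<le> r * w l / sqrt (real n)" "\<bar>?g - ?e\<bar> \<le> r * w l / sqrt (real n)"
        using f(1) g(1) p unfolding credible_iff[OF n] by blast+
      moreover have "r * w l / sqrt (real n) \<le> r * w (int m) / sqrt (real n)"
      proof (intro divide_right_mono mult_left_mono r)
        show "w l \<le> w (int m)"
          using lk True by (intro mono_onD[OF w_mono]) (auto simp: haar_index_def)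
      qed simp
      ultimately have "\<bar>?f - ?g\<bar> \<le> 2 * (r * w (int m) / sqrt (real n))" by linarith
      then show ?thesis using True eq by (simp add: b_def a_def)
    next
      case False
      have "\<bar>?f\<bar> \<le> u * 2 powr (- real_of_int l * (\<gamma> + 1/2))" "\<bar>?g\<bar> \<le> u * 2 powr (- real_of_int l * (\<gamma> + 1/2))"
        using f(2) g(2) lk unfolding smooth_set_def by blast+
      then have "\<bar>?f - ?g\<bar> \<le> 2 * (u * 2 powr (- real_of_int l * (\<gamma> + 1/2)))" by linarith
      then show ?thesis using False eq by (simp add: b_def)
    qed
  qed
  have q: "2 powr (- \<gamma>) \<le> (3 / 4 :: real)"
  proof -
    have "2 powr (- \<gamma>) \<le> 2 powr (- 1/2 :: real)" using gamma by (intro powr_mono) auto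
    also have "\<dots> = 1 / sqrt 2" by (simp add: powr_minus_divide powr_half_sqrt)
    also have "\<dots> \<le> 3 / 4"
    proof -
      have "4 / 3 \<le> sqrt (2::real)" by (rule real_le_rsqrt) (simp add: power2_eq_square)
      then show ?thesis by (simp add: divide_le_eq)
    qed
    finally show ?thesis .
  qed
  have level_le: "2 powr (real l / 2) * b (int l) \<le> (if l \<le> m then a * 2 powr (real l / 2) else 0)
      + 2 * u * 2 powr (- real m * \<gamma>) * (if m < l then (3 / 4) ^ (l - m) else 0)" for l
  proof (cases "l \<le> m")
    case False
    then have l: "real l = real m + real (l - m)" by simp
    have "2 powr (real l / 2) * 2 powr (- real l * (\<gamma> + 1/2)) = 2 powr (- real l * \<gamma>)"
      by (simp add: powr_add[symmetric] algebra_simps)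
    also have "\<dots> = 2 powr (- real m * \<gamma>) * (2 powr (- \<gamma>)) ^ (l - m)"
    proof -
      have "(2 powr (- \<gamma>)) ^ (l - m) = 2 powr (- \<gamma> * real (l - m))"
        by (simp add: powr_realpow[symmetric] powr_powr)
      moreover have "- real l * \<gamma> = - real m * \<gamma> + - \<gamma> * real (l - m)" unfolding l by (simp add: algebra_simps)
      ultimately show ?thesis by (simp only: powr_add)
    qed
    also have "\<dots> \<le> 2 powr (- real m * \<gamma>) * (3 / 4) ^ (l - m)"
      using q by (intro mult_left_mono power_mono) auto
    finally have "2 * u * (2 powr (real l / 2) * 2 powr (- real l * (\<gamma> + 1/2))) \<le> 2 * u * (2 powr (- real m * \<gamma>) * (3 / 4) ^ (l - m))"
      using u0 by (intro mult_left_mono) auto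
    then show ?thesis using False by (simp add: b_def mult_ac)
  qed (simp add: b_def)
  have "b (-1) + (\<Sum>l<M. 2 powr (real l / 2) * b (int l)) \<le> ?B" for M
  proof -
    have "(\<Sum>l<M. if l \<le> m then a * 2 powr (real l / 2) else 0) = (\<Sum>l\<in>{l\<in>{..<M}. l \<le> m}. a * 2 powr (real l / 2))"
      by (rule sum.inter_filter[symmetric]) simp
    also have "\<dots> \<le> (\<Sum>l\<le>m. a * 2 powr (real l / 2))"
      using a0 by (intro sum_mono2) auto
    also have "\<dots> \<le> a * (4 * 2 powr (real m / 2))"
      unfolding sum_distrib_left[symmetric] using a0 by (intro mult_left_mono sum_powr_half_le)
    finally have 1: "(\<Sum>l<M. if l \<le> m then a * 2 powr (real l / 2) else 0) \<le> 4 * (a * 2 powr (real m / 2))" by simp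
    have "(\<Sum>l<M. if m < l then (3 / 4 :: real) ^ (l - m) else 0) \<le> 3"
      by (rule order_trans[OF sum_tail_le]) simp
    then have "2 * u * 2 powr (- real m * \<gamma>) * (\<Sum>l<M. if m < l then (3 / 4 :: real) ^ (l - m) else 0) \<le> 2 * u * 2 powr (- real m * \<gamma>) * 3"
      using u0 by (intro mult_left_mono) auto
    also have "\<dots> = 6 * (u * 2 powr (- real m * \<gamma>))" by simp
    finally have 2: "2 * u * 2 powr (- real m * \<gamma>) * (\<Sum>l<M. if m < l then (3 / 4 :: real) ^ (l - m) else 0) \<le> 6 * (u * 2 powr (- real m * \<gamma>))" .
    have 3: "(\<Sum>l<M. 2 powr (real l / 2) * b (int l)) \<le> (\<Sum>l<M. if l \<le> m then a * 2 powr (real l / 2) else 0)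
      + 2 * u * 2 powr (- real m * \<gamma>) * (\<Sum>l<M. if m < l then (3 / 4) ^ (l - m) else 0)"
      unfolding sum_distrib_left sum.distrib[symmetric] by (intro sum_mono level_le)
    have 4: "b (-1) \<le> a * 2 powr (real m / 2)"
    proof -
      have "a * 1 \<le> a * 2 powr (real m / 2)" using a0 by (intro mult_left_mono ge_one_powr_ge_zero) auto
      then show ?thesis by (simp add: b_def)
    qed
    have 5: "5 * (a * 2 powr (real m / 2)) + 6 * (u * 2 powr (- real m * \<gamma>)) = ?B"
      unfolding a_def wu by (simp add: m_def)
    have "x + y \<le> z" if "y \<le> s1 + s2" "x \<le> p" "5 * p + 6 * q = z" "s1 \<le> 4 * p" "s2 \<le> 6 * q" for x y z s1 s2 p q :: real
      using that by linarith
    from this[OF 3 4 5] show ?thesis using 1 2 by blast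
  qed
  then show "esssup unit_leb (\<lambda>t. ennreal \<bar>f t - g t\<bar>) \<le> ennreal ?B"
    using L2_diff[OF L2] coeff by (rule_tac esssup_le_haar_sum)
qed


section \<open>From the sample sequence to the first observations\<close>

lemma sample_law_eq: "sample_law f0 = (\<Pi>\<^sub>M i\<in>UNIV. P0)"
  by (simp add: sample_law_def P0_def)

lemma prob_space_sample_law: "prob_space (sample_law f0)"
  unfolding sample_law_eq by (intro prob_space_PiM prob_space_P0)

lemma restrict_measurable [measurable]: "(\<lambda>x. restrict x {..<n}) \<in> sample_law f0 \<rightarrow>\<^sub>M P n"
  unfolding sample_law_eq P_def by (rule measurable_restrict_subset) simp

lemma distr_restrict: "distr (sample_law f0) (P n) (\<lambda>x. restrict x {..<n}) = P n"
proof -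
  have "product_prob_space (\<lambda>_::nat. P0)" by (rule product_prob_space_I) (rule prob_space_P0)
  then show ?thesis unfolding sample_law_eq P_def
    by (rule product_prob_space.distr_PiM_restrict_finite) auto
qed

lemma sample_law_sets: "A \<in> sets (P n) \<Longrightarrow> {x \<in> space (sample_law f0). restrict x {..<n} \<in> A} \<in> sets (sample_law f0)"
proof -
  assume "A \<in> sets (P n)"
  then have "(\<lambda>x. restrict x {..<n}) -` A \<inter> space (sample_law f0) \<in> sets (sample_law f0)" by (rule measurable_sets[OF restrict_measurable])
  moreover have "(\<lambda>x. restrict x {..<n}) -` A \<inter> space (sample_law f0) = {x \<in> space (sample_law f0). restrict x {..<n} \<in> A}" by blast
  ultimately show ?thesis by simp
qed

lemma measure_sample_law: "A \<in> sets (P n) \<Longrightarrow> measure (sample_law f0) {x \<in> space (sample_law f0). restrict x {..<n} \<in> A} = measure (P n) A"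
proof -
  assume A: "A \<in> sets (P n)"
  have "measure (P n) A = measure (distr (sample_law f0) (P n) (\<lambda>x. restrict x {..<n})) A" by (simp only: distr_restrict)
  also have "\<dots> = measure (sample_law f0) ((\<lambda>x. restrict x {..<n}) -` A \<inter> space (sample_law f0))"
    using A by (intro measure_distr restrict_measurable)
  also have "(\<lambda>x. restrict x {..<n}) -` A \<inter> space (sample_law f0) = {x \<in> space (sample_law f0). restrict x {..<n} \<in> A}" by blast
  finally show ?thesis by simp
qed

lemma AE_sample_law: "AE y in P n. Q y \<Longrightarrow> AE x in sample_law f0. Q (restrict x {..<n})"
  by (rule AE_distrD[OF restrict_measurable]) (simp only: distr_restrict)


section \<open>The posterior of the credible sets\<close>

lemma haar_scaled_int: "\<exists>z::int. haar l k t = (if l = -1 then 1 else 2 powr (real_of_int l / 2)) * of_int z"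
proof (cases "l = -1")
  case True
  then show ?thesis by (intro exI[of _ "if t \<in> {0..1} then 1 else 0"]) (auto simp: haar_def)
next
  case False
  let ?A = "{real k / 2 ^ nat l <.. (real k + 1/2) / 2 ^ nat l}" and ?B = "{(real k + 1/2) / 2 ^ nat l <.. (real k + 1) / 2 ^ nat l}"
  have "haar l k t = 2 powr (real_of_int l / 2) * of_int ((if t \<in> ?A then 1 else 0) - (if t \<in> ?B then 1 else 0))"
    using False unfolding haar_def indicator_def by simp
  then show ?thesis by (subst if_not_P[OF False]) (rule exI)
qed

text \<open>Haar values are integer multiples of one scale, so the coefficient lies on a lattice.
  This makes the family of credible sets with a fixed radius countable.\<close>

lemma empirical_coeff_countable_range: "\<exists>A. countable A \<and> (\<forall>x. empirical_coeff n x l k \<in> A)"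
proof -
  let ?c = "if l = -1 then 1 else 2 powr (real_of_int l / 2) :: real"
  obtain z :: "real \<Rightarrow> int" where z: "\<And>t. haar l k t = ?c * of_int (z t)" using haar_scaled_int[of l k] by metis
  have "empirical_coeff n x l k = ?c * of_int (\<Sum>i<n. z (x i)) / real n" for x
    unfolding empirical_coeff_def z sum_distrib_left[symmetric] by simp
  then have "empirical_coeff n x l k \<in> range (\<lambda>j::int. ?c * of_int j / real n)" for x by blast
  then show ?thesis by (intro exI[of _ "range (\<lambda>j::int. ?c * of_int j / real n)"]) auto
qed

lemma AE_P_lborel:
  assumes "AE x in (\<Pi>\<^sub>M i\<in>{..<n}. lborel). (\<forall>i<n. x i \<in> {0..1}) \<longrightarrow> Q x"
  shows "AE x in P n. Q x"
proof -
  have "P n = density (\<Pi>\<^sub>M i\<in>{..<n}. lborel) (\<lambda>x. \<Prod>i\<in>{..<n}. ennreal (f1 (x i)))"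
    unfolding P_def P0_eq using prob_space_P0[unfolded P0_eq]
    by (intro PiM_density_lborel) (auto intro: prob_space_imp_sigma_finite)
  moreover have "(\<lambda>x. \<Prod>i\<in>{..<n}. ennreal (f1 (x i))) \<in> borel_measurable (\<Pi>\<^sub>M i\<in>{..<n}. lborel)" by measurable
  ultimately have "AE x in P n. (\<forall>i<n. x i \<in> {0..1}) \<longrightarrow> Q x"
    using assms by (simp only: AE_density) (auto elim: eventually_mono)
  then show ?thesis using AE_P_pos[of n] by eventually_elim auto
qed

text \<open>The radius \<open>s\<close> is deterministic here: a credible set then depends on the
  sample only through finitely many empirical coefficients. The random radius is reached afterwards
  by monotonicity.\<close>

lemma posterior_credible:
  assumes K: "is_posterior (L n) n K" and n: "0 < n"
  shows "AE x in P n. measure (K x) (credible_set w (L n) n s x) = post n s x"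
proof -
  let ?I = "{(l, k) \<in> haar_index. l \<le> int (L n)}"
  have "\<exists>A. countable A \<and> (\<forall>x. empirical_coeff n x (fst p) (snd p) \<in> A)" for p
    by (rule empirical_coeff_countable_range)
  then obtain A where A: "\<And>p. countable (A p)" "\<And>p x. empirical_coeff n x (fst p) (snd p) \<in> A p" by metis
  define e where "e x = restrict (\<lambda>p. empirical_coeff n x (fst p) (snd p)) ?I" for x
  define S where "S e = {f \<in> L2. \<forall>(l, k)\<in>?I. \<bar>inner_L2 f (haar l k) - e (l, k)\<bar> \<le> s * w l / sqrt (real n)}" for e :: "int \<times> nat \<Rightarrow> real"
  have eE: "e x \<in> Pi\<^sub>E ?I A" for x unfolding e_def using A(2) by auto
  have cE: "countable (Pi\<^sub>E ?I A)" using A(1) finite_haar_index_le by (intro countable_PiE) auto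
  have Sm: "S e \<in> sets L2_borel" for e
    unfolding S_def using coeff_box_sets[of "L n" e "\<lambda>p. s * w (fst p) / sqrt (real n)"] by (simp only: fst_conv)
  have Se: "S (e x) = credible_set w (L n) n s x" for x
  proof (rule set_eqI)
    fix f
    have "(\<forall>(l, k)\<in>?I. \<bar>inner_L2 f (haar l k) - e x (l, k)\<bar> \<le> s * w l / sqrt (real n)) \<longleftrightarrow>
      (\<forall>(l, k)\<in>?I. \<bar>inner_L2 f (haar l k) - empirical_coeff n x l k\<bar> \<le> s * w l / sqrt (real n))"
      by (intro ball_cong refl) (auto simp: e_def)
    then show "f \<in> S (e x) \<longleftrightarrow> f \<in> credible_set w (L n) n s x"
      unfolding S_def mem_Collect_eq credible_iff[OF n] by blast
  qed
  have "AE x in P n. emeasure (K x) (S (e x)) = emeasure (E n x) {g \<in> space (E n x). histogram (L n) (normalize (2 ^ L n) g) \<in> S (e x)}"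
    by (rule AE_P_lborel[OF posterior_AE[OF K cE]]) (rule Sm, rule eE)
  then show ?thesis by eventually_elim (simp add: measure_def post_def Se)
qed


section \<open>Membership of the true density\<close>

lemma f0_credible_iff:
  assumes n: "0 < n" and x: "\<forall>i<n. 0 < x i \<and> x i \<le> 1"
  shows "f0 \<in> credible_set w (L n) n r x \<longleftrightarrow> (\<forall>i\<in>I (L n). \<bar>Z n i x\<bar> \<le> r * wt i)"
proof -
  let ?Q = "\<lambda>l k. \<bar>\<theta> l k - empirical_coeff n x l k\<bar> \<le> r * w l / sqrt (real n)"
  have s0: "0 < sqrt (real n)" using n by simp
  have Z: "\<bar>Z n i x\<bar> \<le> r * wt i \<longleftrightarrow> ?Q (int (fst i)) (snd i)" for i
  proof -
    have "\<bar>Z n i x\<bar> = \<bar>\<theta> (int (fst i)) (snd i) - empirical_coeff n x (int (fst i)) (snd i)\<bar> * sqrt (real n)"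
      by (simp add: Z_def abs_mult th_def abs_minus_commute mult.commute)
    then show ?thesis using s0 by (simp only: pos_le_divide_eq wt_def)
  qed
  have e1: "empirical_coeff n x (-1) 0 = 1"
  proof -
    have "(\<Sum>i<n. haar (-1) 0 (x i)) = (\<Sum>i<n. 1)"
      using x by (intro sum.cong refl) (auto simp: haar_def less_imp_le)
    then show ?thesis using n by (simp add: empirical_coeff_def)
  qed
  have "f0 \<in> credible_set w (L n) n r x \<longleftrightarrow> (\<forall>(l, k)\<in>{(l, k) \<in> haar_index. l \<le> int (L n)}. ?Q l k)"
    unfolding credible_iff[OF n] using f0_in_L2 by (simp only: \<theta>_def simp_thms)
  also have "\<dots> \<longleftrightarrow> (\<forall>i\<in>I (L n). ?Q (int (fst i)) (snd i))"
  proof (intro iffI ballI)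
    fix i assume a: "\<forall>(l, k)\<in>{(l, k) \<in> haar_index. l \<le> int (L n)}. ?Q l k" and i: "i \<in> I (L n)"
    have "(int (fst i), snd i) \<in> {(l, k) \<in> haar_index. l \<le> int (L n)}" using i by (auto simp: I_def haar_index_def)
    with a show "?Q (int (fst i)) (snd i)" by blast
  next
    fix p assume a: "\<forall>i\<in>I (L n). ?Q (int (fst i)) (snd i)" and p: "p \<in> {(l, k) \<in> haar_index. l \<le> int (L n)}"
    obtain l k where p': "p = (l, k)" "(l, k) \<in> haar_index" "l \<le> int (L n)" using p by auto
    have "?Q l k"
    proof (cases "l = -1")
      case True
      \<comment> \<open>At level \<open>-1\<close> both coefficients equal \<open>1\<close>, so the
        inequality there only says that \<open>r\<close> is nonnegative, which the inequality at
        index \<open>(0, 0)\<close> forces.\<close>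
      have "0 \<le> r * w 0 / sqrt (real n)" using bspec[OF a, of "(0, 0)"] by (auto simp: I_def intro: order_trans[OF abs_ge_zero])
      then have "0 \<le> r" using w_ge_1[of 0] s0 by (simp add: zero_le_divide_iff zero_le_mult_iff)
      then have "0 \<le> r * w (-1) / sqrt (real n)" using w_ge_1[of "-1"] by simp
      moreover have "k = 0" using p' True by (auto simp: haar_index_def)
      ultimately show ?thesis using True e1 theta_minus_1[of 0] by simp
    next
      case False
      then have "(nat l, k) \<in> I (L n)" "int (nat l) = l" using p' by (auto simp: I_def haar_index_def)
      then show ?thesis using a by force
    qed
    then show "case p of (l, k) \<Rightarrow> ?Q l k" by (simp add: p')
  qed
  finally show ?thesis by (simp only: Z)
qed

lemma level_weight_at_top: "filterlim (\<lambda>n. w (int (L n)) / sqrt (real (L n))) at_top sequentially"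
proof -
  have "filterlim (\<lambda>n. int (L n)) at_top sequentially"
    by (rule filterlim_compose[OF filterlim_int_sequentially L_at_top])
  from filterlim_compose[OF w_ratio_lim this] show ?thesis by simp
qed

text \<open>As \<open>u n\<close> tends to infinity it eventually exceeds \<open>1\<close>, for
  level \<open>-1\<close>, and the Hoelder constant \<open>H\<close>, for all others. Intersecting
  with the smooth set then leaves the coverage unchanged.\<close>

lemma f0_smooth: "\<forall>\<^sub>F n in sequentially. f0 \<in> smooth_set \<gamma> (w (int (L n)) / sqrt (real (L n)))"
proof -
  have "\<forall>\<^sub>F n in sequentially. max 1 H \<le> w (int (L n)) / sqrt (real (L n))"
    using level_weight_at_top by (simp only: filterlim_at_top)
  then show ?thesis
  proof eventually_elim
    case (elim n)
    let ?u = "w (int (L n)) / sqrt (real (L n))"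
    have "\<bar>inner_L2 f0 (haar l k)\<bar> \<le> ?u * 2 powr (- real_of_int l * (\<gamma> + 1/2))" if lk: "(l, k) \<in> haar_index" for l k
    proof (cases "l = -1")
      case True
      have "1 * 1 \<le> ?u * 2 powr (\<gamma> + 1/2)"
        using elim gamma by (intro mult_mono ge_one_powr_ge_zero) auto
      then show ?thesis using theta_minus_1[of k] True by (simp add: \<theta>_def)
    next
      case False
      then have "\<bar>inner_L2 f0 (haar l k)\<bar> \<le> H * 2 powr (- l * (\<gamma> + 1/2))"
        using abs_theta_le[of l k] lk by (auto simp: \<theta>_def haar_index_def)
      also have "\<dots> = H * 2 powr (- real_of_int l * (\<gamma> + 1/2))" by simp
      also have "\<dots> \<le> ?u * 2 powr (- real_of_int l * (\<gamma> + 1/2))" using elim by (intro mult_right_mono) auto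
      finally show ?thesis .
    qed
    then show ?case using f0_in_L2 by (auto simp: smooth_set_def)
  qed
qed

end

section \<open>Calibrated radii\<close>

locale calibrated_radius = histogram_setting f0 \<gamma> L w
  for f0 :: "real \<Rightarrow> real" and \<gamma> :: real and L :: "nat \<Rightarrow> nat" and w :: "int \<Rightarrow> real" +
  fixes \<alpha> :: real and K :: "nat \<Rightarrow> (nat \<Rightarrow> real) \<Rightarrow> (real \<Rightarrow> real) measure" and R :: "nat \<Rightarrow> (nat \<Rightarrow> real) \<Rightarrow> real"
  assumes alpha: "0 < \<alpha>" "\<alpha> < 1"
    and posterior: "\<And>n. n \<ge> 1 \<Longrightarrow> is_posterior (L n) n (K n)"
    and R_measurable: "\<And>n. n \<ge> 1 \<Longrightarrow> R n \<in> borel_measurable (data_space n)"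
    and R_level: "(\<lambda>n. measure (sample_law f0) {x \<in> space (sample_law f0).
       measure (K n (restrict x {..<n})) (credible_set w (L n) n (R n (restrict x {..<n})) x) = 1 - \<alpha>}) \<longlonglongrightarrow> 1"
begin

definition "radius_set s1 s2 n = {y \<in> space (P n). s1 < R n y \<and> R n y < s2}"

definition "coverage_set n = {y \<in> space (P n). f0 \<in> credible_set w (L n) n (R n y) y}"

lemma R_P: "0 < n \<Longrightarrow> R n \<in> borel_measurable (P n)"
  using R_measurable[of n] measurable_cong_sets[OF sets_P refl] by auto

lemma radius_set_sets: "0 < n \<Longrightarrow> radius_set s1 s2 n \<in> sets (P n)"
proof -
  assume "0 < n"
  note [measurable] = R_P[OF this]
  show ?thesis unfolding radius_set_def by measurable
qed

lemma coverage_set_sets: "0 < n \<Longrightarrow> coverage_set n \<in> sets (P n)"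
proof -
  assume n: "0 < n"
  note [measurable] = R_P[OF n]
  have "coverage_set n = {y \<in> space (P n). \<forall>p\<in>{(l, k) \<in> haar_index. l \<le> int (L n)}.
     \<bar>inner_L2 f0 (haar (fst p) (snd p)) - empirical_coeff n y (fst p) (snd p)\<bar> \<le> R n y * w (fst p) / sqrt (real n)}"
    unfolding coverage_set_def credible_iff[OF n] using f0_in_L2 by (auto simp: case_prod_beta')
  also have "\<dots> \<in> sets (P n)"
    by (intro sets.sets_Collect_finite_All finite_haar_index_le borel_measurable_le) measurable
  finally show ?thesis .
qed

text \<open>Posterior mass increases with the radius, so strict inequalities at two fixed radii
  enclose every radius of exact mass \<open>1 - \<alpha>\<close>; uniqueness of such a radius is
  immaterial.\<close>

lemma radius_between:
  assumes n: "0 < n" and y: "y \<in> space (P n)"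
    and s: "measure (K n y) (credible_set w (L n) n s1 y) < 1 - \<alpha>" "1 - \<alpha> < measure (K n y) (credible_set w (L n) n s2 y)"
    and R: "measure (K n y) (credible_set w (L n) n (R n y) y) = 1 - \<alpha>"
  shows "s1 < R n y \<and> R n y < s2"
proof -
  have "K n \<in> data_space n \<rightarrow>\<^sub>M prob_algebra L2_borel"
    using posterior[of n] n unfolding is_posterior_def conditional_law_def by simp
  moreover have "y \<in> space (data_space n)" using y by (simp add: space_PiM)
  ultimately have "K n y \<in> space (prob_algebra L2_borel)" by (rule measurable_space)
  then have K: "prob_space (K n y)" "sets (K n y) = sets L2_borel" by (auto simp: space_prob_algebra)
  interpret K: prob_space "K n y" by (rule K(1))
  have mono: "measure (K n y) (credible_set w (L n) n r y) \<le> measure (K n y) (credible_set w (L n) n r' y)" if "r \<le> r'" for r r'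
    using that credible_set_sets[OF n] K(2) by (intro K.finite_measure_mono credible_set_mono) auto
  show ?thesis using mono[of "R n y" s1] mono[of s2 "R n y"] s R by linarith
qed

text \<open>A sample that is both calibrated and good has its radius between \<open>s1\<close> and
  \<open>s2\<close>, up to a null set where the kernel differs from its Erlang form.\<close>

lemma radius_set_tendsto:
  assumes s1: "\<forall>\<^sub>F n in sequentially. \<forall>x\<in>good J n. post n s1 x < 1 - \<alpha>"
    and s2: "\<forall>\<^sub>F n in sequentially. \<forall>x\<in>good J n. 1 - \<alpha> < post n s2 x"
  shows "(\<lambda>n. measure (P n) (radius_set s1 s2 n)) \<longlonglongrightarrow> 1"
proof -
  interpret S: prob_space "sample_law f0" by (rule prob_space_sample_law)
  define A where "A n = {x \<in> space (sample_law f0).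
       measure (K n (restrict x {..<n})) (credible_set w (L n) n (R n (restrict x {..<n})) x) = 1 - \<alpha>}" for n
  have A1: "(\<lambda>n. measure (sample_law f0) (A n)) \<longlonglongrightarrow> 1" using R_level by (simp only: A_def)
  have "\<forall>\<^sub>F n in sequentially. 0 < measure (sample_law f0) (A n)"
    by (rule order_tendstoD(1)[OF A1]) simp
  then have lower: "\<forall>\<^sub>F n in sequentially. measure (sample_law f0) (A n) + measure (P n) (good J n) - 1 \<le> measure (P n) (radius_set s1 s2 n)"
    using s1 s2 eventually_gt_at_top[of 0]
  proof eventually_elim
    case (elim n)
    have n: "0 < n" using elim by simp
    have Kn: "is_posterior (L n) n (K n)" using n by (intro posterior) simp
    let ?r = "\<lambda>x. restrict x {..<n}"
    \<comment> \<open>A nonmeasurable set has measure \<open>0\<close> by convention, so positive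
      measure, known from the limit \<open>1\<close>, yields measurability.\<close>
    have Am: "A n \<in> sets (sample_law f0)" using elim(1) measure_notin_sets by fastforce
    have Dm: "radius_set s1 s2 n \<in> sets (P n)" by (rule radius_set_sets[OF n])
    have Gm: "space (P n) - good J n \<in> sets (P n)" using good_sets by (rule sets.compl_sets)
    have UP: "radius_set s1 s2 n \<union> (space (P n) - good J n) \<in> sets (P n)" using Dm Gm by (rule sets.Un)
    have "AE y in P n. measure (K n y) (credible_set w (L n) n s1 y) = post n s1 y \<and> measure (K n y) (credible_set w (L n) n s2 y) = post n s2 y"
      using posterior_credible[OF Kn n, of s1] posterior_credible[OF Kn n, of s2] by eventually_elim auto
    from AE_sample_law[OF this]
    have "AE x in sample_law f0. x \<in> A n \<longrightarrow> x \<in> {x \<in> space (sample_law f0). ?r x \<in> radius_set s1 s2 n \<union> (space (P n) - good J n)}"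
    proof eventually_elim
      case (elim x)
      show ?case
      proof
        assume x: "x \<in> A n"
        then have sp: "x \<in> space (sample_law f0)" by (simp add: A_def)
        then have y: "?r x \<in> space (P n)" by (rule measurable_space[OF restrict_measurable])
        have lev: "measure (K n (?r x)) (credible_set w (L n) n (R n (?r x)) (?r x)) = 1 - \<alpha>"
          using x by (simp add: A_def credible_set_restrict)
        have "?r x \<in> radius_set s1 s2 n" if g: "?r x \<in> good J n"
        proof -
          have "post n s1 (?r x) < 1 - \<alpha>" "1 - \<alpha> < post n s2 (?r x)" using g \<open>\<forall>x\<in>good J n. post n s1 x < 1 - \<alpha>\<close> \<open>\<forall>x\<in>good J n. 1 - \<alpha> < post n s2 x\<close> by auto
          then show ?thesis unfolding radius_set_def
            using y radius_between[OF n y _ _ lev, of s1 s2] elim by (simp del: space_P)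
        qed
        then show "x \<in> {x \<in> space (sample_law f0). ?r x \<in> radius_set s1 s2 n \<union> (space (P n) - good J n)}"
          using sp y by blast
      qed
    qed
    then have "measure (sample_law f0) (A n) \<le> measure (sample_law f0) {x \<in> space (sample_law f0). ?r x \<in> radius_set s1 s2 n \<union> (space (P n) - good J n)}"
      using sample_law_sets[OF UP] by (rule S.finite_measure_mono_AE)
    also have "\<dots> = measure (P n) (radius_set s1 s2 n \<union> (space (P n) - good J n))"
      by (rule measure_sample_law[OF UP])
    also have "\<dots> \<le> measure (P n) (radius_set s1 s2 n) + measure (P n) (space (P n) - good J n)"
      using Dm Gm by (rule measure_Un_le)
    also have "measure (P n) (space (P n) - good J n) = 1 - measure (P n) (good J n)"
      using good_sets by (rule P.prob_compl)
    finally show ?case by linarith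
  qed
  show ?thesis
  proof (rule tendsto_sandwich[OF lower _ _ tendsto_const])
    show "\<forall>\<^sub>F n in sequentially. measure (P n) (radius_set s1 s2 n) \<le> 1" by (intro always_eventually allI P.prob_le_1)
    show "(\<lambda>n. measure (sample_law f0) (A n) + measure (P n) (good J n) - 1) \<longlonglongrightarrow> 1"
      using tendsto_diff[OF tendsto_add[OF A1 good_prob[of J]] tendsto_const[of 1]] by simp
  qed
qed

text \<open>When the radius lies between \<open>s1\<close> and \<open>s2\<close>, coverage is
  implied by the box of radius \<open>s1\<close> and implies that of radius \<open>s2\<close>; the
  complement of this event is the only loss.\<close>

lemma measure_coverage_bounds:
  assumes n: "0 < n"
  shows "measure (P n) (FT n s1) + measure (P n) (radius_set s1 s2 n) - 1 \<le> measure (P n) (coverage_set n)"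
    and "measure (P n) (coverage_set n) \<le> measure (P n) (FT n s2) + 1 - measure (P n) (radius_set s1 s2 n)"
proof -
  let ?D = "radius_set s1 s2 n"
  have Dm: "?D \<in> sets (P n)" by (rule radius_set_sets[OF n])
  have Dc: "space (P n) - ?D \<in> sets (P n)" using Dm by (rule sets.compl_sets)
  have Cm: "coverage_set n \<in> sets (P n)" by (rule coverage_set_sets[OF n])
  have Fm: "FT n s \<in> sets (P n)" for s unfolding FT_def by (rule Z_box_sets)
  have compl: "measure (P n) (space (P n) - ?D) = 1 - measure (P n) ?D" using Dm by (rule P.prob_compl)
  have wt: "s * wt i \<le> s' * wt i" if "s \<le> s'" for s s' i
    using that wt_ge_1[of i] by (intro mult_right_mono) auto
  have "AE y in P n. y \<in> FT n s1 \<longrightarrow> y \<in> coverage_set n \<union> (space (P n) - ?D)"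
    using AE_P_pos[of n]
  proof eventually_elim
    case (elim y)
    have "y \<in> coverage_set n" if y: "y \<in> FT n s1" "y \<in> ?D"
    proof -
      have "\<bar>Z n i y\<bar> \<le> R n y * wt i" if i: "i \<in> I (L n)" for i
        using y wt[of s1 "R n y" i] i by (force simp: FT_def radius_set_def)
      then show ?thesis using y f0_credible_iff[OF n elim] by (simp add: coverage_set_def radius_set_def)
    qed
    then show ?case by (auto simp: FT_def)
  qed
  then have "measure (P n) (FT n s1) \<le> measure (P n) (coverage_set n \<union> (space (P n) - ?D))"
    using Cm Dc by (intro P.finite_measure_mono_AE sets.Un)
  also have "\<dots> \<le> measure (P n) (coverage_set n) + measure (P n) (space (P n) - ?D)"
    using Cm Dc by (rule measure_Un_le)
  finally show "measure (P n) (FT n s1) + measure (P n) ?D - 1 \<le> measure (P n) (coverage_set n)" using compl by linarith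
  have "AE y in P n. y \<in> coverage_set n \<longrightarrow> y \<in> FT n s2 \<union> (space (P n) - ?D)"
    using AE_P_pos[of n]
  proof eventually_elim
    case (elim y)
    have "y \<in> FT n s2" if y: "y \<in> coverage_set n" "y \<in> ?D"
    proof -
      have c: "\<forall>i\<in>I (L n). \<bar>Z n i y\<bar> \<le> R n y * wt i"
        using y f0_credible_iff[OF n elim] by (simp add: coverage_set_def)
      have "\<bar>Z n i y\<bar> \<le> s2 * wt i" if i: "i \<in> I (L n)" for i
        using y wt[of "R n y" s2 i] bspec[OF c i] by (simp add: radius_set_def)
      then show ?thesis using y by (simp add: FT_def radius_set_def)
    qed
    then show ?case by (auto simp: coverage_set_def)
  qed
  then have "measure (P n) (coverage_set n) \<le> measure (P n) (FT n s2 \<union> (space (P n) - ?D))"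
    using Fm Dc by (intro P.finite_measure_mono_AE sets.Un)
  also have "\<dots> \<le> measure (P n) (FT n s2) + measure (P n) (space (P n) - ?D)"
    using Fm Dc by (rule measure_Un_le)
  finally show "measure (P n) (coverage_set n) \<le> measure (P n) (FT n s2) + 1 - measure (P n) ?D" using compl by linarith
qed

lemma coverage: "(\<lambda>n. measure (P n) (coverage_set n)) \<longlonglongrightarrow> 1 - \<alpha>"
proof (rule tendstoI)
  fix e :: real assume e: "0 < e"
  \<comment> \<open>The bracket loses \<open>2 * \<eta>\<close> and the radius event another
    \<open>\<eta>\<close>, together less than \<open>e\<close>; the other bound keeps
    \<open>1 - \<alpha> - \<eta>\<close> and \<open>1 - \<alpha> + \<eta>\<close> inside the unit
    interval.\<close>
  define \<eta> where "\<eta> = min (e / 4) (min \<alpha> (1 - \<alpha>) / 2)"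
  have \<eta>: "0 < \<eta>" "\<eta> < 1 - \<alpha>" "\<eta> < 1 - (1 - \<alpha>)" "\<eta> \<le> e / 4" using e alpha by (auto simp: \<eta>_def min_def)
  obtain s1 s2 J where s: "0 < s1" "s1 < s2"
    "\<forall>\<^sub>F n in sequentially. \<forall>x\<in>good J n. post n s1 x < 1 - \<alpha>" "\<forall>\<^sub>F n in sequentially. \<forall>x\<in>good J n. 1 - \<alpha> < post n s2 x"
    "\<forall>\<^sub>F n in sequentially. 1 - \<alpha> - 2 * \<eta> \<le> measure (P n) (FT n s1)" "\<forall>\<^sub>F n in sequentially. measure (P n) (FT n s2) \<le> 1 - \<alpha> + 2 * \<eta>"
    by (rule quantile_bracket[of "1 - \<alpha>" \<eta>]) (use alpha \<eta> in auto)
  have "\<forall>\<^sub>F n in sequentially. 1 - \<eta> < measure (P n) (radius_set s1 s2 n)"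
    using \<eta> by (intro order_tendstoD(1)[OF radius_set_tendsto[OF s(3,4)]]) auto
  then show "\<forall>\<^sub>F n in sequentially. dist (measure (P n) (coverage_set n)) (1 - \<alpha>) < e"
    using s(5,6) eventually_gt_at_top[of 0]
  proof eventually_elim
    case (elim n)
    then show ?case using measure_coverage_bounds[OF elim(4), where ?s1.0=s1 and ?s2.0=s2] \<eta> unfolding dist_real_def abs_less_iff by linarith
  qed
qed

lemma sample_coverage: "(\<lambda>n. measure (sample_law f0) {x \<in> space (sample_law f0). f0 \<in> credible_set w (L n) n (R n (restrict x {..<n})) x}) \<longlonglongrightarrow> 1 - \<alpha>"
proof (rule Lim_transform_eventually[OF coverage])
  show "\<forall>\<^sub>F n in sequentially. measure (P n) (coverage_set n) = measure (sample_law f0) {x \<in> space (sample_law f0). f0 \<in> credible_set w (L n) n (R n (restrict x {..<n})) x}"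
    using eventually_gt_at_top[of 0]
  proof eventually_elim
    case (elim n)
    have "{x \<in> space (sample_law f0). restrict x {..<n} \<in> coverage_set n} = {x \<in> space (sample_law f0). f0 \<in> credible_set w (L n) n (R n (restrict x {..<n})) x}"
      using measurable_space[OF restrict_measurable] by (auto simp: coverage_set_def credible_set_restrict simp del: space_P)
    then show ?case using measure_sample_law[OF coverage_set_sets[OF elim]] by simp
  qed
qed

lemma diameter_bounded_in_prob:
  assumes u: "\<And>n. u n = w (int (L n)) / sqrt (real (L n))"
  shows "bounded_in_prob (sample_law f0)
     (\<lambda>n x. sup_diameter (credible_set w (L n) n (R n (restrict x {..<n})) x \<inter> smooth_set \<gamma> (u n)))
     (\<lambda>n. (ln (real n) / real n) powr (\<gamma> / (2 * \<gamma> + 1)) * u n)"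
  unfolding bounded_in_prob_def
proof (intro allI impI)
  fix \<epsilon> :: real assume \<epsilon>: "0 < \<epsilon>"
  \<comment> \<open>Any admissible bracket will do: only the deterministic upper radius
    \<open>s2\<close> is used, so the final constant does not depend on
    \<open>\<epsilon>\<close>.\<close>
  define \<eta> where "\<eta> = min \<alpha> (1 - \<alpha>) / 2"
  have \<eta>: "0 < \<eta>" "\<eta> < 1 - \<alpha>" "\<eta> < 1 - (1 - \<alpha>)" using alpha by (auto simp: \<eta>_def min_def)
  obtain s1 s2 J where s: "0 < s1" "s1 < s2"
    "\<forall>\<^sub>F n in sequentially. \<forall>x\<in>good J n. post n s1 x < 1 - \<alpha>" "\<forall>\<^sub>F n in sequentially. \<forall>x\<in>good J n. 1 - \<alpha> < post n s2 x"
    "\<forall>\<^sub>F n in sequentially. 1 - \<alpha> - 2 * \<eta> \<le> measure (P n) (FT n s1)" "\<forall>\<^sub>F n in sequentially. measure (P n) (FT n s2) \<le> 1 - \<alpha> + 2 * \<eta>"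
    by (rule quantile_bracket[of "1 - \<alpha>" \<eta>]) (use alpha \<eta> in auto)
  obtain C1 where C1: "\<forall>\<^sub>F n in sequentially. 2 powr (real (L n) / 2) * sqrt (real (L n)) / sqrt (real n) \<le> C1 * (ln (real n) / real n) powr (\<gamma> / (2 * \<gamma> + 1))"
    by (rule stochastic_rate)
  obtain C2 where C2: "\<forall>\<^sub>F n in sequentially. 2 powr (- real (L n) * \<gamma>) \<le> C2 * (ln (real n) / real n) powr (\<gamma> / (2 * \<gamma> + 1))"
    by (rule smooth_rate)
  have "\<forall>\<^sub>F n in sequentially. 1 - \<epsilon> < measure (P n) (radius_set s1 s2 n)"
    using \<epsilon> by (intro order_tendstoD(1)[OF radius_set_tendsto[OF s(3,4)]]) auto
  then have "\<forall>\<^sub>F n in sequentially. \<exists>A\<in>sets (sample_law f0). measure (sample_law f0) A \<ge> 1 - \<epsilon> \<and>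
     (\<forall>x\<in>A. sup_diameter (credible_set w (L n) n (R n (restrict x {..<n})) x \<inter> smooth_set \<gamma> (u n))
        \<le> ennreal ((10 * s2 * C1 + 6 * C2) * ((ln (real n) / real n) powr (\<gamma> / (2 * \<gamma> + 1)) * u n)))"
    using C1 C2 eventually_gt_at_top[of 0] eventually_level_gt[of 0]
  proof eventually_elim
    case (elim n)
    let ?A = "{x \<in> space (sample_law f0). restrict x {..<n} \<in> radius_set s1 s2 n}"
    let ?r = "(ln (real n) / real n) powr (\<gamma> / (2 * \<gamma> + 1))"
    have u0: "0 \<le> u n" using w_ge_1[of "int (L n)"] by (simp add: u)
    have D: "radius_set s1 s2 n \<in> sets (P n)" using elim by (intro radius_set_sets)
    show ?case
    proof (rule bexI[of _ ?A], intro conjI ballI)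
      show "?A \<in> sets (sample_law f0)" by (rule sample_law_sets[OF D])
      show "1 - \<epsilon> \<le> measure (sample_law f0) ?A" using elim(1) measure_sample_law[OF D] by simp
      fix x assume "x \<in> ?A"
      then have "R n (restrict x {..<n}) \<le> s2" by (simp add: radius_set_def)
      then have "credible_set w (L n) n (R n (restrict x {..<n})) x \<inter> smooth_set \<gamma> (u n) \<subseteq> credible_set w (L n) n s2 x \<inter> smooth_set \<gamma> (u n)"
        by (intro Int_mono credible_set_mono order_refl)
      then have "sup_diameter (credible_set w (L n) n (R n (restrict x {..<n})) x \<inter> smooth_set \<gamma> (u n))
        \<le> ennreal (10 * s2 * u n * (2 powr (real (L n) / 2) * sqrt (real (L n)) / sqrt (real n)) + 6 * u n * 2 powr (- real (L n) * \<gamma>))"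
        using elim s by (intro sup_diameter_le[OF _ _ _ u]) auto
      also have "\<dots> \<le> ennreal (10 * s2 * u n * (C1 * ?r) + 6 * u n * (C2 * ?r))"
        using elim u0 s by (intro ennreal_leI add_mono mult_left_mono) auto
      also have "10 * s2 * u n * (C1 * ?r) + 6 * u n * (C2 * ?r) = (10 * s2 * C1 + 6 * C2) * (?r * u n)"
        by (simp add: algebra_simps)
      finally show "sup_diameter (credible_set w (L n) n (R n (restrict x {..<n})) x \<inter> smooth_set \<gamma> (u n)) \<le> ennreal ((10 * s2 * C1 + 6 * C2) * (?r * u n))" .
    qed
  qed
  then show "\<exists>M. \<forall>\<^sub>F n in sequentially. \<exists>A\<in>sets (sample_law f0). measure (sample_law f0) A \<ge> 1 - \<epsilon> \<and>
     (\<forall>x\<in>A. sup_diameter (credible_set w (L n) n (R n (restrict x {..<n})) x \<inter> smooth_set \<gamma> (u n))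
        \<le> ennreal (M * ((ln (real n) / real n) powr (\<gamma> / (2 * \<gamma> + 1)) * u n)))"
    by - (rule exI[of _ "10 * s2 * C1 + 6 * C2"])
qed

end

theorem proposition1:
  fixes \<gamma> \<alpha> :: real
    and f0 :: "real \<Rightarrow> real"
    and L :: "nat \<Rightarrow> nat"
    and w :: "int \<Rightarrow> real"
    and K :: "nat \<Rightarrow> (nat \<Rightarrow> real) \<Rightarrow> (real \<Rightarrow> real) measure"
    and R :: "nat \<Rightarrow> (nat \<Rightarrow> real) \<Rightarrow> real"
    and C C' :: "nat \<Rightarrow> (nat \<Rightarrow> real) \<Rightarrow> (real \<Rightarrow> real) set"
    and u :: "nat \<Rightarrow> real"
  assumes gamma: "1/2 < \<gamma>" "\<gamma> \<le> 1"
    and alpha: "0 < \<alpha>" "\<alpha> < 1"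
    and f0_density: "(LINT x:{0..1}|lborel. f0 x) = 1"
    and f0_lower: "\<exists>c>0. \<forall>x\<in>{0..1}. c \<le> f0 x"
    and f0_hoelder: "bdd_above {\<bar>f0 x - f0 y\<bar> / \<bar>x - y\<bar> powr \<gamma> | x y.
                        x \<in> {0..1} \<and> y \<in> {0..1} \<and> x \<noteq> y}"
    and L_rate: "(\<lambda>n. 2 ^ L n :: real) \<in> \<Theta>(\<lambda>n. (real n / ln (real n)) powr (1 / (2 * \<gamma> + 1)))"
    and w_mono: "mono_on {-1..} w"
    and w_ge_1: "\<And>l. l \<ge> -1 \<Longrightarrow> w l \<ge> 1"
    and w_ratio_mono: "mono_on {1..} (\<lambda>l. w l / sqrt (real_of_int l))"
    and w_ratio_lim: "filterlim (\<lambda>l. w l / sqrt (real_of_int l)) at_top at_top"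
    and posterior: "\<And>n. n \<ge> 1 \<Longrightarrow> is_posterior (L n) n (K n)"
    and R_measurable: "\<And>n. n \<ge> 1 \<Longrightarrow> R n \<in> borel_measurable (data_space n)"
    and C_def: "\<And>n x. C n x = credible_set w (L n) n (R n (restrict x {..<n})) x"
    and R_level: "(\<lambda>n. measure (sample_law f0) {x \<in> space (sample_law f0).
                     measure (K n (restrict x {..<n})) (C n x) = 1 - \<alpha>}) \<longlonglongrightarrow> 1"
    and u_def: "\<And>n. u n = w (int (L n)) / sqrt (real (L n))"
    and C'_def: "\<And>n x. C' n x = C n x \<inter> smooth_set \<gamma> (u n)"
  shows "((\<lambda>n. measure (sample_law f0) {x \<in> space (sample_law f0). f0 \<in> C n x}) \<longlonglongrightarrow> 1 - \<alpha>)
    \<and> ((\<lambda>n. measure (sample_law f0) {x \<in> space (sample_law f0). f0 \<in> C' n x}) \<longlonglongrightarrow> 1 - \<alpha>)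
    \<and> bounded_in_prob (sample_law f0) (\<lambda>n x. sup_diameter (C' n x))
          (\<lambda>n. (ln (real n) / real n) powr (\<gamma> / (2 * \<gamma> + 1)) * u n)"
proof -
  interpret calibrated_radius f0 \<gamma> L w \<alpha> K R
  proof unfold_locales
    show "0 < \<gamma>" using gamma by simp
    show "(\<lambda>n. measure (sample_law f0) {x \<in> space (sample_law f0).
       measure (K n (restrict x {..<n})) (credible_set w (L n) n (R n (restrict x {..<n})) x) = 1 - \<alpha>}) \<longlonglongrightarrow> 1"
      using R_level unfolding C_def .
  qed (fact assms)+
  \<comment> \<open>The smoothness condition on \<open>f0\<close> does not involve the sample, so
    eventually the two coverage events coincide exactly.\<close>
  have "(\<lambda>n. measure (sample_law f0) {x \<in> space (sample_law f0). f0 \<in> C' n x}) \<longlonglongrightarrow> 1 - \<alpha>"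
  proof (rule Lim_transform_eventually[OF sample_coverage])
    show "\<forall>\<^sub>F n in sequentially. measure (sample_law f0) {x \<in> space (sample_law f0). f0 \<in> credible_set w (L n) n (R n (restrict x {..<n})) x}
       = measure (sample_law f0) {x \<in> space (sample_law f0). f0 \<in> C' n x}"
      using f0_smooth by eventually_elim (simp add: C'_def C_def u_def)
  qed
  moreover have "bounded_in_prob (sample_law f0) (\<lambda>n x. sup_diameter (C' n x)) (\<lambda>n. (ln (real n) / real n) powr (\<gamma> / (2 * \<gamma> + 1)) * u n)"
    unfolding C'_def C_def using u_def by (rule diameter_bounded_in_prob)
  ultimately show ?thesis using sample_coverage unfolding C_def by blast
qed

end
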